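(* Fix $d \ge 2$. For any $\epsilon > 0$ and any $x \in \mathcal{A}_d$ with $x \ne f(\square^d)$, there exists a cubical $d$-polytope $P$ such that the angle $\angle\, x\, f(\square^d)\, f(P)$ (the angle at the vertex $f(\square^d)$) is smaller than $\epsilon$.
   Context: A $d$-polytope is cubical if each proper face is combinatorially a cube; $\square^d$ denotes the $d$-cube. For a $d$-polytope $Q$ let $f_i$ be its number of $i$-dimensional faces, $f(Q) = (f_0,\dots,f_{d-1}) \in \mathbb{R}^d$ its $f$-vector, and $f(Q,t) = \sum_{i=0}^{d-1} f_i t^i$. For a cubical $d$-polytope define $h^c(Q,t) = \sum_{i=0}^d h^c_i t^i = \frac{t(1-t)^{d-1}}{1+t} f\left(Q,\frac{2t}{1-t}\right) + 2^{d-1}\frac{1-(-t)^{d+1}}{1+t}$; then $h^c_i = h^c_{d-i}$ (cubical Dehn–Sommerville relations), and the cubical $g$-vector is $g^c_0 = h^c_0 = 2^{d-1}$, $g^c_i = h^c_i - h^c_{i-1}$ for $1 \le i \le \lfloor d/2\rfloor$. The $f$-vector of a cubical $d$-polytope is an affine function of $(g^c_1,\dots,g^c_{\lfloor d/2\rfloor})$, given by inverting these formulas; the Adin cone $\mathcal{A}_d \subset \mathbb{R}^d$ is the image of the nonnegative orthant $\{g \in \mathbb{R}^{\lfloor d/2\rfloor} : g_i \ge 0\}$ under this affine map. Its apex is $f(\square^d)$ (corresponding to $g = 0$). *)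

theory Defs
  imports "HOL-Analysis.Analysis" "HOL-Computational_Algebra.Formal_Power_Series"
begin

definition combinatorially_equivalent :: "'a::real_vector set \<Rightarrow> 'b::real_vector set \<Rightarrow> bool" where
  "combinatorially_equivalent P Q \<longleftrightarrow>
     (\<exists>\<phi>. bij_betw \<phi> {F. F face_of P} {G. G face_of Q} \<and>
          (\<forall>F G. F face_of P \<longrightarrow> G face_of P \<longrightarrow> (F \<subseteq> G \<longleftrightarrow> \<phi> F \<subseteq> \<phi> G)))"

text \<open>For \<open>B \<subseteq> Basis\<close> this is the unit cube of dimension \<open>card B\<close> in the coordinate
  directions \<open>B\<close>; \<open>cube Basis\<close> is the full-dimensional unit cube.\<close>

definition cube :: "'a::euclidean_space set \<Rightarrow> 'a set" where
  "cube B = cbox 0 (\<Sum>B)"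

text \<open>The library counts the empty set as a face; it is not among the proper faces meant here.\<close>

definition cubical_polytope :: "nat \<Rightarrow> 'a::euclidean_space set \<Rightarrow> bool" where
  "cubical_polytope d P \<longleftrightarrow> polytope P \<and> aff_dim P = int d \<and>
     (\<forall>F. F face_of P \<longrightarrow> F \<noteq> P \<longrightarrow> F \<noteq> {} \<longrightarrow>
        (\<exists>B \<subseteq> (Basis :: 'a set). combinatorially_equivalent F (cube B)))"

text \<open>Vectors in \<open>d\<close>-space are functions on the naturals that vanish from index \<open>d\<close> on, so that
  equality of functions is equality of vectors.\<close>

definition Rd :: "nat \<Rightarrow> (nat \<Rightarrow> real) set" where
  "Rd d = {x. \<forall>i\<ge>d. x i = 0}"

definition f_vector :: "'a::euclidean_space set \<Rightarrow> nat \<Rightarrow> real" where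
  "f_vector P i =
     (if int i < aff_dim P then real (card {F. F face_of P \<and> aff_dim F = int i}) else 0)"

definition f_polynomial :: "nat \<Rightarrow> (nat \<Rightarrow> real) \<Rightarrow> real fps \<Rightarrow> real fps" where
  "f_polynomial d f t = (\<Sum>i<d. fps_const (f i) * t ^ i)"

text \<open>The defining rational function is read as a formal power series. Only its coefficients of
  index at most \<open>d\<close> are used. They do not depend on the sign of the term \<open>(-t)^(d+1)\<close>: for odd \<open>d\<close>
  the rational function is a polynomial only after replacing \<open>1 - (-t)^(d+1)\<close> by \<open>1 + t^(d+1)\<close>,
  and the coefficients up to \<open>d\<close> are those of that polynomial.\<close>

definition cubical_h_series :: "nat \<Rightarrow> (nat \<Rightarrow> real) \<Rightarrow> real fps" where
  "cubical_h_series d f =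
     fps_X * (1 - fps_X) ^ (d - 1) / (1 + fps_X) * f_polynomial d f (2 * fps_X / (1 - fps_X))
     + 2 ^ (d - 1) * ((1 - (- fps_X) ^ (d + 1)) / (1 + fps_X))"

definition cubical_h :: "nat \<Rightarrow> (nat \<Rightarrow> real) \<Rightarrow> nat \<Rightarrow> real" where
  "cubical_h d f i = fps_nth (cubical_h_series d f) i"

definition cubical_g :: "nat \<Rightarrow> (nat \<Rightarrow> real) \<Rightarrow> nat \<Rightarrow> real" where
  "cubical_g d f i =
     (if i = 0 then cubical_h d f 0 else cubical_h d f i - cubical_h d f (i - 1))"

definition cubical_Dehn_Sommerville :: "nat \<Rightarrow> (nat \<Rightarrow> real) \<Rightarrow> bool" where
  "cubical_Dehn_Sommerville d f \<longleftrightarrow> (\<forall>i\<le>d. cubical_h d f i = cubical_h d f (d - i))"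

definition f_of_g :: "nat \<Rightarrow> (nat \<Rightarrow> real) \<Rightarrow> nat \<Rightarrow> real" where
  "f_of_g d g = (THE f. f \<in> Rd d \<and> cubical_Dehn_Sommerville d f \<and>
                        (\<forall>i\<in>{1..d div 2}. cubical_g d f i = g i))"

definition Adin_cone :: "nat \<Rightarrow> (nat \<Rightarrow> real) set" where
  "Adin_cone d = f_of_g d ` {g. \<forall>i\<in>{1..d div 2}. 0 \<le> g i}"

definition angle_at :: "nat \<Rightarrow> (nat \<Rightarrow> real) \<Rightarrow> (nat \<Rightarrow> real) \<Rightarrow> (nat \<Rightarrow> real) \<Rightarrow> real" where
  "angle_at d x v y =
     arccos ((\<Sum>i<d. (x i - v i) * (y i - v i)) /
             (L2_set (\<lambda>i. x i - v i) {..<d} * L2_set (\<lambda>i. y i - v i) {..<d}))"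

text \<open>The rest shows that the description in \<open>f_of_g\<close> determines a unique vector.\<close>

definition hcoef :: "nat \<Rightarrow> nat \<Rightarrow> nat \<Rightarrow> real" where
  "hcoef d j i = fps_nth (fps_X * (1 - fps_X) ^ (d - 1) / (1 + fps_X)
                          * (2 * fps_X / (1 - fps_X)) ^ j) i"

definition hconst :: "nat \<Rightarrow> nat \<Rightarrow> real" where
  "hconst d i = fps_nth (2 ^ (d - 1) * ((1 - (- fps_X) ^ (d + 1)) / (1 + fps_X))) i"

lemma cubical_h_expand: "cubical_h d f i = (\<Sum>j<d. f j * hcoef d j i) + hconst d i"
proof -
  have "fps_X * (1 - fps_X) ^ (d - 1) / (1 + fps_X) * f_polynomial d f (2 * fps_X / (1 - fps_X))
      = (\<Sum>j<d. fps_const (f j) * (fps_X * (1 - fps_X) ^ (d - 1) / (1 + fps_X)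
                          * (2 * fps_X / (1 - fps_X)) ^ j))"
    unfolding f_polynomial_def sum_distrib_left by (intro sum.cong) (simp_all only: mult.left_commute)
  then show ?thesis
    unfolding cubical_h_def cubical_h_series_def hcoef_def hconst_def
    by (simp only: fps_add_nth fps_sum_nth fps_mult_left_const_nth)
qed

lemma hcoef_shift:
  obtains A :: "real fps" where "fps_nth A 0 = 2 ^ j"
    and "\<And>i. hcoef d j i = (if i < Suc j then 0 else fps_nth A (i - Suc j))"
proof -
  let ?A = "(1 - fps_X) ^ (d - 1) * inverse (1 + fps_X) * (2 * inverse (1 - fps_X)) ^ j :: real fps"
  have u: "fps_nth (1 + fps_X :: real fps) 0 \<noteq> 0" "fps_nth (1 - fps_X :: real fps) 0 \<noteq> 0" by auto
  have "fps_X * (1 - fps_X) ^ (d - 1) / (1 + fps_X) * (2 * fps_X / (1 - fps_X)) ^ j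
     = fps_X ^ Suc j * ?A"
    by (simp add: fps_divide_unit u power_mult_distrib algebra_simps)
  then have "hcoef d j i = (if i < Suc j then 0 else fps_nth ?A (i - Suc j))" for i
    unfolding hcoef_def by (simp only: fps_X_power_mult_nth)
  moreover have "fps_nth ?A 0 = 2 ^ j"
    by (simp add: fps_power_zeroth)
  ultimately show ?thesis using that by blast
qed

lemma hcoef_zero: "i \<le> j \<Longrightarrow> hcoef d j i = 0"
  by (rule hcoef_shift[of j d]) auto

lemma hcoef_diag: "hcoef d j (Suc j) = 2 ^ j"
  by (rule hcoef_shift[of j d]) auto

lemma hconst_0: "hconst d 0 = 2 ^ (d - 1)"
proof -
  have "(1 - (- fps_X) ^ (d + 1)) / (1 + fps_X :: real fps)
      = (1 - (- fps_X) ^ (d + 1)) * inverse (1 + fps_X)"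
    by (rule fps_divide_unit) simp
  then show ?thesis unfolding hconst_def by (simp add: fps_power_zeroth)
qed

lemma cubical_h_0: "cubical_h d f 0 = 2 ^ (d - 1)"
  by (simp add: cubical_h_expand hcoef_zero hconst_0)

lemma cubical_h_Suc:
  assumes "i < d"
  shows "cubical_h d f (Suc i) = (\<Sum>j<i. f j * hcoef d j (Suc i)) + f i * 2 ^ i + hconst d (Suc i)"
proof -
  have "(\<Sum>j<d. f j * hcoef d j (Suc i)) = (\<Sum>j<Suc i. f j * hcoef d j (Suc i))"
    using assms by (intro sum.mono_neutral_right) (auto simp: hcoef_zero)
  then show ?thesis by (simp add: cubical_h_expand hcoef_diag)
qed

lemma cubical_h_inj:
  assumes "f \<in> Rd d" "f' \<in> Rd d" "\<And>i. i < d \<Longrightarrow> cubical_h d f (Suc i) = cubical_h d f' (Suc i)"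
  shows "f = f'"
proof
  fix i
  show "f i = f' i"
  proof (induction i rule: less_induct)
    case (less i)
    show ?case
    proof (cases "i < d")
      case True
      have "(\<Sum>j<i. f j * hcoef d j (Suc i)) = (\<Sum>j<i. f' j * hcoef d j (Suc i))"
        using less by (intro sum.cong) auto
      then show ?thesis using assms(3)[OF True] by (simp add: cubical_h_Suc True)
    next
      case False
      then show ?thesis using assms by (simp add: Rd_def)
    qed
  qed
qed

lemma cubical_h_surj: "\<exists>f\<in>Rd d. \<forall>i<d. cubical_h d f (Suc i) = H i"
proof -
  have "\<exists>f. (\<forall>i\<ge>m. f i = 0) \<and> (\<forall>i<m. cubical_h d f (Suc i) = H i)" if "m \<le> d" for m
    using that
  proof (induction m)
    case 0
    show ?case by (intro exI[of _ "\<lambda>_. 0"]) simp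
  next
    case (Suc m)
    then obtain f where f: "\<forall>i\<ge>m. f i = 0" "\<forall>i<m. cubical_h d f (Suc i) = H i" by auto
    define f' where "f' = f(m := (H m - (\<Sum>j<m. f j * hcoef d j (Suc m)) - hconst d (Suc m)) / 2 ^ m)"
    have "cubical_h d f' (Suc i) = H i" if "i < Suc m" for i
    proof (cases "i = m")
      case True
      then show ?thesis using Suc.prems by (simp add: cubical_h_Suc f'_def)
    next
      case False
      with that have "i < m" by simp
      then have "cubical_h d f' (Suc i) = cubical_h d f (Suc i)"
        using Suc.prems by (simp add: cubical_h_Suc f'_def)
      then show ?thesis using f \<open>i < m\<close> by simp
    qed
    moreover have "\<forall>i\<ge>Suc m. f' i = 0" using f by (simp add: f'_def)
    ultimately show ?case by blast
  qed
  from this[of d] show ?thesis by (auto simp: Rd_def)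
qed

lemma cubical_h_from_g:
  "i \<le> d \<Longrightarrow> cubical_h d f i = 2 ^ (d - 1) + (\<Sum>k=1..i. cubical_g d f k)"
  by (induction i) (simp_all add: cubical_h_0 cubical_g_def)

lemma f_of_g_unique:
  "\<exists>!f. f \<in> Rd d \<and> cubical_Dehn_Sommerville d f \<and> (\<forall>i\<in>{1..d div 2}. cubical_g d f i = g i)"
proof (rule ex_ex1I)
  define K where "K i = 2 ^ (d - 1) + (\<Sum>k=1..min i (d - i). g k)" for i
  obtain f where f: "f \<in> Rd d" "\<forall>i<d. cubical_h d f (Suc i) = K (Suc i)"
    using cubical_h_surj[of d "\<lambda>i. K (Suc i)"] by blast
  have h: "cubical_h d f i = K i" if "i \<le> d" for i
    using that f(2) by (cases i) (auto simp: cubical_h_0 K_def)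
  have "cubical_Dehn_Sommerville d f"
    unfolding cubical_Dehn_Sommerville_def by (simp add: h) (simp add: K_def min.commute)
  moreover have "cubical_g d f i = g i" if i: "i \<in> {1..d div 2}" for i
  proof -
    obtain k where k: "i = Suc k" using i by (cases i) auto
    with i have "min i (d - i) = Suc k" "min k (d - k) = k" "i \<le> d" "k \<le> d" by auto
    then show ?thesis by (simp add: cubical_g_def h K_def k)
  qed
  ultimately show "\<exists>f. f \<in> Rd d \<and> cubical_Dehn_Sommerville d f \<and>
      (\<forall>i\<in>{1..d div 2}. cubical_g d f i = g i)" using f(1) by (intro exI[of _ f]) simp
next
  fix f f'
  assume f: "f \<in> Rd d \<and> cubical_Dehn_Sommerville d f \<and> (\<forall>i\<in>{1..d div 2}. cubical_g d f i = g i)"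
    and f': "f' \<in> Rd d \<and> cubical_Dehn_Sommerville d f' \<and> (\<forall>i\<in>{1..d div 2}. cubical_g d f' i = g i)"
  have low: "cubical_h d f i = cubical_h d f' i" if "i \<le> d div 2" for i
  proof -
    have "(\<Sum>k=1..i. cubical_g d f k) = (\<Sum>k=1..i. cubical_g d f' k)"
      using f f' that by (intro sum.cong refl) simp
    moreover have "i \<le> d" using that by simp
    ultimately show ?thesis by (simp only: cubical_h_from_g)
  qed
  have "cubical_h d f i = cubical_h d f' i" if "i \<le> d" for i
  proof (cases "i \<le> d div 2")
    case False
    then have "d - i \<le> d div 2" by auto
    from low[OF this] show ?thesis
      using f f' that unfolding cubical_Dehn_Sommerville_def by metis
  qed (rule low)
  then show "f = f'" using f f' by (intro cubical_h_inj[of f d f']) simp_all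
qed

end

theory Submission
  imports Defs "HOL-Computational_Algebra.Polynomial_FPS"
begin

text \<open>A triangular system of piecewise linear functions \<open>y i c = p i \<bullet> c + (\<Sum>j<i. a j i * \<bar>y j c\<bar>)\<close>
  in general position is the sign data of the normal fan of a cubical polytope, a projection of a
  deformed cube: its proper faces correspond to the sign patterns of the \<open>y i\<close> at points \<open>c \<noteq> 0\<close>, the
  dimension of a face being the number of zeros of its pattern. For each \<open>k \<le> d div 2\<close> a system with
  a long chain of additional functions has asymptotically as many patterns with \<open>k - 1\<close> zeros as
  possible (Brouwer's fixed point theorem produces these patterns), and the Dehn-Sommerville symmetry
  of the pattern count then forces the \<open>f\<close>-vectors to approach the direction of the \<open>k\<close>-th extreme
  ray of the Adin cone. The polytopes carry facets that are boxes, so that many of them can be glued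
  into one cubical polytope, whose \<open>f\<close>-vector is the sum up to lower order terms; suitable
  multiplicities approximate every direction in the cone.\<close>

text \<open>For the \<open>k\<close>-th ray only \<open>2 * k\<close> coordinates matter:
  \<open>2 * k - 2\<close> of them parametrize \<open>k - 1\<close> parabolas, one is their common
  leading coefficient and one starts the chain. Each parabola has \<open>l\<close> nodes and can be
  made to vanish at any one of them, which gives about \<open>l ^ (k - 1) * 2 ^ (k * l)\<close>
  patterns with \<open>k - 1\<close> zeros. The generating function of this system, with
  \<open>x\<close> marking zeros, is odd under \<open>x -> -2 - x\<close> and has degree at most
  \<open>2 * k - 1\<close>, so its \<open>k\<close> lowest coefficients determine it; all but the
  last of these are smaller by a factor of order \<open>l\<close>. In the limit only a multiple of
  \<open>(1 + x) * (x * (x + 2)) ^ (k - 1)\<close> is left. To reach dimension \<open>d\<close> the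
  leading coefficient is split into \<open>m = d + 1 - 2 * k\<close> coordinates that enter through
  the sum of their absolute values; this turns a factor \<open>(x + 2) - x\<close> into
  \<open>(x + 2) ^ m - x ^ m\<close>. The obstacle to gluing is convexity. A shear that keeps all
  patterns makes the bottom box wider than everything above it, so the polytope can be flattened
  until it fits on any box. One gluing loses a fixed number of faces, negligible against the size of
  the pieces.\<close>

section \<open>Euler characteristic\<close>

text \<open>The direction \<open>y - x\<close> stays inside the affine set and changes the value of
  \<open>c\<close>, so every value taken on the relatively open set is interior to the range; a
  bounded open convex set of reals is an open interval.\<close>

lemma relatively_open_slice_interval:
  fixes c :: "'a::euclidean_space"
  assumes "affine A" "open U" "convex (A \<inter> U)" "bounded (A \<inter> U)"
    and x: "x \<in> A \<inter> U" and y: "y \<in> A \<inter> U" and xy: "c \<bullet> x \<noteq> c \<bullet> y"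
  obtains a b where "a < b" "\<And>s. (A \<inter> U \<inter> {z. c \<bullet> z = s} \<noteq> {}) \<longleftrightarrow> a < s \<and> s < b"
proof -
  define I where "I = (\<lambda>z. c \<bullet> z) ` (A \<inter> U)"
  have cI: "convex I" unfolding I_def
    by (intro convex_linear_image assms bounded_linear.linear bounded_linear_inner_right)
  have bI: "bounded I" unfolding I_def
    by (intro bounded_linear_image assms bounded_linear_inner_right)
  have neI: "I \<noteq> {}" using x by (auto simp: I_def)
  have opI: "open I" unfolding open_dist
  proof
    fix r assume "r \<in> I"
    then obtain z where z: "z \<in> A" "z \<in> U" and r: "r = c \<bullet> z" by (auto simp: I_def)
    obtain e where e: "e > 0" "ball z e \<subseteq> U" using \<open>open U\<close> z open_contains_ball by blast
    define k where "k = c \<bullet> (y - x)"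
    have k: "k \<noteq> 0" using xy by (simp add: k_def inner_diff_right)
    then have yx: "norm (y - x) > 0" by (auto simp: k_def)
    show "\<exists>d>0. \<forall>s. dist s r < d \<longrightarrow> s \<in> I"
    proof (intro exI[of _ "e * \<bar>k\<bar> / norm (y - x)"] conjI allI impI)
      show "0 < e * \<bar>k\<bar> / norm (y - x)" using e k yx by simp
      fix s assume s: "dist s r < e * \<bar>k\<bar> / norm (y - x)"
      define t where "t = (s - r) / k"
      have "\<bar>t\<bar> * norm (y - x) < e"
        using s k yx by (simp add: t_def dist_real_def field_simps)
      then have "z + t *\<^sub>R (y - x) \<in> U" using e by (auto simp: subset_eq dist_norm)
      moreover have "z + t *\<^sub>R (y - x) \<in> A"
        using mem_affine_3_minus[of A z y x t] assms z x y by auto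
      moreover have "c \<bullet> (z + t *\<^sub>R (y - x)) = s"
        using k by (simp add: inner_add_right t_def r flip: k_def)
      ultimately show "s \<in> I" unfolding I_def by blast
    qed
  qed
  define a b where "a = Inf I" and "b = Sup I"
  have bdd: "bdd_above I" "bdd_below I" using bI by (auto simp: bounded_imp_bdd_above bounded_imp_bdd_below)
  have mem: "s \<in> I \<longleftrightarrow> a < s \<and> s < b" for s
  proof
    assume "s \<in> I"
    then obtain d where d: "d > 0" "\<And>s'. dist s' s < d \<Longrightarrow> s' \<in> I" using opI unfolding open_dist by blast
    have "s - d/2 \<in> I" "s + d/2 \<in> I" using d by (auto intro!: d(2) simp: dist_real_def)
    then have "a \<le> s - d/2" "s + d/2 \<le> b" using bdd by (auto simp: a_def b_def intro: cInf_lower cSup_upper)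
    then show "a < s \<and> s < b" using d by linarith
  next
    assume "a < s \<and> s < b"
    then obtain p q where "p \<in> I" "p < s" "q \<in> I" "s < q"
      using cInf_lessD[OF neI] less_cSupD[OF neI] unfolding a_def b_def by blast
    moreover have "is_interval I" using cI by (simp add: is_interval_convex_1)
    ultimately show "s \<in> I" unfolding is_interval_1 by (meson less_imp_le)
  qed
  have "a < b" using mem neI by fastforce
  moreover have "(A \<inter> U \<inter> {z. c \<bullet> z = s} \<noteq> {}) \<longleftrightarrow> a < s \<and> s < b" for s
    unfolding mem[symmetric] by (auto simp: I_def)
  ultimately show ?thesis using that by blast
qed

lemma aff_dim_nonneg_iff: "0 \<le> aff_dim (S::'a::euclidean_space set) \<longleftrightarrow> S \<noteq> {}"
  using aff_dim_negative_iff[of S] by linarith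

lemma aff_dim_hyperplane_slice:
  fixes c :: "'a::euclidean_space"
  assumes "affine A" "A \<inter> {z. c \<bullet> z = s} \<noteq> {}" "x \<in> A" "y \<in> A" "c \<bullet> x \<noteq> c \<bullet> y"
  shows "aff_dim (A \<inter> {z. c \<bullet> z = s}) = aff_dim A - 1"
proof -
  have "\<not> A \<subseteq> {z. c \<bullet> z = s}"
  proof
    assume "A \<subseteq> {z. c \<bullet> z = s}"
    then have "c \<bullet> x = s" "c \<bullet> y = s" using assms(3,4) by auto
    then show False using assms(5) by simp
  qed
  then show ?thesis using assms by (simp add: aff_dim_affine_Int_hyperplane)
qed

lemma finite_real_gap:
  assumes "finite (C::real set)"
  obtains \<delta> where "\<delta> > 0" "\<And>s t. s \<in> C \<Longrightarrow> t \<in> C \<Longrightarrow> s < t \<Longrightarrow> s + \<delta> < t"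
proof -
  define D where "D = insert 1 ((\<lambda>(s,t). t - s) ` {(s,t). s \<in> C \<and> t \<in> C \<and> s < t})"
  have "finite {(s,t). s \<in> C \<and> t \<in> C \<and> s < t}"
    by (rule finite_subset[of _ "C \<times> C"]) (use assms in auto)
  then have fD: "finite D" by (simp add: D_def)
  have pos: "Min D > 0" using fD by (subst Min_gr_iff) (auto simp: D_def)
  have "s + Min D / 2 < t" if "s \<in> C" "t \<in> C" "s < t" for s t
  proof -
    have "Min D \<le> t - s" using fD that by (intro Min_le) (auto simp: D_def)
    then show ?thesis using pos by linarith
  qed
  then show ?thesis using that[of "Min D / 2"] pos by simp
qed

text \<open>Hadwiger's induction: the alternating sum is the sum over all levels \<open>s\<close> of the jump, from
  \<open>s\<close> to just above \<open>s\<close>, of the alternating sum of the slices by the hyperplane at level \<open>s\<close>. With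
  \<open>cl\<close> the set \<open>K\<close> is compact, without it \<open>K\<close> is relatively open.\<close>

lemma euler_characteristic_partition:
  fixes K :: "'a::euclidean_space set" and I :: "'i set"
  assumes "finite I"
    and "\<And>i. i \<in> I \<Longrightarrow> affine (A i) \<and> open (U i) \<and> convex (A i \<inter> U i) \<and> A i \<inter> U i \<noteq> {}"
    and "disjoint_family_on (\<lambda>i. A i \<inter> U i) I"
    and "K = (\<Union>i\<in>I. A i \<inter> U i)" "convex K" "bounded K" "K \<noteq> {}"
    and "if cl then closed K else K = B \<inter> W \<and> affine B \<and> open W"
  shows "(\<Sum>i\<in>I. (-1::real) ^ nat (aff_dim (A i))) = (if cl then 1 else (-1) ^ nat (aff_dim B))"
  using assms
proof (induction "nat (aff_dim K)" arbitrary: K I A U B W rule: less_induct)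
  case less
  note fin = less.prems(1) and piece = less.prems(2) and disj = less.prems(3)
    and K = less.prems(4) and conv = less.prems(5) and bdd = less.prems(6) and ne = less.prems(7)
    and type = less.prems(8)
  have sub: "A i \<inter> U i \<subseteq> K" if "i \<in> I" for i using K that by blast
  show ?case
  proof (cases "\<exists>x\<in>K. \<exists>y\<in>K. x \<noteq> y")
    case False
    then obtain x where x: "K = {x}" using ne by blast
    then have single: "A i \<inter> U i = {x}" if "i \<in> I" for i using piece[OF that] sub[OF that] by blast
    have op: "A = {x}" if "A \<inter> U = {x}" "affine A" "open U" for A U
    proof -
      have "openin (top_of_set A) {x}" using that by (metis openin_open_Int)
      then have "openin (top_of_set (affine hull A)) {x}" using that by (simp add: affine_hull_eq[THEN iffD2])
      then have "affine hull {x} = affine hull A" by (rule affine_hull_openin) simp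
      then show ?thesis using that by (simp add: affine_hull_eq[THEN iffD2])
    qed
    have dim0: "aff_dim (A i) = 0" if "i \<in> I" for i
      using op[OF single[OF that]] piece[OF that] by simp
    obtain i where i: "i \<in> I" using ne K by blast
    have "I = {i}"
    proof -
      have "j = i" if "j \<in> I" for j
      proof (rule ccontr)
        assume "j \<noteq> i"
        then have "(A j \<inter> U j) \<inter> (A i \<inter> U i) = {}" using disj that i by (auto simp: disjoint_family_on_def)
        then show False using single[OF that] single[OF i] by simp
      qed
      then show ?thesis using i by blast
    qed
    moreover have "\<not> cl \<longrightarrow> aff_dim B = 0" using type op[of B W] x by auto
    ultimately show ?thesis using dim0[OF i] by simp
  next
    case True
    then obtain x y where xy: "x \<in> K" "y \<in> K" "x \<noteq> y" by blast
    define c where "c = x - y"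
    have cxy: "c \<bullet> x \<noteq> c \<bullet> y" 
    proof
      assume "c \<bullet> x = c \<bullet> y"
      then have "c \<bullet> c = 0" by (simp add: c_def inner_diff_right)
      then show False using xy by (simp add: c_def)
    qed
    define H where "H s = {z. c \<bullet> z = s}" for s
    have affH: "affine (A \<inter> H s)" if "affine A" for A s
      unfolding H_def by (intro affine_Int that affine_hyperplane)
    have cv: "convex (H s)" "closed (H s)" for s
      unfolding H_def by (auto intro: convex_hyperplane closed_hyperplane)
    \<comment> \<open>Contribution of piece \<open>i\<close> to the slice at level \<open>s\<close>.
      The slices have smaller dimension than \<open>K\<close>, so the induction hypothesis evaluates
      their total \<open>E s\<close>.\<close>
    define e where "e i s = (if A i \<inter> U i \<inter> H s \<noteq> {} then (-1::real) ^ nat (aff_dim (A i \<inter> H s)) else 0)" for i s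
    define E where "E s = (\<Sum>i\<in>I. e i s)" for s
    have E: "E s = (if K \<inter> H s = {} then 0 else if cl then 1 else (-1) ^ nat (aff_dim (B \<inter> H s)))" for s
    proof (cases "K \<inter> H s = {}")
      case True
      then have "e i s = 0" if "i \<in> I" for i using sub[OF that] by (auto simp: e_def)
      then show ?thesis using True by (simp add: E_def)
    next
      case False
      let ?I = "{i\<in>I. A i \<inter> U i \<inter> H s \<noteq> {}}"
      have "E s = (\<Sum>i\<in>?I. (-1) ^ nat (aff_dim (A i \<inter> H s)))"
        unfolding E_def using fin by (intro sum.mono_neutral_cong_right) (auto simp: e_def)
      also have "\<dots> = (if cl then 1 else (-1) ^ nat (aff_dim (B \<inter> H s)))"
      proof (rule less.hyps[where K="K \<inter> H s" and U=U and W=W])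
        have "aff_dim (K \<inter> H s) < aff_dim K"
        proof -
          have "\<not> affine hull K \<subseteq> H s" using xy cxy hull_inc[of x K affine] hull_inc[of y K affine]
            by (auto simp: H_def)
          moreover have "affine hull K \<inter> H s \<noteq> {}" using False hull_subset[of K affine] by blast
          ultimately have "aff_dim (affine hull K \<inter> H s) = aff_dim (affine hull K) - 1"
            unfolding H_def by (subst aff_dim_affine_Int_hyperplane) auto
          moreover have "aff_dim (K \<inter> H s) \<le> aff_dim (affine hull K \<inter> H s)"
            by (rule aff_dim_subset) (use hull_subset[of K affine] in auto)
          ultimately show ?thesis by simp
        qed
        moreover have "aff_dim (K \<inter> H s) \<ge> 0" using False by (simp add: aff_dim_nonneg_iff)
        ultimately show "nat (aff_dim (K \<inter> H s)) < nat (aff_dim K)" by simp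
        show "finite ?I" using fin by simp
        show "affine (A i \<inter> H s) \<and> open (U i) \<and> convex (A i \<inter> H s \<inter> U i) \<and> A i \<inter> H s \<inter> U i \<noteq> {}" if "i \<in> ?I" for i
        proof -
          have eq: "A i \<inter> H s \<inter> U i = A i \<inter> U i \<inter> H s" by blast
          have "i \<in> I" using that by simp
          then show ?thesis using piece[of i] affH[of "A i" s] cv[of s] that unfolding eq
            by (auto intro: convex_Int)
        qed
        show "disjoint_family_on (\<lambda>i. A i \<inter> H s \<inter> U i) ?I"
          using disj by (auto simp: disjoint_family_on_def)
        show "K \<inter> H s = (\<Union>i\<in>?I. A i \<inter> H s \<inter> U i)" using K by auto
        show "convex (K \<inter> H s)" using conv cv by (auto intro: convex_Int)
        show "bounded (K \<inter> H s)" using bdd by (rule bounded_subset) auto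
        show "K \<inter> H s \<noteq> {}" by fact
        show "if cl then closed (K \<inter> H s) else K \<inter> H s = B \<inter> H s \<inter> W \<and> affine (B \<inter> H s) \<and> open W"
          using type cv affH[of B s] by (auto intro: closed_Int)
      qed
      finally show ?thesis using False by simp
    qed
    \<comment> \<open>A piece on which \<open>c\<close> varies is met exactly at the levels of an
      open interval, in one dimension less, hence with opposite sign; a piece inside one hyperplane
      is met at a single level with its own sign. The case \<open>a = b\<close> encodes the
      latter.\<close>
    define Q where "Q i a b \<longleftrightarrow> a \<le> b \<and> (\<forall>s. e i s = (if a = b then if s = a then (-1) ^ nat (aff_dim (A i)) else 0
        else if a < s \<and> s < b then - ((-1) ^ nat (aff_dim (A i))) else 0))" for i a b
    have intv: "\<exists>a b. a \<le> b \<and> (\<forall>s. e i s = (if a = b then if s = a then (-1) ^ nat (aff_dim (A i)) else 0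
        else if a < s \<and> s < b then - ((-1) ^ nat (aff_dim (A i))) else 0))" if i: "i \<in> I" for i
    proof (cases "\<exists>u\<in>A i \<inter> U i. \<exists>v\<in>A i \<inter> U i. c \<bullet> u \<noteq> c \<bullet> v")
      case True
      then obtain u v where uv: "u \<in> A i \<inter> U i" "v \<in> A i \<inter> U i" "c \<bullet> u \<noteq> c \<bullet> v" by blast
      have "bounded (A i \<inter> U i)" using bdd sub[OF i] bounded_subset by blast
      then obtain a b where ab: "a < b" "\<And>s. (A i \<inter> U i \<inter> H s \<noteq> {}) \<longleftrightarrow> a < s \<and> s < b"
        using relatively_open_slice_interval[of "A i" "U i" u v c] piece[OF i] uv unfolding H_def by metis
      have "e i s = - ((-1) ^ nat (aff_dim (A i)))" if "a < s \<and> s < b" for s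
      proof -
        have n: "A i \<inter> H s \<noteq> {}" using ab(2) that by blast
        then have "aff_dim (A i \<inter> H s) = aff_dim (A i) - 1" unfolding H_def
          using aff_dim_hyperplane_slice[of "A i" c s u v] piece[OF i] uv by auto
        moreover have "aff_dim (A i \<inter> H s) \<ge> 0" using n by (simp add: aff_dim_nonneg_iff)
        ultimately have "nat (aff_dim (A i)) = Suc (nat (aff_dim (A i \<inter> H s)))" by simp
        then show ?thesis using ab(2)[of s] that by (simp add: e_def)
      qed
      moreover have "e i s = 0" if "\<not> (a < s \<and> s < b)" for s using ab(2)[of s] that by (auto simp: e_def)
      ultimately show ?thesis using ab(1) by (intro exI[of _ a] exI[of _ b]) auto
    next
      case False
      obtain u where u: "u \<in> A i \<inter> U i" using piece[OF i] by blast
      define a where "a = c \<bullet> u"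
      \<comment> \<open>If \<open>c\<close> is constant on a relatively open part of
        \<open>A i\<close>, it is constant on \<open>A i\<close>: a short move from \<open>u\<close>
        towards \<open>v\<close> stays in the piece.\<close>
      have all: "c \<bullet> v = a" if "v \<in> A i" for v
      proof (rule ccontr)
        assume nv: "c \<bullet> v \<noteq> a"
        obtain d where d: "d > 0" "ball u d \<subseteq> U i" using piece[OF i] u open_contains_ball by blast
        define t where "t = d / (2 * (1 + norm (v - u)))"
        have np: "1 + norm (v - u) > 0" by (simp add: add_pos_nonneg)
        have t: "t > 0" using d np by (simp add: t_def)
        have "t * norm (v - u) < d"
        proof -
          have "t * norm (v - u) \<le> t * (1 + norm (v - u))" using t by simp
          also have "\<dots> = d / 2" using np by (simp add: t_def divide_simps)
          finally show ?thesis using d by simp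
        qed
        then have "u + t *\<^sub>R (v - u) \<in> U i" using d t by (auto simp: subset_eq dist_norm)
        moreover have "u + t *\<^sub>R (v - u) \<in> A i" using mem_affine_3_minus[of "A i" u v u t] piece[OF i] u that by auto
        ultimately have "c \<bullet> (u + t *\<^sub>R (v - u)) = a" using False u a_def by (metis IntI)
        then show False using t nv by (simp add: inner_add_right inner_diff_right a_def)
      qed
      have "e i a = (-1) ^ nat (aff_dim (A i))"
      proof -
        have "A i \<inter> H a = A i" using all by (auto simp: H_def)
        moreover have "A i \<inter> U i \<inter> H a \<noteq> {}" using u by (auto simp: H_def a_def)
        ultimately show ?thesis by (simp add: e_def)
      qed
      moreover have "e i s = 0" if "s \<noteq> a" for s
      proof -
        have "A i \<inter> U i \<inter> H s = {}" using all that by (auto simp: H_def)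
        then show ?thesis by (simp add: e_def)
      qed
      ultimately show ?thesis by (intro exI[of _ a]) auto
    qed
    then have "\<forall>i\<in>I. \<exists>a b. Q i a b" by (simp add: Q_def)
    then obtain a b where "\<forall>i\<in>I. Q i (a i) (b i)" by metis
    then have ab: "\<And>i. i \<in> I \<Longrightarrow> a i \<le> b i"
      "\<And>i s. i \<in> I \<Longrightarrow> e i s = (if a i = b i then if s = a i then (-1) ^ nat (aff_dim (A i)) else 0
        else if a i < s \<and> s < b i then - ((-1) ^ nat (aff_dim (A i))) else 0)" by (simp_all add: Q_def)
    have EK: "\<exists>\<alpha> \<beta>. \<alpha> < \<beta> \<and> (\<forall>s. E s = (if cl then if \<alpha> \<le> s \<and> s \<le> \<beta> then 1 else 0
         else if \<alpha> < s \<and> s < \<beta> then - ((-1) ^ nat (aff_dim B)) else 0))"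
    proof (cases cl)
      case True
      define I' where "I' = (\<lambda>z. c \<bullet> z) ` K"
      have "compact K" using True type bdd by (simp add: compact_eq_bounded_closed)
      then have "compact I'" unfolding I'_def by (intro compact_continuous_image continuous_intros)
      moreover have "connected I'" unfolding I'_def
        by (intro connected_continuous_image continuous_intros convex_connected conv)
      ultimately obtain \<alpha> \<beta> where I': "I' = {\<alpha>..\<beta>}" using connected_compact_interval_1[of I'] by (auto)
      have "(K \<inter> H s \<noteq> {}) \<longleftrightarrow> s \<in> I'" for s by (auto simp: I'_def H_def)
      then have "E s = (if \<alpha> \<le> s \<and> s \<le> \<beta> then 1 else 0)" for s using E[of s] True I' by auto
      moreover have "\<alpha> < \<beta>"
      proof -
        have "c \<bullet> x \<in> I'" "c \<bullet> y \<in> I'" using xy by (auto simp: I'_def)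
        then show ?thesis using cxy I' by auto
      qed
      ultimately show ?thesis using True by auto
    next
      case False
      then have KB: "K = B \<inter> W" "affine B" "open W" using type by auto
      obtain \<alpha> \<beta> where "\<alpha> < \<beta>" and h: "\<And>s. (K \<inter> H s \<noteq> {}) \<longleftrightarrow> \<alpha> < s \<and> s < \<beta>"
        using relatively_open_slice_interval[of B W x y c] KB conv bdd xy cxy unfolding H_def by metis
      have "E s = - ((-1) ^ nat (aff_dim B))" if s: "\<alpha> < s \<and> s < \<beta>" for s
      proof -
        have n: "B \<inter> H s \<noteq> {}" using h[of s] s KB by blast
        then have "aff_dim (B \<inter> H s) = aff_dim B - 1" unfolding H_def
          using aff_dim_hyperplane_slice[of B c s x y] KB xy cxy by auto
        moreover have "aff_dim (B \<inter> H s) \<ge> 0" using n by (simp add: aff_dim_nonneg_iff)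
        ultimately have "nat (aff_dim B) = Suc (nat (aff_dim (B \<inter> H s)))" by simp
        then show ?thesis using E[of s] h[of s] s False by simp
      qed
      moreover have "E s = 0" if "\<not> (\<alpha> < s \<and> s < \<beta>)" for s using E[of s] h[of s] that by auto
      ultimately show ?thesis using False \<open>\<alpha> < \<beta>\<close> by (intro exI[of _ \<alpha>] exI[of _ \<beta>]) auto
    qed
    then obtain \<alpha> \<beta> where "\<alpha> < \<beta> \<and> (\<forall>s. E s = (if cl then if \<alpha> \<le> s \<and> s \<le> \<beta> then 1 else 0
         else if \<alpha> < s \<and> s < \<beta> then - ((-1) ^ nat (aff_dim B)) else 0))" by (elim exE)
    then have \<alpha>\<beta>: "\<alpha> < \<beta>" "\<And>s. E s = (if cl then if \<alpha> \<le> s \<and> s \<le> \<beta> then 1 else 0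
         else if \<alpha> < s \<and> s < \<beta> then - ((-1) ^ nat (aff_dim B)) else 0)" by simp_all
    \<comment> \<open>\<open>C\<close> contains every level at which a contribution changes, and
      \<open>\<delta>\<close> is below all gaps in \<open>C\<close>, so \<open>s + \<delta>\<close>
      means just above \<open>s\<close>. Summed over \<open>C\<close>, the jumps from
      \<open>s\<close> to \<open>s + \<delta>\<close> return the weight of each piece: an open
      interval jumps at its left end, a point at itself. The total is treated alike, with a closed
      interval jumping at its right end.\<close>
    define C where "C = insert \<alpha> (insert \<beta> (a ` I \<union> b ` I))"
    have fC: "finite C" using fin by (simp add: C_def)
    obtain \<delta> where \<delta>: "\<delta> > 0" "\<And>s t. s \<in> C \<Longrightarrow> t \<in> C \<Longrightarrow> s < t \<Longrightarrow> s + \<delta> < t"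
      using finite_real_gap[OF fC] by blast
    have above: "(u < s + \<delta> \<longleftrightarrow> u \<le> s) \<and> (s + \<delta> < u \<longleftrightarrow> s < u) \<and> s + \<delta> \<noteq> u" if "s \<in> C" "u \<in> C" for s u
      using \<delta>(2)[OF that] \<delta>(1) by (cases "s < u") auto
    have open_jump: "(\<Sum>s\<in>C. (if u < s \<and> s < v then - q else 0) - (if u < s + \<delta> \<and> s + \<delta> < v then - q else (0::real))) = q"
      if "u \<in> C" "v \<in> C" "u < v" for u v q
    proof -
      have "(if u < s \<and> s < v then - q else 0) - (if u < s + \<delta> \<and> s + \<delta> < v then - q else 0) = (if s = u then q else 0)"
        if "s \<in> C" for s using above[OF that \<open>u \<in> C\<close>] above[OF that \<open>v \<in> C\<close>] \<open>u < v\<close> by auto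
      then have "(\<Sum>s\<in>C. (if u < s \<and> s < v then - q else 0) - (if u < s + \<delta> \<and> s + \<delta> < v then - q else (0::real)))
          = (\<Sum>s\<in>C. if s = u then q else 0)" by (intro sum.cong) auto
      then show ?thesis using fC that by simp
    qed
    have "(\<Sum>s\<in>C. e i s - e i (s + \<delta>)) = (-1) ^ nat (aff_dim (A i))" if i: "i \<in> I" for i
    proof (cases "a i = b i")
      case True
      have "e i s - e i (s + \<delta>) = (if s = a i then (-1) ^ nat (aff_dim (A i)) else 0)" if "s \<in> C" for s
        using above[OF that, of "a i"] i True by (auto simp: ab(2)[OF i] C_def)
      then have "(\<Sum>s\<in>C. e i s - e i (s + \<delta>)) = (\<Sum>s\<in>C. if s = a i then (-1) ^ nat (aff_dim (A i)) else 0)"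
        by (intro sum.cong) auto
      then show ?thesis using fC i by (simp add: C_def)
    next
      case False
      then show ?thesis using open_jump[of "a i" "b i" "(-1) ^ nat (aff_dim (A i))"] i ab(1)[OF i]
        by (simp add: ab(2)[OF i] C_def)
    qed
    then have "(\<Sum>i\<in>I. (-1) ^ nat (aff_dim (A i))) = (\<Sum>i\<in>I. \<Sum>s\<in>C. e i s - e i (s + \<delta>))" by simp
    also have "\<dots> = (\<Sum>s\<in>C. E s - E (s + \<delta>))"
      unfolding E_def by (subst sum.swap) (simp add: sum_subtractf)
    also have "\<dots> = (if cl then 1 else (-1) ^ nat (aff_dim B))"
    proof (cases cl)
      case True
      have "E s - E (s + \<delta>) = (if s = \<beta> then 1 else 0)" if "s \<in> C" for s
        using above[OF that, of \<alpha>] above[OF that, of \<beta>] \<alpha>\<beta> True unfolding C_def by auto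
      then have "(\<Sum>s\<in>C. E s - E (s + \<delta>)) = (\<Sum>s\<in>C. if s = \<beta> then 1 else 0)" by (intro sum.cong) auto
      then show ?thesis using fC True by (simp add: C_def)
    next
      case False
      then show ?thesis using open_jump[of \<alpha> \<beta> "(-1) ^ nat (aff_dim B)"] \<alpha>\<beta> by (simp add: C_def)
    qed
    finally show ?thesis .
  qed
qed

section \<open>Triangular piecewise linear systems\<close>

lemma sgn_pos_combination:
  fixes x y r q \<tau> :: real
  assumes "x > 0" "y > 0" "sgn r = \<tau>" "sgn q = \<tau>"
  shows "sgn (x * r + y * q) = \<tau>"
proof (cases r "0::real" rule: linorder_cases)
  case less
  then have "q < 0" using assms(3,4) by (cases q "0::real" rule: linorder_cases) auto
  then have "x * r + y * q < 0" using less assms(1,2) by (simp add: add_neg_neg mult_pos_neg)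
  then show ?thesis using less assms(3) by simp
next
  case equal
  then show ?thesis using assms(3,4) by (auto simp: sgn_0_0)
next
  case greater
  then have "q > 0" using assms(3,4) by (cases q "0::real" rule: linorder_cases) auto
  then have "x * r + y * q > 0" using greater assms(1,2) by (simp add: add_pos_pos)
  then show ?thesis using greater assms(3) by simp
qed

context
  fixes p :: "nat \<Rightarrow> 'a::euclidean_space" and a :: "nat \<Rightarrow> nat \<Rightarrow> real"
begin

context
  notes sum.cong [fundef_cong]
begin

fun plf :: "nat \<Rightarrow> 'a \<Rightarrow> real" where
  "plf i c = p i \<bullet> c + (\<Sum>j<i. a j i * \<bar>plf j c\<bar>)"

text \<open>Where \<open>\<bar>y j\<bar> = s j * y j\<close> for all earlier \<open>j\<close>, the
  function \<open>plf i\<close> is linear; \<open>linv s i\<close> is its gradient there.\<close>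

fun linv :: "(nat \<Rightarrow> real) \<Rightarrow> nat \<Rightarrow> 'a" where
  "linv s i = p i + (\<Sum>j<i. (a j i * s j) *\<^sub>R linv s j)"

end

declare plf.simps [simp del] linv.simps [simp del]

lemma continuous_on_plf [continuous_intros]: "continuous_on A (plf i)"
proof (induction i rule: less_induct)
  case (less i)
  have "continuous_on A (\<lambda>c. p i \<bullet> c + (\<Sum>j<i. a j i * \<bar>plf j c\<bar>))"
    using less by (intro continuous_intros) auto
  moreover have "plf i = (\<lambda>c. p i \<bullet> c + (\<Sum>j<i. a j i * \<bar>plf j c\<bar>))"
    by (rule ext) (rule plf.simps)
  ultimately show ?case by metis
qed

lemma plf_scaleR: "r \<ge> 0 \<Longrightarrow> plf i (r *\<^sub>R c) = r * plf i c"
proof (induction i rule: less_induct)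
  case (less i)
  have "(\<Sum>j<i. a j i * \<bar>plf j (r *\<^sub>R c)\<bar>) = r * (\<Sum>j<i. a j i * \<bar>plf j c\<bar>)"
    unfolding sum_distrib_left using less by (intro sum.cong) (auto simp: abs_mult)
  then show ?case by (simp add: plf.simps[of i] distrib_left)
qed

lemma plf_eq_linv:
  assumes "\<And>j. j < i \<Longrightarrow> \<bar>plf j c\<bar> = s j * plf j c"
  shows "plf i c = linv s i \<bullet> c"
  using assms
proof (induction i rule: less_induct)
  case (less i)
  have "(\<Sum>j<i. a j i * \<bar>plf j c\<bar>) = (\<Sum>j<i. a j i * (s j * (linv s j \<bullet> c)))"
    using less by (intro sum.cong) auto
  then show ?case
    by (simp add: plf.simps[of i] linv.simps[of s i] inner_add_left inner_sum_left mult.assoc)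
qed

lemma linv_eq_plf:
  assumes "\<And>j. j < i \<Longrightarrow> \<bar>linv s j \<bullet> c\<bar> = s j * (linv s j \<bullet> c)"
  shows "plf i c = linv s i \<bullet> c"
  using assms
proof (induction i rule: less_induct)
  case (less i)
  then have "plf j c = linv s j \<bullet> c" if "j < i" for j using that by auto
  then show ?case using less.prems by (intro plf_eq_linv) auto
qed

text \<open>Along the chain, the sign conditions on the piecewise linear functions and on their
  linear forms imply each other step by step. Hence every cell is a relatively open polyhedral
  cone.\<close>

lemma sgn_plf_iff_linv:
  "(\<forall>j<n. sgn (plf j c) = s j) \<longleftrightarrow> (\<forall>j<n. sgn (linv s j \<bullet> c) = s j)" (is "?L \<longleftrightarrow> ?R")
proof
  assume L: ?L
  have "\<bar>plf j c\<bar> = s j * plf j c" if "j < n" for j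
    using L that by (metis linordered_idom_class.abs_sgn mult.commute)
  then have "plf j c = linv s j \<bullet> c" if "j < n" for j using that by (intro plf_eq_linv) auto
  then show ?R using L by simp
next
  assume R: ?R
  have "\<bar>linv s j \<bullet> c\<bar> = s j * (linv s j \<bullet> c)" if "j < n" for j
    using R that by (metis linordered_idom_class.abs_sgn mult.commute)
  then have "plf j c = linv s j \<bullet> c" if "j < n" for j using that by (intro linv_eq_plf) auto
  then show ?L using R by simp
qed

lemma plf_same_cell:
  assumes "\<forall>j<n. sgn (plf j c) = s j" "i \<le> n"
  shows "plf i c = linv s i \<bullet> c"
proof (rule plf_eq_linv)
  fix j assume "j < i"
  then show "\<bar>plf j c\<bar> = s j * plf j c"
    using assms by (metis linordered_idom_class.abs_sgn mult.commute order_less_le_trans)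
qed

text \<open>On the subspace \<open>S\<close> the functions with index outside \<open>J\<close> vanish, and no other one vanishes
  identically on a cell of its predecessors.\<close>

definition generic :: "'a set \<Rightarrow> nat set \<Rightarrow> nat \<Rightarrow> bool" where
  "generic S J n \<longleftrightarrow> subspace S \<and>
     (\<forall>i<n. i \<notin> J \<longrightarrow> (\<forall>c\<in>S. plf i c = 0)) \<and>
     (\<forall>i<n. i \<in> J \<longrightarrow> (\<forall>c\<in>S - {0}. \<exists>c'\<in>S - {0}. (\<forall>j<i. sgn (plf j c') = sgn (plf j c)) \<and> plf i c' \<noteq> 0))"

lemma generic_mono: "generic S J n \<Longrightarrow> m \<le> n \<Longrightarrow> generic S J m"
  unfolding generic_def by (meson order_less_le_trans)

lemma eventually_sgn_same:
  fixes f :: "'b::topological_space \<Rightarrow> real"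
  assumes "continuous_on UNIV f" "f x \<noteq> 0"
  shows "eventually (\<lambda>z. sgn (f z) = sgn (f x)) (nhds x)"
proof (cases "f x > 0")
  case True
  have "open {z. f z > 0}" using assms(1) by (intro open_Collect_less continuous_intros) auto
  then show ?thesis using True eventually_nhds_in_open[of "{z. f z > 0}" x]
    by (auto elim: eventually_mono)
next
  case False
  then have "f x < 0" using assms by simp
  moreover have "open {z. f z < 0}" using assms(1) by (intro open_Collect_less continuous_intros) auto
  ultimately show ?thesis using eventually_nhds_in_open[of "{z. f z < 0}" x]
    by (auto elim: eventually_mono)
qed

text \<open>Moving along \<open>d\<close> keeps the vanishing linear forms at zero, and nonzero
  signs are open conditions.\<close>

lemma cell_perturb:
  assumes c: "\<forall>j<n. sgn (plf j c) = s j" and d: "\<forall>j<n. s j = 0 \<longrightarrow> linv s j \<bullet> d = 0" and "c \<noteq> 0" "\<delta> > 0"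
  obtains \<eta> where "\<eta> > 0" "\<And>\<theta>. \<bar>\<theta>\<bar> \<le> \<eta> \<Longrightarrow> c + \<theta> *\<^sub>R d \<noteq> 0 \<and> dist (c + \<theta> *\<^sub>R d) c < \<delta> \<and>
      (\<forall>j<n. sgn (plf j (c + \<theta> *\<^sub>R d)) = s j)"
proof -
  have c': "\<forall>j<n. sgn (linv s j \<bullet> c) = s j" using c sgn_plf_iff_linv[of n _ s] by simp
  let ?z = "\<lambda>\<theta>::real. c + \<theta> *\<^sub>R d"
  have "eventually (\<lambda>\<theta>. sgn (linv s j \<bullet> ?z \<theta>) = s j) (nhds 0)" if "j < n" for j
  proof (cases "s j = 0")
    case True
    then have "linv s j \<bullet> c = 0" "linv s j \<bullet> d = 0" using c' d that by (auto simp: sgn_0_0)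
    then show ?thesis using True by (simp add: inner_add_right)
  next
    case False
    have "linv s j \<bullet> ?z 0 \<noteq> 0" using c' that False by (metis scaleR_zero_left add.right_neutral sgn_0)
    then have "eventually (\<lambda>\<theta>. sgn (linv s j \<bullet> ?z \<theta>) = sgn (linv s j \<bullet> ?z 0)) (nhds 0)"
      by (intro eventually_sgn_same[of "\<lambda>\<theta>. linv s j \<bullet> ?z \<theta>"] continuous_intros)
    then show ?thesis using c' that by simp
  qed
  then have "eventually (\<lambda>\<theta>. \<forall>j\<in>{..<n}. sgn (linv s j \<bullet> ?z \<theta>) = s j) (nhds 0)"
    by (intro eventually_ball_finite) auto
  moreover have "eventually (\<lambda>\<theta>. ?z \<theta> \<in> ball c (min \<delta> (norm c))) (nhds 0)"
  proof -
    have "continuous_on UNIV ?z" by (intro continuous_intros)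
    then have "open (?z -` ball c (min \<delta> (norm c)))" by (simp add: continuous_on_open_vimage)
    moreover have "0 \<in> ?z -` ball c (min \<delta> (norm c))" using assms by simp
    ultimately show ?thesis using eventually_nhds_in_open by fastforce
  qed
  ultimately have "eventually (\<lambda>\<theta>. ?z \<theta> \<in> ball c (min \<delta> (norm c)) \<and> (\<forall>j<n. sgn (linv s j \<bullet> ?z \<theta>) = s j)) (nhds 0)"
    by eventually_elim auto
  then obtain e where e: "e > 0" "\<And>\<theta>. dist \<theta> 0 < e \<Longrightarrow> ?z \<theta> \<in> ball c (min \<delta> (norm c)) \<and> (\<forall>j<n. sgn (linv s j \<bullet> ?z \<theta>) = s j)"
    unfolding eventually_nhds_metric by blast
  show ?thesis
  proof (rule that[of "e / 2"])
    show "e / 2 > 0" using e by simp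
    fix \<theta> assume "\<bar>\<theta>\<bar> \<le> e / 2"
    then have h: "?z \<theta> \<in> ball c (min \<delta> (norm c))" "\<forall>j<n. sgn (linv s j \<bullet> ?z \<theta>) = s j" using e by auto
    have "?z \<theta> \<noteq> 0"
    proof
      assume "?z \<theta> = 0"
      then have "0 \<in> ball c (min \<delta> (norm c))" using h(1) by metis
      then show False by simp
    qed
    then show "?z \<theta> \<noteq> 0 \<and> dist (?z \<theta>) c < \<delta> \<and> (\<forall>j<n. sgn (plf j (?z \<theta>)) = s j)"
      using h sgn_plf_iff_linv[of n "?z \<theta>" s] by (auto simp: dist_commute)
  qed
qed

text \<open>This is what makes faces cubes: arbitrarily close to any point the zeros of a generic
  system can be resolved into independent signs. Once both signs of the newest function occur
  together with the prescribed earlier signs, a convex combination of the two points realizes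
  zero.\<close>

lemma generic_refine:
  assumes "generic S J n" "c \<in> S - {0}" "\<delta> > 0"
    and "\<forall>j<n. t j \<in> {-1, 0, 1} \<and> (j \<notin> J \<longrightarrow> t j = 0) \<and> (plf j c \<noteq> 0 \<longrightarrow> t j = sgn (plf j c))"
  shows "\<exists>c'\<in>S - {0}. dist c' c < \<delta> \<and> (\<forall>j<n. sgn (plf j c') = t j)"
  using assms
proof (induction n arbitrary: c \<delta>)
  case 0
  then show ?case by (intro bexI[of _ c]) auto
next
  case (Suc n)
  have gen: "generic S J n" using Suc.prems(1) by (rule generic_mono) simp
  have S: "subspace S" using gen by (simp add: generic_def)
  note t = Suc.prems(4)
  have IH: "\<exists>c'\<in>S - {0}. dist c' e < r \<and> (\<forall>j<n. sgn (plf j c') = t j)"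
    if "e \<in> S - {0}" "r > 0" "\<forall>j<n. sgn (plf j e) = sgn (plf j c)" for e r
  proof (rule Suc.IH[OF gen that(1,2)])
    show "\<forall>j<n. t j \<in> {-1, 0, 1} \<and> (j \<notin> J \<longrightarrow> t j = 0) \<and> (plf j e \<noteq> 0 \<longrightarrow> t j = sgn (plf j e))"
    proof (intro allI impI)
      fix j assume "j < n"
      then have "j < Suc n" "sgn (plf j e) = sgn (plf j c)" using that(3) by auto
      moreover from this(2) have "plf j e \<noteq> 0 \<longleftrightarrow> plf j c \<noteq> 0" by (metis sgn_0_0)
      ultimately show "t j \<in> {-1, 0, 1} \<and> (j \<notin> J \<longrightarrow> t j = 0) \<and> (plf j e \<noteq> 0 \<longrightarrow> t j = sgn (plf j e))"
        using t by auto
    qed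
  qed
  \<comment> \<open>A nonzero value of the newest function survives a sufficiently small refinement
    of the earlier signs. A distance below \<open>norm c\<close> excludes the origin, also for the
    convex combination formed later.\<close>
  have keep: "\<exists>c'\<in>S - {0}. dist c' c < \<delta> \<and> dist c' c < norm c \<and> (\<forall>j<n. sgn (plf j c') = t j) \<and> sgn (plf n c') = sgn (plf n e)"
    if e: "e \<in> S - {0}" "dist e c < min \<delta> (norm c)" "\<forall>j<n. sgn (plf j e) = sgn (plf j c)" "plf n e \<noteq> 0" for e
  proof -
    have "eventually (\<lambda>z. sgn (plf n z) = sgn (plf n e)) (nhds e)"
      using e(4) by (intro eventually_sgn_same continuous_intros)
    then obtain r where r: "r > 0" "\<And>z. dist z e < r \<Longrightarrow> sgn (plf n z) = sgn (plf n e)"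
      unfolding eventually_nhds_metric by blast
    define r' where "r' = min r (min \<delta> (norm c) - dist e c)"
    have "r' > 0" using r e by (simp add: r'_def)
    from IH[OF e(1) this e(3)] obtain c' where c': "c' \<in> S - {0}" "dist c' e < r'" "\<forall>j<n. sgn (plf j c') = t j" by blast
    have "dist c' c \<le> dist c' e + dist e c" by (rule dist_triangle)
    moreover have "dist c' e < min \<delta> (norm c) - dist e c" "dist c' e < r" using c'(2) by (simp_all add: r'_def)
    ultimately have "dist c' c < min \<delta> (norm c)" "sgn (plf n c') = sgn (plf n e)" using r(2)[of c'] by linarith+
    then show ?thesis using c' by (intro bexI[of _ c']) simp_all
  qed
  consider "n \<notin> J" | "plf n c \<noteq> 0" | "n \<in> J" "plf n c = 0" by blast
  then show ?case
  proof cases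
    case 1
    then have "plf n z = 0" if "z \<in> S" for z using Suc.prems(1) that by (auto simp: generic_def)
    moreover obtain c' where "c'\<in>S - {0}" "dist c' c < \<delta>" "\<forall>j<n. sgn (plf j c') = t j"
      using IH[OF Suc.prems(2,3)] by blast
    moreover have "t n = 0" using 1 t by simp
    ultimately show ?thesis by (intro bexI[of _ c'] conjI allI impI) (auto simp: less_Suc_eq)
  next
    case 2
    then have "t n = sgn (plf n c)" using t by simp
    moreover obtain c' where "c' \<in> S - {0}" "dist c' c < \<delta>" "\<forall>j<n. sgn (plf j c') = t j" "sgn (plf n c') = sgn (plf n c)"
      using keep[of c] 2 Suc.prems(2,3) by auto
    ultimately show ?thesis by (intro bexI[of _ c'] conjI allI impI) (auto simp: less_Suc_eq)
  next
    case 3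
    \<comment> \<open>Genericity gives a point \<open>d\<close> of the same cell at which function
      \<open>n\<close> does not vanish. On that cell the function is linear and zero at
      \<open>c\<close>, so \<open>c + \<theta> *\<^sub>R d\<close> takes both signs.\<close>
    obtain d where d: "d \<in> S - {0}" "\<forall>j<n. sgn (plf j d) = sgn (plf j c)" "plf n d \<noteq> 0"
      using Suc.prems(1,2) 3 unfolding generic_def by blast
    define s where "s j = sgn (plf j c)" for j
    have cs: "\<forall>j<n. sgn (plf j c) = s j" and ds: "\<forall>j<n. sgn (plf j d) = s j" using d by (auto simp: s_def)
    have "c \<noteq> 0" "min \<delta> (norm c) > 0" using Suc.prems by auto
    moreover have "\<forall>j<n. s j = 0 \<longrightarrow> linv s j \<bullet> d = 0"
      using ds sgn_plf_iff_linv[of n d s] by (metis sgn_0_0)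
    ultimately obtain \<eta> where \<eta>: "\<eta> > 0" "\<And>\<theta>. \<bar>\<theta>\<bar> \<le> \<eta> \<Longrightarrow> c + \<theta> *\<^sub>R d \<noteq> 0 \<and>
        dist (c + \<theta> *\<^sub>R d) c < min \<delta> (norm c) \<and> (\<forall>j<n. sgn (plf j (c + \<theta> *\<^sub>R d)) = s j)" using cell_perturb[OF cs] by blast
    have val: "plf n (c + \<theta> *\<^sub>R d) = \<theta> * plf n d" if "\<bar>\<theta>\<bar> \<le> \<eta>" for \<theta>
    proof -
      have "plf n (c + \<theta> *\<^sub>R d) = linv s n \<bullet> (c + \<theta> *\<^sub>R d)" using \<eta>(2)[OF that] by (intro plf_same_cell[of n]) simp_all
      moreover have "plf n c = linv s n \<bullet> c" "plf n d = linv s n \<bullet> d"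
        using plf_same_cell[OF cs] plf_same_cell[OF ds] by simp_all
      ultimately show ?thesis using 3 by (simp add: inner_add_right)
    qed
    have signed: "\<exists>c'\<in>S - {0}. dist c' c < \<delta> \<and> dist c' c < norm c \<and> (\<forall>j<n. sgn (plf j c') = t j) \<and> sgn (plf n c') = \<tau>"
      if "\<tau> = 1 \<or> \<tau> = -1" for \<tau> :: real
    proof -
      define \<theta> where "\<theta> = \<eta> * \<tau> * sgn (plf n d)"
      have \<theta>: "\<bar>\<theta>\<bar> \<le> \<eta>" using \<eta>(1) that d(3) by (auto simp: \<theta>_def abs_mult abs_sgn_eq)
      define e where "e = c + \<theta> *\<^sub>R d"
      have "plf n e = \<tau> * (\<eta> * \<bar>plf n d\<bar>)" using val[OF \<theta>] by (simp add: e_def \<theta>_def abs_sgn mult_ac)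
      then have sg: "sgn (plf n e) = \<tau>" "plf n e \<noteq> 0" using \<eta>(1) d(3) that by (auto simp: sgn_mult)
      have "e \<in> S - {0}" using \<eta>(2)[OF \<theta>] d(1) Suc.prems(2) S by (auto simp: e_def subspace_add subspace_scale)
      moreover have "dist e c < min \<delta> (norm c)" "\<forall>j<n. sgn (plf j e) = sgn (plf j c)"
        using \<eta>(2)[OF \<theta>] by (simp_all add: e_def s_def)
      ultimately show ?thesis using keep[of e] sg by simp
    qed
    show ?thesis
    proof (cases "t n = 0")
      case False
      then have "t n = 1 \<or> t n = -1" using t by auto
      then obtain c' where "c' \<in> S - {0}" "dist c' c < \<delta>" "\<forall>j<n. sgn (plf j c') = t j" "sgn (plf n c') = t n"
        using signed by metis
      then show ?thesis by (intro bexI[of _ c'] conjI allI impI) (auto simp only: less_Suc_eq)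
    next
      case True
      obtain u where u: "u \<in> S" "dist u c < \<delta>" "dist u c < norm c" "\<forall>j<n. sgn (plf j u) = t j" "sgn (plf n u) = 1"
        using signed[of 1] by auto
      obtain v where v: "v \<in> S" "dist v c < \<delta>" "dist v c < norm c" "\<forall>j<n. sgn (plf j v) = t j" "sgn (plf n v) = -1"
        using signed[of "-1"] by auto
      define \<alpha> \<beta> where "\<alpha> = plf n u" and "\<beta> = - plf n v"
      have ab: "\<alpha> > 0" "\<beta> > 0" using u v by (auto simp: \<alpha>_def \<beta>_def sgn_1_pos sgn_1_neg)
      \<comment> \<open>The weights make the linear form of function \<open>n\<close> vanish at
        \<open>w\<close>; \<open>u\<close> and \<open>v\<close> lie in the same convex cell of the
        earlier functions.\<close>
      define x y where "x = \<beta> / (\<alpha> + \<beta>)" and "y = \<alpha> / (\<alpha> + \<beta>)"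
      have xy: "x > 0" "y > 0" "x + y = 1" using ab by (simp_all add: x_def y_def add.commute flip: add_divide_distrib)
      define w where "w = x *\<^sub>R u + y *\<^sub>R v"
      have lu: "\<forall>j<n. sgn (linv t j \<bullet> u) = t j" "plf n u = linv t n \<bullet> u"
        using u(4) sgn_plf_iff_linv[of n u t] plf_same_cell[OF u(4)] by simp_all
      have lv: "\<forall>j<n. sgn (linv t j \<bullet> v) = t j" "plf n v = linv t n \<bullet> v"
        using v(4) sgn_plf_iff_linv[of n v t] plf_same_cell[OF v(4)] by simp_all
      have "sgn (linv t j \<bullet> w) = t j" if "j < n" for j
      proof -
        have "linv t j \<bullet> w = x * (linv t j \<bullet> u) + y * (linv t j \<bullet> v)" by (simp add: w_def inner_add_right)
        moreover have "sgn (linv t j \<bullet> u) = t j" "sgn (linv t j \<bullet> v) = t j" using lu lv that by simp_all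
        ultimately show ?thesis using sgn_pos_combination[OF xy(1,2)] by simp
      qed
      then have wn: "\<forall>j<n. sgn (plf j w) = t j" using sgn_plf_iff_linv[of n w t] by simp
      then have "plf n w = linv t n \<bullet> w" by (rule plf_same_cell) simp
      also have "\<dots> = x * \<alpha> - y * \<beta>" using lu lv by (simp add: w_def inner_add_right \<alpha>_def \<beta>_def)
      also have "\<dots> = 0" by (simp add: x_def y_def)
      finally have "plf n w = 0" .
      have "w \<in> ball c (min \<delta> (norm c))" unfolding w_def
        using u v xy by (intro convexD[OF convex_ball]) (auto simp: dist_commute)
      then have "dist w c < \<delta>" "dist w c < norm c" by (simp_all add: dist_commute)
      moreover from this(2) have "w \<noteq> 0" by auto
      moreover have "w \<in> S" using u v S by (simp add: w_def subspace_add subspace_scale)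
      moreover have "sgn (plf j w) = t j" if "j < Suc n" for j
        using wn \<open>plf n w = 0\<close> True that by (auto simp only: less_Suc_eq sgn_0)
      ultimately show ?thesis by (intro bexI[of _ w]) simp_all
    qed
  qed
qed

end

section \<open>Sign patterns\<close>

lemma minus_one_power_diff: "k \<le> m \<Longrightarrow> (-1::real) ^ (m - k) = (-1) ^ m * (-1) ^ k"
  by (auto simp: minus_one_power_iff)

definition sign_refinements :: "nat set \<Rightarrow> (nat \<Rightarrow> real) \<Rightarrow> (nat \<Rightarrow> real) set" where
  "sign_refinements A t = {s. (\<forall>j\<in>A. s j \<in> {-1, 0, 1}) \<and> (\<forall>j. j \<notin> A \<longrightarrow> s j = t j)}"

lemma sign_refinements_insert:
  assumes "a \<notin> A"
  shows "sign_refinements (insert a A) t = (\<lambda>(v, s). s(a := v)) ` ({-1, 0, 1} \<times> sign_refinements A t)"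
    (is "?L = ?f ` ?R")
proof
  show "?L \<subseteq> ?f ` ?R"
  proof
    fix s assume s: "s \<in> ?L"
    then have "(s a, s(a := t a)) \<in> ?R" "s = ?f (s a, s(a := t a))"
      using assms by (auto simp: sign_refinements_def)
    then show "s \<in> ?f ` ?R" by blast
  qed
  show "?f ` ?R \<subseteq> ?L" using assms by (auto simp: sign_refinements_def) metis+
qed

lemma finite_sign_refinements:
  assumes "finite A"
  shows "finite (sign_refinements A t)"
  using assms
proof (induction A)
  case empty
  have "sign_refinements {} t \<subseteq> {t}" by (auto simp: sign_refinements_def)
  then show ?case using finite_subset by blast
next
  case (insert a A)
  then show ?case by (simp add: sign_refinements_insert)
qed

text \<open>Each free coordinate contributes \<open>x\<close> for the value 0 and 1 for each of the
  two signs; this is the face polynomial of a cube.\<close>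

lemma sum_sign_refinements:
  fixes x :: real
  assumes "finite A"
  shows "(\<Sum>s\<in>sign_refinements A t. x ^ card {j\<in>A. s j = 0}) = (x + 2) ^ card A"
  using assms
proof (induction A)
  case empty
  have "sign_refinements {} t = {t}" by (auto simp: sign_refinements_def)
  then show ?case by simp
next
  case (insert a A)
  have inj: "inj_on (\<lambda>(v, s). s(a := v)) ({-1, 0, 1} \<times> sign_refinements A t)"
  proof (rule inj_onI, clarify)
    fix v s v' s' assume s: "s \<in> sign_refinements A t" "s' \<in> sign_refinements A t" and e: "s(a := v) = s'(a := v')"
    have "s j = s' j" for j
      using fun_cong[OF e, of j] s insert.hyps(2) by (cases "j = a") (auto simp: sign_refinements_def)
    then show "v = v' \<and> s = s'" using fun_cong[OF e, of a] by auto
  qed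
  have cnt: "card {j \<in> insert a A. (s(a := v)) j = 0} = (if v = 0 then 1 else 0) + card {j\<in>A. s j = 0}" for s and v :: real
  proof -
    have "{j \<in> insert a A. (s(a := v)) j = 0} = (if v = 0 then insert a {j\<in>A. s j = 0} else {j\<in>A. s j = 0})"
      using insert.hyps by auto
    then show ?thesis using insert.hyps by simp
  qed
  have "(\<Sum>s\<in>sign_refinements (insert a A) t. x ^ card {j\<in>insert a A. s j = 0})
      = (\<Sum>(v, s)\<in>{-1, 0, 1} \<times> sign_refinements A t. x ^ card {j\<in>insert a A. (s(a := v)) j = 0})"
    unfolding sign_refinements_insert[OF insert.hyps(2)] by (subst sum.reindex[OF inj]) (simp add: case_prod_beta o_def)
  also have "\<dots> = (\<Sum>v\<in>{-1, 0, 1::real}. \<Sum>s\<in>sign_refinements A t. (if v = 0 then x else 1) * x ^ card {j\<in>A. s j = 0})"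
    unfolding sum.cartesian_product[symmetric] cnt by (intro sum.cong) auto
  also have "\<dots> = (x + 2) * (x + 2) ^ card A"
    by (simp add: insert.IH flip: sum_distrib_left) (simp add: algebra_simps)
  finally show ?case using insert.hyps by simp
qed

context
  fixes p :: "nat \<Rightarrow> 'a::euclidean_space" and a :: "nat \<Rightarrow> nat \<Rightarrow> real"
begin

definition sign_pattern :: "nat \<Rightarrow> 'a \<Rightarrow> nat \<Rightarrow> real" where
  "sign_pattern n c = (\<lambda>j. if j < n then sgn (plf p a j c) else 0)"

definition patterns :: "'a set \<Rightarrow> nat \<Rightarrow> (nat \<Rightarrow> real) set" where
  "patterns S n = sign_pattern n ` (S - {0})"

lemma pattern_values: "t \<in> patterns S n \<Longrightarrow> t j \<in> {-1, 0, 1}"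
  by (auto simp: patterns_def sign_pattern_def sgn_if)

lemma pattern_outside: "t \<in> patterns S n \<Longrightarrow> n \<le> j \<Longrightarrow> t j = 0"
  by (auto simp: patterns_def sign_pattern_def)

lemma patterns_subset: "patterns S n \<subseteq> sign_refinements {..<n} (\<lambda>_. 0)"
  by (auto simp: sign_refinements_def pattern_outside dest: pattern_values)

lemma finite_patterns: "finite (patterns S n)"
  using patterns_subset finite_sign_refinements finite_subset by blast

lemma patternE:
  assumes "t \<in> patterns S n"
  obtains c where "c \<in> S" "c \<noteq> 0" "\<forall>j<n. sgn (plf p a j c) = t j"
proof -
  obtain c where "c \<in> S - {0}" "t = sign_pattern n c" using assms by (auto simp: patterns_def)
  then show ?thesis using that[of c] by (simp add: sign_pattern_def)
qed

lemma patternI: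
  assumes "c \<in> S" "c \<noteq> 0" "\<forall>j<n. sgn (plf p a j c) = t j" "\<forall>j\<ge>n. t j = 0"
  shows "t \<in> patterns S n"
proof -
  have "sign_pattern n c = t" using assms(3,4) by (auto simp: sign_pattern_def)
  then show ?thesis using assms(1,2) by (auto simp: patterns_def)
qed

text \<open>\<open>lin_space\<close> and \<open>sign_region\<close> split a cell into a subspace and
  an open convex set, the form in which \<open>euler_characteristic_partition\<close> takes its
  pieces.\<close>

definition lin_space :: "'a set \<Rightarrow> nat \<Rightarrow> (nat \<Rightarrow> real) \<Rightarrow> 'a set" where
  "lin_space S n t = {c\<in>S. \<forall>j<n. t j = 0 \<longrightarrow> linv p a t j \<bullet> c = 0}"

definition sign_region :: "nat \<Rightarrow> (nat \<Rightarrow> real) \<Rightarrow> 'a set" where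
  "sign_region n t = {c. \<forall>j\<in>{j. j < n \<and> t j \<noteq> 0}. 0 < t j * (linv p a t j \<bullet> c)}"

lemma subspace_lin_space: "subspace S \<Longrightarrow> subspace (lin_space S n t)"
  by (auto simp: lin_space_def subspace_def inner_add_right)

lemma open_sign_region: "open (sign_region n t)"
proof -
  have "sign_region n t = (\<Inter>j\<in>{j. j < n \<and> t j \<noteq> 0}. {c. 0 < t j * (linv p a t j \<bullet> c)})"
    by (auto simp: sign_region_def)
  then show ?thesis by (auto intro!: open_INT open_Collect_less continuous_intros)
qed

lemma convex_sign_region: "convex (sign_region n t)"
proof -
  have "sign_region n t = (\<Inter>j\<in>{j. j < n \<and> t j \<noteq> 0}. {c. (t j *\<^sub>R linv p a t j) \<bullet> c > 0})"
    by (auto simp: sign_region_def)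
  moreover have "convex (\<Inter>j\<in>{j. j < n \<and> t j \<noteq> 0}. {c. (t j *\<^sub>R linv p a t j) \<bullet> c > 0})"
    by (rule convex_INT) (rule convex_halfspace_gt)
  ultimately show ?thesis by (simp only:)
qed

lemma cell_eq:
  assumes "\<And>j. t j \<in> {-1, 0, 1}"
  shows "{c\<in>S. \<forall>j<n. sgn (plf p a j c) = t j} = lin_space S n t \<inter> sign_region n t"
proof -
  have "sgn (r::real) = t j \<longleftrightarrow> (t j = 0 \<longrightarrow> r = 0) \<and> (t j \<noteq> 0 \<longrightarrow> 0 < t j * r)" for r j
  proof -
    consider "t j = -1" | "t j = 0" | "t j = 1" using assms[of j] by blast
    then show ?thesis by cases (auto simp: sgn_if)
  qed
  then show ?thesis
    unfolding sgn_plf_iff_linv lin_space_def sign_region_def by auto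
qed

text \<open>A zero with index in \<open>J\<close> lowers the dimension by exactly one, because
  genericity yields a point of the cell of the earlier functions where that function is nonzero; a
  zero outside \<open>J\<close> lowers nothing, because the function vanishes on all of
  \<open>S\<close>.\<close>

lemma dim_lin_space:
  assumes gen: "generic p a S J n" and t: "t \<in> patterns S n" and "J \<subseteq> {..<n}"
  shows "dim (lin_space S n t) + card {j\<in>J. t j = 0} = dim S"
proof -
  obtain c where c: "c \<in> S" "c \<noteq> 0" "\<forall>j<n. sgn (plf p a j c) = t j" using t by (rule patternE)
  have S: "subspace S" using gen by (simp add: generic_def)
  have "m \<le> n \<Longrightarrow> dim (lin_space S m t) + card {j\<in>J. j < m \<and> t j = 0} = dim S" for m
  proof (induction m)
    case 0
    show ?case by (simp add: lin_space_def)
  next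
    case (Suc m)
    have cm: "\<forall>j<m. sgn (plf p a j c) = t j" using c Suc.prems by auto
    have IH: "dim (lin_space S m t) + card {j\<in>J. j < m \<and> t j = 0} = dim S" using Suc by simp
    have zeros: "{j\<in>J. j < Suc m \<and> t j = 0} = (if m \<in> J \<and> t m = 0 then insert m {j\<in>J. j < m \<and> t j = 0} else {j\<in>J. j < m \<and> t j = 0})"
      by (auto simp: less_Suc_eq)
    have fin: "finite {j\<in>J. j < m \<and> t j = 0}" by (rule finite_subset[of _ "{..<m}"]) auto
    have L: "lin_space S (Suc m) t = (if t m = 0 then lin_space S m t \<inter> {z. linv p a t m \<bullet> z = 0} else lin_space S m t)"
      by (auto simp: lin_space_def less_Suc_eq)
    consider "t m \<noteq> 0" | "t m = 0" "m \<notin> J" | "t m = 0" "m \<in> J" by blast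
    then show ?case
    proof cases
      case 1
      then show ?thesis using IH by (simp add: L zeros)
    next
      case 2
      have van: "plf p a m z = 0" if "z \<in> S" for z using gen 2 Suc.prems that unfolding generic_def by auto
      \<comment> \<open>The function vanishes at \<open>c\<close> and at a perturbed point of the
        same cell, hence its linear form vanishes at the difference.\<close>
      have "linv p a t m \<bullet> z = 0" if z: "z \<in> lin_space S m t" for z
      proof -
        have "\<forall>j<m. t j = 0 \<longrightarrow> linv p a t j \<bullet> z = 0" using z by (simp add: lin_space_def)
        then obtain \<eta> where \<eta>: "\<eta> > 0" "\<And>\<theta>. \<bar>\<theta>\<bar> \<le> \<eta> \<Longrightarrow> c + \<theta> *\<^sub>R z \<noteq> 0 \<and> dist (c + \<theta> *\<^sub>R z) c < 1 \<and>
            (\<forall>j<m. sgn (plf p a j (c + \<theta> *\<^sub>R z)) = t j)" using cell_perturb[OF cm _ c(2), of z 1] by auto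
        have "plf p a m (c + \<eta> *\<^sub>R z) = linv p a t m \<bullet> (c + \<eta> *\<^sub>R z)" "plf p a m c = linv p a t m \<bullet> c"
          using \<eta> cm by (auto intro!: plf_same_cell[of m])
        moreover have "c + \<eta> *\<^sub>R z \<in> S" using z c S by (auto simp: lin_space_def intro: subspace_add subspace_scale)
        ultimately show ?thesis using van[of "c + \<eta> *\<^sub>R z"] van[of c] c(1) \<eta>(1) by (simp add: inner_add_right)
      qed
      then have "lin_space S (Suc m) t = lin_space S m t" using 2 unfolding L by auto
      then show ?thesis using IH 2 by (simp add: zeros)
    next
      case 3
      obtain c' where c': "c' \<in> S" "\<forall>j<m. sgn (plf p a j c') = sgn (plf p a j c)" "plf p a m c' \<noteq> 0"
      proof -
        have "c \<in> S - {0}" "m < n" using c Suc.prems by auto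
        then have "\<exists>c'\<in>S - {0}. (\<forall>j<m. sgn (plf p a j c') = sgn (plf p a j c)) \<and> plf p a m c' \<noteq> 0"
          using gen 3(2) unfolding generic_def by simp
        then show ?thesis using that by blast
      qed
      have c'm: "\<forall>j<m. sgn (plf p a j c') = t j" using c' cm by simp
      then have "linv p a t m \<bullet> c' \<noteq> 0" using c'(3) plf_same_cell[OF c'm, of m] by simp
      moreover have "c' \<in> lin_space S m t"
        using c'm c'(1) sgn_plf_iff_linv[of m p a c' t] unfolding lin_space_def by (auto simp: sgn_0_0)
      ultimately have ns: "\<not> lin_space S m t \<subseteq> {z. linv p a t m \<bullet> z = 0}" by blast
      have sub: "subspace (lin_space S m t)" by (rule subspace_lin_space[OF S])
      have "0 \<in> lin_space S m t \<inter> {z. linv p a t m \<bullet> z = 0}" using subspace_0[OF sub] by simp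
      then have "aff_dim (lin_space S m t \<inter> {z. linv p a t m \<bullet> z = 0}) = aff_dim (lin_space S m t) - 1"
        using ns by (subst aff_dim_affine_Int_hyperplane) (auto intro: subspace_imp_affine sub)
      then have "int (dim (lin_space S (Suc m) t)) = int (dim (lin_space S m t)) - 1"
        using aff_dim_subspace[OF sub] aff_dim_subspace[OF subspace_lin_space[OF S, of "Suc m" t]] 3 by (simp add: L)
      then show ?thesis using IH 3 fin by (simp add: zeros)
    qed
  qed
  from this[of n] have "dim (lin_space S n t) + card {j\<in>J. j < n \<and> t j = 0} = dim S" by simp
  moreover have "{j\<in>J. j < n \<and> t j = 0} = {j\<in>J. t j = 0}" using assms(3) by auto
  ultimately show ?thesis by simp
qed

text \<open>Compactness of the unit sphere in \<open>S\<close> and positive homogeneity. The bound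
  is used for the cross section of a closed cell in \<open>euler_closed_cell\<close>.\<close>

lemma plf_norm_bound:
  assumes "subspace S" "\<And>c. c \<in> S - {0} \<Longrightarrow> \<exists>j<n. plf p a j c \<noteq> 0"
  obtains m where "m > 0" "\<And>c. c \<in> S \<Longrightarrow> m * norm c \<le> (\<Sum>j<n. \<bar>plf p a j c\<bar>)"
proof (cases "S \<inter> sphere 0 1 = {}")
  case True
  have "c = 0" if "c \<in> S" for c
  proof (rule ccontr)
    assume "c \<noteq> 0"
    then have "(1 / norm c) *\<^sub>R c \<in> S \<inter> sphere 0 1" using that assms(1) by (auto simp: subspace_scale)
    then show False using True by blast
  qed
  then have "1 * norm c \<le> (\<Sum>j<n. \<bar>plf p a j c\<bar>)" if "c \<in> S" for c
    using that by (metis mult_1 norm_zero sum_nonneg abs_ge_zero)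
  then show ?thesis using that[of 1] by simp
next
  case False
  have "compact (S \<inter> sphere 0 1)" using assms(1) by (intro closed_Int_compact closed_subspace) auto
  then obtain c0 where c0: "c0 \<in> S \<inter> sphere 0 1"
    "\<And>c. c \<in> S \<inter> sphere 0 1 \<Longrightarrow> (\<Sum>j<n. \<bar>plf p a j c0\<bar>) \<le> (\<Sum>j<n. \<bar>plf p a j c\<bar>)"
  proof -
    have "continuous_on (S \<inter> sphere 0 1) (\<lambda>c. \<Sum>j<n. \<bar>plf p a j c\<bar>)"
      by (intro continuous_on_sum continuous_on_rabs continuous_on_plf)
    then show ?thesis using that continuous_attains_inf[OF \<open>compact (S \<inter> sphere 0 1)\<close> False] by blast
  qed
  define m where "m = (\<Sum>j<n. \<bar>plf p a j c0\<bar>)"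
  have "c0 \<in> S - {0}" using c0(1) by auto
  then obtain j where j: "j < n" "plf p a j c0 \<noteq> 0" using assms(2) by blast
  then have "\<bar>plf p a j c0\<bar> \<le> m" unfolding m_def by (intro member_le_sum) auto
  then have "m > 0" using j by simp
  moreover have "m * norm c \<le> (\<Sum>j<n. \<bar>plf p a j c\<bar>)" if "c \<in> S" for c
  proof (cases "c = 0")
    case False
    define d where "d = (1 / norm c) *\<^sub>R c"
    have d: "d \<in> S \<inter> sphere 0 1" using that False assms(1) by (auto simp: d_def subspace_scale)
    have "c = norm c *\<^sub>R d" using False by (simp add: d_def)
    then have "plf p a j c = norm c * plf p a j d" for j by (metis plf_scaleR norm_ge_zero)
    then have "(\<Sum>j<n. \<bar>plf p a j c\<bar>) = norm c * (\<Sum>j<n. \<bar>plf p a j d\<bar>)" by (simp add: abs_mult sum_distrib_left)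
    moreover have "m \<le> (\<Sum>j<n. \<bar>plf p a j d\<bar>)" using c0(2)[OF d] by (simp add: m_def)
    ultimately show ?thesis using mult_left_mono[of m "\<Sum>j<n. \<bar>plf p a j d\<bar>" "norm c"] by (simp add: mult.commute)
  qed (simp add: sum_nonneg)
  ultimately show ?thesis using that by blast
qed

text \<open>The cell contains a nonzero point, so its subspace has positive dimension.\<close>

lemma zeros_less_dim:
  assumes "generic p a S J n" "t \<in> patterns S n" "J \<subseteq> {..<n}"
  shows "card {j\<in>J. t j = 0} < dim S"
proof -
  obtain c where c: "c \<in> S" "c \<noteq> 0" "\<forall>j<n. sgn (plf p a j c) = t j" using assms(2) by (rule patternE)
  then have "c \<in> lin_space S n t" using cell_eq[of t S n] pattern_values[OF assms(2)] by blast
  then have "\<not> lin_space S n t \<subseteq> {0}" using c(2) by auto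
  then have "dim (lin_space S n t) > 0" using dim_eq_0[of "lin_space S n t"] by linarith
  then show ?thesis using dim_lin_space[OF assms] by linarith
qed

lemma closed_cell_plf:
  assumes "\<forall>j<n. \<bar>linv p a s j \<bullet> c\<bar> = s j * (linv p a s j \<bullet> c)"
  shows "\<forall>j<n. plf p a j c = linv p a s j \<bullet> c"
  using assms by (auto intro!: linv_eq_plf)

text \<open>The closed cell of \<open>s\<close>, cut by the hyperplane on which the sum of all
  \<open>\<bar>y j\<bar>\<close> is 1, is a nonempty compact convex set, and the cells whose
  patterns arise from \<open>s\<close> by turning signs into zeros partition it. The cut lowers
  every dimension by one, hence the exponent \<open>dim S - 1\<close>.\<close>

lemma euler_closed_cell:
  assumes gen: "generic p a S J n" and J: "J \<subseteq> {..<n}" and nz: "\<And>c. c \<in> S - {0} \<Longrightarrow> \<exists>j<n. plf p a j c \<noteq> 0"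
    and s: "s \<in> patterns S n"
  shows "(\<Sum>t | t \<in> patterns S n \<and> (\<forall>j. t j = 0 \<or> t j = s j). (-1::real) ^ (dim S - 1) * (-1) ^ card {j\<in>J. t j = 0}) = 1"
proof -
  have S: "subspace S" using gen by (simp add: generic_def)
  define I where "I = {t. t \<in> patterns S n \<and> (\<forall>j. t j = 0 \<or> t j = s j)}"
  have finI: "finite I" using finite_patterns[of S n] by (simp add: I_def)
  \<comment> \<open>On the closed cell of \<open>s\<close> this linear form is the sum of the
    absolute values of all functions, hence positive away from the origin.\<close>
  define q where "q = (\<Sum>j<n. s j *\<^sub>R linv p a s j)"
  define K where "K = {c\<in>S. (\<forall>j<n. \<bar>linv p a s j \<bullet> c\<bar> = s j * (linv p a s j \<bullet> c)) \<and> q \<bullet> c = 1}"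
  define A where "A t = lin_space S n t \<inter> {c. q \<bullet> c = 1}" for t
  have sv: "s j \<in> {-1, 0, 1}" for j using pattern_values[OF s] .
  have qval: "q \<bullet> c = (\<Sum>j<n. \<bar>plf p a j c\<bar>)" if "\<forall>j<n. \<bar>linv p a s j \<bullet> c\<bar> = s j * (linv p a s j \<bullet> c)" for c
    using closed_cell_plf[OF that] that by (simp add: q_def inner_sum_left)
  have piece_eq: "A t \<inter> sign_region n t = {c\<in>S. (\<forall>j<n. sgn (plf p a j c) = t j) \<and> q \<bullet> c = 1}" if "t \<in> patterns S n" for t
    using cell_eq[of t S n] pattern_values[OF that] by (auto simp: A_def)
  have coarse: "\<forall>j<n. \<bar>linv p a s j \<bullet> c\<bar> = s j * (linv p a s j \<bullet> c)" if "t \<in> I" "\<forall>j<n. sgn (plf p a j c) = t j" for t c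
  proof -
    have ab: "\<bar>plf p a j c\<bar> = s j * plf p a j c" if "j < n" for j
    proof -
      have "t j = 0 \<or> t j = s j" "sgn (plf p a j c) = t j" using \<open>t \<in> I\<close> that \<open>\<forall>j<n. sgn (plf p a j c) = t j\<close> by (auto simp: I_def)
      then show ?thesis by (metis abs_sgn mult.commute mult_zero_right sgn_0_0 abs_zero)
    qed
    then have "plf p a j c = linv p a s j \<bullet> c" if "j < n" for j using that by (intro plf_eq_linv) auto
    then show ?thesis using ab by simp
  qed
  have ex: "\<exists>c. c \<in> A t \<inter> sign_region n t" if t: "t \<in> I" for t
  proof -
    have "t \<in> patterns S n" using t by (simp add: I_def)
    then obtain c where c: "c \<in> S" "c \<noteq> 0" "\<forall>j<n. sgn (plf p a j c) = t j" by (rule patternE)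
    define r where "r = q \<bullet> c"
    obtain j where j: "j < n" "plf p a j c \<noteq> 0" using nz c by blast
    have "\<bar>plf p a j c\<bar> \<le> r" unfolding r_def qval[OF coarse[OF t c(3)]] using j by (intro member_le_sum) auto
    then have r: "r > 0" using j by simp
    define d where "d = (1 / r) *\<^sub>R c"
    have "sgn (plf p a j d) = sgn (plf p a j c)" for j using r by (simp add: d_def plf_scaleR sgn_mult)
    moreover have "d \<in> S" using c S by (simp add: d_def subspace_scale)
    moreover have "q \<bullet> d = 1" using r by (simp add: d_def r_def)
    ultimately show ?thesis unfolding piece_eq[OF \<open>t \<in> patterns S n\<close>] using c by auto
  qed
  have dimA: "nat (aff_dim (A t)) = dim S - 1 - card {j\<in>J. t j = 0}" if t: "t \<in> I" for t
  proof -
    have tp: "t \<in> patterns S n" using t by (simp add: I_def)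
    have sub: "subspace (lin_space S n t)" by (rule subspace_lin_space[OF S])
    have "\<not> lin_space S n t \<subseteq> {c. q \<bullet> c = 1}" using subspace_0[OF sub] by auto
    moreover have "lin_space S n t \<inter> {c. q \<bullet> c = 1} \<noteq> {}" using ex[OF t] by (auto simp: A_def)
    ultimately have "aff_dim (A t) = aff_dim (lin_space S n t) - 1"
      unfolding A_def by (subst aff_dim_affine_Int_hyperplane) (auto intro: subspace_imp_affine sub)
    then show ?thesis using dim_lin_space[OF gen tp J] aff_dim_subspace[OF sub] by simp
  qed
  have "(\<Sum>t\<in>I. (-1::real) ^ nat (aff_dim (A t))) = (if True then 1 else (-1) ^ nat (aff_dim (UNIV::'a set)))"
  proof (rule euler_characteristic_partition[where K=K and U="sign_region n" and W=UNIV])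
    show "finite I" by (rule finI)
    show "affine (A t) \<and> open (sign_region n t) \<and> convex (A t \<inter> sign_region n t) \<and> A t \<inter> sign_region n t \<noteq> {}" if "t \<in> I" for t
    proof -
      have "affine (A t)" unfolding A_def by (intro affine_Int subspace_imp_affine subspace_lin_space S affine_hyperplane)
      then show ?thesis using ex[OF that] open_sign_region
          convex_Int[OF affine_imp_convex convex_sign_region] by blast
    qed
    show "disjoint_family_on (\<lambda>t. A t \<inter> sign_region n t) I"
      unfolding disjoint_family_on_def
    proof (intro ballI impI)
      fix t t' assume tt: "t \<in> I" "t' \<in> I" "t \<noteq> t'"
      then have P: "t \<in> patterns S n" "t' \<in> patterns S n" by (auto simp: I_def)
      obtain j where j: "t j \<noteq> t' j" using tt(3) by blast
      have "j < n"
      proof (rule ccontr)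
        assume "\<not> j < n"
        then show False using j pattern_outside[OF P(1), of j] pattern_outside[OF P(2), of j] by simp
      qed
      with j show "(A t \<inter> sign_region n t) \<inter> (A t' \<inter> sign_region n t') = {}"
        unfolding piece_eq[OF P(1)] piece_eq[OF P(2)] by auto
    qed
    show "K = (\<Union>t\<in>I. A t \<inter> sign_region n t)"
    proof
      show "(\<Union>t\<in>I. A t \<inter> sign_region n t) \<subseteq> K"
      proof
        fix c assume "c \<in> (\<Union>t\<in>I. A t \<inter> sign_region n t)"
        then obtain t where t: "t \<in> I" "c \<in> A t \<inter> sign_region n t" by blast
        then have "c \<in> S" "\<forall>j<n. sgn (plf p a j c) = t j" "q \<bullet> c = 1" using piece_eq[of t] by (auto simp: I_def)
        then show "c \<in> K" using coarse[OF t(1)] by (simp add: K_def)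
      qed
      show "K \<subseteq> (\<Union>t\<in>I. A t \<inter> sign_region n t)"
      proof
        fix c assume c: "c \<in> K"
        then have cc: "\<forall>j<n. \<bar>linv p a s j \<bullet> c\<bar> = s j * (linv p a s j \<bullet> c)" "c \<in> S" "q \<bullet> c = 1" by (auto simp: K_def)
        have "c \<noteq> 0" using cc(3) by auto
        define t where "t = sign_pattern n c"
        have tp: "t \<in> patterns S n" using cc \<open>c \<noteq> 0\<close> by (auto simp: t_def patterns_def)
        have "t j = 0 \<or> t j = s j" for j
        proof (cases "j < n")
          case True
          then have "\<bar>plf p a j c\<bar> = s j * plf p a j c" using closed_cell_plf[OF cc(1)] cc(1) by simp
          then have "plf p a j c = 0 \<or> sgn (plf p a j c) = s j" using sv[of j] by (auto simp: sgn_if)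
          then show ?thesis using True by (auto simp: t_def sign_pattern_def)
        qed (simp add: t_def sign_pattern_def)
        then have "t \<in> I" using tp by (simp add: I_def)
        moreover have "c \<in> A t \<inter> sign_region n t" unfolding piece_eq[OF tp] using cc by (simp add: t_def sign_pattern_def)
        ultimately show "c \<in> (\<Union>t\<in>I. A t \<inter> sign_region n t)" by blast
      qed
    qed
    have Keq: "K = S \<inter> (\<Inter>j\<in>{..<n}. {c. \<bar>linv p a s j \<bullet> c\<bar> = s j * (linv p a s j \<bullet> c)}) \<inter> {c. q \<bullet> c = 1}"
      by (auto simp: K_def)
    have half: "{c. \<bar>linv p a s j \<bullet> c\<bar> = s j * (linv p a s j \<bullet> c)} = (if s j = 0 then {c. linv p a s j \<bullet> c = 0} else {c. (s j *\<^sub>R linv p a s j) \<bullet> c \<ge> 0})" for j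
      using sv[of j] by auto
    have hc: "convex {c. \<bar>linv p a s j \<bullet> c\<bar> = s j * (linv p a s j \<bullet> c)}" for j
      unfolding half using convex_hyperplane[of "linv p a s j" 0] convex_halfspace_ge[of 0 "s j *\<^sub>R linv p a s j"] by simp
    have hcl: "closed {c. \<bar>linv p a s j \<bullet> c\<bar> = s j * (linv p a s j \<bullet> c)}" for j
      unfolding half using closed_hyperplane[of "linv p a s j" 0] closed_halfspace_ge[of 0 "s j *\<^sub>R linv p a s j"] by simp
    show "convex K" unfolding Keq
      by (rule convex_Int[OF convex_Int[OF subspace_imp_convex[OF S] convex_INT] convex_hyperplane]) (rule hc)
    have "closed K" unfolding Keq
      by (rule closed_Int[OF closed_Int[OF closed_subspace[OF S] closed_INT] closed_hyperplane]) (simp add: hcl)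
    then show "if True then closed K else K = UNIV \<inter> UNIV \<and> affine (UNIV::'a set) \<and> open (UNIV::'a set)" by simp
    show "bounded K"
    proof -
      obtain m where m: "m > 0" "\<And>c. c \<in> S \<Longrightarrow> m * norm c \<le> (\<Sum>j<n. \<bar>plf p a j c\<bar>)"
        using plf_norm_bound[OF S nz] by blast
      have "norm c \<le> 1 / m" if "c \<in> K" for c
        using m(2)[of c] qval[of c] that m(1) by (simp add: K_def field_simps)
      then show ?thesis unfolding bounded_iff by blast
    qed
    have "s \<in> I" using s by (simp add: I_def)
    then obtain c where "c \<in> A s \<inter> sign_region n s" using ex by blast
    then have "c \<in> S" "\<forall>j<n. sgn (plf p a j c) = s j" "q \<bullet> c = 1" using piece_eq[OF s] by auto
    then have "c \<in> K" using coarse[OF \<open>s \<in> I\<close>] by (simp add: K_def)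
    then show "K \<noteq> {}" by blast
  qed
  moreover have "(-1::real) ^ nat (aff_dim (A t)) = (-1) ^ (dim S - 1) * (-1) ^ card {j\<in>J. t j = 0}" if t: "t \<in> I" for t
  proof -
    have "card {j\<in>J. t j = 0} \<le> dim S - 1" using zeros_less_dim[OF gen _ J, of t] t by (simp add: I_def)
    then show ?thesis unfolding dimA[OF t] by (rule minus_one_power_diff)
  qed
  ultimately show ?thesis by (simp add: I_def)
qed

end

section \<open>Symmetry of pattern counts\<close>

context
  fixes p :: "nat \<Rightarrow> 'a::euclidean_space" and a :: "nat \<Rightarrow> nat \<Rightarrow> real"
begin

text \<open>The Euler characteristic of the open unit ball of \<open>S\<close>, partitioned into the
  cells and the origin. The origin has no pattern and is the piece indexed by
  \<open>None\<close>.\<close>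

lemma euler_all_cells:
  assumes gen: "generic p a S J n" and J: "J \<subseteq> {..<n}" and nz: "\<And>c. c \<in> S - {0} \<Longrightarrow> \<exists>j<n. plf p a j c \<noteq> 0"
  shows "1 + (\<Sum>t\<in>patterns p a S n. (-1::real) ^ dim S * (-1) ^ card {j\<in>J. t j = 0}) = (-1) ^ dim S"
proof -
  have S: "subspace S" using gen by (simp add: generic_def)
  define A where "A o' = (case o' of None \<Rightarrow> {0} | Some t \<Rightarrow> lin_space p a S n t)" for o'
  define U where "U o' = (case o' of None \<Rightarrow> UNIV | Some t \<Rightarrow> sign_region p a n t \<inter> ball 0 1)" for o'
  define I where "I = insert None (Some ` patterns p a S n)"
  have piece: "A (Some t) \<inter> U (Some t) = {c\<in>S. \<forall>j<n. sgn (plf p a j c) = t j} \<inter> ball 0 1" if "t \<in> patterns p a S n" for t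
    using cell_eq[where t=t and p=p and a=a and S=S and n=n] pattern_values[OF that] by (auto simp: A_def U_def)
  have ex: "\<exists>c. c \<in> A (Some t) \<inter> U (Some t)" if t: "t \<in> patterns p a S n" for t
  proof -
    obtain c where c: "c \<in> S" "c \<noteq> 0" "\<forall>j<n. sgn (plf p a j c) = t j" using t by (rule patternE)
    define d where "d = (1 / (2 * norm c)) *\<^sub>R c"
    have "sgn (plf p a j d) = sgn (plf p a j c)" for j using c(2) by (simp add: d_def plf_scaleR sgn_mult)
    moreover have "d \<in> S" "norm d < 1" using c S by (auto simp: d_def subspace_scale)
    ultimately show ?thesis unfolding piece[OF t] using c by auto
  qed
  have nz0: "\<exists>j<n. t j \<noteq> 0" if "t \<in> patterns p a S n" for t
  proof -
    obtain c where c: "c \<in> S" "c \<noteq> 0" "\<forall>j<n. sgn (plf p a j c) = t j" using \<open>t \<in> patterns p a S n\<close> by (rule patternE)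
    then obtain j where "j < n" "plf p a j c \<noteq> 0" using nz by blast
    then show ?thesis using c(3) by (metis sgn_0_0)
  qed
  have zero: "0 \<notin> A (Some t) \<inter> U (Some t)" if t: "t \<in> patterns p a S n" for t
  proof
    assume "0 \<in> A (Some t) \<inter> U (Some t)"
    then have "\<forall>j<n. sgn (plf p a j 0) = t j" using piece[OF t] by blast
    moreover have "plf p a j 0 = 0" for j using plf_scaleR[of 0 p a j 0] by simp
    ultimately show False using nz0[OF t] by auto
  qed
  have "(\<Sum>i\<in>I. (-1::real) ^ nat (aff_dim (A i))) = (if False then 1 else (-1) ^ nat (aff_dim S))"
  proof (rule euler_characteristic_partition[where K="S \<inter> ball 0 1" and U=U and W="ball 0 1"])
    show "finite I" by (simp add: I_def finite_patterns)
    show "affine (A i) \<and> open (U i) \<and> convex (A i \<inter> U i) \<and> A i \<inter> U i \<noteq> {}" if "i \<in> I" for i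
    proof (cases i)
      case None
      then show ?thesis by (simp add: A_def U_def)
    next
      case (Some t)
      have t: "t \<in> patterns p a S n" using that Some by (auto simp: I_def)
      have "affine (A i)" unfolding A_def Some by (simp add: subspace_imp_affine subspace_lin_space S)
      moreover have "open (U i)" unfolding U_def Some by (simp add: open_Int open_sign_region)
      moreover have "convex (U i)" unfolding U_def Some by (simp add: convex_Int convex_sign_region)
      ultimately show ?thesis using ex[OF t] Some affine_imp_convex convex_Int by blast
    qed
    show "disjoint_family_on (\<lambda>i. A i \<inter> U i) I"
      unfolding disjoint_family_on_def
    proof (intro ballI impI)
      fix i i' assume ii: "i \<in> I" "i' \<in> I" "i \<noteq> i'"
      show "(A i \<inter> U i) \<inter> (A i' \<inter> U i') = {}"
      proof (cases i; cases i')
        fix t t' assume tt: "i = Some t" "i' = Some t'"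
        then have P: "t \<in> patterns p a S n" "t' \<in> patterns p a S n" "t \<noteq> t'" using ii by (auto simp: I_def)
        obtain j where j: "t j \<noteq> t' j" using P(3) by blast
        have "j < n"
        proof (rule ccontr)
          assume "\<not> j < n"
          then show False using j pattern_outside[OF P(1), of j] pattern_outside[OF P(2), of j] by simp
        qed
        with j show ?thesis unfolding tt piece[OF P(1)] piece[OF P(2)] by auto
      next
        fix t assume tt: "i = None" "i' = Some t"
        then have "t \<in> patterns p a S n" using ii by (auto simp: I_def)
        from zero[OF this] show ?thesis unfolding tt by (auto simp: A_def)
      next
        fix t assume tt: "i = Some t" "i' = None"
        then have "t \<in> patterns p a S n" using ii by (auto simp: I_def)
        from zero[OF this] show ?thesis unfolding tt by (auto simp: A_def)
      qed (use ii in auto)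
    qed
    show "S \<inter> ball 0 1 = (\<Union>i\<in>I. A i \<inter> U i)"
    proof
      show "(\<Union>i\<in>I. A i \<inter> U i) \<subseteq> S \<inter> ball 0 1"
      proof
        fix c assume "c \<in> (\<Union>i\<in>I. A i \<inter> U i)"
        then consider "c \<in> A None" | t where "t \<in> patterns p a S n" "c \<in> A (Some t) \<inter> U (Some t)" by (auto simp: I_def)
        then show "c \<in> S \<inter> ball 0 1"
        proof cases
          case 1
          then show ?thesis using subspace_0[OF S] by (simp add: A_def)
        next
          case 2
          then show ?thesis using piece[of t] by auto
        qed
      qed
      show "S \<inter> ball 0 1 \<subseteq> (\<Union>i\<in>I. A i \<inter> U i)"
      proof
        fix c assume c: "c \<in> S \<inter> ball 0 1"
        show "c \<in> (\<Union>i\<in>I. A i \<inter> U i)"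
        proof (cases "c = 0")
          case True
          then have "c \<in> A None \<inter> U None" by (simp add: A_def U_def)
          then show ?thesis by (auto simp: I_def)
        next
          case False
          define t where "t = sign_pattern p a n c"
          have t: "t \<in> patterns p a S n" using c False by (auto simp: t_def patterns_def)
          have "c \<in> A (Some t) \<inter> U (Some t)" unfolding piece[OF t] using c by (simp add: t_def sign_pattern_def)
          then show ?thesis using t unfolding I_def by blast
        qed
      qed
    qed
    show "convex (S \<inter> ball 0 1)" using S by (intro convex_Int subspace_imp_convex convex_ball)
    show "bounded (S \<inter> ball 0 1)" by (rule bounded_subset[of "ball 0 1"]) auto
    show "S \<inter> ball 0 1 \<noteq> {}" using subspace_0[OF S] by auto
    show "if False then closed (S \<inter> ball 0 1) else S \<inter> ball 0 1 = S \<inter> ball 0 1 \<and> affine S \<and> open (ball 0 1)"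
      using S by (simp add: subspace_imp_affine)
  qed
  moreover have "(\<Sum>i\<in>I. (-1::real) ^ nat (aff_dim (A i))) = 1 + (\<Sum>t\<in>patterns p a S n. (-1::real) ^ nat (aff_dim (A (Some t))))"
  proof -
    have "A None = {0}" by (simp add: A_def)
    moreover have "finite (Some ` patterns p a S n)" by (simp add: finite_patterns)
    ultimately show ?thesis unfolding I_def by (subst sum.insert) (auto simp: sum.reindex)
  qed
  moreover have "(-1::real) ^ nat (aff_dim (A (Some t))) = (-1) ^ dim S * (-1) ^ card {j\<in>J. t j = 0}" if t: "t \<in> patterns p a S n" for t
  proof -
    have "nat (aff_dim (A (Some t))) = dim (lin_space p a S n t)"
      by (simp add: A_def aff_dim_subspace subspace_lin_space S)
    also have "\<dots> = dim S - card {j\<in>J. t j = 0}" using dim_lin_space[OF gen t J] by simp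
    finally show ?thesis using zeros_less_dim[OF gen t J] by (simp add: minus_one_power_diff)
  qed
  ultimately show ?thesis using S by (simp add: aff_dim_subspace)
qed

text \<open>As the dimension of a face is the number of zeros of its pattern, this is an
  \<open>f\<close>-polynomial in the variable \<open>x\<close>.\<close>

definition pattern_gf :: "'a set \<Rightarrow> nat set \<Rightarrow> nat \<Rightarrow> real \<Rightarrow> real" where
  "pattern_gf S J n x = (\<Sum>s\<in>patterns p a S n. x ^ card {j\<in>J. s j = 0})"

text \<open>Euler's relation for the boundary of a polytope, obtained from
  \<open>euler_all_cells\<close> by multiplying with the sign of the dimension.\<close>

lemma pattern_gf_minus_one:
  assumes "generic p a S J n" "J \<subseteq> {..<n}" "\<And>c. c \<in> S - {0} \<Longrightarrow> \<exists>j<n. plf p a j c \<noteq> 0"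
  shows "pattern_gf S J n (-1) = 1 - (-1) ^ dim S"
proof -
  have "(-1::real) ^ dim S * (1 + (-1) ^ dim S * pattern_gf S J n (-1)) = (-1) ^ dim S * (-1) ^ dim S"
    using euler_all_cells[OF assms] by (simp add: pattern_gf_def sum_distrib_left)
  moreover have "(-1::real) ^ dim S * (-1) ^ dim S = 1" by (simp flip: power_mult_distrib)
  ultimately show ?thesis by (simp add: distrib_left flip: mult.assoc)
qed

text \<open>By \<open>generic_refine\<close> nothing obstructs the resolution of the zeros of
  \<open>t\<close> in \<open>J\<close>, so these patterns form a full sign cube; indices outside
  \<open>J\<close> stay zero.\<close>

lemma pattern_refinements:
  assumes gen: "generic p a S J n" and J: "J \<subseteq> {..<n}" and t: "t \<in> patterns p a S n"
  shows "{s \<in> patterns p a S n. \<forall>j. t j = 0 \<or> t j = s j} = sign_refinements {j\<in>J. t j = 0} t"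
proof
  show "{s \<in> patterns p a S n. \<forall>j. t j = 0 \<or> t j = s j} \<subseteq> sign_refinements {j\<in>J. t j = 0} t"
  proof
    fix s assume "s \<in> {s \<in> patterns p a S n. \<forall>j. t j = 0 \<or> t j = s j}"
    then have s: "s \<in> patterns p a S n" "\<forall>j. t j = 0 \<or> t j = s j" by auto
    obtain c where c: "c \<in> S" "c \<noteq> 0" "\<forall>j<n. sgn (plf p a j c) = s j" using s(1) by (rule patternE)
    have "s j = t j" if "j \<notin> {j\<in>J. t j = 0}" for j
    proof (cases "t j = 0")
      case True
      then have "j \<notin> J" using that by simp
      then have "s j = 0"
      proof (cases "j < n")
        case True
        then have "plf p a j c = 0" using gen c(1) \<open>j \<notin> J\<close> by (simp add: generic_def)
        then show ?thesis using c(3) True by (metis sgn_0)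
      qed (use pattern_outside[OF s(1), of j] in simp)
      then show ?thesis using True by simp
    qed (use s in force)
    then show "s \<in> sign_refinements {j\<in>J. t j = 0} t"
      using pattern_values[OF s(1)] by (auto simp: sign_refinements_def)
  qed
  show "sign_refinements {j\<in>J. t j = 0} t \<subseteq> {s \<in> patterns p a S n. \<forall>j. t j = 0 \<or> t j = s j}"
  proof
    fix s assume s: "s \<in> sign_refinements {j\<in>J. t j = 0} t"
    obtain c where c: "c \<in> S" "c \<noteq> 0" "\<forall>j<n. sgn (plf p a j c) = t j" using t by (rule patternE)
    have "s j \<in> {-1, 0, 1} \<and> (j \<notin> J \<longrightarrow> s j = 0) \<and> (plf p a j c \<noteq> 0 \<longrightarrow> s j = sgn (plf p a j c))" if "j < n" for j
    proof (cases "j \<in> J \<and> t j = 0")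
      case True
      then have "plf p a j c = 0" using c that by (metis sgn_0_0)
      then show ?thesis using s True by (auto simp: sign_refinements_def)
    next
      case False
      then have st: "s j = t j" using s by (auto simp: sign_refinements_def)
      moreover have "j \<notin> J \<longrightarrow> t j = 0"
      proof
        assume "j \<notin> J"
        then have "plf p a j c = 0" using gen c(1) that by (simp add: generic_def)
        then show "t j = 0" using c(3) that by (metis sgn_0)
      qed
      ultimately show ?thesis using pattern_values[OF t, of j] c that by simp
    qed
    then have "\<exists>c'\<in>S - {0}. dist c' c < 1 \<and> (\<forall>j<n. sgn (plf p a j c') = s j)"
      using c by (intro generic_refine[OF gen]) simp_all
    moreover have "\<forall>j\<ge>n. s j = 0"
    proof (intro allI impI)
      fix j assume "n \<le> j"
      then have "j \<notin> J" "t j = 0" using J pattern_outside[OF t, of j] by auto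
      then show "s j = 0" using s by (simp add: sign_refinements_def)
    qed
    ultimately have "s \<in> patterns p a S n" by (auto intro: patternI)
    moreover have "t j = 0 \<or> t j = s j" for j using s by (auto simp: sign_refinements_def)
    ultimately show "s \<in> {s \<in> patterns p a S n. \<forall>j. t j = 0 \<or> t j = s j}" by simp
  qed
qed

text \<open>The Dehn--Sommerville relations, as a symmetry of the generating function about \<open>-1\<close>.\<close>

lemma pattern_gf_symmetric:
  assumes gen: "generic p a S J n" and J: "J \<subseteq> {..<n}" and nz: "\<And>c. c \<in> S - {0} \<Longrightarrow> \<exists>j<n. plf p a j c \<noteq> 0"
  shows "pattern_gf S J n x = (-1) ^ (dim S - 1) * pattern_gf S J n (- 2 - x)"
proof -
  have fin: "finite (patterns p a S n)" by (rule finite_patterns)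
  have fJ: "finite {j\<in>J. t j = 0}" for t by (rule finite_subset[of _ "{..<n}"]) (use J in auto)
  define z where "z s = card {j\<in>J. s j = 0}" for s :: "nat \<Rightarrow> real"
  have loc: "(\<Sum>t\<in>patterns p a S n. if \<forall>j. t j = 0 \<or> t j = s j then (-1::real) ^ (dim S - 1) * (-1) ^ z t else 0) = 1" if "s \<in> patterns p a S n" for s
    unfolding z_def using euler_closed_cell[OF gen J nz that] fin by (simp add: sum.inter_filter del: One_nat_def)
  have up: "(\<Sum>s\<in>patterns p a S n. if \<forall>j. t j = 0 \<or> t j = s j then x ^ z s else 0) = (x + 2) ^ z t" if t: "t \<in> patterns p a S n" for t
  proof -
    have "(\<Sum>s\<in>patterns p a S n. if \<forall>j. t j = 0 \<or> t j = s j then x ^ z s else 0)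
        = (\<Sum>s\<in>sign_refinements {j\<in>J. t j = 0} t. x ^ z s)"
      using fin by (simp add: sum.inter_filter flip: pattern_refinements[OF gen J t])
    also have "\<dots> = (\<Sum>s\<in>sign_refinements {j\<in>J. t j = 0} t. x ^ card {j\<in>{j\<in>J. t j = 0}. s j = 0})"
    proof (rule sum.cong)
      fix s assume s: "s \<in> sign_refinements {j\<in>J. t j = 0} t"
      then have "{j\<in>{j\<in>J. t j = 0}. s j = 0} = {j\<in>J. s j = 0}" by (auto simp: sign_refinements_def)
      then show "x ^ z s = x ^ card {j\<in>{j\<in>J. t j = 0}. s j = 0}" by (simp add: z_def)
    qed simp
    finally show ?thesis using sum_sign_refinements[OF fJ] by (simp add: z_def)
  qed
  \<comment> \<open>Each summand is multiplied by the Euler sum \<open>loc\<close> over its closed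
    cell, which is 1. After the sums are swapped, the inner one runs over all refinements of
    \<open>t\<close> and equals \<open>(x + 2) ^ z t\<close>; the signs turn this into a power of
    \<open>- 2 - x\<close>.\<close>
  have "pattern_gf S J n x = (\<Sum>s\<in>patterns p a S n. x ^ z s * (\<Sum>t\<in>patterns p a S n. if \<forall>j. t j = 0 \<or> t j = s j then (-1::real) ^ (dim S - 1) * (-1) ^ z t else 0))"
    unfolding pattern_gf_def z_def[symmetric] using loc by (intro sum.cong) auto
  also have "\<dots> = (\<Sum>t\<in>patterns p a S n. (-1::real) ^ (dim S - 1) * (-1) ^ z t * (\<Sum>s\<in>patterns p a S n. if \<forall>j. t j = 0 \<or> t j = s j then x ^ z s else 0))"
    unfolding sum_distrib_left by (subst sum.swap) (intro sum.cong, auto)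
  also have "\<dots> = (\<Sum>t\<in>patterns p a S n. (-1::real) ^ (dim S - 1) * (-1) ^ z t * (x + 2) ^ z t)"
    using up by simp
  also have "\<dots> = (-1) ^ (dim S - 1) * pattern_gf S J n (- 2 - x)"
  proof -
    have "(-1) * (x + 2) = - 2 - x" by simp
    then have "(-1) ^ k * (x + 2) ^ k = (- 2 - x) ^ k" for k by (metis power_mult_distrib)
    then show ?thesis by (simp add: pattern_gf_def sum_distrib_left mult.assoc flip: z_def)
  qed
  finally show ?thesis .
qed

end

section \<open>Polytopes with cubical sign data\<close>

text \<open>\<open>None\<close> is the empty face. In a sign vector a nonzero entry fixes the
  coordinate at one of its two ends and a zero leaves it free.\<close>

definition cube_faces :: "nat \<Rightarrow> (nat \<Rightarrow> real) option set" where
  "cube_faces r = insert None (Some ` sign_refinements {..<r} (\<lambda>_. 0))"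

fun cube_face_le :: "(nat \<Rightarrow> real) option \<Rightarrow> (nat \<Rightarrow> real) option \<Rightarrow> bool" where
  "cube_face_le None q = True"
| "cube_face_le (Some t) None = False"
| "cube_face_le (Some t) (Some t') = (\<forall>j. t' j = 0 \<or> t' j = t j)"

lemma cube_face_le_antisym:
  assumes "cube_face_le q q'" "cube_face_le q' q"
  shows "q = q'"
proof (cases q; cases q')
  fix t t' assume q: "q = Some t" "q' = Some t'"
  have "t j = t' j" for j using assms by (simp add: q) metis
  then show ?thesis using q by auto
qed (use assms in auto)

text \<open>One combinatorial model of the face poset of the \<open>r\<close>-cube, through which
  faces in different spaces are compared.\<close>

definition cube_like :: "nat \<Rightarrow> 'a::real_vector set \<Rightarrow> bool" where
  "cube_like r F \<longleftrightarrow> (\<exists>\<psi>. bij_betw \<psi> (cube_faces r) {G. G face_of F} \<and>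
     (\<forall>q\<in>cube_faces r. \<forall>q'\<in>cube_faces r. cube_face_le q q' \<longleftrightarrow> \<psi> q \<subseteq> \<psi> q'))"

lemma cube_like_combinatorially_equivalent:
  assumes "cube_like r F" "cube_like r G"
  shows "combinatorially_equivalent F G"
proof -
  obtain \<psi> where \<psi>: "bij_betw \<psi> (cube_faces r) {H. H face_of F}"
    "\<And>q q'. q \<in> cube_faces r \<Longrightarrow> q' \<in> cube_faces r \<Longrightarrow> cube_face_le q q' \<longleftrightarrow> \<psi> q \<subseteq> \<psi> q'"
    using assms(1) by (auto simp: cube_like_def)
  obtain \<omega> where \<omega>: "bij_betw \<omega> (cube_faces r) {H. H face_of G}"
    "\<And>q q'. q \<in> cube_faces r \<Longrightarrow> q' \<in> cube_faces r \<Longrightarrow> cube_face_le q q' \<longleftrightarrow> \<omega> q \<subseteq> \<omega> q'"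
    using assms(2) by (auto simp: cube_like_def)
  define \<psi>' where "\<psi>' = inv_into (cube_faces r) \<psi>"
  have \<psi>': "bij_betw \<psi>' {H. H face_of F} (cube_faces r)" unfolding \<psi>'_def by (rule bij_betw_inv_into[OF \<psi>(1)])
  have inv: "\<psi>' H \<in> cube_faces r" "\<psi> (\<psi>' H) = H" if "H face_of F" for H
    using that \<psi>' \<psi>(1) by (auto simp: \<psi>'_def bij_betw_def f_inv_into_f inv_into_into)
  have "bij_betw (\<omega> \<circ> \<psi>') {H. H face_of F} {H. H face_of G}" by (rule bij_betw_trans[OF \<psi>' \<omega>(1)])
  moreover have "H \<subseteq> H' \<longleftrightarrow> (\<omega> \<circ> \<psi>') H \<subseteq> (\<omega> \<circ> \<psi>') H'" if "H face_of F" "H' face_of F" for H H'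
    using \<psi>(2)[of "\<psi>' H" "\<psi>' H'"] \<omega>(2)[of "\<psi>' H" "\<psi>' H'"] inv[OF that(1)] inv[OF that(2)] by simp
  ultimately show ?thesis unfolding combinatorially_equivalent_def by blast
qed

text \<open>The value 1 from \<open>N\<close> on gives each vertex of the \<open>N\<close>-cube
  exactly one representative.\<close>

definition sign_vertices :: "nat \<Rightarrow> (nat \<Rightarrow> real) set" where
  "sign_vertices N = {v. (\<forall>i<N. v i = 1 \<or> v i = -1) \<and> (\<forall>i\<ge>N. v i = 1)}"

lemma finite_sign_vertices: "finite (sign_vertices N)"
proof (rule finite_subset)
  show "sign_vertices N \<subseteq> sign_refinements {..<N} (\<lambda>_. 1)"
    by (auto simp: sign_vertices_def sign_refinements_def)
qed (simp add: finite_sign_refinements)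

text \<open>The data from which the face poset of a projected cube can be read off: \<open>u\<close>
  gives the images of the cube vertices and \<open>h\<close> is the support function. By
  \<open>gap\<close> a vertex \<open>v\<close> is maximal in direction \<open>c\<close> exactly if
  \<open>v i\<close> is the sign of \<open>y i c\<close> wherever that is nonzero. The locale covers
  both the deformed cubes and the unit cube.\<close>

locale sign_polytope =
  fixes N :: nat and y :: "nat \<Rightarrow> 'a::euclidean_space \<Rightarrow> real" and u :: "(nat \<Rightarrow> real) \<Rightarrow> 'a"
    and w :: "(nat \<Rightarrow> real) \<Rightarrow> nat \<Rightarrow> real" and h :: "'a \<Rightarrow> real"
  assumes w_pos: "v \<in> sign_vertices N \<Longrightarrow> i < N \<Longrightarrow> 0 < w v i"
    and gap: "v \<in> sign_vertices N \<Longrightarrow> h c - c \<bullet> u v = (\<Sum>i<N. (\<bar>y i c\<bar> - v i * y i c) * w v i)"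
    and nonzero: "c \<noteq> 0 \<Longrightarrow> \<exists>i<N. y i c \<noteq> 0"
    and refine: "c \<noteq> 0 \<Longrightarrow> (\<And>i. i < N \<Longrightarrow> t i \<in> {-1, 0, 1}) \<Longrightarrow>
        (\<And>i. i < N \<Longrightarrow> y i c \<noteq> 0 \<Longrightarrow> t i = sgn (y i c)) \<Longrightarrow> \<exists>c'. c' \<noteq> 0 \<and> (\<forall>i<N. sgn (y i c') = t i)"
    and dim_cell: "c \<noteq> 0 \<Longrightarrow> DIM('a) \<le> dim {c'. \<forall>i<N. sgn (y i c') = sgn (y i c)} + card {i. i < N \<and> y i c = 0}"
begin

definition body :: "'a set" where "body = convex hull (u ` sign_vertices N)"

definition pats :: "(nat \<Rightarrow> real) set" where
  "pats = {s. (\<forall>i\<ge>N. s i = 0) \<and> (\<exists>c. c \<noteq> 0 \<and> (\<forall>i<N. sgn (y i c) = s i))}"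

definition compat :: "(nat \<Rightarrow> real) \<Rightarrow> (nat \<Rightarrow> real) set" where
  "compat s = {v \<in> sign_vertices N. \<forall>i<N. s i \<noteq> 0 \<longrightarrow> v i = s i}"

definition face :: "(nat \<Rightarrow> real) \<Rightarrow> 'a set" where "face s = convex hull (u ` compat s)"

lemma pat_values: "s \<in> pats \<Longrightarrow> s i \<in> {-1, 0, 1}"
proof -
  assume "s \<in> pats"
  then obtain c where "\<forall>i<N. sgn (y i c) = s i" "\<forall>i\<ge>N. s i = 0" by (auto simp: pats_def)
  then have "s i = (if i < N then sgn (y i c) else 0)" by simp
  then show ?thesis by (simp add: sgn_if)
qed

lemma summand_nonneg:
  assumes "v \<in> sign_vertices N" "i < N"
  shows "0 \<le> (\<bar>y i c\<bar> - v i * y i c) * w v i"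
    and "(\<bar>y i c\<bar> - v i * y i c) * w v i = 0 \<longleftrightarrow> (y i c \<noteq> 0 \<longrightarrow> v i = sgn (y i c))"
proof -
  have v: "v i = 1 \<or> v i = -1" using assms by (auto simp: sign_vertices_def)
  then show "0 \<le> (\<bar>y i c\<bar> - v i * y i c) * w v i" using w_pos[OF assms] by (auto intro!: mult_nonneg_nonneg)
  show "(\<bar>y i c\<bar> - v i * y i c) * w v i = 0 \<longleftrightarrow> (y i c \<noteq> 0 \<longrightarrow> v i = sgn (y i c))"
    using v w_pos[OF assms] by (auto simp: sgn_if)
qed

lemma support_le: "v \<in> sign_vertices N \<Longrightarrow> c \<bullet> u v \<le> h c"
  using gap[of v c] sum_nonneg[of "{..<N}" "\<lambda>i. (\<bar>y i c\<bar> - v i * y i c) * w v i"] summand_nonneg(1) by fastforce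

lemma support_eq:
  assumes "v \<in> sign_vertices N"
  shows "c \<bullet> u v = h c \<longleftrightarrow> (\<forall>i<N. y i c \<noteq> 0 \<longrightarrow> v i = sgn (y i c))"
proof -
  have "c \<bullet> u v = h c \<longleftrightarrow> (\<Sum>i<N. (\<bar>y i c\<bar> - v i * y i c) * w v i) = 0" using gap[OF assms, of c] by linarith
  also have "\<dots> \<longleftrightarrow> (\<forall>i\<in>{..<N}. (\<bar>y i c\<bar> - v i * y i c) * w v i = 0)"
    using summand_nonneg(1)[OF assms] by (intro sum_nonneg_eq_0_iff) auto
  finally show ?thesis using summand_nonneg(2)[OF assms] by auto
qed

lemma compat_nonempty:
  assumes "\<And>i. s i \<in> {-1, 0, 1}"
  shows "compat s \<noteq> {}"
proof -
  have "(\<lambda>i. if i < N \<and> s i \<noteq> 0 then s i else 1) \<in> compat s"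
    using assms by (auto simp: compat_def sign_vertices_def)
  then show ?thesis by blast
qed

lemma compat_subset: "compat s \<subseteq> sign_vertices N" by (auto simp: compat_def)

lemma polytope_body: "polytope body"
  unfolding body_def by (rule polytope_convex_hull) (simp add: finite_sign_vertices)

lemma body_le: "x \<in> body \<Longrightarrow> c \<bullet> x \<le> h c"
proof -
  have "body \<subseteq> {x. c \<bullet> x \<le> h c}" unfolding body_def
    by (rule hull_minimal) (auto simp: support_le convex_halfspace_le)
  then show "x \<in> body \<Longrightarrow> c \<bullet> x \<le> h c" by blast
qed

lemma supporting_face:
  assumes "\<forall>i<N. sgn (y i c) = s i"
  shows "body \<inter> {x. c \<bullet> x = h c} = face s"
proof
  have tight: "v \<in> compat s \<longleftrightarrow> v \<in> sign_vertices N \<and> c \<bullet> u v = h c" for v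
    using support_eq[of v c] assms by (auto simp: compat_def) (metis sgn_0_0)+
  show "face s \<subseteq> body \<inter> {x. c \<bullet> x = h c}"
  proof
    fix x assume x: "x \<in> face s"
    have "face s \<subseteq> body" unfolding face_def body_def by (intro hull_mono image_mono compat_subset)
    moreover have "face s \<subseteq> {x. c \<bullet> x = h c}" unfolding face_def
      by (rule hull_minimal) (auto simp: tight convex_hyperplane)
    ultimately show "x \<in> body \<inter> {x. c \<bullet> x = h c}" using x by blast
  qed
  have "body \<inter> {x. c \<bullet> x = h c} face_of convex hull (u ` sign_vertices N)"
    using body_le polytope_imp_convex[OF polytope_body]
    by (auto intro!: face_of_Int_supporting_hyperplane_le simp: body_def)
  moreover have "compact (u ` sign_vertices N)" by (simp add: finite_imp_compact finite_sign_vertices)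
  ultimately obtain B where B: "B \<subseteq> u ` sign_vertices N" "body \<inter> {x. c \<bullet> x = h c} = convex hull B"
    using face_of_convex_hull_subset by blast
  have "B \<subseteq> u ` compat s"
  proof
    fix x assume "x \<in> B"
    then obtain v where v: "v \<in> sign_vertices N" "x = u v" using B(1) by blast
    have "x \<in> convex hull B" using \<open>x \<in> B\<close> by (simp add: hull_inc)
    then have "c \<bullet> x = h c" using B(2) by blast
    then show "x \<in> u ` compat s" using v tight by blast
  qed
  then show "body \<inter> {x. c \<bullet> x = h c} \<subseteq> face s" unfolding B(2) face_def by (rule hull_mono)
qed

lemma face_face_of: "s \<in> pats \<Longrightarrow> face s face_of body"
proof -
  assume "s \<in> pats"
  then obtain c where "\<forall>i<N. sgn (y i c) = s i" by (auto simp: pats_def)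
  then have "face s = body \<inter> {x. c \<bullet> x = h c}" using supporting_face by metis
  then show ?thesis using body_le polytope_imp_convex[OF polytope_body]
    by (auto intro!: face_of_Int_supporting_hyperplane_le)
qed

lemma face_nonempty: "s \<in> pats \<Longrightarrow> face s \<noteq> {}"
  using compat_nonempty[of s] pat_values[of s] by (simp add: face_def)

lemma face_mono_iff:
  assumes "s \<in> pats" "s' \<in> pats"
  shows "face s \<subseteq> face s' \<longleftrightarrow> (\<forall>i. s' i = 0 \<or> s' i = s i)"
proof
  assume "\<forall>i. s' i = 0 \<or> s' i = s i"
  then have "compat s \<subseteq> compat s'" unfolding compat_def by fastforce
  then show "face s \<subseteq> face s'" unfolding face_def by (intro hull_mono image_mono)
next
  assume sub: "face s \<subseteq> face s'"
  obtain c' where c': "\<forall>i<N. sgn (y i c') = s' i" using assms(2) by (auto simp: pats_def)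
  have all: "v i = s' i" if v: "v \<in> compat s" "i < N" "s' i \<noteq> 0" for v i
  proof -
    have "u v \<in> face s" unfolding face_def using v by (simp add: hull_inc)
    then have "c' \<bullet> u v = h c'" using sub supporting_face[OF c'] by blast
    then show ?thesis using support_eq[of v c'] v c' compat_subset by (metis sgn_0 subsetD)
  qed
  show "\<forall>i. s' i = 0 \<or> s' i = s i"
  proof (intro allI)
    fix i
    show "s' i = 0 \<or> s' i = s i"
    proof (cases "i < N \<and> s' i \<noteq> 0")
      case True
      \<comment> \<open>Two compatible vertices that differ at every free index. If
        \<open>s i\<close> were zero, \<open>v 1 i\<close> and \<open>v (-1) i\<close> would differ,
        although both equal \<open>s' i\<close>.\<close>
      define v where "v r j = (if j < N then if s j \<noteq> 0 then s j else r else 1)" for r :: real and j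
      have "v r \<in> compat s" if "r = 1 \<or> r = -1" for r
        using pat_values[OF assms(1)] that by (auto simp: compat_def sign_vertices_def v_def)
      then have "v 1 \<in> compat s" "v (-1) \<in> compat s" by auto
      then have "v 1 i = s' i" "v (-1) i = s' i" using all True by blast+
      then show ?thesis using True by (auto simp: v_def split: if_splits)
    next
      case False
      then show ?thesis using assms(2) by (auto simp: pats_def)
    qed
  qed
qed

lemma face_inj: "inj_on face pats"
proof (rule inj_onI)
  fix s s' assume s: "s \<in> pats" "s' \<in> pats" and "face s = face s'"
  then have "\<forall>i. s' i = 0 \<or> s' i = s i" "\<forall>i. s i = 0 \<or> s i = s' i"
    using face_mono_iff[OF s] face_mono_iff[OF s(2,1)] by auto
  then show "s = s'" by (intro ext) metis
qed

text \<open>If \<open>body\<close> lay in a hyperplane with normal \<open>c\<close>, every vertex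
  would be maximal in direction \<open>c\<close>, so all vertices would have the same sign at an
  index where \<open>y i c\<close> is nonzero.\<close>

lemma aff_dim_body: "aff_dim body = DIM('a)"
proof (rule ccontr)
  assume "aff_dim body \<noteq> DIM('a)"
  then have "aff_dim body < DIM('a)" using aff_dim_le_DIM[of body] by linarith
  then obtain c b where c: "c \<noteq> 0" "body \<subseteq> {x. c \<bullet> x = b}" using aff_lowdim_subset_hyperplane by metis
  obtain i where i: "i < N" "y i c \<noteq> 0" using nonzero[OF c(1)] by blast
  have val: "c \<bullet> u v = b" if "v \<in> sign_vertices N" for v
    using c(2) that hull_inc[of "u v" "u ` sign_vertices N" convex] by (auto simp: body_def)
  have "compat (\<lambda>i. sgn (y i c)) \<noteq> {}" by (rule compat_nonempty) (auto simp: sgn_if)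
  then obtain v0 where v0: "v0 \<in> compat (\<lambda>i. sgn (y i c))" by blast
  then have "c \<bullet> u v0 = h c" using support_eq[of v0 c] by (auto simp: compat_def sgn_0_0)
  then have "b = h c" using val v0 compat_subset by blast
  then have all: "v i = sgn (y i c)" if "v \<in> sign_vertices N" for v using support_eq[OF that] val[OF that] i by metis
  have "(\<lambda>_. 1) \<in> sign_vertices N" "(\<lambda>j. if j = i then -1 else 1) \<in> sign_vertices N"
    using i(1) by (auto simp: sign_vertices_def)
  from all[OF this(1)] all[OF this(2)] show False by simp
qed

lemma face_neq_body: "s \<in> pats \<Longrightarrow> face s \<noteq> body"
proof
  assume s: "s \<in> pats" and "face s = body"
  then obtain c where c: "c \<noteq> 0" "\<forall>i<N. sgn (y i c) = s i" by (auto simp: pats_def)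
  then have "body \<subseteq> {x. c \<bullet> x = h c}" using supporting_face[OF c(2)] \<open>face s = body\<close> by blast
  then have "aff_dim body \<le> aff_dim {x. c \<bullet> x = h c}" by (rule aff_dim_subset)
  then show False using aff_dim_body c(1) by (simp add: aff_dim_hyperplane)
qed

text \<open>Every proper face of a polytope is exposed, and by \<open>supporting_face\<close> an
  exposed face depends only on the pattern of its normal.\<close>

lemma faces_eq: "{F. F face_of body \<and> F \<noteq> {} \<and> F \<noteq> body} = face ` pats"
proof
  show "face ` pats \<subseteq> {F. F face_of body \<and> F \<noteq> {} \<and> F \<noteq> body}"
    using face_face_of face_nonempty face_neq_body by blast
  show "{F. F face_of body \<and> F \<noteq> {} \<and> F \<noteq> body} \<subseteq> face ` pats"
  proof
    fix F assume "F \<in> {F. F face_of body \<and> F \<noteq> {} \<and> F \<noteq> body}"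
    then have F: "F face_of body" "F \<noteq> {}" "F \<noteq> body" by auto
    then have "F exposed_face_of body"
      using exposed_face_of_polyhedron[OF polytope_imp_polyhedron[OF polytope_body]] by blast
    then obtain c b where cb: "body \<subseteq> {x. c \<bullet> x \<le> b}" "F = body \<inter> {x. c \<bullet> x = b}"
      unfolding exposed_face_of_def by blast
    have "c \<noteq> 0" using F cb by auto
    define s where "s i = (if i < N then sgn (y i c) else 0)" for i
    have s: "\<forall>i<N. sgn (y i c) = s i" by (simp add: s_def)
    have sp: "s \<in> pats" using \<open>c \<noteq> 0\<close> by (auto simp: pats_def s_def intro!: exI[of _ c])
    obtain x where "x \<in> F" using F(2) by blast
    then have "b \<le> h c" using cb(2) body_le[of x c] by auto
    moreover have "h c \<le> b"
    proof -
      obtain z where "z \<in> face s" using face_nonempty[OF sp] by blast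
      then have "z \<in> body" "c \<bullet> z = h c" using supporting_face[OF s] by auto
      then show ?thesis using cb(1) by auto
    qed
    ultimately have "F = face s" using cb(2) supporting_face[OF s] by simp
    then show "F \<in> face ` pats" using sp by blast
  qed
qed

lemma pats_refine:
  assumes "s \<in> pats" "t \<in> sign_refinements {i. i < N \<and> s i = 0} s"
  shows "t \<in> pats"
proof -
  obtain c where c: "c \<noteq> 0" "\<forall>i<N. sgn (y i c) = s i" using assms(1) by (auto simp: pats_def)
  have "t i \<in> {-1, 0, 1}" for i
    using assms(2) pat_values[OF assms(1), of i] by (cases "i < N \<and> s i = 0") (auto simp: sign_refinements_def)
  moreover have "t i = sgn (y i c)" if "i < N" "y i c \<noteq> 0" for i
  proof -
    have "s i \<noteq> 0" using c(2) that by (metis sgn_0_0)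
    then show ?thesis using assms(2) c(2) that by (simp add: sign_refinements_def)
  qed
  ultimately obtain c' where "c' \<noteq> 0" "\<forall>i<N. sgn (y i c') = t i" using refine[OF c(1), of t] by blast
  moreover have "\<forall>i\<ge>N. t i = 0" using assms by (auto simp: sign_refinements_def pats_def)
  ultimately show ?thesis by (auto simp: pats_def)
qed

text \<open>From above, the face is orthogonal to all normals with the same pattern, whose span is
  large by \<open>dim_cell\<close>. From below, resolving the zeros one at a time gives a strictly
  descending chain of nonempty faces.\<close>

lemma aff_dim_face:
  assumes "s \<in> pats"
  shows "aff_dim (face s) = card {i. i < N \<and> s i = 0}"
proof (rule antisym)
  show "aff_dim (face s) \<le> card {i. i < N \<and> s i = 0}"
  proof -
    obtain c where c: "c \<noteq> 0" "\<forall>i<N. sgn (y i c) = s i" using assms by (auto simp: pats_def)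
    define A where "A = {c'. \<forall>i<N. sgn (y i c') = sgn (y i c)}"
    have "{i. i < N \<and> y i c = 0} = {i. i < N \<and> s i = 0}" using c(2) by (metis sgn_0_0)
    then have dA: "DIM('a) \<le> dim A + card {i. i < N \<and> s i = 0}" using dim_cell[OF c(1)] by (simp add: A_def)
    obtain x0 where x0: "x0 \<in> face s" using face_nonempty[OF assms] by blast
    have "(+) (- x0) ` face s \<subseteq> {z \<in> UNIV. \<forall>c'\<in>span A. orthogonal c' z}"
    proof clarsimp
      fix x c' assume x: "x \<in> face s" and "c' \<in> span A"
      have "orthogonal (x - x0) c'" using \<open>c' \<in> span A\<close>
      proof (rule orthogonal_to_span)
        fix d assume "d \<in> A"
        then have "\<forall>i<N. sgn (y i d) = s i" using c by (simp add: A_def)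
        from supporting_face[OF this] have "d \<bullet> x = h d" "d \<bullet> x0 = h d" using x x0 by blast+
        then show "orthogonal (x - x0) d" by (simp add: orthogonal_def inner_diff_right inner_commute[of _ d])
      qed
      then show "orthogonal c' (x - x0)" by (simp add: orthogonal_commute)
    qed
    then have "dim ((+) (- x0) ` face s) \<le> dim {z \<in> UNIV. \<forall>c'\<in>span A. orthogonal c' z}" by (rule dim_subset)
    moreover have "dim {z \<in> (UNIV::'a set). \<forall>c'\<in>span A. orthogonal c' z} + dim (span A) = dim (UNIV::'a set)"
      by (rule dim_subspace_orthogonal_to_vectors) auto
    moreover have "aff_dim (face s) = int (dim ((+) (- x0) ` face s))" using aff_dim_eq_dim[of x0 "face s"] x0 by (simp add: hull_inc)
    ultimately show ?thesis using dA by simp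
  qed
  show "card {i. i < N \<and> s i = 0} \<le> aff_dim (face s)"
    using assms
  proof (induction "card {i. i < N \<and> s i = 0}" arbitrary: s)
    case 0
    have "0 \<le> aff_dim (face s)" using face_nonempty[OF 0(2)] by (simp add: aff_dim_nonneg_iff)
    then show ?case using 0(1) by linarith
  next
    case (Suc k)
    then have "{i. i < N \<and> s i = 0} \<noteq> {}" by (metis card.empty nat.distinct(1))
    then obtain i where i: "i < N" "s i = 0" by blast
    have t: "s(i := 1) \<in> pats" using i by (intro pats_refine[OF Suc.prems]) (auto simp: sign_refinements_def)
    have "{j. j < N \<and> (s(i := 1)) j = 0} = {j. j < N \<and> s j = 0} - {i}" using i by auto
    then have "k = card {j. j < N \<and> (s(i := 1)) j = 0}" using Suc(2) i by simp
    with Suc.hyps(1)[OF this t] have k: "int k \<le> aff_dim (face (s(i := 1)))" by simp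
    have "face (s(i := 1)) \<subseteq> face s" using face_mono_iff[OF t Suc.prems] i by auto
    moreover have "\<not> face s \<subseteq> face (s(i := 1))" using face_mono_iff[OF Suc.prems t] i by auto
    ultimately have "aff_dim (face (s(i := 1))) < aff_dim (face s)"
      using face_of_subset[OF face_face_of[OF t], of "face s"] face_of_imp_subset[OF face_face_of[OF Suc.prems]]
        face_of_imp_convex[OF face_face_of[OF Suc.prems]] by (intro face_of_aff_dim_lt) auto
    then show ?case using k Suc(2) by simp
  qed
qed

lemma faces_below:
  assumes "s \<in> pats"
  shows "{G. G face_of face s} = insert {} (face ` sign_refinements {i. i < N \<and> s i = 0} s)"
proof
  have sub: "face s \<subseteq> body" using face_of_imp_subset[OF face_face_of[OF assms]] .
  show "insert {} (face ` sign_refinements {i. i < N \<and> s i = 0} s) \<subseteq> {G. G face_of face s}"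
  proof
    fix G assume "G \<in> insert {} (face ` sign_refinements {i. i < N \<and> s i = 0} s)"
    then consider "G = {}" | t where "t \<in> sign_refinements {i. i < N \<and> s i = 0} s" "G = face t" by blast
    then show "G \<in> {G. G face_of face s}"
    proof cases
      case 2
      then have t: "t \<in> pats" using pats_refine[OF assms] by blast
      have "\<forall>i. s i = 0 \<or> s i = t i" using 2 by (auto simp: sign_refinements_def)
      then have "face t \<subseteq> face s" using face_mono_iff[OF t assms] by blast
      then show ?thesis using 2 face_of_subset[OF face_face_of[OF t] _ sub] by simp
    qed simp
  qed
  show "{G. G face_of face s} \<subseteq> insert {} (face ` sign_refinements {i. i < N \<and> s i = 0} s)"
  proof
    fix G assume "G \<in> {G. G face_of face s}"
    then have G: "G face_of face s" by simp
    show "G \<in> insert {} (face ` sign_refinements {i. i < N \<and> s i = 0} s)"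
    proof (cases "G = {}")
      case False
      have "G face_of body" using G face_face_of[OF assms] face_of_trans by blast
      moreover have "G \<subseteq> face s" using G face_of_imp_subset by blast
      moreover have "G \<noteq> body" using calculation(2) sub face_neq_body[OF assms] by blast
      ultimately obtain t where t: "t \<in> pats" "G = face t" using faces_eq False by blast
      then have "\<forall>i. s i = 0 \<or> s i = t i" using face_mono_iff[OF t(1) assms] \<open>G \<subseteq> face s\<close> by blast
      moreover have "\<forall>i\<ge>N. t i = s i" using t(1) assms by (auto simp: pats_def)
      ultimately have "t \<in> sign_refinements {i. i < N \<and> s i = 0} s"
        using pat_values[OF t(1)] by (auto simp: sign_refinements_def)
      then show ?thesis using t by blast
    qed simp
  qed
qed

lemma cube_like_face:
  assumes "s \<in> pats"
  shows "cube_like (card {i. i < N \<and> s i = 0}) (face s)"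
proof -
  define Z where "Z = {i. i < N \<and> s i = 0}"
  define r where "r = card Z"
  obtain \<beta> where \<beta>: "bij_betw \<beta> {..<r} Z"
    using ex_bij_betw_nat_finite[of Z] by (auto simp: Z_def r_def atLeast0LessThan)
  define \<gamma> where "\<gamma> = inv_into {..<r} \<beta>"
  have \<gamma>: "\<gamma> i < r" "\<beta> (\<gamma> i) = i" if "i \<in> Z" for i
    using that \<beta> inv_into_into[of i \<beta> "{..<r}"] by (auto simp: \<gamma>_def bij_betw_def f_inv_into_f)
  have \<beta>Z: "\<beta> j \<in> Z" "\<gamma> (\<beta> j) = j" if "j < r" for j
    using that \<beta> by (auto simp: \<gamma>_def bij_betw_def)
  define lift where "lift t i = (if i \<in> Z then t (\<gamma> i) else s i)" for t :: "nat \<Rightarrow> real" and i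
  have lift: "lift t \<in> sign_refinements Z s" if "t \<in> sign_refinements {..<r} (\<lambda>_. 0)" for t
    using that \<gamma> by (auto simp: sign_refinements_def lift_def)
  have liftle: "(\<forall>i. lift t' i = 0 \<or> lift t' i = lift t i) \<longleftrightarrow> (\<forall>j. t' j = 0 \<or> t' j = t j)"
    if "t \<in> sign_refinements {..<r} (\<lambda>_. 0)" "t' \<in> sign_refinements {..<r} (\<lambda>_. 0)" for t t'
  proof
    assume L: "\<forall>i. lift t' i = 0 \<or> lift t' i = lift t i"
    show "\<forall>j. t' j = 0 \<or> t' j = t j"
    proof
      fix j show "t' j = 0 \<or> t' j = t j"
        using L[rule_format, of "\<beta> j"] \<beta>Z[of j] that by (cases "j < r") (auto simp: lift_def sign_refinements_def)
    qed
  qed (auto simp: lift_def)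
  define \<psi> where "\<psi> q = (case q of None \<Rightarrow> {} | Some t \<Rightarrow> face (lift t))" for q
  have pat: "lift t \<in> pats" if "t \<in> sign_refinements {..<r} (\<lambda>_. 0)" for t
    using pats_refine[OF assms] lift[OF that] by (simp add: Z_def)
  have le: "cube_face_le q q' \<longleftrightarrow> \<psi> q \<subseteq> \<psi> q'" if "q \<in> cube_faces r" "q' \<in> cube_faces r" for q q'
  proof (cases q; cases q')
    fix t t' assume "q = Some t" "q' = Some t'"
    moreover then have "t \<in> sign_refinements {..<r} (\<lambda>_. 0)" "t' \<in> sign_refinements {..<r} (\<lambda>_. 0)"
      using that by (auto simp: cube_faces_def)
    ultimately show ?thesis using face_mono_iff[OF pat pat] liftle by (simp add: \<psi>_def)
  next
    fix t assume "q = Some t" "q' = None"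
    moreover then have "t \<in> sign_refinements {..<r} (\<lambda>_. 0)" using that by (auto simp: cube_faces_def)
    ultimately show ?thesis using face_nonempty[OF pat] by (simp add: \<psi>_def)
  qed (auto simp: \<psi>_def)
  have "bij_betw \<psi> (cube_faces r) {G. G face_of face s}"
    unfolding bij_betw_def
  proof
    show "inj_on \<psi> (cube_faces r)"
    proof (rule inj_onI)
      fix q q' assume q: "q \<in> cube_faces r" "q' \<in> cube_faces r" "\<psi> q = \<psi> q'"
      then have "cube_face_le q q'" "cube_face_le q' q" using le by auto
      then show "q = q'" by (rule cube_face_le_antisym)
    qed
    show "\<psi> ` cube_faces r = {G. G face_of face s}"
    proof -
      have "lift ` sign_refinements {..<r} (\<lambda>_. 0) = sign_refinements Z s"
      proof
        show "lift ` sign_refinements {..<r} (\<lambda>_. 0) \<subseteq> sign_refinements Z s" using lift by blast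
        show "sign_refinements Z s \<subseteq> lift ` sign_refinements {..<r} (\<lambda>_. 0)"
        proof
          fix t assume t: "t \<in> sign_refinements Z s"
          define t' where "t' j = (if j < r then t (\<beta> j) else 0)" for j
          have "t' \<in> sign_refinements {..<r} (\<lambda>_. 0)" using t \<beta>Z by (auto simp: t'_def sign_refinements_def)
          moreover have "lift t' = t" using t \<gamma> by (intro ext) (auto simp: t'_def lift_def sign_refinements_def)
          ultimately show "t \<in> lift ` sign_refinements {..<r} (\<lambda>_. 0)" by blast
        qed
      qed
      moreover have "\<psi> ` cube_faces r = insert {} (face ` lift ` sign_refinements {..<r} (\<lambda>_. 0))"
        by (simp add: cube_faces_def \<psi>_def image_image)
      ultimately show ?thesis using faces_below[OF assms] by (simp add: Z_def)
    qed
  qed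
  then show ?thesis unfolding cube_like_def using le by (auto simp: r_def Z_def)
qed

lemma card_faces:
  assumes "i < DIM('a)"
  shows "card {F. F face_of body \<and> aff_dim F = int i} = card {s\<in>pats. card {j. j < N \<and> s j = 0} = i}"
proof -
  have "{F. F face_of body \<and> aff_dim F = int i} = face ` {s\<in>pats. card {j. j < N \<and> s j = 0} = i}"
  proof
    show "{F. F face_of body \<and> aff_dim F = int i} \<subseteq> face ` {s\<in>pats. card {j. j < N \<and> s j = 0} = i}"
    proof
      fix F assume "F \<in> {F. F face_of body \<and> aff_dim F = int i}"
      then have F: "F face_of body" "aff_dim F = int i" by auto
      then have "F \<noteq> {}" "F \<noteq> body" using assms aff_dim_body by auto
      then obtain s where "s \<in> pats" "F = face s" using faces_eq F by blast
      then show "F \<in> face ` {s\<in>pats. card {j. j < N \<and> s j = 0} = i}" using aff_dim_face F by auto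
    qed
    show "face ` {s\<in>pats. card {j. j < N \<and> s j = 0} = i} \<subseteq> {F. F face_of body \<and> aff_dim F = int i}"
      using face_face_of aff_dim_face by auto
  qed
  moreover have "inj_on face {s\<in>pats. card {j. j < N \<and> s j = 0} = i}" using face_inj by (rule inj_on_subset) auto
  ultimately show ?thesis by (simp add: card_image)
qed

end

section \<open>Stacking polytopes along a facet\<close>

lemma faces_affine_image:
  assumes "linear f" "inj f"
  shows "{G. G face_of (\<lambda>x. a + f x) ` S} = (\<lambda>F. (\<lambda>x. a + f x) ` F) ` {F. F face_of S}"
proof -
  have eq: "(\<lambda>x. a + f x) ` F = (+) a ` f ` F" for F by (simp add: image_image)
  have iff: "((\<lambda>x. a + f x) ` F face_of (\<lambda>x. a + f x) ` S) \<longleftrightarrow> F face_of S" for F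
    unfolding eq by (simp add: face_of_translation_eq face_of_linear_image assms)
  show ?thesis
  proof
    show "{G. G face_of (\<lambda>x. a + f x) ` S} \<subseteq> (\<lambda>F. (\<lambda>x. a + f x) ` F) ` {F. F face_of S}"
    proof
      fix G assume "G \<in> {G. G face_of (\<lambda>x. a + f x) ` S}"
      then have G: "G face_of (\<lambda>x. a + f x) ` S" by simp
      define F where "F = {x\<in>S. a + f x \<in> G}"
      have "G = (\<lambda>x. a + f x) ` F" using face_of_imp_subset[OF G] by (auto simp: F_def)
      then show "G \<in> (\<lambda>F. (\<lambda>x. a + f x) ` F) ` {F. F face_of S}" using G iff by blast
    qed
  qed (use iff in auto)
qed

lemma aff_dim_affine_image:
  fixes f :: "'a::euclidean_space \<Rightarrow> 'b::euclidean_space"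
  assumes "linear f" "inj f"
  shows "aff_dim ((\<lambda>x. a + f x) ` S) = aff_dim S"
proof -
  have "(\<lambda>x. a + f x) ` S = (+) a ` f ` S" by (simp add: image_image)
  then show ?thesis by (simp add: aff_dim_translation_eq aff_dim_injective_linear_image assms)
qed

lemma inj_affine_map:
  fixes f :: "'a::real_vector \<Rightarrow> 'b::real_vector"
  assumes "inj f"
  shows "inj (\<lambda>x. a + f x)"
  using assms by (auto simp: inj_def)

lemma cube_like_affine_image:
  fixes f :: "'a::euclidean_space \<Rightarrow> 'b::euclidean_space"
  assumes "linear f" "inj f" "cube_like r F"
  shows "cube_like r ((\<lambda>x. a + f x) ` F)"
proof -
  let ?g = "\<lambda>x. a + f x"
  obtain \<psi> where \<psi>: "bij_betw \<psi> (cube_faces r) {G. G face_of F}"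
    "\<And>q q'. q \<in> cube_faces r \<Longrightarrow> q' \<in> cube_faces r \<Longrightarrow> cube_face_le q q' \<longleftrightarrow> \<psi> q \<subseteq> \<psi> q'"
    using assms(3) by (auto simp: cube_like_def)
  have inj: "inj ?g" by (rule inj_affine_map[OF assms(2)])
  have "bij_betw (\<lambda>G. ?g ` G) {G. G face_of F} {G. G face_of ?g ` F}"
    unfolding bij_betw_def faces_affine_image[OF assms(1,2)]
    using inj by (auto simp: inj_on_def inj_image_eq_iff)
  from bij_betw_trans[OF \<psi>(1) this] have "bij_betw ((\<lambda>G. ?g ` G) \<circ> \<psi>) (cube_faces r) {G. G face_of ?g ` F}" .
  moreover have "cube_face_le q q' \<longleftrightarrow> ((\<lambda>G. ?g ` G) \<circ> \<psi>) q \<subseteq> ((\<lambda>G. ?g ` G) \<circ> \<psi>) q'"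
    if "q \<in> cube_faces r" "q' \<in> cube_faces r" for q q'
    using \<psi>(2)[OF that] inj by (simp add: inj_image_subset_iff)
  ultimately show ?thesis unfolding cube_like_def by blast
qed

definition face_number :: "'a::euclidean_space set \<Rightarrow> nat \<Rightarrow> nat" where
  "face_number P i = card {F. F face_of P \<and> aff_dim F = int i}"

lemma face_number_affine_image:
  fixes f :: "'a::euclidean_space \<Rightarrow> 'b::euclidean_space"
  assumes "linear f" "inj f"
  shows "face_number ((\<lambda>x. a + f x) ` P) i = face_number P i"
proof -
  let ?g = "\<lambda>x. a + f x"
  have "{F. F face_of ?g ` P \<and> aff_dim F = int i} = (\<lambda>F. ?g ` F) ` {F. F face_of P \<and> aff_dim F = int i}"
  proof
    show "{F. F face_of ?g ` P \<and> aff_dim F = int i} \<subseteq> (\<lambda>F. ?g ` F) ` {F. F face_of P \<and> aff_dim F = int i}"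
    proof
      fix G assume G: "G \<in> {F. F face_of ?g ` P \<and> aff_dim F = int i}"
      then obtain F where "F face_of P" "G = ?g ` F" using faces_affine_image[OF assms, of a P] by blast
      then show "G \<in> (\<lambda>F. ?g ` F) ` {F. F face_of P \<and> aff_dim F = int i}"
        using G aff_dim_affine_image[OF assms, of a F] by auto
    qed
    show "(\<lambda>F. ?g ` F) ` {F. F face_of P \<and> aff_dim F = int i} \<subseteq> {F. F face_of ?g ` P \<and> aff_dim F = int i}"
      using faces_affine_image[OF assms, of a P] aff_dim_affine_image[OF assms, of a] by auto
  qed
  moreover have "inj_on (\<lambda>F. ?g ` F) A" for A using inj_affine_map[OF assms(2)] by (auto simp: inj_on_def inj_image_eq_iff)
  ultimately show ?thesis by (simp add: face_number_def card_image)
qed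

text \<open>The bound on \<open>r\<close> ensures that a coordinate cube realizing the combinatorial
  model exists; see \<open>cube_like_cube\<close>.\<close>

definition cubical :: "'a::euclidean_space set \<Rightarrow> bool" where
  "cubical P \<longleftrightarrow> polytope P \<and> aff_dim P = DIM('a) \<and>
     (\<forall>F. F face_of P \<longrightarrow> F \<noteq> P \<longrightarrow> F \<noteq> {} \<longrightarrow> (\<exists>r<DIM('a). cube_like r F))"

lemma cubical_affine_image:
  fixes f :: "'a::euclidean_space \<Rightarrow> 'a"
  assumes "linear f" "inj f" "cubical P"
  shows "cubical ((\<lambda>x. a + f x) ` P)"
  unfolding cubical_def
proof (intro conjI allI impI)
  have "(\<lambda>x. a + f x) ` P = (+) a ` f ` P" by (simp add: image_image)
  then show "polytope ((\<lambda>x. a + f x) ` P)"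
    using assms by (simp add: cubical_def polytope_translation_eq polytope_linear_image)
  show "aff_dim ((\<lambda>x. a + f x) ` P) = DIM('a)" using assms by (simp add: aff_dim_affine_image cubical_def)
  fix G assume G: "G face_of (\<lambda>x. a + f x) ` P" "G \<noteq> (\<lambda>x. a + f x) ` P" "G \<noteq> {}"
  then obtain F where F: "F face_of P" "G = (\<lambda>x. a + f x) ` F" using faces_affine_image[OF assms(1,2)] by blast
  then have "F \<noteq> P" "F \<noteq> {}" using G by auto
  then obtain r where "r < DIM('a)" "cube_like r F" using assms(3) F by (auto simp: cubical_def)
  then show "\<exists>r<DIM('a). cube_like r G" using F cube_like_affine_image[OF assms(1,2)] by blast
qed

section \<open>Two polytopes on either side of a common facet\<close>

lemma crossing_point:
  assumes "x \<bullet> e < \<tau>" "\<tau> < y \<bullet> e"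
  obtains z where "z \<in> open_segment x y" "z \<bullet> e = \<tau>"
proof -
  define l where "l = (\<tau> - x \<bullet> e) / (y \<bullet> e - x \<bullet> e)"
  have l: "0 < l" "l < 1" using assms by (auto simp: l_def)
  define z where "z = (1 - l) *\<^sub>R x + l *\<^sub>R y"
  have "x \<noteq> y" using assms by auto
  then have "z \<in> open_segment x y" using l by (auto simp: in_segment z_def)
  moreover have "z \<bullet> e = x \<bullet> e + l * (y \<bullet> e - x \<bullet> e)" by (simp add: z_def inner_add_left algebra_simps)
  then have "z \<bullet> e = \<tau>" using assms by (simp add: l_def)
  ultimately show ?thesis by (rule that)
qed

text \<open>A face that meets the relative interior of a facet contains it, and the dimensions leave
  nothing strictly between the facet and \<open>P\<close>.\<close>

lemma face_meets_facet:
  fixes P :: "'a::euclidean_space set"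
  assumes "convex P" "F face_of P" "aff_dim F = aff_dim P - 1" "G face_of P" "G \<noteq> P" "G \<inter> rel_interior F \<noteq> {}"
  shows "G = F"
proof (rule ccontr)
  assume "G \<noteq> F"
  have "F \<subseteq> G" using assms face_of_imp_subset subset_of_face_of by blast
  then have "F face_of G" using assms(2,4) by (meson face_of_imp_subset face_of_subset)
  then have "aff_dim F < aff_dim G" using \<open>G \<noteq> F\<close> face_of_imp_convex[OF assms(4)] by (intro face_of_aff_dim_lt) auto
  moreover have "aff_dim G < aff_dim P" using assms by (intro face_of_aff_dim_lt)
  ultimately show False using assms(3) by linarith
qed

text \<open>\<open>P\<close> below and \<open>T\<close> above the hyperplane share the facet \<open>F\<close>; every segment from one to the other
  crosses the hyperplane in the relative interior of \<open>F\<close>.\<close>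

locale stacked =
  fixes P T F :: "'a::euclidean_space set" and e :: 'a and \<tau> :: real
  assumes polytopes: "polytope P" "polytope T"
    and sides: "\<And>x. x \<in> P \<Longrightarrow> x \<bullet> e \<le> \<tau>" "\<And>x. x \<in> T \<Longrightarrow> \<tau> \<le> x \<bullet> e"
    and common: "P \<inter> {x. x \<bullet> e = \<tau>} = F" "T \<inter> {x. x \<bullet> e = \<tau>} = F"
    and dims: "aff_dim P = DIM('a)" "aff_dim T = DIM('a)" "aff_dim F = DIM('a) - 1"
    and crossing: "\<And>x y z. x \<in> P - F \<Longrightarrow> y \<in> T - F \<Longrightarrow> z \<in> open_segment x y \<Longrightarrow> z \<bullet> e = \<tau> \<Longrightarrow> z \<in> rel_interior F"
begin

lemma F_sub: "F \<subseteq> P" "F \<subseteq> T" using common by auto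

lemma flip: "stacked T P F (- e) (- \<tau>)"
proof
  show "z \<in> rel_interior F" if "x \<in> T - F" "y \<in> P - F" "z \<in> open_segment x y" "z \<bullet> - e = - \<tau>" for x y z
    using crossing[of y x z] that by (simp add: open_segment_commute)
qed (use polytopes sides common dims in auto)

lemma inter: "P \<inter> T = F" using sides common by (auto intro: antisym)

lemma facet: "F face_of P" "F \<noteq> P"
proof -
  have "P \<inter> {x. e \<bullet> x = \<tau>} face_of P"
    using sides(1) polytope_imp_convex[OF polytopes(1)]
    by (intro face_of_Int_supporting_hyperplane_le) (auto simp: inner_commute)
  then show "F face_of P" using common(1) by (simp add: inner_commute)
  show "F \<noteq> P" using dims by auto
qed

lemma strict_sides: "x \<in> P - F \<Longrightarrow> x \<bullet> e < \<tau>" "x \<in> T - F \<Longrightarrow> \<tau> < x \<bullet> e"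
  using sides common by (auto simp: order_less_le)

lemma cross_obtain:
  assumes "x \<in> P - F" "y \<in> T - F"
  obtains z where "z \<in> open_segment x y" "z \<in> rel_interior F"
  using crossing_point[OF strict_sides(1)[OF assms(1)] strict_sides(2)[OF assms(2)]] crossing[OF assms] by blast

text \<open>The crossing point lies in the common facet and splits the segment into a part in
  \<open>P\<close> and a part in \<open>T\<close>.\<close>

lemma segment_sub:
  assumes "x \<in> P" "y \<in> T"
  shows "closed_segment x y \<subseteq> P \<union> T"
proof -
  have cv: "convex P" "convex T" using polytopes polytope_imp_convex by auto
  consider "x \<in> F" | "y \<in> F" | "x \<in> P - F" "y \<in> T - F" using assms by blast
  then show ?thesis
  proof cases
    case 1
    then show ?thesis using assms F_sub cv convex_contains_segment by blast
  next
    case 2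
    then show ?thesis using assms F_sub cv convex_contains_segment by blast
  next
    case 3
    then obtain z where z: "z \<in> open_segment x y" "z \<in> rel_interior F" using cross_obtain by blast
    then have "z \<in> F" "z \<in> closed_segment x y" using rel_interior_subset by (auto simp: open_segment_def)
    then have "closed_segment x y = closed_segment x z \<union> closed_segment z y" by (simp add: Un_closed_segment)
    moreover have "closed_segment x z \<subseteq> P" "closed_segment z y \<subseteq> T"
      using \<open>z \<in> F\<close> F_sub assms cv by (blast intro: closed_segment_subset[THEN subsetD])+
    ultimately show ?thesis by blast
  qed
qed

lemma convex_union: "convex (P \<union> T)"
  unfolding convex_contains_segment
proof (intro ballI)
  fix x y assume xy: "x \<in> P \<union> T" "y \<in> P \<union> T"
  have cv: "convex P" "convex T" using polytopes polytope_imp_convex by auto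
  consider "x \<in> P" "y \<in> P" | "x \<in> T" "y \<in> T" | "x \<in> P" "y \<in> T" | "y \<in> P" "x \<in> T" using xy by blast
  then show "closed_segment x y \<subseteq> P \<union> T"
  proof cases
    case 1
    then show ?thesis using cv(1) unfolding convex_contains_segment by blast
  next
    case 2
    then show ?thesis using cv(2) unfolding convex_contains_segment by blast
  next
    case 3
    then show ?thesis by (rule segment_sub)
  next
    case 4
    then show ?thesis using segment_sub[of y x] by (simp add: closed_segment_commute)
  qed
qed

lemma polytope_union: "polytope (P \<union> T)"
proof -
  obtain V W where V: "finite V" "P = convex hull V" and W: "finite W" "T = convex hull W"
    using polytopes by (auto simp: polytope_def)
  have "convex hull (V \<union> W) \<subseteq> P \<union> T"
    using V W by (intro hull_minimal convex_union) (auto intro: hull_inc)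
  moreover have "P \<subseteq> convex hull (V \<union> W)" "T \<subseteq> convex hull (V \<union> W)" using V W by (auto intro: hull_mono[THEN subsetD])
  ultimately have "P \<union> T = convex hull (V \<union> W)" by blast
  then show ?thesis using V W by (auto simp: polytope_def)
qed

text \<open>If a point \<open>z\<close> of \<open>G\<close> lies between \<open>x\<close> in
  \<open>P - F\<close> and \<open>y\<close> in \<open>T - F\<close>, the segment leaves
  \<open>P\<close> at a relative interior point \<open>q\<close> of \<open>F\<close>, and
  \<open>z\<close> lies before \<open>q\<close>. Then \<open>q\<close> belongs to \<open>G\<close>,
  which forces \<open>G = F\<close> by \<open>face_meets_facet\<close>.\<close>

lemma face_lift:
  assumes G: "G face_of P" "G \<noteq> P" "G \<noteq> F"
  shows "G face_of (P \<union> T)"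
proof -
  have cv: "convex P" using polytopes polytope_imp_convex by auto
  have no: "q \<notin> G" if "q \<in> rel_interior F" for q
    using face_meets_facet[OF cv facet(1) _ G(1,2)] dims G(3) that by auto
  have sub: "G \<subseteq> P" using G face_of_imp_subset by blast
  have mixed: False if mx: "x \<in> P - F" "y \<in> T - F" "z \<in> open_segment x y" "z \<in> G" for x y z
  proof -
    obtain q where q: "q \<in> open_segment x y" "q \<in> rel_interior F" using cross_obtain[OF mx(1,2)] by blast
    have qF: "q \<in> F" using q rel_interior_subset by blast
    then have qe: "q \<bullet> e = \<tau>" "q \<in> P" using common by auto
    have zq: "z \<noteq> q" using no[OF q(2)] mx(4) by blast
    have xe: "x \<bullet> e < \<tau>" "\<tau> < y \<bullet> e" using strict_sides mx by auto
    obtain m where m: "0 < m" "m < 1" "q = (1 - m) *\<^sub>R x + m *\<^sub>R y" using q by (auto simp: in_segment)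
    obtain l where l: "0 < l" "l < 1" "z = (1 - l) *\<^sub>R x + l *\<^sub>R y" using mx(3) by (auto simp: in_segment)
    have "z \<bullet> e \<le> q \<bullet> e" using sides(1) sub mx(4) qe by auto
    then have "l * (y \<bullet> e - x \<bullet> e) \<le> m * (y \<bullet> e - x \<bullet> e)" by (simp add: l(3) m(3) inner_add_left algebra_simps)
    then have "l \<le> m" using xe by (simp add: mult_le_cancel_right)
    then have "l < m" using zq l(3) m(3) by (metis order_less_le)
    define k where "k = l / m"
    have k: "0 < k" "k < 1" "k * m = l" using l m \<open>l < m\<close> by (auto simp: k_def)
    have "(1 - k) *\<^sub>R x + k *\<^sub>R q = (1 - k + k * (1 - m)) *\<^sub>R x + (k * m) *\<^sub>R y"
      by (simp add: m(3) scaleR_add_right scaleR_add_left)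
    also have "1 - k + k * (1 - m) = 1 - k * m" by (simp add: algebra_simps)
    finally have "z = (1 - k) *\<^sub>R x + k *\<^sub>R q" using k l(3) by simp
    moreover have "x \<noteq> q" using xe qe by auto
    ultimately have "z \<in> open_segment x q" using k by (auto simp: in_segment)
    then have "q \<in> G" using G(1) mx(1,4) qe(2) unfolding face_of_def by blast
    then show False using no[OF q(2)] by blast
  qed
  show ?thesis unfolding face_of_def
  proof (intro conjI ballI impI)
    show "G \<subseteq> P \<union> T" using sub by blast
    show "convex G" using G face_of_imp_convex by blast
    fix x y z assume xyz: "x \<in> P \<union> T" "y \<in> P \<union> T" "z \<in> G" "z \<in> open_segment x y"
    have "x \<in> P \<and> y \<in> P"
    proof (rule ccontr)
      assume not: "\<not> (x \<in> P \<and> y \<in> P)"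
      consider "x \<in> T - F" "y \<in> T" | "x \<in> T" "y \<in> T - F" | "x \<in> P - F" "y \<in> T - F" | "y \<in> P - F" "x \<in> T - F"
        using not xyz(1,2) F_sub inter by blast
      then show False
      proof cases
        case 3
        then show ?thesis using mixed xyz by blast
      next
        case 4
        then show ?thesis using mixed[of y x z] xyz by (simp add: open_segment_commute)
      next
        case 1
        obtain l where l: "0 < l" "l < 1" "z = (1 - l) *\<^sub>R x + l *\<^sub>R y" using xyz by (auto simp: in_segment)
        have "(1 - l) * \<tau> < (1 - l) * (x \<bullet> e)" "l * \<tau> \<le> l * (y \<bullet> e)" using l strict_sides 1 sides by auto
        then have "\<tau> < z \<bullet> e" by (simp add: l(3) inner_add_left algebra_simps)
        then show ?thesis using sides(1)[of z] sub xyz by auto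
      next
        case 2
        obtain l where l: "0 < l" "l < 1" "z = (1 - l) *\<^sub>R x + l *\<^sub>R y" using xyz by (auto simp: in_segment)
        have "(1 - l) * \<tau> \<le> (1 - l) * (x \<bullet> e)" "l * \<tau> < l * (y \<bullet> e)" using l strict_sides 2 sides by auto
        then have "\<tau> < z \<bullet> e" by (simp add: l(3) inner_add_left algebra_simps)
        then show ?thesis using sides(1)[of z] sub xyz by auto
      qed
    qed
    then show "x \<in> G" "y \<in> G" using G(1) xyz unfolding face_of_def by blast+
  qed
qed

text \<open>A face with points strictly on both sides contains a relative interior point of
  \<open>F\<close>, hence \<open>F\<close>; every other point is joined through \<open>F\<close> to
  a point on the opposite side and is absorbed as well.\<close>

lemma face_cases:
  assumes G: "G face_of (P \<union> T)" "G \<noteq> P \<union> T"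
  shows "G \<subseteq> P \<or> G \<subseteq> T"
proof (rule ccontr)
  assume "\<not> (G \<subseteq> P \<or> G \<subseteq> T)"
  moreover have sub: "G \<subseteq> P \<union> T" using G face_of_imp_subset by blast
  ultimately obtain x y where xy: "x \<in> G" "x \<in> P - F" "y \<in> G" "y \<in> T - F" using inter by blast
  obtain z where z: "z \<in> open_segment x y" "z \<in> rel_interior F" using cross_obtain xy by blast
  have "z \<in> G" using xy z face_of_imp_convex[OF G(1)]
    by (metis convex_contains_open_segment subsetD)
  then have FG: "F \<subseteq> G" using subset_of_face_of[OF G(1), of F] z F_sub by blast
  have push: "w \<in> G" if "w \<in> P \<union> T" "v \<in> P \<union> T" "q \<in> open_segment w v" "q \<in> rel_interior F" for w v q
    using G(1) that FG rel_interior_subset unfolding face_of_def by blast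
  have "P \<subseteq> G"
  proof
    fix w assume "w \<in> P"
    show "w \<in> G"
    proof (cases "w \<in> F")
      case False
      then obtain q where "q \<in> open_segment w y" "q \<in> rel_interior F" using cross_obtain[of w y] xy \<open>w \<in> P\<close> by blast
      then show ?thesis using push[of w y q] \<open>w \<in> P\<close> xy by blast
    qed (use FG in blast)
  qed
  moreover have "T \<subseteq> G"
  proof
    fix w assume "w \<in> T"
    show "w \<in> G"
    proof (cases "w \<in> F")
      case False
      then obtain q where "q \<in> open_segment x w" "q \<in> rel_interior F" using cross_obtain[of x w] xy \<open>w \<in> T\<close> by blast
      then show ?thesis using push[of w x q] \<open>w \<in> T\<close> xy by (auto simp: open_segment_commute)
    qed (use FG in blast)
  qed
  ultimately show False using sub G(2) by blast
qed

lemma F_not_face: "\<not> F face_of (P \<union> T)"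
proof
  assume F: "F face_of (P \<union> T)"
  have "T \<noteq> F" using dims by auto
  then obtain x y where xy: "x \<in> P - F" "y \<in> T - F" using F_sub facet(2) by blast
  obtain z where "z \<in> open_segment x y" "z \<in> rel_interior F" using cross_obtain xy by blast
  then have "x \<in> F" using F xy rel_interior_subset unfolding face_of_def by blast
  then show False using xy by blast
qed

lemma faces_union:
  "{G. G face_of (P \<union> T) \<and> G \<noteq> P \<union> T} = ({G. G face_of P} - {P, F}) \<union> ({G. G face_of T} - {T, F})" (is "?L = ?R")
proof
  interpret flip: stacked T P F "- e" "- \<tau>" by (rule flip)
  have aux: "\<not> T \<subseteq> P" "\<not> P \<subseteq> T" using inter facet(2) flip.facet(2) by blast+
  show "?L \<subseteq> ?R"
  proof
    fix G assume "G \<in> ?L"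
    then have G: "G face_of (P \<union> T)" "G \<noteq> P \<union> T" by auto
    have "G \<noteq> F" using F_not_face G by blast
    have nP: "\<not> P \<subseteq> G" if "G \<subseteq> P"
    proof
      assume "P \<subseteq> G"
      then have "G = P" using that by simp
      have "F \<subseteq> G" using F_sub \<open>G = P\<close> by simp
      obtain y where y: "y \<in> T - F" using flip.facet(2) F_sub by blast
      obtain x where x: "x \<in> P - F" using facet(2) F_sub by blast
      obtain z where "z \<in> open_segment x y" "z \<in> rel_interior F" using cross_obtain x y by blast
      then have "y \<in> G" using G(1) x y \<open>F \<subseteq> G\<close> rel_interior_subset unfolding face_of_def by blast
      then show False using y \<open>G = P\<close> inter by blast
    qed
    have nT: "\<not> T \<subseteq> G" if "G \<subseteq> T"
    proof
      assume "T \<subseteq> G"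
      then have "G = T" using that by simp
      have "F \<subseteq> G" using F_sub \<open>G = T\<close> by simp
      obtain y where y: "y \<in> T - F" using flip.facet(2) F_sub by blast
      obtain x where x: "x \<in> P - F" using facet(2) F_sub by blast
      obtain z where "z \<in> open_segment x y" "z \<in> rel_interior F" using cross_obtain x y by blast
      then have "x \<in> G" using G(1) x y \<open>F \<subseteq> G\<close> rel_interior_subset unfolding face_of_def by blast
      then show False using x \<open>G = T\<close> inter by blast
    qed
    from face_cases[OF G] show "G \<in> ?R"
    proof
      assume "G \<subseteq> P"
      then have "G face_of P" using face_of_subset[OF G(1)] by blast
      then show ?thesis using nP[OF \<open>G \<subseteq> P\<close>] \<open>G \<noteq> F\<close> by blast
    next
      assume "G \<subseteq> T"
      then have "G face_of T" using face_of_subset[OF G(1)] by blast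
      then show ?thesis using nT[OF \<open>G \<subseteq> T\<close>] \<open>G \<noteq> F\<close> by blast
    qed
  qed
  show "?R \<subseteq> ?L"
  proof
    fix G assume "G \<in> ?R"
    then consider "G face_of P" "G \<noteq> P" "G \<noteq> F" | "G face_of T" "G \<noteq> T" "G \<noteq> F" by blast
    then show "G \<in> ?L"
    proof cases
      case 1
      then show ?thesis using face_lift face_of_imp_subset aux by blast
    next
      case 2
      then show ?thesis using flip.face_lift[of G] face_of_imp_subset aux by (auto simp: Un_commute)
    qed
  qed
qed

lemma aff_dim_union: "aff_dim (P \<union> T) = DIM('a)"
  using aff_dim_subset[of P "P \<union> T"] aff_dim_le_DIM[of "P \<union> T"] dims by simp

text \<open>Proper faces of \<open>F\<close> are faces of both parts and are counted twice;
  \<open>F\<close> itself is a facet of both parts but not a face of the union, which accounts for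
  the 2.\<close>

lemma face_number_union:
  assumes "i < DIM('a)"
  shows "face_number (P \<union> T) i + (card {G. G face_of F \<and> G \<noteq> F \<and> aff_dim G = int i} + (if Suc i = DIM('a) then 2 else 0))
     = face_number P i + face_number T i"
proof -
  interpret flip: stacked T P F "- e" "- \<tau>" by (rule flip)
  define A where "A = {G. G face_of P \<and> aff_dim G = int i} - {F}"
  define B where "B = {G. G face_of T \<and> aff_dim G = int i} - {F}"
  have fin: "finite {G. G face_of P \<and> aff_dim G = int i}" "finite {G. G face_of T \<and> aff_dim G = int i}"
    by (rule finite_subset[OF _ finite_polytope_faces[OF polytopes(1)]], blast)
       (rule finite_subset[OF _ finite_polytope_faces[OF polytopes(2)]], blast)
  have U: "{G. G face_of (P \<union> T) \<and> aff_dim G = int i} = A \<union> B"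
  proof -
    have "{G. G face_of (P \<union> T) \<and> aff_dim G = int i} = {G. G face_of (P \<union> T) \<and> G \<noteq> P \<union> T} \<inter> {G. aff_dim G = int i}"
      using assms aff_dim_union by auto
    also have "\<dots> = A \<union> B" unfolding faces_union A_def B_def using assms dims by auto
    finally show ?thesis .
  qed
  have I: "A \<inter> B = {G. G face_of F \<and> G \<noteq> F \<and> aff_dim G = int i}"
  proof
    show "A \<inter> B \<subseteq> {G. G face_of F \<and> G \<noteq> F \<and> aff_dim G = int i}"
    proof
      fix G assume "G \<in> A \<inter> B"
      then have G: "G face_of P" "G face_of T" "G \<noteq> F" "aff_dim G = int i" by (auto simp: A_def B_def)
      then have "G \<subseteq> F" using inter face_of_imp_subset by blast
      then show "G \<in> {G. G face_of F \<and> G \<noteq> F \<and> aff_dim G = int i}" using face_of_subset[OF G(1)] F_sub G by blast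
    qed
    show "{G. G face_of F \<and> G \<noteq> F \<and> aff_dim G = int i} \<subseteq> A \<inter> B"
      using face_of_trans[OF _ facet(1)] face_of_trans[OF _ flip.facet(1)] by (auto simp: A_def B_def)
  qed
  have cA: "card A + (if Suc i = DIM('a) then 1 else 0) = face_number P i"
  proof -
    have "F \<in> {G. G face_of P \<and> aff_dim G = int i} \<longleftrightarrow> Suc i = DIM('a)" using facet dims by auto
    then show ?thesis using fin(1) card_Suc_Diff1[OF fin(1), of F] by (auto simp: A_def face_number_def)
  qed
  have cB: "card B + (if Suc i = DIM('a) then 1 else 0) = face_number T i"
  proof -
    have "F \<in> {G. G face_of T \<and> aff_dim G = int i} \<longleftrightarrow> Suc i = DIM('a)" using flip.facet dims by auto
    then show ?thesis using fin(2) card_Suc_Diff1[OF fin(2), of F] by (auto simp: B_def face_number_def)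
  qed
  have "card (A \<union> B) + card (A \<inter> B) = card A + card B"
    using card_Un_Int[of A B] fin by (simp add: A_def B_def)
  then show ?thesis using cA cB U I by (simp add: face_number_def split: if_splits)
qed

lemma cubical_union:
  assumes "cubical P" "cubical T"
  shows "cubical (P \<union> T)"
  unfolding cubical_def
proof (intro conjI allI impI)
  show "polytope (P \<union> T)" by (rule polytope_union)
  show "aff_dim (P \<union> T) = DIM('a)" by (rule aff_dim_union)
  fix G assume G: "G face_of (P \<union> T)" "G \<noteq> P \<union> T" "G \<noteq> {}"
  then have "G \<in> {G. G face_of (P \<union> T) \<and> G \<noteq> P \<union> T}" by simp
  then consider "G face_of P" "G \<noteq> P" | "G face_of T" "G \<noteq> T" unfolding faces_union by blast
  then show "\<exists>r<DIM('a). cube_like r G"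
  proof cases
    case 1
    then show ?thesis using assms(1) G(3) unfolding cubical_def by metis
  next
    case 2
    then show ?thesis using assms(2) G(3) unfolding cubical_def by metis
  qed
qed

end

section \<open>Gluing along boxes\<close>

definition flat_box :: "'a::euclidean_space \<Rightarrow> real \<Rightarrow> ('a \<Rightarrow> real) \<Rightarrow> 'a set" where
  "flat_box e \<tau> \<beta> = {x. x \<bullet> e = \<tau> \<and> (\<forall>b\<in>Basis - {e}. \<bar>x \<bullet> b\<bar> \<le> \<beta> b)}"

definition box_topped :: "'a::euclidean_space \<Rightarrow> 'a set \<Rightarrow> real \<Rightarrow> ('a \<Rightarrow> real) \<Rightarrow> bool" where
  "box_topped e P \<tau> \<beta> \<longleftrightarrow> (\<forall>b\<in>Basis - {e}. 0 < \<beta> b) \<and> (\<forall>x\<in>P. x \<bullet> e \<le> \<tau>) \<and>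
     P \<inter> {x. x \<bullet> e = \<tau>} = flat_box e \<tau> \<beta>"

text \<open>The strict inequality above the base lets such a polytope, after compression along
  \<open>e\<close>, be put on top of any \<open>box_topped\<close> polytope without losing
  convexity.\<close>

definition box_cap :: "'a::euclidean_space \<Rightarrow> 'a set \<Rightarrow> real \<Rightarrow> ('a \<Rightarrow> real) \<Rightarrow> bool" where
  "box_cap e T \<sigma> \<beta> \<longleftrightarrow> (\<forall>b\<in>Basis - {e}. 0 < \<beta> b) \<and> (\<forall>x\<in>T. \<sigma> \<le> x \<bullet> e) \<and>
     T \<inter> {x. x \<bullet> e = \<sigma>} = flat_box e \<sigma> \<beta> \<and>
     (\<forall>x\<in>T. \<sigma> < x \<bullet> e \<longrightarrow> (\<forall>b\<in>Basis - {e}. \<bar>x \<bullet> b\<bar> < \<beta> b))"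

lemma flat_box_rel_interior:
  assumes "z \<bullet> e = \<tau>" "\<And>b. b \<in> Basis - {e} \<Longrightarrow> \<bar>z \<bullet> b\<bar> < \<beta> b"
  shows "z \<in> rel_interior (flat_box e \<tau> \<beta>)"
proof -
  define U where "U = (\<Inter>b\<in>Basis - {e}. {x. \<bar>x \<bullet> b\<bar> < \<beta> b})"
  have "open U" unfolding U_def by (intro open_INT finite_Diff finite_Basis ballI open_Collect_less continuous_intros)
  moreover have "affine hull flat_box e \<tau> \<beta> \<subseteq> {x. e \<bullet> x = \<tau>}"
    by (rule hull_minimal) (simp_all add: affine_hyperplane, auto simp: flat_box_def inner_commute)
  then have "U \<inter> affine hull flat_box e \<tau> \<beta> \<subseteq> flat_box e \<tau> \<beta>"
    by (force simp: U_def flat_box_def inner_commute)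
  moreover have "z \<in> U" using assms(2) by (auto simp: U_def)
  moreover have "z \<in> flat_box e \<tau> \<beta>" using assms by (force simp: flat_box_def)
  ultimately show ?thesis unfolding mem_rel_interior by blast
qed

lemma aff_dim_flat_box:
  fixes e :: "'a::euclidean_space"
  assumes "e \<in> Basis" "\<And>b. b \<in> Basis - {e} \<Longrightarrow> 0 < \<beta> b"
  shows "aff_dim (flat_box e \<tau> \<beta>) = DIM('a) - 1"
proof -
  define U where "U = (\<Inter>b\<in>Basis - {e}. {x. \<bar>x \<bullet> b\<bar> < \<beta> b})"
  define H where "H = {x. e \<bullet> x = \<tau>}"
  have "e \<noteq> 0" using assms(1) by auto
  then have dH: "aff_dim H = DIM('a) - 1" by (simp add: H_def aff_dim_hyperplane)
  have aH: "affine hull H = H" by (simp add: H_def affine_hull_eq affine_hyperplane)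
  have "open U" unfolding U_def by (intro open_INT finite_Diff finite_Basis ballI open_Collect_less continuous_intros)
  then have "openin (top_of_set (affine hull H)) (H \<inter> U)" unfolding aH by (rule openin_open_Int)
  moreover have "\<tau> *\<^sub>R e \<in> H \<inter> U" using assms by (auto simp: H_def U_def inner_Basis)
  ultimately have "affine hull (H \<inter> U) = affine hull H" by (intro affine_hull_openin) auto
  then have "aff_dim (H \<inter> U) = aff_dim H" by (metis aff_dim_affine_hull)
  moreover have "H \<inter> U \<subseteq> flat_box e \<tau> \<beta>" "flat_box e \<tau> \<beta> \<subseteq> H"
    by (force simp: H_def U_def flat_box_def inner_commute)+
  ultimately show ?thesis using aff_dim_subset dH by (metis antisym)
qed

definition diag_map :: "('a \<Rightarrow> real) \<Rightarrow> 'a \<Rightarrow> 'a::euclidean_space" where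
  "diag_map \<sigma> x = (\<Sum>b\<in>Basis. (\<sigma> b * (x \<bullet> b)) *\<^sub>R b)"

lemma diag_map_inner: "b \<in> Basis \<Longrightarrow> diag_map \<sigma> x \<bullet> b = \<sigma> b * (x \<bullet> b)"
  unfolding diag_map_def by (simp add: inner_sum_left inner_Basis if_distrib cong: if_cong)

lemma linear_diag_map: "linear (diag_map \<sigma>)"
  by (rule linearI)
    (simp_all add: diag_map_def distrib_left scaleR_add_left sum.distrib scaleR_sum_right mult.left_commute inner_add_left)

lemma inj_diag_map:
  assumes "\<And>b. b \<in> Basis \<Longrightarrow> \<sigma> b \<noteq> 0"
  shows "inj (diag_map \<sigma>)"
proof (rule injI, rule euclidean_eqI)
  fix x z b assume "diag_map \<sigma> x = diag_map \<sigma> z" "b \<in> (Basis::'a set)"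
  then show "x \<bullet> b = z \<bullet> b" using assms[of b] diag_map_inner[of b \<sigma>] by (metis mult_left_cancel)
qed

lemma flat_box_affine_image:
  fixes e :: "'a::euclidean_space"
  assumes e: "e \<in> Basis" and pos: "\<And>b. b \<in> Basis \<Longrightarrow> 0 < \<sigma> b"
  shows "(\<lambda>x. a *\<^sub>R e + diag_map \<sigma> x) ` flat_box e \<tau> \<beta> = flat_box e (a + \<sigma> e * \<tau>) (\<lambda>b. \<sigma> b * \<beta> b)" (is "?g ` _ = _")
proof
  have ge: "?g x \<bullet> e = a + \<sigma> e * (x \<bullet> e)" for x using e by (simp add: inner_add_left diag_map_inner)
  have gb: "?g x \<bullet> b = \<sigma> b * (x \<bullet> b)" if "b \<in> Basis - {e}" for x b
    using e that by (auto simp: inner_add_left diag_map_inner inner_Basis)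
  show "?g ` flat_box e \<tau> \<beta> \<subseteq> flat_box e (a + \<sigma> e * \<tau>) (\<lambda>b. \<sigma> b * \<beta> b)"
  proof
    fix z assume "z \<in> ?g ` flat_box e \<tau> \<beta>"
    then obtain x where x: "x \<in> flat_box e \<tau> \<beta>" "z = ?g x" by blast
    have "\<bar>z \<bullet> b\<bar> \<le> \<sigma> b * \<beta> b" if b: "b \<in> Basis - {e}" for b
    proof -
      have "\<bar>x \<bullet> b\<bar> \<le> \<beta> b" "0 < \<sigma> b" using x(1) b pos by (auto simp: flat_box_def)
      then show ?thesis unfolding x(2) gb[OF b] by (simp add: abs_mult)
    qed
    then show "z \<in> flat_box e (a + \<sigma> e * \<tau>) (\<lambda>b. \<sigma> b * \<beta> b)"
      using x ge by (simp add: flat_box_def)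
  qed
  show "flat_box e (a + \<sigma> e * \<tau>) (\<lambda>b. \<sigma> b * \<beta> b) \<subseteq> ?g ` flat_box e \<tau> \<beta>"
  proof
    fix z assume z: "z \<in> flat_box e (a + \<sigma> e * \<tau>) (\<lambda>b. \<sigma> b * \<beta> b)"
    define x where "x = diag_map (\<lambda>b. 1 / \<sigma> b) (z - a *\<^sub>R e)"
    have xb: "x \<bullet> b = (z \<bullet> b - a * (e \<bullet> b)) / \<sigma> b" if "b \<in> Basis" for b
      using that by (simp add: x_def diag_map_inner inner_diff_left)
    have "?g x = z"
    proof (rule euclidean_eqI)
      fix b :: 'a assume "b \<in> Basis"
      then show "?g x \<bullet> b = z \<bullet> b" using pos[of b] by (simp add: inner_add_left diag_map_inner xb)
    qed
    moreover have "x \<in> flat_box e \<tau> \<beta>"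
      unfolding flat_box_def
    proof (intro CollectI conjI ballI)
      show "x \<bullet> e = \<tau>" using z e pos[OF e] by (simp add: xb flat_box_def)
      fix b assume b: "b \<in> Basis - {e}"
      then have "x \<bullet> b = (z \<bullet> b) / \<sigma> b" using e by (auto simp: xb inner_Basis)
      moreover have "\<bar>z \<bullet> b\<bar> \<le> \<sigma> b * \<beta> b" using z b by (auto simp: flat_box_def)
      ultimately show "\<bar>x \<bullet> b\<bar> \<le> \<beta> b"
        using pos[of b] b by (simp add: abs_divide pos_divide_le_eq mult.commute)
    qed
    ultimately show "z \<in> ?g ` flat_box e \<tau> \<beta>" by blast
  qed
qed

text \<open>The faces lost in one gluing, measured on a unit box. By \<open>box_loss_eq\<close> the
  loss is the same for all boxes, which makes it negligible for large polytopes.\<close>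

definition box_loss :: "'a::euclidean_space \<Rightarrow> nat \<Rightarrow> nat" where
  "box_loss e i = card {G. G face_of flat_box e 0 (\<lambda>_. 1) \<and> G \<noteq> flat_box e 0 (\<lambda>_. 1) \<and> aff_dim G = int i}
     + (if Suc i = DIM('a) then 2 else 0)"

lemma box_loss_eq:
  fixes e :: "'a::euclidean_space"
  assumes e: "e \<in> Basis" and pos: "\<And>b. b \<in> Basis - {e} \<Longrightarrow> 0 < \<beta> b"
  shows "card {G. G face_of flat_box e \<tau> \<beta> \<and> G \<noteq> flat_box e \<tau> \<beta> \<and> aff_dim G = int i}
     + (if Suc i = DIM('a) then 2 else 0) = box_loss e i"
proof -
  define \<sigma> where "\<sigma> b = (if b = e then 1 else \<beta> b)" for b
  have s: "0 < \<sigma> b" if "b \<in> Basis" for b using pos that by (auto simp: \<sigma>_def)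
  let ?g = "\<lambda>x. \<tau> *\<^sub>R e + diag_map \<sigma> x"
  have lin: "linear (diag_map \<sigma>)" "inj (diag_map \<sigma>)" using s linear_diag_map inj_diag_map[of \<sigma>] by (auto simp: order_less_le)
  have "?g ` flat_box e 0 (\<lambda>_. 1) = flat_box e \<tau> \<sigma>" using flat_box_affine_image[OF e s] by simp
  also have "\<dots> = flat_box e \<tau> \<beta>" by (auto simp: flat_box_def \<sigma>_def)
  finally have im: "?g ` flat_box e 0 (\<lambda>_. 1) = flat_box e \<tau> \<beta>" .
  have inj: "inj ?g" by (rule inj_affine_map[OF lin(2)])
  have "{G. G face_of flat_box e \<tau> \<beta> \<and> G \<noteq> flat_box e \<tau> \<beta> \<and> aff_dim G = int i}
      = (\<lambda>F. ?g ` F) ` {G. G face_of flat_box e 0 (\<lambda>_. 1) \<and> G \<noteq> flat_box e 0 (\<lambda>_. 1) \<and> aff_dim G = int i}" (is "?L = ?R")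
  proof
    show "?L \<subseteq> ?R"
    proof
      fix G assume G: "G \<in> ?L"
      then obtain F where F: "F face_of flat_box e 0 (\<lambda>_. 1)" "G = ?g ` F"
      proof -
        have "G \<in> {G. G face_of ?g ` flat_box e 0 (\<lambda>_. 1)}" using G im by simp
        then show ?thesis unfolding faces_affine_image[OF lin] using that by blast
      qed
      moreover have "F \<noteq> flat_box e 0 (\<lambda>_. 1)" using G F im by auto
      moreover have "aff_dim F = int i" using G F aff_dim_affine_image[OF lin, of "\<tau> *\<^sub>R e" F] by auto
      ultimately show "G \<in> ?R" by blast
    qed
    show "?R \<subseteq> ?L"
    proof
      fix G assume "G \<in> ?R"
      then obtain F where F: "F face_of flat_box e 0 (\<lambda>_. 1)" "F \<noteq> flat_box e 0 (\<lambda>_. 1)" "aff_dim F = int i" "G = ?g ` F" by blast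
      have "G face_of flat_box e \<tau> \<beta>" using faces_affine_image[OF lin, of "\<tau> *\<^sub>R e" "flat_box e 0 (\<lambda>_. 1)"] im F by auto
      moreover have "G \<noteq> flat_box e \<tau> \<beta>" using F inj im by (metis inj_image_eq_iff)
      moreover have "aff_dim G = int i" using F aff_dim_affine_image[OF lin, of "\<tau> *\<^sub>R e" F] by auto
      ultimately show "G \<in> ?L" by blast
    qed
  qed
  moreover have "inj_on (\<lambda>F. ?g ` F) A" for A using inj by (auto simp: inj_on_def inj_image_eq_iff)
  ultimately show ?thesis by (simp add: box_loss_def card_image)
qed

lemma polytope_below_roof:
  fixes e :: "'a::euclidean_space"
  assumes "finite V" "P = convex hull V" "\<And>v. v \<in> V \<Longrightarrow> \<bar>v \<bullet> b\<bar> \<le> \<beta> + \<kappa> * (\<tau> - v \<bullet> e)" "x \<in> P"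
  shows "\<bar>x \<bullet> b\<bar> \<le> \<beta> + \<kappa> * (\<tau> - x \<bullet> e)"
proof -
  have eq: "{x. \<bar>x \<bullet> b\<bar> \<le> \<beta> + \<kappa> * (\<tau> - x \<bullet> e)}
     = {x. (b + \<kappa> *\<^sub>R e) \<bullet> x \<le> \<beta> + \<kappa> * \<tau>} \<inter> {x. (\<kappa> *\<^sub>R e - b) \<bullet> x \<le> \<beta> + \<kappa> * \<tau>}"
    by (auto simp: inner_add_left inner_diff_left inner_commute[of _ b] inner_commute[of _ e] algebra_simps abs_le_iff)
  have "P \<subseteq> {x. \<bar>x \<bullet> b\<bar> \<le> \<beta> + \<kappa> * (\<tau> - x \<bullet> e)}" unfolding assms(2)
  proof (rule hull_minimal)
    show "convex {x. \<bar>x \<bullet> b\<bar> \<le> \<beta> + \<kappa> * (\<tau> - x \<bullet> e)}" unfolding eq by (intro convex_Int convex_halfspace_le)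
  qed (use assms(3) in auto)
  then show ?thesis using assms(4) by blast
qed

text \<open>There are finitely many vertices: those at the top level lie in the box, and each other
  one spreads beyond the box at a finite rate per unit of depth. The bound is a convex condition, so
  it passes from the vertices to \<open>P\<close>.\<close>

lemma box_topped_slope:
  fixes e :: "'a::euclidean_space"
  assumes "polytope P" "box_topped e P \<tau> \<beta>"
  obtains \<kappa> where "\<kappa> > 0" "\<And>x b. x \<in> P \<Longrightarrow> b \<in> Basis - {e} \<Longrightarrow> \<bar>x \<bullet> b\<bar> \<le> \<beta> b + \<kappa> * (\<tau> - x \<bullet> e)"
proof -
  obtain V where V: "finite V" "P = convex hull V" using assms(1) by (auto simp: polytope_def)
  define K where "K = insert 1 ((\<lambda>(v, b). (\<bar>v \<bullet> b\<bar> - \<beta> b) / (\<tau> - v \<bullet> e)) ` (V \<times> (Basis - {e})))"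
  have fK: "finite K" using V by (simp add: K_def)
  have k1: "1 \<le> Max K" using fK by (intro Max_ge) (auto simp: K_def)
  have "\<bar>v \<bullet> b\<bar> \<le> \<beta> b + Max K * (\<tau> - v \<bullet> e)" if "v \<in> V" "b \<in> Basis - {e}" for v b
  proof -
    have vP: "v \<in> P" using V that by (simp add: hull_inc)
    show ?thesis
    proof (cases "v \<bullet> e = \<tau>")
      case True
      then have "v \<in> flat_box e \<tau> \<beta>" using vP assms(2) by (auto simp: box_topped_def)
      then show ?thesis using True that by (auto simp: flat_box_def)
    next
      case False
      then have "v \<bullet> e < \<tau>" using vP assms(2) by (auto simp: box_topped_def order_less_le)
      moreover have "(\<bar>v \<bullet> b\<bar> - \<beta> b) / (\<tau> - v \<bullet> e) \<le> Max K" using fK that by (intro Max_ge) (auto simp: K_def)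
      ultimately show ?thesis by (simp add: pos_divide_le_eq)
    qed
  qed
  then show ?thesis using that[of "Max K"] k1 polytope_below_roof[OF V] by (meson less_le_trans zero_less_one)
qed

text \<open>The finitely many vertices above the base have positive inward slopes; a positive lower
  bound for them is a slope for the whole polytope, again by convexity.\<close>

lemma cap_slope:
  fixes e :: "'a::euclidean_space"
  assumes V: "finite V" "T = convex hull V" and ge: "\<And>v. v \<in> V \<Longrightarrow> \<sigma> \<le> v \<bullet> e"
    and base: "\<And>v b. v \<in> V \<Longrightarrow> v \<bullet> e = \<sigma> \<Longrightarrow> b \<in> Basis - {e} \<Longrightarrow> \<bar>v \<bullet> b\<bar> \<le> \<beta> b"
    and strict: "\<And>v b. v \<in> V \<Longrightarrow> \<sigma> < v \<bullet> e \<Longrightarrow> b \<in> Basis - {e} \<Longrightarrow> \<bar>v \<bullet> b\<bar> < \<beta> b"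
  obtains \<mu> where "\<mu> > 0" "\<And>x b. x \<in> T \<Longrightarrow> b \<in> Basis - {e} \<Longrightarrow> \<bar>x \<bullet> b\<bar> \<le> \<beta> b - \<mu> * (x \<bullet> e - \<sigma>)"
proof -
  define K where "K = insert 1 ((\<lambda>(v, b). (\<beta> b - \<bar>v \<bullet> b\<bar>) / (v \<bullet> e - \<sigma>)) ` ((V \<inter> {v. \<sigma> < v \<bullet> e}) \<times> (Basis - {e})))"
  have fK: "finite K" using V by (simp add: K_def)
  have pos: "Min K > 0"
  proof -
    have "(\<beta> b - \<bar>v \<bullet> b\<bar>) / (v \<bullet> e - \<sigma>) > 0" if "v \<in> V" "\<sigma> < v \<bullet> e" "b \<in> Basis - {e}" for v b
      using strict[OF that] that(2) by simp
    then show ?thesis using fK by (subst Min_gr_iff) (auto simp: K_def)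
  qed
  have "\<bar>v \<bullet> b\<bar> \<le> \<beta> b + Min K * (\<sigma> - v \<bullet> e)" if "v \<in> V" "b \<in> Basis - {e}" for v b
  proof (cases "v \<bullet> e = \<sigma>")
    case True
    then show ?thesis using base that by simp
  next
    case False
    then have "\<sigma> < v \<bullet> e" using ge[OF that(1)] by simp
    moreover have "Min K \<le> (\<beta> b - \<bar>v \<bullet> b\<bar>) / (v \<bullet> e - \<sigma>)" using fK that \<open>\<sigma> < v \<bullet> e\<close> by (intro Min_le) (auto simp: K_def)
    ultimately have "Min K * (v \<bullet> e - \<sigma>) \<le> \<beta> b - \<bar>v \<bullet> b\<bar>" by (simp add: pos_le_divide_eq)
    then show ?thesis by (simp add: algebra_simps)
  qed
  then have "\<bar>x \<bullet> b\<bar> \<le> \<beta> b + Min K * (\<sigma> - x \<bullet> e)" if "x \<in> T" "b \<in> Basis - {e}" for x b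
    using polytope_below_roof[OF V, of b "\<beta> b" "Min K" \<sigma> e x] that by blast
  then have "\<bar>x \<bullet> b\<bar> \<le> \<beta> b - Min K * (x \<bullet> e - \<sigma>)" if "x \<in> T" "b \<in> Basis - {e}" for x b
    using that by (simp add: algebra_simps)
  then show ?thesis using that[of "Min K"] pos by blast
qed

lemma box_cap_slope:
  fixes e :: "'a::euclidean_space"
  assumes "polytope T" and cap: "box_cap e T \<sigma> \<beta>"
  obtains \<mu> where "\<mu> > 0" "\<And>x b. x \<in> T \<Longrightarrow> b \<in> Basis - {e} \<Longrightarrow> \<bar>x \<bullet> b\<bar> \<le> \<beta> b - \<mu> * (x \<bullet> e - \<sigma>)"
proof -
  obtain V where V: "finite V" "T = convex hull V" using assms(1) by (auto simp: polytope_def)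
  have VT: "v \<in> T" if "v \<in> V" for v using V that by (simp add: hull_inc)
  have "\<bar>v \<bullet> b\<bar> \<le> \<beta> b" if "v \<in> V" "v \<bullet> e = \<sigma>" "b \<in> Basis - {e}" for v b
  proof -
    have "v \<in> flat_box e \<sigma> \<beta>" using VT[OF that(1)] that(2) cap by (auto simp: box_cap_def)
    then show ?thesis using that(3) by (auto simp: flat_box_def)
  qed
  moreover have "\<sigma> \<le> v \<bullet> e" if "v \<in> V" for v using VT[OF that] cap by (auto simp: box_cap_def)
  moreover have "\<bar>v \<bullet> b\<bar> < \<beta> b" if "v \<in> V" "\<sigma> < v \<bullet> e" "b \<in> Basis - {e}" for v b
    using VT[OF that(1)] that(2,3) cap by (auto simp: box_cap_def)
  ultimately show ?thesis using cap_slope[OF V, of \<sigma> e \<beta>] that by blast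
qed

text \<open>Convexity across the common box requires that the cap narrows faster than
  \<open>P\<close> widens. Compression of \<open>T\<close> along \<open>e\<close> makes its inward
  slope as large as desired and does not alter its combinatorics.\<close>

lemma box_glue:
  fixes e :: "'a::euclidean_space"
  assumes e: "e \<in> Basis" and P: "cubical P" "box_topped e P \<tau> \<beta>"
    and T: "cubical T" "box_cap e T \<sigma> \<gamma>" "box_topped e T \<tau>' \<beta>'" "\<sigma> < \<tau>'"
  obtains R \<tau>'' \<beta>'' where "cubical R" "box_topped e R \<tau>'' \<beta>''"
    "\<And>i. i < DIM('a) \<Longrightarrow> face_number R i + box_loss e i = face_number P i + face_number T i"
proof -
  have poly: "polytope P" "polytope T" using P T by (auto simp: cubical_def)
  have \<beta>: "0 < \<beta> b" and \<gamma>: "0 < \<gamma> b" and \<beta>': "0 < \<beta>' b" if "b \<in> Basis - {e}" for b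
    using P(2) T(2,3) that by (auto simp: box_topped_def box_cap_def)
  obtain \<kappa> where \<kappa>: "\<kappa> > 0" "\<And>x b. x \<in> P \<Longrightarrow> b \<in> Basis - {e} \<Longrightarrow> \<bar>x \<bullet> b\<bar> \<le> \<beta> b + \<kappa> * (\<tau> - x \<bullet> e)"
    using box_topped_slope[OF poly(1) P(2)] by blast
  obtain \<mu> where \<mu>: "\<mu> > 0" "\<And>x b. x \<in> T \<Longrightarrow> b \<in> Basis - {e} \<Longrightarrow> \<bar>x \<bullet> b\<bar> \<le> \<gamma> b - \<mu> * (x \<bullet> e - \<sigma>)"
    using box_cap_slope[OF poly(2) T(2)] by blast
  \<comment> \<open>A positive lower bound for the inward slopes of \<open>T\<close> after its base
    is rescaled to the box of \<open>P\<close>; the entry 1 keeps the minimum defined in dimension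
    one.\<close>
  define m where "m = Min (insert 1 ((\<lambda>b. \<mu> * (\<beta> b / \<gamma> b)) ` (Basis - {e})))"
  have m: "m > 0" unfolding m_def using \<mu>(1) \<beta> \<gamma> by (subst Min_gr_iff) auto
  have mle: "m \<le> \<mu> * (\<beta> b / \<gamma> b)" if "b \<in> Basis - {e}" for b unfolding m_def using that by (intro Min_le) auto
  \<comment> \<open>Compression by \<open>\<eta>\<close> divides slopes by \<open>\<eta>\<close>, so
    the cap narrows at rate at least \<open>m / \<eta> = 2 * \<kappa>\<close>, twice the rate at
    which \<open>P\<close> can widen.\<close>
  define \<eta> where "\<eta> = m / (2 * \<kappa>)"
  have \<eta>: "\<eta> > 0" "m = 2 * \<kappa> * \<eta>" using m \<kappa> by (auto simp: \<eta>_def)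
  define s where "s b = (if b = e then \<eta> else \<beta> b / \<gamma> b)" for b
  have s: "0 < s b" if "b \<in> Basis" for b using \<eta> \<beta> \<gamma> that by (auto simp: s_def)
  define a where "a = \<tau> - \<eta> * \<sigma>"
  define g where "g x = a *\<^sub>R e + diag_map s x" for x
  have lin: "linear (diag_map s)" "inj (diag_map s)" using s linear_diag_map inj_diag_map[of s] by (auto simp: order_less_le)
  have ge: "g x \<bullet> e = \<tau> + \<eta> * (x \<bullet> e - \<sigma>)" for x
    using e by (simp add: g_def inner_add_left diag_map_inner s_def a_def algebra_simps)
  have gb: "g x \<bullet> b = (\<beta> b / \<gamma> b) * (x \<bullet> b)" if "b \<in> Basis - {e}" for x b
    using e that by (auto simp: g_def inner_add_left diag_map_inner inner_Basis s_def)
  have gbox: "g ` flat_box e \<rho> \<delta> = flat_box e (\<tau> + \<eta> * (\<rho> - \<sigma>)) (\<lambda>b. s b * \<delta> b)" for \<rho> \<delta>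
  proof -
    have "g ` flat_box e \<rho> \<delta> = flat_box e (a + s e * \<rho>) (\<lambda>b. s b * \<delta> b)"
      unfolding g_def[abs_def] by (rule flat_box_affine_image[OF e s])
    also have "a + s e * \<rho> = \<tau> + \<eta> * (\<rho> - \<sigma>)" by (simp add: s_def a_def algebra_simps)
    finally show ?thesis .
  qed
  have injg: "inj g" unfolding g_def by (rule inj_affine_map[OF lin(2)])
  define F where "F = flat_box e \<tau> \<beta>"
  have level: "g ` T \<inter> {x. x \<bullet> e = \<tau> + \<eta> * (\<rho> - \<sigma>)} = g ` (T \<inter> {x. x \<bullet> e = \<rho>})" for \<rho>
    using \<eta>(1) by (auto simp: ge)
  have base: "g ` T \<inter> {x. x \<bullet> e = \<tau>} = F"
  proof -
    have "g ` T \<inter> {x. x \<bullet> e = \<tau>} = g ` flat_box e \<sigma> \<gamma>"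
      using level[of \<sigma>] T(2) by (simp add: box_cap_def)
    also have "\<dots> = flat_box e \<tau> (\<lambda>b. s b * \<gamma> b)" using gbox[of \<sigma> \<gamma>] by simp
    also have "\<dots> = F"
    proof -
      have "s b * \<gamma> b = \<beta> b" if "b \<in> Basis - {e}" for b using \<gamma>[OF that] that by (auto simp: s_def)
      then show ?thesis by (auto simp: F_def flat_box_def)
    qed
    finally show ?thesis .
  qed
  have dF: "aff_dim F = DIM('a) - 1" unfolding F_def by (rule aff_dim_flat_box[OF e \<beta>])
  have cT: "cubical (g ` T)" unfolding g_def by (rule cubical_affine_image[OF lin T(1)])
  have above: "\<tau> \<le> x \<bullet> e" if "x \<in> g ` T" for x using that T(2) \<eta>(1) by (auto simp: ge box_cap_def)
  interpret stacked P "g ` T" F e \<tau>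
  proof
    show "polytope P" "polytope (g ` T)" using poly(1) cT by (auto simp: cubical_def)
    show "x \<bullet> e \<le> \<tau>" if "x \<in> P" for x using P(2) that by (auto simp: box_topped_def)
    show "\<tau> \<le> x \<bullet> e" if "x \<in> g ` T" for x by (rule above[OF that])
    show "P \<inter> {x. x \<bullet> e = \<tau>} = F" using P(2) by (simp add: box_topped_def F_def)
    show "g ` T \<inter> {x. x \<bullet> e = \<tau>} = F" by (rule base)
    show "aff_dim P = DIM('a)" "aff_dim (g ` T) = DIM('a)" using P(1) cT by (auto simp: cubical_def)
    show "aff_dim F = DIM('a) - 1" by (rule dF)
    fix x y z assume x: "x \<in> P - F" and y: "y \<in> g ` T - F" and z: "z \<in> open_segment x y" "z \<bullet> e = \<tau>"
    have xe: "x \<bullet> e < \<tau>" using x P(2) by (auto simp: box_topped_def F_def order_less_le)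
    have ye: "\<tau> < y \<bullet> e" using y above[of y] base by (auto simp: order_less_le)
    obtain y0 where y0: "y0 \<in> T" "y = g y0" using y by blast
    obtain l where l: "0 < l" "l < 1" "z = (1 - l) *\<^sub>R x + l *\<^sub>R y" using z by (auto simp: in_segment)
    \<comment> \<open>At the crossing point the weighted depth below equals the weighted height
      above, so the gain at rate \<open>\<kappa>\<close> and the loss at rate
      \<open>2 * \<kappa>\<close> compare directly and a strict deficit remains.\<close>
    have bal: "(1 - l) * (\<tau> - x \<bullet> e) = l * (y \<bullet> e - \<tau>)" using z(2) by (simp add: l(3) inner_add_left algebra_simps)
    show "z \<in> rel_interior F" unfolding F_def
    proof (rule flat_box_rel_interior[OF z(2)])
      fix b assume b: "b \<in> Basis - {e}"
      have q: "0 < \<beta> b / \<gamma> b" using \<beta>[OF b] \<gamma>[OF b] by simp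
      have "\<bar>y \<bullet> b\<bar> = (\<beta> b / \<gamma> b) * \<bar>y0 \<bullet> b\<bar>"
        using \<beta>[OF b] \<gamma>[OF b] by (simp add: y0 gb[OF b] abs_mult)
      also have "\<dots> \<le> (\<beta> b / \<gamma> b) * (\<gamma> b - \<mu> * (y0 \<bullet> e - \<sigma>))"
        using \<mu>(2)[OF y0(1) b] q by (intro mult_left_mono) auto
      also have "\<dots> = \<beta> b - \<mu> * (\<beta> b / \<gamma> b) * (y0 \<bullet> e - \<sigma>)" using \<gamma>[OF b] by (simp add: field_simps)
      also have "\<dots> \<le> \<beta> b - m * (y0 \<bullet> e - \<sigma>)"
        using mle[OF b] T(2) y0(1) by (intro diff_left_mono mult_right_mono) (auto simp: box_cap_def)
      also have "\<dots> = \<beta> b - 2 * \<kappa> * (y \<bullet> e - \<tau>)" unfolding y0(2) ge \<eta>(2) by simp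
      finally have yb: "\<bar>y \<bullet> b\<bar> \<le> \<beta> b - 2 * \<kappa> * (y \<bullet> e - \<tau>)" .
      have xb: "\<bar>x \<bullet> b\<bar> \<le> \<beta> b + \<kappa> * (\<tau> - x \<bullet> e)" using \<kappa>(2)[of x b] x b by blast
      have "\<bar>z \<bullet> b\<bar> \<le> (1 - l) * \<bar>x \<bullet> b\<bar> + l * \<bar>y \<bullet> b\<bar>"
        using l abs_triangle_ineq[of "(1 - l) * (x \<bullet> b)" "l * (y \<bullet> b)"] by (simp add: inner_add_left abs_mult)
      also have "\<dots> \<le> (1 - l) * (\<beta> b + \<kappa> * (\<tau> - x \<bullet> e)) + l * (\<beta> b - 2 * \<kappa> * (y \<bullet> e - \<tau>))"
        using xb yb l by (intro add_mono mult_left_mono) auto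
      also have "\<dots> = \<beta> b + \<kappa> * ((1 - l) * (\<tau> - x \<bullet> e)) - 2 * \<kappa> * (l * (y \<bullet> e - \<tau>))" by (simp add: algebra_simps)
      also have "\<dots> = \<beta> b - \<kappa> * (l * (y \<bullet> e - \<tau>))" unfolding bal by simp
      also have "\<dots> < \<beta> b" using \<kappa>(1) l ye by simp
      finally show "\<bar>z \<bullet> b\<bar> < \<beta> b" .
    qed
  qed
  have "box_topped e (P \<union> g ` T) (\<tau> + \<eta> * (\<tau>' - \<sigma>)) (\<lambda>b. s b * \<beta>' b)"
    unfolding box_topped_def
  proof (intro conjI ballI)
    have up: "\<tau> < \<tau> + \<eta> * (\<tau>' - \<sigma>)" using \<eta>(1) T(4) by simp
    show "0 < s b * \<beta>' b" if "b \<in> Basis - {e}" for b using s[of b] \<beta>'[OF that] that by simp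
    show "x \<bullet> e \<le> \<tau> + \<eta> * (\<tau>' - \<sigma>)" if "x \<in> P \<union> g ` T" for x
      using that
    proof
      assume "x \<in> P"
      then show ?thesis using sides(1) up by fastforce
    next
      assume "x \<in> g ` T"
      then show ?thesis using T(3) \<eta>(1) by (auto simp: ge box_topped_def)
    qed
    have "(P \<union> g ` T) \<inter> {x. x \<bullet> e = \<tau> + \<eta> * (\<tau>' - \<sigma>)} = g ` T \<inter> {x. x \<bullet> e = \<tau> + \<eta> * (\<tau>' - \<sigma>)}"
      using sides(1) up by fastforce
    also have "\<dots> = g ` flat_box e \<tau>' \<beta>'" using level[of \<tau>'] T(3) by (simp add: box_topped_def)
    finally show "(P \<union> g ` T) \<inter> {x. x \<bullet> e = \<tau> + \<eta> * (\<tau>' - \<sigma>)} = flat_box e (\<tau> + \<eta> * (\<tau>' - \<sigma>)) (\<lambda>b. s b * \<beta>' b)"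
      using gbox by simp
  qed
  moreover have "face_number (P \<union> g ` T) i + box_loss e i = face_number P i + face_number T i" if "i < DIM('a)" for i
  proof -
    have "card {G. G face_of F \<and> G \<noteq> F \<and> aff_dim G = int i} + (if Suc i = DIM('a) then 2 else 0) = box_loss e i"
      unfolding F_def by (rule box_loss_eq[OF e \<beta>])
    moreover have "face_number (g ` T) i = face_number T i"
      unfolding g_def[abs_def] by (rule face_number_affine_image[OF lin])
    ultimately show ?thesis using face_number_union[OF that] by simp
  qed
  ultimately show ?thesis using that cubical_union[OF P(1) cT] by blast
qed

section \<open>Projections of deformed cubes\<close>

context
  fixes N :: nat and a :: "nat \<Rightarrow> nat \<Rightarrow> real"
  notes sum.cong [fundef_cong]
begin

text \<open>Defined backwards from the last index so that for every choice of signs the correction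
  in \<open>dual_weight\<close> has absolute value at most \<open>dual_bound i - 1\<close>; all
  weights then lie between 1 and \<open>2 * dual_bound i\<close>.\<close>

function dual_bound :: "nat \<Rightarrow> real" where
  "dual_bound i = 1 + (\<Sum>j\<in>{i<..<N}. 2 * \<bar>a i j\<bar> * dual_bound j)"
  by simp_all
termination
proof (relation "Wellfounded.measure (\<lambda>i. N - i)", goal_cases)
  case (2 i x)
  then have "i < x" "x < N" by (simp_all only: greaterThanLessThan_iff)
  then have "N - x < N - i" by linarith
  then show ?case by (simp only: in_measure)
qed (rule wf_measure)

declare dual_bound.simps [simp del]

text \<open>The deformed cube is given by
  \<open>\<bar>x i\<bar> \<le> dual_bound i + (\<Sum>j. a i j * x j)\<close>, the sum running over
  \<open>j > i\<close>. Its vertex labelled \<open>v\<close> has the coordinates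
  \<open>x i = v i * dual_weight v i\<close>.\<close>

function dual_weight :: "(nat \<Rightarrow> real) \<Rightarrow> nat \<Rightarrow> real" where
  "dual_weight v i = dual_bound i + (\<Sum>j\<in>{i<..<N}. a i j * v j * dual_weight v j)"
  by (pat_completeness, simp)
termination
proof (relation "Wellfounded.measure (\<lambda>(v, i). N - i)", goal_cases)
  case (2 v i x)
  then have "i < x" "x < N" by (simp_all only: greaterThanLessThan_iff)
  then have "N - x < N - i" by linarith
  then show ?case by (simp only: in_measure split_conv)
qed (rule wf_measure)

declare dual_weight.simps [simp del]

end

lemma dual_weight_bounds:
  assumes v: "v \<in> sign_vertices N"
  shows "1 \<le> dual_weight N a v i \<and> dual_weight N a v i \<le> 2 * dual_bound N a i"
proof (induction "N - i" arbitrary: i rule: less_induct)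
  case less
  have "\<bar>\<Sum>j\<in>{i<..<N}. a i j * v j * dual_weight N a v j\<bar> \<le> (\<Sum>j\<in>{i<..<N}. 2 * \<bar>a i j\<bar> * dual_bound N a j)"
  proof (rule order_trans[OF sum_abs], rule sum_mono)
    fix j assume j: "j \<in> {i<..<N}"
    then have IH: "1 \<le> dual_weight N a v j \<and> dual_weight N a v j \<le> 2 * dual_bound N a j" by (intro less) auto
    have "\<bar>v j\<bar> = 1" using v j by (auto simp: sign_vertices_def)
    then have "\<bar>a i j * v j * dual_weight N a v j\<bar> = \<bar>a i j\<bar> * dual_weight N a v j" using IH by (simp add: abs_mult)
    also have "\<dots> \<le> \<bar>a i j\<bar> * (2 * dual_bound N a j)" using IH by (intro mult_left_mono) auto
    finally show "\<bar>a i j * v j * dual_weight N a v j\<bar> \<le> 2 * \<bar>a i j\<bar> * dual_bound N a j" by simp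
  qed
  then show ?case unfolding dual_weight.simps[of N a v i] using dual_bound.simps[of N a i] by linarith
qed

lemma dual_bound_cong:
  assumes "\<And>i' j. i \<le> i' \<Longrightarrow> i' < j \<Longrightarrow> a i' j = a' i' j"
  shows "dual_bound N a i = dual_bound N a' i"
  using assms
proof (induction "N - i" arbitrary: i rule: less_induct)
  case less
  have "dual_bound N a j = dual_bound N a' j" if "j \<in> {i<..<N}" for j
    using that by (intro less.hyps less.prems) auto
  then have "(\<Sum>j\<in>{i<..<N}. 2 * \<bar>a i j\<bar> * dual_bound N a j) = (\<Sum>j\<in>{i<..<N}. 2 * \<bar>a' i j\<bar> * dual_bound N a' j)"
    using less.prems by (intro sum.cong) auto
  then show ?case by (simp add: dual_bound.simps[of N _ i])
qed

lemma dual_weight_cong: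
  assumes "\<And>i' j. i \<le> i' \<Longrightarrow> i' < j \<Longrightarrow> a i' j = a' i' j" "\<And>j. i < j \<Longrightarrow> j < N \<Longrightarrow> v j = v' j"
  shows "dual_weight N a v i = dual_weight N a' v' i"
  using assms
proof (induction "N - i" arbitrary: i rule: less_induct)
  case less
  have "dual_weight N a v j = dual_weight N a' v' j" if "j \<in> {i<..<N}" for j
    using that by (intro less.hyps less.prems) auto
  then have "(\<Sum>j\<in>{i<..<N}. a i j * v j * dual_weight N a v j) = (\<Sum>j\<in>{i<..<N}. a' i j * v' j * dual_weight N a' v' j)"
    using less.prems by (intro sum.cong) auto
  moreover have "dual_bound N a i = dual_bound N a' i" using less.prems(1) by (rule dual_bound_cong)
  ultimately show ?case by (simp add: dual_weight.simps[of N _ _ i])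
qed

text \<open>The image of the vertex \<open>v\<close> of the deformed cube under the projection with
  columns \<open>p i\<close>.\<close>

definition dual_point :: "(nat \<Rightarrow> 'a::euclidean_space) \<Rightarrow> nat \<Rightarrow> (nat \<Rightarrow> nat \<Rightarrow> real) \<Rightarrow> (nat \<Rightarrow> real) \<Rightarrow> 'a" where
  "dual_point p N a v = (\<Sum>i<N. (v i * dual_weight N a v i) *\<^sub>R p i)"

definition support_function :: "(nat \<Rightarrow> 'a::euclidean_space) \<Rightarrow> nat \<Rightarrow> (nat \<Rightarrow> nat \<Rightarrow> real) \<Rightarrow> 'a \<Rightarrow> real" where
  "support_function p N a c = (\<Sum>i<N. dual_bound N a i * \<bar>plf p a i c\<bar>)"

text \<open>Linear programming duality: when \<open>p i \<bullet> c\<close> is expanded by the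
  recursion for \<open>plf\<close> and the double sum is reordered, the coefficients of
  \<open>\<bar>plf p a j c\<bar>\<close> assemble to \<open>dual_weight\<close> minus
  \<open>dual_bound\<close>.\<close>

lemma support_gap:
  "support_function p N a c - c \<bullet> dual_point p N a v
     = (\<Sum>i<N. (\<bar>plf p a i c\<bar> - v i * plf p a i c) * dual_weight N a v i)"
proof -
  let ?D = "dual_weight N a v" and ?y = "\<lambda>i. plf p a i c"
  have pc: "p i \<bullet> c = ?y i - (\<Sum>j<i. a j i * \<bar>?y j\<bar>)" for i by (simp add: plf.simps[of p a i])
  have "c \<bullet> dual_point p N a v = (\<Sum>i<N. v i * ?D i * (p i \<bullet> c))"
    by (simp add: dual_point_def inner_sum_right inner_commute)
  also have "\<dots> = (\<Sum>i<N. v i * ?D i * ?y i) - (\<Sum>i<N. \<Sum>j<i. v i * ?D i * (a j i * \<bar>?y j\<bar>))"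
    by (simp add: pc right_diff_distrib sum_subtractf sum_distrib_left)
  also have "(\<Sum>i<N. \<Sum>j<i. v i * ?D i * (a j i * \<bar>?y j\<bar>)) = (\<Sum>j<N. \<Sum>i\<in>{j<..<N}. v i * ?D i * (a j i * \<bar>?y j\<bar>))"
    unfolding sum.Sigma[OF finite_lessThan ballI[OF finite_lessThan]]
      sum.Sigma[OF finite_lessThan ballI[OF finite_greaterThanLessThan]]
    by (rule sum.reindex_bij_witness[of _ "\<lambda>(j, i). (i, j)" "\<lambda>(i, j). (j, i)"]) auto
  also have "\<dots> = (\<Sum>j<N. \<bar>?y j\<bar> * (?D j - dual_bound N a j))"
  proof (intro sum.cong refl)
    fix j
    have "?D j - dual_bound N a j = (\<Sum>i\<in>{j<..<N}. a j i * v i * ?D i)" using dual_weight.simps[of N a v j] by linarith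
    then show "(\<Sum>i\<in>{j<..<N}. v i * ?D i * (a j i * \<bar>?y j\<bar>)) = \<bar>?y j\<bar> * (?D j - dual_bound N a j)"
      by (simp add: sum_distrib_left mult_ac)
  qed
  finally show ?thesis
    by (simp add: support_function_def left_diff_distrib right_diff_distrib sum_subtractf mult_ac)
qed

text \<open>Each zero lowers the dimension of the subspace by at most one, and the cell is
  relatively open in that subspace, so it spans it. The bound is applied to \<open>a'\<close> in
  \<open>sign_polytope_plf\<close>, where only \<open>a\<close> is given as generic.\<close>

lemma dim_cell_ge:
  fixes p :: "nat \<Rightarrow> 'a::euclidean_space"
  assumes "c \<noteq> 0"
  shows "DIM('a) \<le> dim {c'. \<forall>i<N. sgn (plf p a i c') = sgn (plf p a i c)} + card {i. i < N \<and> plf p a i c = 0}"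
proof -
  define t where "t = sign_pattern p a N c"
  have tp: "t \<in> patterns p a UNIV N" using assms by (auto simp: t_def patterns_def)
  define L where "L m = lin_space p a UNIV m t" for m
  have subL: "subspace (L m)" for m unfolding L_def by (rule subspace_lin_space) simp
  have "DIM('a) \<le> dim (L m) + card {i. i < m \<and> t i = 0}" for m
  proof (induction m)
    case 0
    show ?case by (simp add: L_def lin_space_def)
  next
    case (Suc m)
    have fin: "finite {i. i < m \<and> t i = 0}" by simp
    show ?case
    proof (cases "t m = 0")
      case True
      have "{i. i < Suc m \<and> t i = 0} = insert m {i. i < m \<and> t i = 0}" using True by (auto simp: less_Suc_eq)
      then have cd: "card {i. i < Suc m \<and> t i = 0} = Suc (card {i. i < m \<and> t i = 0})" using fin by simp
      have LS: "L (Suc m) = L m \<inter> {z. linv p a t m \<bullet> z = 0}" using True by (auto simp: L_def lin_space_def less_Suc_eq)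
      have "0 \<in> L m \<inter> {z. linv p a t m \<bullet> z = 0}" using subspace_0[OF subL] by simp
      then have "aff_dim (L m \<inter> {z. linv p a t m \<bullet> z = 0}) \<ge> aff_dim (L m) - 1"
        using subspace_imp_affine[OF subL, of m] by (subst aff_dim_affine_Int_hyperplane) auto
      then have "int (dim (L (Suc m))) \<ge> int (dim (L m)) - 1" using LS aff_dim_subspace[OF subL] by metis
      then show ?thesis using Suc cd by linarith
    next
      case False
      then have "L (Suc m) = L m" "{i. i < Suc m \<and> t i = 0} = {i. i < m \<and> t i = 0}"
        by (auto simp: L_def lin_space_def less_Suc_eq)
      then show ?thesis using Suc by simp
    qed
  qed
  then have "DIM('a) \<le> dim (L N) + card {i. i < N \<and> t i = 0}" by blast
  moreover have "{i. i < N \<and> t i = 0} = {i. i < N \<and> plf p a i c = 0}" by (auto simp: t_def sign_pattern_def sgn_0_0)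
  moreover have "dim (L N) \<le> dim {c'. \<forall>i<N. sgn (plf p a i c') = sgn (plf p a i c)}"
  proof -
    define C where "C = {c'. \<forall>i<N. sgn (plf p a i c') = sgn (plf p a i c)}"
    have "C = {c'\<in>UNIV. \<forall>i<N. sgn (plf p a i c') = t i}" by (auto simp: C_def t_def sign_pattern_def)
    also have "\<dots> = L N \<inter> sign_region p a N t" unfolding L_def by (rule cell_eq) (rule pattern_values[OF tp])
    finally have C: "C = L N \<inter> sign_region p a N t" .
    have "c \<in> C" by (simp add: C_def)
    have aL: "affine hull (L N) = L N" using subspace_imp_affine[OF subL] by (simp add: affine_hull_eq)
    have "openin (top_of_set (affine hull L N)) C" unfolding C aL by (rule openin_open_Int[OF open_sign_region])
    then have "affine hull C = affine hull (L N)" using \<open>c \<in> C\<close> by (intro affine_hull_openin) auto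
    then have "aff_dim C = int (dim (L N))" using aff_dim_affine_hull[of C] aL aff_dim_subspace[OF subL] by simp
    moreover have "aff_dim C \<le> aff_dim (span C)" by (intro aff_dim_subset span_superset)
    moreover have "aff_dim (span C) = int (dim C)" by (simp add: aff_dim_subspace)
    ultimately show ?thesis by (simp add: C_def)
  qed
  ultimately show ?thesis by simp
qed

text \<open>The refinement property depends only on the set of patterns, so it is inherited from a
  generic system with the same patterns. This allows \<open>a'\<close> to be a sheared version of
  \<open>a\<close>, chosen for the shape of its facets.\<close>

lemma sign_polytope_plf:
  fixes p :: "nat \<Rightarrow> 'a::euclidean_space"
  assumes gen: "generic p a UNIV {..<N} N" and nz: "\<And>c. c \<noteq> 0 \<Longrightarrow> \<exists>i<N. plf p a' i c \<noteq> 0"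
    and same: "patterns p a' UNIV N = patterns p a UNIV N"
  shows "sign_polytope N (plf p a') (dual_point p N a') (dual_weight N a') (support_function p N a')"
proof
  show "0 < dual_weight N a' v i" if "v \<in> sign_vertices N" for v i
    using dual_weight_bounds[OF that, of a' i] by linarith
  show "support_function p N a' c - c \<bullet> dual_point p N a' v
      = (\<Sum>i<N. (\<bar>plf p a' i c\<bar> - v i * plf p a' i c) * dual_weight N a' v i)" for v c
    by (rule support_gap)
  show "\<exists>i<N. plf p a' i c \<noteq> 0" if "c \<noteq> 0" for c by (rule nz[OF that])
  show "DIM('a) \<le> dim {c'. \<forall>i<N. sgn (plf p a' i c') = sgn (plf p a' i c)} + card {i. i < N \<and> plf p a' i c = 0}"
    if "c \<noteq> 0" for c by (rule dim_cell_ge[OF that])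
  fix c :: 'a and t :: "nat \<Rightarrow> real"
  assume c: "c \<noteq> 0" and t: "\<And>i. i < N \<Longrightarrow> t i \<in> {-1, 0, 1}" "\<And>i. i < N \<Longrightarrow> plf p a' i c \<noteq> 0 \<Longrightarrow> t i = sgn (plf p a' i c)"
  have "sign_pattern p a' N c \<in> patterns p a' UNIV N" using c by (auto simp: patterns_def)
  then have "sign_pattern p a' N c \<in> patterns p a UNIV N" using same by simp
  then obtain c0 where c0: "c0 \<in> UNIV" "c0 \<noteq> 0" "\<forall>j<N. sgn (plf p a j c0) = sign_pattern p a' N c j" by (rule patternE)
  define t' where "t' j = (if j < N then t j else 0)" for j
  have "\<exists>c1\<in>UNIV - {0}. dist c1 c0 < 1 \<and> (\<forall>j<N. sgn (plf p a j c1) = t' j)"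
  proof (rule generic_refine[OF gen])
    show "\<forall>j<N. t' j \<in> {- 1, 0, 1} \<and> (j \<notin> {..<N} \<longrightarrow> t' j = 0) \<and> (plf p a j c0 \<noteq> 0 \<longrightarrow> t' j = sgn (plf p a j c0))"
    proof (intro allI impI)
      fix j assume j: "j < N"
      then have "sgn (plf p a j c0) = sgn (plf p a' j c)" using c0(3) by (simp add: sign_pattern_def)
      moreover from this have "plf p a j c0 \<noteq> 0 \<longleftrightarrow> plf p a' j c \<noteq> 0" by (metis sgn_0_0)
      ultimately show "t' j \<in> {- 1, 0, 1} \<and> (j \<notin> {..<N} \<longrightarrow> t' j = 0) \<and> (plf p a j c0 \<noteq> 0 \<longrightarrow> t' j = sgn (plf p a j c0))"
        using t[OF j] j by (simp add: t'_def)
    qed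
  qed (use c0 in auto)
  then obtain c1 where "c1 \<noteq> 0" "\<forall>j<N. sgn (plf p a j c1) = t' j" by blast
  then have "t' \<in> patterns p a UNIV N" by (intro patternI[of c1]) (simp_all add: t'_def)
  then have "t' \<in> patterns p a' UNIV N" using same by simp
  then obtain c' where "c' \<in> UNIV" "c' \<noteq> 0" "\<forall>j<N. sgn (plf p a' j c') = t' j" by (rule patternE)
  then show "\<exists>c'. c' \<noteq> 0 \<and> (\<forall>i<N. sgn (plf p a' i c') = t i)" by (intro exI[of _ c']) (simp add: t'_def)
qed

context sign_polytope
begin

lemma cubical_body: "cubical body"
  unfolding cubical_def
proof (intro conjI allI impI)
  show "polytope body" by (rule polytope_body)
  show "aff_dim body = DIM('a)" by (rule aff_dim_body)
  fix F assume "F face_of body" "F \<noteq> body" "F \<noteq> {}"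
  then obtain s where s: "s \<in> pats" "F = face s" using faces_eq by blast
  have "aff_dim (face s) < aff_dim body"
    using face_of_aff_dim_lt[OF polytope_imp_convex[OF polytope_body] face_face_of[OF s(1)] face_neq_body[OF s(1)]] .
  then have "card {i. i < N \<and> s i = 0} < DIM('a)" using aff_dim_face[OF s(1)] aff_dim_body by simp
  then show "\<exists>r<DIM('a). cube_like r F" using cube_like_face[OF s(1)] s(2) by blast
qed

end

lemma sign_polytope_pats:
  assumes "sign_polytope N (plf p a) u w h"
  shows "sign_polytope.pats N (plf p a) = patterns p a UNIV N"
proof -
  interpret sign_polytope N "plf p a" u w h by fact
  show ?thesis
  proof
    show "pats \<subseteq> patterns p a UNIV N" by (auto simp: pats_def intro: patternI)
    show "patterns p a UNIV N \<subseteq> pats"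
    proof
      fix s assume s: "s \<in> patterns p a UNIV N"
      then obtain c where "c \<in> UNIV" "c \<noteq> 0" "\<forall>j<N. sgn (plf p a j c) = s j" by (rule patternE)
      then show "s \<in> pats" using pattern_outside[OF s] unfolding pats_def by blast
    qed
  qed
qed

section \<open>Box-shaped end facets\<close>

lemma convex_flat_box: "convex (flat_box e \<tau> \<beta>)"
proof -
  have "flat_box e \<tau> \<beta> = {x. e \<bullet> x = \<tau>} \<inter> (\<Inter>b\<in>Basis - {e}. {x. b \<bullet> x \<le> \<beta> b} \<inter> {x. b \<bullet> x \<ge> - \<beta> b})"
    by (auto simp: flat_box_def abs_le_iff inner_commute minus_le_iff)
  then show ?thesis
    by (auto intro!: convex_Int convex_INT convex_hyperplane convex_halfspace_le convex_halfspace_ge)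
qed

text \<open>A point of the box outside the hull would be strictly separated from it by some
  \<open>c\<close>; the corner whose signs oppose those of \<open>c\<close> minimizes
  \<open>c\<close> on the box and lies in \<open>W\<close>.\<close>

lemma flat_box_eq_hull:
  fixes e :: "'a::euclidean_space"
  assumes e: "e \<in> Basis" and W: "finite W" "W \<subseteq> flat_box e \<tau> \<beta>"
    and corner: "\<And>\<epsilon>. (\<And>b. \<epsilon> b = 1 \<or> \<epsilon> b = -1) \<Longrightarrow> \<exists>w\<in>W. \<forall>b\<in>Basis - {e}. w \<bullet> b = \<epsilon> b * \<beta> b"
  shows "convex hull W = flat_box e \<tau> \<beta>"
proof
  show "convex hull W \<subseteq> flat_box e \<tau> \<beta>" using W(2) by (rule hull_minimal) (rule convex_flat_box)
  show "flat_box e \<tau> \<beta> \<subseteq> convex hull W"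
  proof (rule subsetI, rule ccontr)
    fix z assume z: "z \<in> flat_box e \<tau> \<beta>" "z \<notin> convex hull W"
    have "closed (convex hull W)" using W(1) by (simp add: finite_imp_compact_convex_hull compact_imp_closed)
    then obtain c q where cq: "c \<bullet> z < q" "\<And>x. x \<in> convex hull W \<Longrightarrow> q < c \<bullet> x"
      using separating_hyperplane_closed_point[OF convex_convex_hull _ z(2)] by blast
    define \<epsilon> where "\<epsilon> b = (if c \<bullet> b > 0 then -1 else 1 :: real)" for b
    have "\<exists>w\<in>W. \<forall>b\<in>Basis - {e}. w \<bullet> b = \<epsilon> b * \<beta> b" by (rule corner) (simp add: \<epsilon>_def)
    then obtain w where w: "w \<in> W" "\<And>b. b \<in> Basis - {e} \<Longrightarrow> w \<bullet> b = \<epsilon> b * \<beta> b" by blast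
    have "w \<bullet> e = \<tau>" "z \<bullet> e = \<tau>" using w(1) W(2) z(1) by (auto simp: flat_box_def)
    have "c \<bullet> w = (\<Sum>b\<in>Basis. (c \<bullet> b) * (w \<bullet> b))" by (rule euclidean_inner)
    also have "\<dots> \<le> (\<Sum>b\<in>Basis. (c \<bullet> b) * (z \<bullet> b))"
    proof (rule sum_mono)
      fix b :: 'a assume b: "b \<in> Basis"
      show "(c \<bullet> b) * (w \<bullet> b) \<le> (c \<bullet> b) * (z \<bullet> b)"
      proof (cases "b = e")
        case True
        then show ?thesis using \<open>w \<bullet> e = \<tau>\<close> \<open>z \<bullet> e = \<tau>\<close> by simp
      next
        case False
        then have zb: "\<bar>z \<bullet> b\<bar> \<le> \<beta> b" and wb: "w \<bullet> b = \<epsilon> b * \<beta> b" using z(1) w(2) b by (auto simp: flat_box_def)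
        show ?thesis
        proof (cases "c \<bullet> b > 0")
          case True
          then show ?thesis using zb wb by (intro mult_left_mono) (auto simp: \<epsilon>_def)
        next
          case False
          then show ?thesis using zb wb by (intro mult_left_mono_neg) (auto simp: \<epsilon>_def)
        qed
      qed
    qed
    also have "\<dots> = c \<bullet> z" by (rule euclidean_inner[symmetric])
    finally show False using cq w(1) hull_inc[of w W convex] by fastforce
  qed
qed

text \<open>The first \<open>d\<close> functions start from the coordinates, all later ones are
  combinations of absolute values alone. The last coordinate \<open>\<kappa>\<close> is singled out:
  the box facets are orthogonal to \<open>e\<close>, and the chain of additional functions starts
  there.\<close>

locale coordinates =
  fixes b p :: "nat \<Rightarrow> 'a::euclidean_space" and \<kappa> d :: nat
  assumes dim: "DIM('a) = d" and kappa_Suc: "d = Suc \<kappa>"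
    and b: "bij_betw b {..<d} Basis"
    and p_low: "\<And>i. i < d \<Longrightarrow> p i = b i" and p_high: "\<And>i. d \<le> i \<Longrightarrow> p i = 0"
begin

abbreviation "e \<equiv> b \<kappa>"

lemma kappa: "\<kappa> < d" "Suc \<kappa> = d" using kappa_Suc by auto

lemma less_d: "i < \<kappa> \<Longrightarrow> i < d" using kappa by simp

lemma b_Basis: "i < d \<Longrightarrow> b i \<in> Basis" using b by (auto simp: bij_betw_def)

lemma inner_b: "i < d \<Longrightarrow> j < d \<Longrightarrow> b i \<bullet> b j = (if i = j then 1 else 0)"
  using b b_Basis[of i] b_Basis[of j] by (auto simp: inner_Basis bij_betw_def inj_on_def)

lemma coords_zero:
  assumes "\<And>r. r < d \<Longrightarrow> b r \<bullet> c = 0"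
  shows "c = 0"
proof (rule euclidean_eqI)
  fix x :: 'a assume "x \<in> Basis"
  then obtain r where "r < d" "x = b r" using b by (auto simp: bij_betw_def)
  then show "c \<bullet> x = 0 \<bullet> x" using assms[of r] by (simp add: inner_commute)
qed

lemma e_Basis: "e \<in> Basis" using b_Basis kappa by simp

lemma plf_low:
  assumes "\<And>j. j < i \<Longrightarrow> a j i = 0" "i < d"
  shows "plf p a i c = b i \<bullet> c"
  using assms by (simp add: plf.simps[of p a i] p_low)

end

locale outer_system = coordinates b p \<kappa> d
  for b p :: "nat \<Rightarrow> 'a::euclidean_space" and \<kappa> d +
  fixes N :: nat and a :: "nat \<Rightarrow> nat \<Rightarrow> real"
  assumes N: "d \<le> N"
    and outer: "\<And>i j. i < d \<Longrightarrow> j < i \<Longrightarrow> a j i = 0"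
    and gen: "generic p a UNIV {..<N} N"
begin

text \<open>Adds \<open>- \<nu>\<close> times the sum of the other absolute coordinates to the
  special function. By \<open>plf_shear\<close> this is composition with the piecewise linear
  bijection \<open>shift\<close>, so the patterns and with them the combinatorial type persist,
  while a large \<open>\<nu>\<close> makes the bottom facet wider than every section above
  it.\<close>

definition shear :: "real \<Rightarrow> nat \<Rightarrow> nat \<Rightarrow> real" where
  "shear \<nu> j i = (if i = \<kappa> then - \<nu> else a j i)"

definition shift :: "real \<Rightarrow> 'a \<Rightarrow> 'a" where
  "shift \<nu> c = c - (\<nu> * (\<Sum>r<\<kappa>. \<bar>b r \<bullet> c\<bar>)) *\<^sub>R e"

lemma plf_outer: "i < d \<Longrightarrow> plf p a i c = b i \<bullet> c"
  using outer by (intro plf_low)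

lemma shift_coord: "r < \<kappa> \<Longrightarrow> b r \<bullet> shift \<nu> c = b r \<bullet> c"
  using kappa(1) less_d[of r] by (simp add: shift_def inner_diff_right inner_b)

lemma plf_shear: "plf p (shear \<nu>) i c = plf p a i (shift \<nu> c)"
proof (induction i rule: less_induct)
  case (less i)
  consider "i < \<kappa>" | "i = \<kappa>" | "d \<le> i" using kappa by linarith
  then show ?case
  proof cases
    case 1
    then have "(\<Sum>j<i. shear \<nu> j i * \<bar>plf p (shear \<nu>) j c\<bar>) = 0"
      using outer[of i] less_d[of i] by (intro sum.neutral) (auto simp: shear_def)
    then have "plf p (shear \<nu>) i c = b i \<bullet> c" using 1 kappa by (simp add: plf.simps[of p "shear \<nu>" i] p_low)
    then show ?thesis using 1 plf_outer[of i "shift \<nu> c"] shift_coord[OF 1] less_d[OF 1] by simp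
  next
    case 2
    have "(\<Sum>j<\<kappa>. shear \<nu> j \<kappa> * \<bar>plf p (shear \<nu>) j c\<bar>) = (\<Sum>j<\<kappa>. - \<nu> * \<bar>b j \<bullet> c\<bar>)"
    proof (intro sum.cong refl)
      fix j assume j: "j \<in> {..<\<kappa>}"
      then have "plf p (shear \<nu>) j c = plf p a j (shift \<nu> c)" using less[of j] 2 by simp
      also have "\<dots> = b j \<bullet> c" using j plf_outer[of j "shift \<nu> c"] shift_coord[of j] less_d[of j] by simp
      finally show "shear \<nu> j \<kappa> * \<bar>plf p (shear \<nu>) j c\<bar> = - \<nu> * \<bar>b j \<bullet> c\<bar>" by (simp add: shear_def)
    qed
    then have "plf p (shear \<nu>) \<kappa> c = e \<bullet> c - \<nu> * (\<Sum>j<\<kappa>. \<bar>b j \<bullet> c\<bar>)"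
      using kappa(1) by (simp add: plf.simps[of p "shear \<nu>" \<kappa>] sum_distrib_left sum_negf p_low)
    also have "\<dots> = e \<bullet> shift \<nu> c" using kappa by (simp add: shift_def inner_diff_right inner_b)
    finally show ?thesis using 2 plf_outer[of \<kappa> "shift \<nu> c"] kappa by simp
  next
    case 3
    then have "i \<noteq> \<kappa>" using kappa by linarith
    then have "(\<Sum>j<i. shear \<nu> j i * \<bar>plf p (shear \<nu>) j c\<bar>) = (\<Sum>j<i. a j i * \<bar>plf p a j (shift \<nu> c)\<bar>)"
    proof (intro sum.cong refl)
      fix j assume "j \<in> {..<i}"
      then have "plf p (shear \<nu>) j c = plf p a j (shift \<nu> c)" using less[of j] by simp
      then show "shear \<nu> j i * \<bar>plf p (shear \<nu>) j c\<bar> = a j i * \<bar>plf p a j (shift \<nu> c)\<bar>"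
        using \<open>i \<noteq> \<kappa>\<close> by (simp add: shear_def[of \<nu> j i])
    qed
    then show ?thesis using 3 by (simp add: plf.simps[of p _ i] p_high)
  qed
qed

lemma shift_eq_0_iff: "shift \<nu> c = 0 \<longleftrightarrow> c = 0"
proof
  assume s: "shift \<nu> c = 0"
  then have "b r \<bullet> c = 0" if "r < \<kappa>" for r using shift_coord[OF that, of \<nu> c] by simp
  then have "shift \<nu> c = c" by (simp add: shift_def)
  then show "c = 0" using s by simp
qed (simp add: shift_def)

lemma shift_inverse: "shift \<nu> (shift (- \<nu>) c) = c"
  using shift_coord[of _ "- \<nu>" c] by (simp add: shift_def[of \<nu>]) (simp add: shift_def)

lemma patterns_shear: "patterns p (shear \<nu>) UNIV N = patterns p a UNIV N"
proof -
  have pt: "sign_pattern p (shear \<nu>) N c = sign_pattern p a N (shift \<nu> c)" for c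
    unfolding sign_pattern_def plf_shear ..
  have "shift \<nu> ` (UNIV - {0}) = UNIV - {0}"
  proof
    show "shift \<nu> ` (UNIV - {0}) \<subseteq> UNIV - {0}" using shift_eq_0_iff by auto
    show "UNIV - {0} \<subseteq> shift \<nu> ` (UNIV - {0})"
    proof
      fix c :: 'a assume "c \<in> UNIV - {0}"
      then have "shift (- \<nu>) c \<in> UNIV - {0}" using shift_eq_0_iff[of "- \<nu>" c] by auto
      then show "c \<in> shift \<nu> ` (UNIV - {0})" using shift_inverse[of \<nu> c] by (metis image_eqI)
    qed
  qed
  then show ?thesis unfolding patterns_def pt by (metis (no_types, lifting) image_cong image_image)
qed

lemma plf_nonzero: "c \<noteq> 0 \<Longrightarrow> \<exists>i<N. plf p a i c \<noteq> 0"
proof (rule ccontr)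
  assume "c \<noteq> 0" "\<not> (\<exists>i<N. plf p a i c \<noteq> 0)"
  then have "b r \<bullet> c = 0" if "r < d" for r using plf_outer[OF that, of c] that N by simp
  then show False using coords_zero \<open>c \<noteq> 0\<close> by blast
qed

lemma sign_polytope_shear:
  "sign_polytope N (plf p (shear \<nu>)) (dual_point p N (shear \<nu>)) (dual_weight N (shear \<nu>)) (support_function p N (shear \<nu>))"
proof (rule sign_polytope_plf[OF gen _ patterns_shear])
  fix c :: 'a assume "c \<noteq> 0"
  then show "\<exists>i<N. plf p (shear \<nu>) i c \<noteq> 0" using plf_nonzero[of "shift \<nu> c"] shift_eq_0_iff by (simp add: plf_shear)
qed

text \<open>Only the special coordinate is nonzero at \<open>\<plusminus>e\<close>, so genericity leaves no room for further zeros.\<close>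

lemma plf_e_nonzero:
  assumes "d \<le> i" "i < N" "\<epsilon> = 1 \<or> \<epsilon> = (-1::real)"
  shows "plf p a i (\<epsilon> *\<^sub>R e) \<noteq> 0"
proof
  assume z: "plf p a i (\<epsilon> *\<^sub>R e) = 0"
  define t where "t = sign_pattern p a N (\<epsilon> *\<^sub>R e)"
  have "e \<noteq> 0" using e_Basis by auto
  then have "t \<in> patterns p a UNIV N" using assms(3) by (auto simp: t_def patterns_def)
  from zeros_less_dim[OF gen this] have lt: "card {j\<in>{..<N}. t j = 0} < d" using dim by simp
  have "insert i {..<\<kappa>} \<subseteq> {j\<in>{..<N}. t j = 0}"
    using z assms N kappa by (auto simp: t_def sign_pattern_def plf_outer inner_b)
  then have "card (insert i {..<\<kappa>}) \<le> card {j\<in>{..<N}. t j = 0}" by (intro card_mono) auto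
  moreover have "card (insert i {..<\<kappa>}) = d" using assms kappa by simp
  ultimately show False using lt by simp
qed

text \<open>The later functions depend on the coordinates only through absolute values. Hence
  \<open>e\<close> and \<open>- e\<close> give the same signs from index \<open>d\<close> on, and
  one sign vector \<open>X\<close> describes both end facets in \<open>shear_body\<close>.\<close>

lemma plf_abs_sym: "d \<le> i \<Longrightarrow> plf p a i (\<epsilon> *\<^sub>R e) = \<bar>\<epsilon>\<bar> * plf p a i e"
proof (induction i rule: less_induct)
  case (less i)
  have "\<bar>plf p a j (\<epsilon> *\<^sub>R e)\<bar> = \<bar>\<epsilon>\<bar> * \<bar>plf p a j e\<bar>" if "j < i" for j
    using less.IH[OF that] plf_outer[of j] by (cases "d \<le> j") (auto simp: abs_mult)
  then have "(\<Sum>j<i. a j i * \<bar>plf p a j (\<epsilon> *\<^sub>R e)\<bar>) = \<bar>\<epsilon>\<bar> * (\<Sum>j<i. a j i * \<bar>plf p a j e\<bar>)"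
    by (simp add: sum_distrib_left mult_ac)
  then show ?case using less.prems by (simp add: plf.simps[of p a i] p_high)
qed

lemma dual_weight_high: "\<kappa> \<le> i \<Longrightarrow> dual_weight N (shear \<nu>) v i = dual_weight N a v i"
  by (rule dual_weight_cong) (auto simp: shear_def)

lemma dual_weight_low:
  assumes "r < \<kappa>"
  shows "dual_weight N (shear \<nu>) v r = dual_bound N (shear \<nu>) r - \<nu> * (v \<kappa> * dual_weight N a v \<kappa>)
     + (\<Sum>j\<in>{d..<N}. a r j * (v j * dual_weight N a v j))"
proof -
  let ?f = "\<lambda>j. shear \<nu> r j * v j * dual_weight N (shear \<nu>) v j"
  have "{r<..<N} = {r<..<\<kappa>} \<union> ({\<kappa>} \<union> {d..<N})" using assms N kappa by auto
  then have "(\<Sum>j\<in>{r<..<N}. ?f j) = (\<Sum>j\<in>{r<..<\<kappa>}. ?f j) + (\<Sum>j\<in>{\<kappa>} \<union> {d..<N}. ?f j)"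
    using kappa by (simp only:) (intro sum.union_disjoint; auto)
  also have "(\<Sum>j\<in>{\<kappa>} \<union> {d..<N}. ?f j) = ?f \<kappa> + (\<Sum>j\<in>{d..<N}. ?f j)"
    using kappa by (subst sum.union_disjoint) auto
  also have "(\<Sum>j\<in>{r<..<\<kappa>}. ?f j) = 0"
  proof (intro sum.neutral ballI)
    fix j assume "j \<in> {r<..<\<kappa>}"
    then show "?f j = 0" using outer[of j r] less_d[of j] by (simp add: shear_def)
  qed
  also have "?f \<kappa> = - \<nu> * (v \<kappa> * dual_weight N a v \<kappa>)" by (simp add: shear_def dual_weight_high)
  also have "(\<Sum>j\<in>{d..<N}. ?f j) = (\<Sum>j\<in>{d..<N}. a r j * (v j * dual_weight N a v j))"
    using kappa by (intro sum.cong) (auto simp: shear_def dual_weight_high)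
  finally show ?thesis by (simp add: dual_weight.simps[of N "shear \<nu>" v r])
qed

lemma dual_point_inner:
  assumes "r < d"
  shows "dual_point p N a' v \<bullet> b r = v r * dual_weight N a' v r"
proof -
  have "dual_point p N a' v \<bullet> b r = (\<Sum>i<N. if i = r then v i * dual_weight N a' v i else 0)"
    unfolding dual_point_def inner_sum_left 
  proof (intro sum.cong refl)
    fix i
    show "(v i * dual_weight N a' v i) *\<^sub>R p i \<bullet> b r = (if i = r then v i * dual_weight N a' v i else 0)"
      using assms by (cases "i < d") (auto simp: inner_b p_low p_high)
  qed
  then show ?thesis using assms N by simp
qed

text \<open>At \<open>\<plusminus>e\<close> exactly the first \<open>\<kappa>\<close> functions
  vanish. The vertices of the corresponding facet have fixed signs \<open>X\<close> from index
  \<open>d\<close> on, hence fixed weights, and free signs in the first \<open>\<kappa>\<close>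
  coordinates: they are the corners of a box.\<close>

lemma shear_body:
  obtains T \<sigma> \<gamma> \<tau> \<beta> where "cubical T" "box_cap e T \<sigma> \<gamma>" "box_topped e T \<tau> \<beta>" "\<sigma> < \<tau>"
    "\<And>i. i < d \<Longrightarrow> face_number T i = card {s \<in> patterns p a UNIV N. card {j\<in>{..<N}. s j = 0} = i}"
proof -
  define X where "X i = (if d \<le> i \<and> i < N then sgn (plf p a i e) else 1)" for i
  have X: "X i = 1 \<or> X i = -1" for i using plf_e_nonzero[of i 1] by (auto simp: X_def sgn_if)
  define U where "U = dual_weight N a X \<kappa>"
  define Q where "Q r v = (\<Sum>j\<in>{d..<N}. a r j * (v j * dual_weight N a v j))" for r v
  \<comment> \<open>\<open>- U\<close> is the level of the bottom facet, and \<open>G v\<close> is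
    the height of the vertex \<open>v\<close> above it.\<close>
  define G where "G v = U + v \<kappa> * dual_weight N a v \<kappa>" for v :: "nat \<Rightarrow> real"
  \<comment> \<open>For a vertex above the bottom, weight \<open>r\<close> is below its bottom value
    as soon as \<open>\<nu>\<close> exceeds the quotient \<open>(Q r v - Q r X) / G v\<close>; only
    finitely many quotients occur.\<close>
  define bad where "bad = insert 0 ((\<lambda>(r, v). (Q r v - Q r X) / G v) ` ({..<\<kappa>} \<times> sign_vertices N))"
  have fbad: "finite bad" by (simp add: bad_def finite_sign_vertices)
  define \<nu> where "\<nu> = 1 + Max bad"
  have \<nu>: "Q r v - Q r X < \<nu> * G v" if "r < \<kappa>" "v \<in> sign_vertices N" "G v > 0" for r v
  proof -
    have "(Q r v - Q r X) / G v \<le> Max bad" using that fbad by (intro Max_ge) (auto simp: bad_def)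
    then have "(Q r v - Q r X) / G v < \<nu>" by (simp add: \<nu>_def)
    then show ?thesis using that(3) by (simp add: pos_divide_less_eq)
  qed
  interpret sign_polytope N "plf p (shear \<nu>)" "dual_point p N (shear \<nu>)" "dual_weight N (shear \<nu>)" "support_function p N (shear \<nu>)"
    by (rule sign_polytope_shear)
  have absv: "\<bar>v r\<bar> = 1" if "v \<in> sign_vertices N" "r < \<kappa>" for v r
  proof -
    have "r < N" using that(2) N kappa by linarith
    then have "v r = 1 \<or> v r = -1" using that(1) by (simp add: sign_vertices_def)
    then show ?thesis by auto
  qed
  define vp where "vp = dual_point p N (shear \<nu>)"
  have vpr: "vp v \<bullet> b r = v r * dual_weight N (shear \<nu>) v r" if "r < d" for v r
    unfolding vp_def by (rule dual_point_inner[OF that])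
  have vpe: "vp v \<bullet> e = v \<kappa> * dual_weight N a v \<kappa>" for v
    using vpr[OF kappa(1), of v] dual_weight_high[of \<kappa> \<nu> v] by simp
  have wpos: "0 < dual_weight N a' v i" if "v \<in> sign_vertices N" for a' v i using dual_weight_bounds[OF that, of a' i] by linarith
  have X1: "X i = 1" if "N \<le> i" for i using that by (simp add: X_def)
  have Xs: "X \<in> sign_vertices N" using X X1 by (simp add: sign_vertices_def)
  have Upos: "U > 0" unfolding U_def by (rule wpos[OF Xs])
  define \<delta> where "\<delta> \<epsilon> r = dual_bound N (shear \<nu>) r - \<nu> * (\<epsilon> * U) + Q r X" for \<epsilon> r
  have ysh: "plf p (shear \<nu>) i (\<epsilon> *\<^sub>R e) = (if i < \<kappa> then 0 else if i = \<kappa> then \<epsilon> else \<bar>\<epsilon>\<bar> * plf p a i e)" for i \<epsilon>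
  proof -
    have "shift \<nu> (\<epsilon> *\<^sub>R e) = \<epsilon> *\<^sub>R e" using kappa by (simp add: shift_def inner_b)
    then have "plf p (shear \<nu>) i (\<epsilon> *\<^sub>R e) = plf p a i (\<epsilon> *\<^sub>R e)" by (simp add: plf_shear)
    moreover consider "i < \<kappa>" | "i = \<kappa>" | "d \<le> i" using kappa by linarith
    then have "plf p a i (\<epsilon> *\<^sub>R e) = (if i < \<kappa> then 0 else if i = \<kappa> then \<epsilon> else \<bar>\<epsilon>\<bar> * plf p a i e)"
    proof cases
      case 3
      then show ?thesis using plf_abs_sym[of i \<epsilon>] kappa by auto
    qed (use plf_outer[of i "\<epsilon> *\<^sub>R e"] kappa in \<open>auto simp: inner_b\<close>)
    ultimately show ?thesis by simp
  qed
  define s where "s \<epsilon> = sign_pattern p (shear \<nu>) N (\<epsilon> *\<^sub>R e)" for \<epsilon>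
  have compat_iff: "v \<in> compat (s \<epsilon>) \<longleftrightarrow> v \<in> sign_vertices N \<and> v \<kappa> = \<epsilon> \<and> (\<forall>i. d \<le> i \<and> i < N \<longrightarrow> v i = X i)"
    if \<epsilon>: "\<epsilon> = 1 \<or> \<epsilon> = -1" for \<epsilon> v
  proof -
    have val: "s \<epsilon> i = (if i < \<kappa> then 0 else if i = \<kappa> then \<epsilon> else X i)" if "i < N" for i
      using that \<epsilon> kappa plf_e_nonzero[of i 1] by (auto simp: s_def sign_pattern_def ysh X_def)
    have nz: "X i \<noteq> 0" for i using X[of i] by auto
    show ?thesis
    proof
      assume v: "v \<in> compat (s \<epsilon>)"
      then have "v i = s \<epsilon> i" if "i < N" "s \<epsilon> i \<noteq> 0" for i using that by (auto simp: compat_def)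
      then show "v \<in> sign_vertices N \<and> v \<kappa> = \<epsilon> \<and> (\<forall>i. d \<le> i \<and> i < N \<longrightarrow> v i = X i)"
        using v val \<epsilon> N kappa nz compat_subset by (auto simp: subset_eq)
    next
      assume v: "v \<in> sign_vertices N \<and> v \<kappa> = \<epsilon> \<and> (\<forall>i. d \<le> i \<and> i < N \<longrightarrow> v i = X i)"
      have "v i = s \<epsilon> i" if "i < N" "s \<epsilon> i \<noteq> 0" for i
      proof -
        consider "i < \<kappa>" | "i = \<kappa>" | "d \<le> i" using kappa by linarith
        then show ?thesis using v val[OF that(1)] that kappa by cases auto
      qed
      then show "v \<in> compat (s \<epsilon>)" using v by (simp add: compat_def)
    qed
  qed
  have weights: "dual_weight N a v \<kappa> = U \<and> (\<forall>r<\<kappa>. dual_weight N (shear \<nu>) v r = \<delta> \<epsilon> r)"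
    if \<epsilon>: "\<epsilon> = 1 \<or> \<epsilon> = -1" and v: "v \<in> compat (s \<epsilon>)" for \<epsilon> v
  proof -
    have vv: "v \<in> sign_vertices N" "v \<kappa> = \<epsilon>" "\<And>i. d \<le> i \<Longrightarrow> i < N \<Longrightarrow> v i = X i"
      using compat_iff[OF \<epsilon>] v by auto
    have high: "dual_weight N a v i = dual_weight N a X i" if "\<kappa> \<le> i" for i
      using that kappa vv(3) by (intro dual_weight_cong) auto
    then have QX: "Q r v = Q r X" for r unfolding Q_def using vv(3) kappa by (intro sum.cong) auto
    show ?thesis using high[of \<kappa>] vv(2) QX dual_weight_low[of _ \<nu> v] by (auto simp: U_def \<delta>_def Q_def)
  qed
  define \<beta> where "\<beta> \<epsilon> x = \<delta> \<epsilon> (inv_into {..<d} b x)" for \<epsilon> x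
  have \<beta>b: "\<beta> \<epsilon> (b r) = \<delta> \<epsilon> r" if "r < d" for \<epsilon> r
    using that b by (simp add: \<beta>_def bij_betw_def inv_into_f_f)
  have others: "\<exists>r<\<kappa>. x = b r" if x: "x \<in> Basis - {e}" for x
  proof -
    obtain r where r: "r < d" "x = b r" using x b by (auto simp: bij_betw_def)
    then have "r \<noteq> \<kappa>" using x by auto
    then show ?thesis using r kappa_Suc by (auto simp: less_Suc_eq)
  qed
  have nonempty: "\<exists>v. v \<in> compat (s \<epsilon>)" if "\<epsilon> = 1 \<or> \<epsilon> = -1" for \<epsilon>
  proof -
    have "X(\<kappa> := \<epsilon>) \<in> compat (s \<epsilon>)" using compat_iff[OF that] Xs that N kappa by (auto simp: sign_vertices_def)
    then show ?thesis by blast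
  qed
  have \<beta>pos: "0 < \<beta> \<epsilon> x" if \<epsilon>: "\<epsilon> = 1 \<or> \<epsilon> = -1" and x: "x \<in> Basis - {e}" for \<epsilon> x
  proof -
    obtain r where r: "r < \<kappa>" "x = b r" using others[OF x] by blast
    obtain v where v: "v \<in> compat (s \<epsilon>)" using nonempty[OF \<epsilon>] by blast
    then have "v \<in> sign_vertices N" using compat_subset by blast
    then show ?thesis using weights[OF \<epsilon> v] r \<beta>b[of r \<epsilon>] wpos[of v "shear \<nu>" r] kappa by simp
  qed
  have flat: "body \<inter> {x. x \<bullet> e = \<epsilon> * U} = flat_box e (\<epsilon> * U) (\<beta> \<epsilon>)" if \<epsilon>: "\<epsilon> = 1 \<or> \<epsilon> = -1" for \<epsilon>
  proof -
    have sp: "\<forall>i<N. sgn (plf p (shear \<nu>) i (\<epsilon> *\<^sub>R e)) = s \<epsilon> i" by (simp add: s_def sign_pattern_def)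
    obtain v where v: "v \<in> compat (s \<epsilon>)" using nonempty[OF \<epsilon>] by blast
    have vk: "v \<kappa> = \<epsilon>" using compat_iff[OF \<epsilon>] v by blast
    have "vp v \<in> face (s \<epsilon>)" unfolding face_def vp_def using v by (simp add: hull_inc)
    then have "(\<epsilon> *\<^sub>R e) \<bullet> vp v = support_function p N (shear \<nu>) (\<epsilon> *\<^sub>R e)" using supporting_face[OF sp] by blast
    then have "support_function p N (shear \<nu>) (\<epsilon> *\<^sub>R e) = U"
      using vpe[of v] weights[OF \<epsilon> v] vk \<epsilon> by (auto simp: inner_commute)
    then have "body \<inter> {x. (\<epsilon> *\<^sub>R e) \<bullet> x = U} = face (s \<epsilon>)" using supporting_face[OF sp] by simp
    moreover have "{x. (\<epsilon> *\<^sub>R e) \<bullet> x = U} = {x. x \<bullet> e = \<epsilon> * U}" using \<epsilon> by (auto simp: inner_commute)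
    moreover have "face (s \<epsilon>) = flat_box e (\<epsilon> * U) (\<beta> \<epsilon>)" unfolding face_def
    proof (rule flat_box_eq_hull[OF e_Basis])
      show "finite (dual_point p N (shear \<nu>) ` compat (s \<epsilon>))"
        using finite_subset[OF compat_subset finite_sign_vertices] by simp
      show "dual_point p N (shear \<nu>) ` compat (s \<epsilon>) \<subseteq> flat_box e (\<epsilon> * U) (\<beta> \<epsilon>)"
      proof
        fix z assume "z \<in> dual_point p N (shear \<nu>) ` compat (s \<epsilon>)"
        then obtain v where v: "v \<in> compat (s \<epsilon>)" "z = vp v" by (auto simp: vp_def)
        have vs: "v \<in> sign_vertices N" "v \<kappa> = \<epsilon>" using compat_iff[OF \<epsilon>] v by blast+
        have "\<bar>z \<bullet> x\<bar> \<le> \<beta> \<epsilon> x" if x: "x \<in> Basis - {e}" for x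
        proof -
          obtain r where r: "r < \<kappa>" "x = b r" using others[OF x] by blast
          have "\<bar>v r\<bar> = 1" by (rule absv[OF vs(1) r(1)])
          then have "\<bar>z \<bullet> x\<bar> = \<bar>dual_weight N (shear \<nu>) v r\<bar>" using vpr[of r v] less_d[OF r(1)] r v(2) by (simp add: abs_mult)
          also have "\<dots> = \<delta> \<epsilon> r" using weights[OF \<epsilon> v(1)] r wpos[OF vs(1), of "shear \<nu>" r] by simp
          finally show ?thesis using r less_d[OF r(1)] \<beta>b[of r \<epsilon>] by simp
        qed
        moreover have "z \<bullet> e = \<epsilon> * U" using v vpe[of v] weights[OF \<epsilon> v(1)] vs(2) by simp
        ultimately show "z \<in> flat_box e (\<epsilon> * U) (\<beta> \<epsilon>)" by (simp add: flat_box_def)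
      qed
      fix \<eta> :: "'a \<Rightarrow> real" assume \<eta>: "\<And>x. \<eta> x = 1 \<or> \<eta> x = -1"
      define v where "v i = (if i < \<kappa> then \<eta> (b i) else if i = \<kappa> then \<epsilon> else X i)" for i
      have "v \<in> sign_vertices N"
        unfolding sign_vertices_def using \<eta> \<epsilon> X X1 N kappa by (auto simp: v_def)
      then have v: "v \<in> compat (s \<epsilon>)" using compat_iff[OF \<epsilon>] kappa by (auto simp: v_def)
      have "vp v \<bullet> x = \<eta> x * \<beta> \<epsilon> x" if x: "x \<in> Basis - {e}" for x
      proof -
        obtain r where r: "r < \<kappa>" "x = b r" using others[OF x] by blast
        from r show ?thesis using vpr[of r v] less_d[OF r(1)] weights[OF \<epsilon> v] \<beta>b[of r \<epsilon>] by (simp add: v_def)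
      qed
      then show "\<exists>w\<in>dual_point p N (shear \<nu>) ` compat (s \<epsilon>). \<forall>x\<in>Basis - {e}. w \<bullet> x = \<eta> x * \<beta> \<epsilon> x"
        using v unfolding vp_def by blast
    qed
    ultimately show ?thesis by simp
  qed
  have body_e: "\<bar>x \<bullet> e\<bar> \<le> U" if "x \<in> body" for x
  proof -
    have "(\<epsilon> *\<^sub>R e) \<bullet> x \<le> U" if \<epsilon>: "\<epsilon> = 1 \<or> \<epsilon> = -1" for \<epsilon>
    proof -
      obtain v where v: "v \<in> compat (s \<epsilon>)" using nonempty[OF \<epsilon>] by blast
      have vk: "v \<kappa> = \<epsilon>" using compat_iff[OF \<epsilon>] v by blast
      have sp: "\<forall>i<N. sgn (plf p (shear \<nu>) i (\<epsilon> *\<^sub>R e)) = s \<epsilon> i" by (simp add: s_def sign_pattern_def)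
      have "vp v \<in> face (s \<epsilon>)" unfolding face_def vp_def using v by (simp add: hull_inc)
      then have "(\<epsilon> *\<^sub>R e) \<bullet> vp v = support_function p N (shear \<nu>) (\<epsilon> *\<^sub>R e)" using supporting_face[OF sp] by blast
      then have "support_function p N (shear \<nu>) (\<epsilon> *\<^sub>R e) = U"
        using vpe[of v] weights[OF \<epsilon> v] vk \<epsilon> by (auto simp: inner_commute)
      then show ?thesis using body_le[OF \<open>x \<in> body\<close>, of "\<epsilon> *\<^sub>R e"] by simp
    qed
    from this[of 1] this[of "-1"] show ?thesis by (simp add: abs_le_iff inner_commute)
  qed
  have VT: "body = convex hull (vp ` sign_vertices N)" by (simp add: body_def vp_def)
  have strictV: "\<bar>vp v \<bullet> x\<bar> < \<beta> (-1) x" if v: "v \<in> sign_vertices N" and gt: "- U < vp v \<bullet> e" and x: "x \<in> Basis - {e}" for v x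
  proof -
    obtain r where r: "r < \<kappa>" "x = b r" using others[OF x] by blast
    have "G v > 0" using gt by (simp add: G_def vpe)
    then have "Q r v - Q r X < \<nu> * G v" by (rule \<nu>[OF r(1) v])
    then have lt: "dual_weight N (shear \<nu>) v r < \<delta> (-1) r"
      using dual_weight_low[OF r(1), of \<nu> v] by (simp add: \<delta>_def G_def Q_def algebra_simps)
    have "\<bar>v r\<bar> = 1" by (rule absv[OF v r(1)])
    then have "\<bar>vp v \<bullet> x\<bar> = dual_weight N (shear \<nu>) v r" using vpr[of r v] less_d[OF r(1)] r wpos[OF v, of "shear \<nu>" r] by (simp add: abs_mult)
    then show ?thesis using lt r less_d[OF r(1)] \<beta>b[of r "-1"] by simp
  qed
  have vbody: "vp v \<in> body" if "v \<in> sign_vertices N" for v using that by (simp add: VT hull_inc)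
  obtain \<mu> where \<mu>: "\<mu> > 0" "\<And>x z. x \<in> body \<Longrightarrow> z \<in> Basis - {e} \<Longrightarrow> \<bar>x \<bullet> z\<bar> \<le> \<beta> (-1) z - \<mu> * (x \<bullet> e - (- U))"
  proof (rule cap_slope[OF _ VT, of "- U" e "\<beta> (-1)"])
    show "finite (vp ` sign_vertices N)" by (simp add: finite_sign_vertices)
    show "- U \<le> v \<bullet> e" if "v \<in> vp ` sign_vertices N" for v using body_e[of v] vbody that by (auto simp: abs_le_iff)
    show "\<bar>v \<bullet> x\<bar> \<le> \<beta> (-1) x" if "v \<in> vp ` sign_vertices N" "v \<bullet> e = - U" "x \<in> Basis - {e}" for v x
    proof -
      have "v \<in> body \<inter> {x. x \<bullet> e = (-1) * U}" using vbody that by auto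
      moreover have "body \<inter> {x. x \<bullet> e = (-1) * U} = flat_box e ((-1) * U) (\<beta> (-1))" by (rule flat) simp
      ultimately have "v \<in> flat_box e ((-1) * U) (\<beta> (-1))" by blast
      then show ?thesis using that(3) by (simp add: flat_box_def)
    qed
    show "\<bar>v \<bullet> x\<bar> < \<beta> (-1) x" if "v \<in> vp ` sign_vertices N" "- U < v \<bullet> e" "x \<in> Basis - {e}" for v x
      using strictV that by auto
  qed blast
  have "box_cap e body (- U) (\<beta> (-1))" unfolding box_cap_def
  proof (intro conjI ballI impI)
    show "0 < \<beta> (-1) x" if "x \<in> Basis - {e}" for x using \<beta>pos[of "-1" x] that by simp
    show "- U \<le> x \<bullet> e" if "x \<in> body" for x using body_e[OF that] by (simp add: abs_le_iff)
    show "body \<inter> {x. x \<bullet> e = - U} = flat_box e (- U) (\<beta> (-1))" using flat[of "-1"] by simp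
    fix x z assume xz: "x \<in> body" "- U < x \<bullet> e" "z \<in> Basis - {e}"
    then have "0 < \<mu> * (x \<bullet> e - (- U))" using \<mu>(1) by (intro mult_pos_pos) auto
    then show "\<bar>x \<bullet> z\<bar> < \<beta> (-1) z" using \<mu>(2)[OF xz(1,3)] by linarith
  qed
  moreover have "box_topped e body U (\<beta> 1)" unfolding box_topped_def
    using \<beta>pos[of 1] body_e flat[of 1] by (auto simp: abs_le_iff)
  moreover have "face_number body i = card {s \<in> patterns p a UNIV N. card {j\<in>{..<N}. s j = 0} = i}" if "i < d" for i
    using card_faces[of i] that dim sign_polytope_pats[OF sign_polytope_shear] patterns_shear by (simp add: face_number_def)
  ultimately show ?thesis using that[of body "- U" "\<beta> (-1)" U "\<beta> 1"] cubical_body Upos by simp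
qed

end

section \<open>General position\<close>

lemma plf_cong:
  assumes "\<And>i' j. i' \<le> i \<Longrightarrow> j < i' \<Longrightarrow> a j i' = a' j i'"
  shows "plf p a i c = plf p a' i c"
  using assms
proof (induction i rule: less_induct)
  case (less i)
  have "plf p a j c = plf p a' j c" if "j < i" for j using that less.prems by (intro less.IH) auto
  then have "(\<Sum>j<i. a j i * \<bar>plf p a j c\<bar>) = (\<Sum>j<i. a' j i * \<bar>plf p a' j c\<bar>)"
    using less.prems by (intro sum.cong) auto
  then show ?case by (simp add: plf.simps[of p _ i])
qed

context coordinates
begin

definition coord_space :: "nat set \<Rightarrow> 'a set" where
  "coord_space B = {c. \<forall>r<d. r \<notin> B \<longrightarrow> b r \<bullet> c = 0}"

definition vec :: "(nat \<Rightarrow> real) \<Rightarrow> 'a" where "vec f = (\<Sum>r<d. f r *\<^sub>R b r)"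

lemma inner_vec: "r < d \<Longrightarrow> b r \<bullet> vec f = f r"
  by (simp add: vec_def inner_sum_right inner_b if_distrib cong: if_cong)

lemma vec_coords: "vec (\<lambda>r. b r \<bullet> c) = c"
proof -
  have "vec (\<lambda>r. b r \<bullet> c) - c = 0" by (rule coords_zero) (simp add: inner_diff_right inner_vec)
  then show ?thesis by simp
qed

lemma subspace_coord_space: "subspace (coord_space B)"
  by (auto simp: coord_space_def subspace_def inner_add_right)

lemma coord_space_UNIV: "coord_space {..<d} = UNIV" by (auto simp: coord_space_def)

lemma dim_coord_space:
  assumes "B \<subseteq> {..<d}"
  shows "dim (coord_space B) = card B"
proof -
  have "coord_space B = span (b ` B)"
  proof
    show "span (b ` B) \<subseteq> coord_space B"
      using assms by (intro span_minimal subspace_coord_space) (auto simp: coord_space_def inner_b)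
    show "coord_space B \<subseteq> span (b ` B)"
    proof
      fix c assume c: "c \<in> coord_space B"
      have "c = (\<Sum>r<d. (b r \<bullet> c) *\<^sub>R b r)" using vec_coords[of c] by (simp add: vec_def)
      also have "\<dots> = (\<Sum>r\<in>B. (b r \<bullet> c) *\<^sub>R b r)"
        using c assms by (intro sum.mono_neutral_right) (auto simp: coord_space_def)
      also have "\<dots> \<in> span (b ` B)" by (intro span_sum span_scale span_base) auto
      finally show "c \<in> span (b ` B)" .
    qed
  qed
  moreover have "inj_on b B" using b assms by (auto simp: bij_betw_def intro: inj_on_subset)
  moreover have "independent (b ` B)"
    using b_Basis assms by (intro independent_mono[OF independent_Basis]) auto
  ultimately show ?thesis by (simp add: dim_span dim_eq_card_independent card_image)
qed

lemma plf_nonzero_coord: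
  assumes "\<And>i j. i < d \<Longrightarrow> j < i \<Longrightarrow> a j i = 0" "d \<le> n" "c \<in> S - {0}"
  shows "\<exists>j<n. plf p a j c \<noteq> 0"
proof (rule ccontr)
  assume "\<not> (\<exists>j<n. plf p a j c \<noteq> 0)"
  then have "b r \<bullet> c = 0" if "r < d" for r using plf_low[of r a c] assms(1,2) that by simp
  then show False using coords_zero assms(3) by blast
qed

lemma generic_outer:
  assumes a: "\<And>i j. i < d \<Longrightarrow> j < i \<Longrightarrow> a j i = 0" and B: "B \<subseteq> {..<d}"
  shows "generic p a (coord_space B) B d"
  unfolding generic_def
proof (intro conjI allI impI ballI)
  show "subspace (coord_space B)" by (rule subspace_coord_space)
  show "plf p a i c = 0" if "i < d" "i \<notin> B" "c \<in> coord_space B" for i c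
    using that plf_low[of i a c] a by (auto simp: coord_space_def)
  fix i c assume i: "i < d" "i \<in> B" and c: "c \<in> coord_space B - {0}"
  define c' where "c' = (if b i \<bullet> c = 0 then c + b i else c)"
  have c'i: "b i \<bullet> c' \<noteq> 0" using i by (simp add: c'_def inner_add_right inner_b)
  then have "c' \<noteq> 0" by auto
  moreover have "c' \<in> coord_space B" using c i by (auto simp: c'_def coord_space_def inner_add_right inner_b)
  moreover have "sgn (plf p a j c') = sgn (plf p a j c)" if "j < i" for j
    using that i plf_low[of j a] a by (simp add: c'_def inner_add_right inner_b)
  moreover have "plf p a i c' \<noteq> 0" using plf_low[of i a c'] a i c'i by simp
  ultimately show "\<exists>c'\<in>coord_space B - {0}. (\<forall>j<i. sgn (plf p a j c') = sgn (plf p a j c)) \<and> plf p a i c' \<noteq> 0" by blast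
qed

text \<open>Adds \<open>t i\<close> times the sum of all absolute coordinates to each inner
  function. That sum is positive off the origin, so a change of \<open>t i\<close> moves the
  function at every nonzero point.\<close>

definition perturbed :: "(nat \<Rightarrow> nat \<Rightarrow> real) \<Rightarrow> (nat \<Rightarrow> real) \<Rightarrow> nat \<Rightarrow> nat \<Rightarrow> real" where
  "perturbed a t j i = (if i < d then 0 else a j i + (if j < d then t i else 0))"

lemma perturbed_outer: "i < d \<Longrightarrow> perturbed a t j i = 0" by (simp add: perturbed_def)

lemma plf_perturbed_low: "i < d \<Longrightarrow> plf p (perturbed a t) i c = b i \<bullet> c"
  by (rule plf_low) (auto simp: perturbed_def)

lemma plf_perturbed:
  assumes "d \<le> i"
  shows "plf p (perturbed a t) i c = (\<Sum>j<i. a j i * \<bar>plf p (perturbed a t) j c\<bar>) + t i * (\<Sum>r<d. \<bar>b r \<bullet> c\<bar>)"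
proof -
  have "(\<Sum>j<i. perturbed a t j i * \<bar>plf p (perturbed a t) j c\<bar>)
      = (\<Sum>j<i. a j i * \<bar>plf p (perturbed a t) j c\<bar>) + (\<Sum>j<i. if j < d then t i * \<bar>b j \<bullet> c\<bar> else 0)"
    unfolding sum.distrib[symmetric]
  proof (intro sum.cong refl)
    fix j
    show "perturbed a t j i * \<bar>plf p (perturbed a t) j c\<bar>
        = a j i * \<bar>plf p (perturbed a t) j c\<bar> + (if j < d then t i * \<bar>b j \<bullet> c\<bar> else 0)"
      using assms plf_perturbed_low[of j a t c] by (simp add: perturbed_def[of a t j i] distrib_right)
  qed
  also have "(\<Sum>j<i. if j < d then t i * \<bar>b j \<bullet> c\<bar> else 0) = t i * (\<Sum>r<d. \<bar>b r \<bullet> c\<bar>)"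
    unfolding sum_distrib_left using assms by (intro sum.mono_neutral_cong_right) auto
  finally show ?thesis using assms by (simp add: plf.simps[of p "perturbed a t" i] p_high)
qed

text \<open>At a representative of each cell only one value of the new parameter makes the new
  function vanish. There are finitely many cells over all coordinate subspaces, so one small value
  suits all of them at once.\<close>

lemma generic_perturbation:
  assumes "d \<le> n" "\<tau> > 0"
  shows "\<exists>t. (\<forall>i. 0 < t i \<and> t i < \<tau>) \<and>
     (\<forall>B\<subseteq>{..<d}. generic p (perturbed a t) (coord_space B) (B \<union> {d..<n}) n)"
  using assms(1)
proof (induction n rule: nat_induct_at_least)
  case base
  show ?case
  proof (intro exI[of _ "\<lambda>_. \<tau> / 2"] conjI allI impI)
    fix B assume "B \<subseteq> {..<d}"
    then show "generic p (perturbed a (\<lambda>_. \<tau> / 2)) (coord_space B) (B \<union> {d..<d}) d"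
      using generic_outer[of "perturbed a (\<lambda>_. \<tau> / 2)" B] by (simp add: perturbed_outer)
  qed (use assms(2) in auto)
next
  case (Suc n)
  obtain t where "(\<forall>i. 0 < t i \<and> t i < \<tau>) \<and>
     (\<forall>B\<subseteq>{..<d}. generic p (perturbed a t) (coord_space B) (B \<union> {d..<n}) n)" using Suc.IH by (elim exE)
  then have t: "\<And>i. 0 < t i \<and> t i < \<tau>"
    "\<And>B. B \<subseteq> {..<d} \<Longrightarrow> generic p (perturbed a t) (coord_space B) (B \<union> {d..<n}) n" by simp_all
  define y where "y = plf p (perturbed a t)"
  define f where "f c = (\<Sum>j<n. a j n * \<bar>y j c\<bar>)" for c
  define g where "g c = (\<Sum>r<d. \<bar>b r \<bullet> c\<bar>)" for c
  have g: "g c > 0" if c: "c \<noteq> 0" for c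
  proof -
    obtain r where "r < d" "b r \<bullet> c \<noteq> 0" using coords_zero[of c] c by blast
    then have "\<bar>b r \<bullet> c\<bar> \<le> g c" "\<bar>b r \<bullet> c\<bar> > 0" unfolding g_def by (auto intro: member_le_sum)
    then show ?thesis by linarith
  qed
  \<comment> \<open>One point per cell and coordinate subspace; the excluded values of the new
    parameter are the quotients \<open>- f / g\<close> at these points.\<close>
  define rep where "rep B s = (SOME c. c \<in> coord_space B \<and> c \<noteq> 0 \<and> (\<forall>j<n. sgn (y j c) = s j))" for B s
  define R where "R = (SIGMA B:Pow {..<d}. patterns p (perturbed a t) (coord_space B) n)"
  have finR: "finite R" unfolding R_def by (intro finite_SigmaI finite_patterns) auto
  have rep: "rep B s \<in> coord_space B \<and> rep B s \<noteq> 0 \<and> (\<forall>j<n. sgn (y j (rep B s)) = s j)"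
    if s: "s \<in> patterns p (perturbed a t) (coord_space B) n" for B s
  proof -
    obtain c where "c \<in> coord_space B" "c \<noteq> 0" "\<forall>j<n. sgn (y j c) = s j" using s unfolding y_def by (rule patternE)
    then have "\<exists>c. c \<in> coord_space B \<and> c \<noteq> 0 \<and> (\<forall>j<n. sgn (y j c) = s j)" by blast
    then show ?thesis unfolding rep_def by (rule someI_ex)
  qed
  have "finite ((\<lambda>(B, s). - f (rep B s) / g (rep B s)) ` R)" using finR by simp
  moreover have "infinite {0<..<\<tau>}" using assms(2) by simp
  ultimately obtain x where x: "x \<in> {0<..<\<tau>}" "x \<notin> (\<lambda>(B, s). - f (rep B s) / g (rep B s)) ` R"
    by (meson finite_subset subsetI)
  define t' where "t' = t(n := x)"
  have same: "plf p (perturbed a t') i c = y i c" if "i < n" for i c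
    unfolding y_def using that by (intro plf_cong) (auto simp: perturbed_def t'_def)
  have new: "plf p (perturbed a t') n c = f c + x * g c" for c
  proof -
    have "(\<Sum>j<n. a j n * \<bar>plf p (perturbed a t') j c\<bar>) = f c" unfolding f_def using same by (intro sum.cong) auto
    then show ?thesis using plf_perturbed[OF \<open>d \<le> n\<close>, of a t' c] by (simp add: t'_def g_def)
  qed
  have "generic p (perturbed a t') (coord_space B) (B \<union> {d..<Suc n}) (Suc n)" if B: "B \<subseteq> {..<d}" for B
    unfolding generic_def
  proof (intro conjI allI impI ballI)
    have gB: "generic p (perturbed a t) (coord_space B) (B \<union> {d..<n}) n" by (rule t(2)[OF B])
    show "subspace (coord_space B)" by (rule subspace_coord_space)
    show "plf p (perturbed a t') i c = 0" if "i < Suc n" "i \<notin> B \<union> {d..<Suc n}" "c \<in> coord_space B" for i c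
      using that plf_perturbed_low[of i a t' c] by (auto simp: coord_space_def)
    fix i c assume i: "i < Suc n" "i \<in> B \<union> {d..<Suc n}" and c: "c \<in> coord_space B - {0}"
    show "\<exists>c'\<in>coord_space B - {0}. (\<forall>j<i. sgn (plf p (perturbed a t') j c') = sgn (plf p (perturbed a t') j c)) \<and>
        plf p (perturbed a t') i c' \<noteq> 0"
    proof (cases "i < n")
      case True
      then have "i \<in> B \<union> {d..<n}" using i by auto
      then have "\<exists>c'\<in>coord_space B - {0}. (\<forall>j<i. sgn (y j c') = sgn (y j c)) \<and> y i c' \<noteq> 0"
        using gB c True unfolding generic_def y_def by blast
      then show ?thesis using same True by auto
    next
      case False
      then have "i = n" using i by simp
      define s where "s = sign_pattern p (perturbed a t) n c"
      have s: "s \<in> patterns p (perturbed a t) (coord_space B) n" using c by (auto simp: s_def patterns_def)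
      note r = rep[OF s]
      have "(B, s) \<in> R" using s B by (auto simp: R_def)
      then have "x \<noteq> - f (rep B s) / g (rep B s)" using x(2) by (metis (mono_tags, lifting) case_prod_conv image_eqI)
      then have "f (rep B s) + x * g (rep B s) \<noteq> 0" using g[of "rep B s"] r by (auto simp: field_simps add_eq_0_iff)
      then have "plf p (perturbed a t') n (rep B s) \<noteq> 0" by (simp add: new)
      moreover have "\<forall>j<n. sgn (plf p (perturbed a t') j (rep B s)) = sgn (plf p (perturbed a t') j c)"
        using r same by (simp add: s_def sign_pattern_def y_def)
      ultimately show ?thesis using r \<open>i = n\<close> by blast
    qed
  qed
  moreover have "0 < t' i \<and> t' i < \<tau>" for i using t(1)[of i] x(1) by (auto simp: t'_def)
  ultimately show ?case by blast
qed

text \<open>The coordinates in \<open>M\<close> enter the inner functions only through the sum of their absolute values,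
  so a pattern consists of an arbitrary sign vector on \<open>M\<close> and a pattern of the rest that only
  depends on whether this sign vector vanishes.\<close>

lemma pattern_gf_duplicates:
  assumes a: "\<And>i j. i < d \<Longrightarrow> j < i \<Longrightarrow> a j i = 0" and N: "d \<le> N"
    and M: "M \<subseteq> {..<d}" "\<And>i r r'. d \<le> i \<Longrightarrow> r \<in> M \<Longrightarrow> r' \<in> M \<Longrightarrow> a r i = a r' i"
    and B: "B = {..<d} - M"
  shows "\<exists>U :: (nat \<Rightarrow> real) set. \<forall>M'. M' \<subseteq> M \<longrightarrow> M' \<noteq> {} \<longrightarrow> (\<forall>x. pattern_gf p a (coord_space (B \<union> M')) (B \<union> M' \<union> {d..<N}) N x
      = ((x + 2) ^ card M' - x ^ card M') * (\<Sum>\<rho>\<in>U. x ^ card {j \<in> B \<union> {d..<N}. \<rho> j = 0})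
        + x ^ card M' * pattern_gf p a (coord_space B) (B \<union> {d..<N}) N x)"
proof -
  define off where "off c j = (if j < N \<and> j \<notin> M then sgn (plf p a j c) else 0)" for c j
  \<comment> \<open>The patterns off \<open>M\<close> of points with some nonzero coordinate in
    \<open>M\<close>. They do not depend on \<open>M'\<close>, so one \<open>U\<close> serves all
    choices of \<open>M'\<close>.\<close>
  define U where "U = off ` {c. \<exists>r\<in>M. b r \<bullet> c \<noteq> 0}"
  define J where "J = B \<union> {d..<N}"
  have JM: "J \<inter> M = {}" "finite J" using M B by (auto simp: J_def)
  have finM: "finite M" using M(1) finite_subset by blast
  have low: "plf p a r c = b r \<bullet> c" if "r < d" for r c using plf_low[of r a c] a that by simp
  \<comment> \<open>By induction on \<open>i\<close>, since all coordinates in \<open>M\<close>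
    enter an inner function with one common coefficient.\<close>
  have inner: "plf p a i c = plf p a i c'" if eq: "\<And>r. r \<in> B \<Longrightarrow> b r \<bullet> c = b r \<bullet> c'"
    "(\<Sum>r\<in>M. \<bar>b r \<bullet> c\<bar>) = (\<Sum>r\<in>M. \<bar>b r \<bullet> c'\<bar>)" and i: "d \<le> i" for c c' i
    using i
  proof (induction i rule: less_induct)
    case (less i)
    have split: "sum F {..<i} = sum F ({..<i} - M) + sum F M" for F :: "nat \<Rightarrow> real"
      using M(1) less.prems by (intro sum.subset_diff) auto
    have sumM: "(\<Sum>j\<in>M. a j i * \<bar>plf p a j z\<bar>) = (if M = {} then 0 else a (SOME r. r \<in> M) i * (\<Sum>r\<in>M. \<bar>b r \<bullet> z\<bar>))" for z
    proof (cases "M = {}")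
      case False
      then have "(SOME r. r \<in> M) \<in> M" by (simp add: some_in_eq)
      then have "(\<Sum>j\<in>M. a j i * \<bar>plf p a j z\<bar>) = (\<Sum>j\<in>M. a (SOME r. r \<in> M) i * \<bar>b j \<bullet> z\<bar>)"
      proof (intro sum.cong refl)
        fix j assume "j \<in> M"
        then have "j < d" "a j i = a (SOME r. r \<in> M) i"
          using M(1) M(2)[OF less.prems _ \<open>(SOME r. r \<in> M) \<in> M\<close>] by auto
        then show "a j i * \<bar>plf p a j z\<bar> = a (SOME r. r \<in> M) i * \<bar>b j \<bullet> z\<bar>" using low by simp
      qed
      then show ?thesis using False by (simp add: sum_distrib_left)
    qed simp
    have "(\<Sum>j\<in>{..<i} - M. a j i * \<bar>plf p a j c\<bar>) = (\<Sum>j\<in>{..<i} - M. a j i * \<bar>plf p a j c'\<bar>)"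
    proof (intro sum.cong refl)
      fix j assume j: "j \<in> {..<i} - M"
      have "plf p a j c = plf p a j c'"
      proof (cases "j < d")
        case True
        then show ?thesis using low[OF True] eq(1)[of j] j B by simp
      qed (use less.IH[of j] j in auto)
      then show "a j i * \<bar>plf p a j c\<bar> = a j i * \<bar>plf p a j c'\<bar>" by simp
    qed
    then have "(\<Sum>j<i. a j i * \<bar>plf p a j c\<bar>) = (\<Sum>j<i. a j i * \<bar>plf p a j c'\<bar>)"
      unfolding split by (simp add: sumM eq(2))
    then show ?case using less.prems by (simp add: plf.simps[of p a i] p_high)
  qed
  have finU: "finite U"
  proof (rule finite_subset)
    have "sgn r \<in> {-1, 0, 1}" for r :: real by (simp add: sgn_if)
    then have "off c j \<in> {-1, 0, 1}" for c j by (simp add: off_def)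
    moreover have "off c j = 0" if "\<not> j < N" for c j using that by (simp add: off_def)
    ultimately show "U \<subseteq> sign_refinements {..<N} (\<lambda>_. 0)" by (auto simp: U_def sign_refinements_def)
  qed (simp add: finite_sign_refinements)
  have main: "pattern_gf p a (coord_space (B \<union> M')) (B \<union> M' \<union> {d..<N}) N x
      = ((x + 2) ^ card M' - x ^ card M') * (\<Sum>\<rho>\<in>U. x ^ card {j \<in> J. \<rho> j = 0})
        + x ^ card M' * pattern_gf p a (coord_space B) J N x" if M': "M' \<subseteq> M" "M' \<noteq> {}" for M' x
  proof -
    have finM': "finite M'" using M' finM finite_subset by blast
    \<comment> \<open>The zero sign vector on \<open>M'\<close> is excluded, as it belongs to the
      patterns in \<open>V\<close>; this yields the term \<open>- x ^ card M'\<close>.\<close>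
    define W where "W = sign_refinements M' (\<lambda>_. 0) - {\<lambda>_. 0}"
    define V where "V = patterns p a (coord_space B) N"
    let ?S = "coord_space (B \<union> M')"
    have Wz: "w j = 0" if "w \<in> W" "j \<notin> M'" for w j using that by (auto simp: W_def sign_refinements_def)
    have Uz: "\<rho> j = 0" if "\<rho> \<in> U" "j \<in> M \<or> N \<le> j" for \<rho> j using that by (auto simp: U_def off_def)
    have Vz: "\<rho> j = 0" if \<rho>: "\<rho> \<in> V" and j: "j \<in> M" for \<rho> j
    proof -
      obtain c where c: "c \<in> coord_space B" "\<forall>j<N. sgn (plf p a j c) = \<rho> j" using \<rho> unfolding V_def by (rule patternE)
      have "j < d" "j \<notin> B" using j M B by auto
      then have "plf p a j c = 0" "j < N" using c(1) low[of j c] N by (auto simp: coord_space_def)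
      then show ?thesis using c(2) by (metis sgn_0)
    qed
    define h :: "(nat \<Rightarrow> real) \<times> (nat \<Rightarrow> real) \<Rightarrow> nat \<Rightarrow> real" where "h = (\<lambda>(w, \<rho>) j. w j + \<rho> j)"
    have decomp: "patterns p a ?S N = h ` (W \<times> U) \<union> V"
    proof
      show "patterns p a ?S N \<subseteq> h ` (W \<times> U) \<union> V"
      proof
        fix s assume s: "s \<in> patterns p a ?S N"
        then obtain c where c: "c \<in> ?S" "c \<noteq> 0" "\<forall>j<N. sgn (plf p a j c) = s j" by (rule patternE)
        show "s \<in> h ` (W \<times> U) \<union> V"
        proof (cases "\<exists>r\<in>M. b r \<bullet> c \<noteq> 0")
          case True
          define w where "w j = (if j \<in> M then s j else 0)" for j
          have sM: "s r = sgn (b r \<bullet> c)" if "r \<in> M" for r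
          proof -
            have "r < d" "r < N" using that M(1) N by auto
            then show ?thesis using c(3) low[of r c] by auto
          qed
          have "w j = 0" if "j \<notin> M'" for j
          proof (cases "j \<in> M")
            case True
            then have "j < d" "j \<notin> B \<union> M'" using M(1) B that by auto
            then show ?thesis using sM[OF True] c(1) by (simp add: w_def coord_space_def)
          qed (simp add: w_def)
          then have "w \<in> sign_refinements M' (\<lambda>_. 0)"
            using pattern_values[OF s] by (auto simp: sign_refinements_def w_def)
          moreover have "w \<noteq> (\<lambda>_. 0)"
          proof
            assume w0: "w = (\<lambda>_. 0)"
            obtain r where r: "r \<in> M" "b r \<bullet> c \<noteq> 0" using True by blast
            have "w r = 0" by (simp add: w0)
            then show False using sM[OF r(1)] r by (simp add: w_def sgn_0_0)
          qed
          ultimately have "w \<in> W" by (simp add: W_def)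
          moreover have "off c \<in> U" using True by (auto simp: U_def)
          moreover have "s = h (w, off c)"
          proof
            fix j show "s j = h (w, off c) j"
              using c(3) pattern_outside[OF s, of j] M(1) N
              by (cases "j < N") (auto simp: h_def w_def off_def subset_eq)
          qed
          ultimately show ?thesis by blast
        next
          case False
          then have "c \<in> coord_space B" using B by (auto simp: coord_space_def)
          then have "s \<in> V" unfolding V_def using c pattern_outside[OF s] by (intro patternI[of c]) auto
          then show ?thesis by blast
        qed
      qed
      show "h ` (W \<times> U) \<union> V \<subseteq> patterns p a ?S N"
      proof (intro Un_least subsetI)
        fix s assume "s \<in> V"
        moreover have "coord_space B \<subseteq> ?S" by (auto simp: coord_space_def)
        ultimately show "s \<in> patterns p a ?S N" unfolding V_def patterns_def by blast
      next
        fix s assume "s \<in> h ` (W \<times> U)"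
        then obtain w c where w: "w \<in> W" and c: "\<exists>r\<in>M. b r \<bullet> c \<noteq> 0" and s: "s = h (w, off c)" by (auto simp: U_def)
        define A where "A = (\<Sum>r\<in>M. \<bar>b r \<bullet> c\<bar>)"
        obtain r0 where r0: "r0 \<in> M" "b r0 \<bullet> c \<noteq> 0" using c by blast
        have "\<bar>b r0 \<bullet> c\<bar> \<le> A" unfolding A_def using r0 finM by (intro member_le_sum) auto
        then have A: "A > 0" using r0 by auto
        define n where "n = (\<Sum>r\<in>M. \<bar>w r\<bar>)"
        have wv: "w r \<in> {-1, 0, 1}" for r using w by (cases "r \<in> M'") (auto simp: W_def sign_refinements_def)
        obtain r1 where r1: "w r1 \<noteq> 0" using w by (auto simp: W_def)
        then have "r1 \<in> M" using Wz[OF w] M' by blast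
        then have "\<bar>w r1\<bar> \<le> n" unfolding n_def using finM by (intro member_le_sum) auto
        then have n: "n > 0" using r1 by auto
        \<comment> \<open>The coordinates in \<open>M\<close> are replaced by a multiple of
          \<open>w\<close> with the same absolute sum \<open>A\<close>, so the inner functions keep
          their values.\<close>
        define c' where "c' = vec (\<lambda>r. if r \<in> M then w r * (A / n) else b r \<bullet> c)"
        have cM: "b r \<bullet> c' = w r * (A / n)" if "r \<in> M" for r using that M(1) by (auto simp: c'_def inner_vec subset_eq)
        have cB: "b r \<bullet> c' = b r \<bullet> c" if "r \<in> B" for r using that B by (auto simp: c'_def inner_vec)
        have "(\<Sum>r\<in>M. \<bar>b r \<bullet> c'\<bar>) = (\<Sum>r\<in>M. \<bar>w r\<bar>) * (A / n)"
          unfolding sum_distrib_right using A n by (intro sum.cong) (auto simp: cM abs_mult)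
        also have "\<dots> = A" using n by (simp add: n_def)
        finally have eqi: "plf p a i c' = plf p a i c" if "d \<le> i" for i using inner[of c' c i] cB that by (simp add: A_def)
        have "c' \<noteq> 0" using cM[OF \<open>r1 \<in> M\<close>] r1 A n by auto
        moreover have "c' \<in> ?S" unfolding coord_space_def
        proof (intro CollectI allI impI)
          fix r assume r: "r < d" "r \<notin> B \<union> M'"
          then have "r \<in> M" using B by auto
          then show "b r \<bullet> c' = 0" using cM Wz[OF w, of r] r by simp
        qed
        moreover have "sgn (plf p a j c') = s j" if "j < N" for j
        proof -
          consider "j \<in> M" | "j \<in> B" | "d \<le> j" using B by fastforce
          then show ?thesis
          proof cases
            case 1
            then have "plf p a j c' = w j * (A / n)" using low[of j c'] M(1) cM by auto
            moreover have "off c j = 0" using 1 by (simp add: off_def)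
            ultimately show ?thesis using A n wv[of j] by (auto simp: s h_def sgn_mult)
          next
            case 2
            then have "plf p a j c' = plf p a j c" using low[of j] B cB by simp
            moreover have "w j = 0" using 2 B Wz[OF w, of j] M' by auto
            ultimately show ?thesis using 2 B that by (simp add: s h_def off_def)
          next
            case 3
            then have "j \<notin> M" using M(1) by auto
            then show ?thesis using eqi[OF 3] Wz[OF w, of j] M' that by (auto simp: s h_def off_def)
          qed
        qed
        moreover have "s j = 0" if "N \<le> j" for j
        proof -
          have "j \<notin> M'" using that N M' M(1) by auto
          then show ?thesis using Wz[OF w, of j] that by (simp add: s h_def off_def)
        qed
        ultimately show "s \<in> patterns p a ?S N" by (intro patternI[of c']) auto
      qed
    qed
    have inj: "inj_on h (W \<times> U)"
    proof (rule inj_onI, clarify)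
      fix w \<rho> w' \<rho>' assume *: "w \<in> W" "\<rho> \<in> U" "w' \<in> W" "\<rho>' \<in> U" "h (w, \<rho>) = h (w', \<rho>')"
      have e: "w j + \<rho> j = w' j + \<rho>' j" for j using fun_cong[OF *(5), of j] by (simp add: h_def)
      have "w j = w' j \<and> \<rho> j = \<rho>' j" for j
        using e[of j] Wz[OF *(1), of j] Wz[OF *(3), of j] Uz[OF *(2), of j] Uz[OF *(4), of j] M' by (cases "j \<in> M'") auto
      then show "w = w' \<and> \<rho> = \<rho>'" by auto
    qed
    have disj: "h ` (W \<times> U) \<inter> V = {}"
    proof -
      have False if wp: "w \<in> W" "\<rho> \<in> U" "h (w, \<rho>) \<in> V" for w \<rho>
      proof -
        obtain r where "w r \<noteq> 0" using wp(1) by (auto simp: W_def)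
        then have "r \<in> M" using Wz[OF wp(1)] M' by blast
        then show False using Vz[OF wp(3), of r] Uz[OF wp(2), of r] \<open>w r \<noteq> 0\<close> by (simp add: h_def)
      qed
      then show ?thesis by auto
    qed
    have finW: "finite W" unfolding W_def using finM' by (simp add: finite_sign_refinements)
    have JJ: "B \<union> M' \<union> {d..<N} = M' \<union> J" "M' \<inter> J = {}" using JM M' by (auto simp: J_def)
    have cardsplit: "card {j \<in> M' \<union> J. s j = 0} = card {j\<in>M'. s j = 0} + card {j\<in>J. s j = 0}" for s :: "nat \<Rightarrow> real"
    proof -
      have "{j \<in> M' \<union> J. s j = 0} = {j\<in>M'. s j = 0} \<union> {j\<in>J. s j = 0}" by auto
      then show ?thesis using JJ(2) finM' JM by (simp only:) (intro card_Un_disjoint; auto)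
    qed
    have cardh: "card {j \<in> M' \<union> J. h (w, \<rho>) j = 0} = card {j\<in>M'. w j = 0} + card {j\<in>J. \<rho> j = 0}" if "w \<in> W" "\<rho> \<in> U" for w \<rho>
    proof -
      have "\<rho> j = 0" if "j \<in> M'" for j using Uz[OF \<open>\<rho> \<in> U\<close>] that M' by blast
      then have "{j\<in>M'. h (w, \<rho>) j = 0} = {j\<in>M'. w j = 0}" by (auto simp: h_def)
      moreover have "w j = 0" if "j \<in> J" for j using Wz[OF \<open>w \<in> W\<close>] that JJ(2) by blast
      then have "{j\<in>J. h (w, \<rho>) j = 0} = {j\<in>J. \<rho> j = 0}" by (auto simp: h_def)
      ultimately show ?thesis unfolding cardsplit by simp
    qed
    have "pattern_gf p a ?S (B \<union> M' \<union> {d..<N}) N x = (\<Sum>s\<in>h ` (W \<times> U) \<union> V. x ^ card {j \<in> M' \<union> J. s j = 0})"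
      by (simp add: pattern_gf_def decomp JJ)
    also have "\<dots> = (\<Sum>s\<in>h ` (W \<times> U). x ^ card {j \<in> M' \<union> J. s j = 0}) + (\<Sum>s\<in>V. x ^ card {j \<in> M' \<union> J. s j = 0})"
      using finW finU disj by (intro sum.union_disjoint) (auto simp: V_def finite_patterns)
    also have "(\<Sum>s\<in>h ` (W \<times> U). x ^ card {j \<in> M' \<union> J. s j = 0})
        = (\<Sum>(w, \<rho>)\<in>W \<times> U. x ^ card {j\<in>M'. w j = 0} * x ^ card {j\<in>J. \<rho> j = 0})"
      unfolding sum.reindex[OF inj] o_def
    proof (intro sum.cong refl)
      fix wr assume "wr \<in> W \<times> U"
      then obtain w \<rho> where "wr = (w, \<rho>)" "w \<in> W" "\<rho> \<in> U" by blast
      then show "x ^ card {j \<in> M' \<union> J. h wr j = 0} = (case wr of (w, \<rho>) \<Rightarrow> x ^ card {j\<in>M'. w j = 0} * x ^ card {j\<in>J. \<rho> j = 0})"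
        using cardh[of w \<rho>] by (simp only: power_add split_conv)
    qed
    also have "\<dots> = (\<Sum>w\<in>W. x ^ card {j\<in>M'. w j = 0}) * (\<Sum>\<rho>\<in>U. x ^ card {j\<in>J. \<rho> j = 0})"
      by (simp add: sum_product sum.cartesian_product)
    also have "(\<Sum>w\<in>W. x ^ card {j\<in>M'. w j = 0}) = (x + 2) ^ card M' - x ^ card M'"
    proof -
      have z: "(\<lambda>_. 0) \<in> sign_refinements M' (\<lambda>_. 0)" by (simp add: sign_refinements_def)
      have "{j\<in>M'. True} = M'" by simp
      then show ?thesis unfolding W_def
        using sum_sign_refinements[OF finM', of x "\<lambda>_. 0"] finite_sign_refinements[OF finM', of "\<lambda>_. 0"]
          sum_diff1[of "sign_refinements M' (\<lambda>_. 0)" "\<lambda>w. x ^ card {j\<in>M'. w j = 0}" "\<lambda>_. 0"] z by simp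
    qed
    also have "(\<Sum>s\<in>V. x ^ card {j \<in> M' \<union> J. s j = 0}) = x ^ card M' * pattern_gf p a (coord_space B) J N x"
    proof -
      have "card {j \<in> M' \<union> J. s j = 0} = card M' + card {j\<in>J. s j = 0}" if "s \<in> V" for s
      proof -
        have "{j\<in>M'. s j = 0} = M'" using Vz[OF that] M' by auto
        then show ?thesis unfolding cardsplit by simp
      qed
      then have "(\<Sum>s\<in>V. x ^ card {j \<in> M' \<union> J. s j = 0}) = (\<Sum>s\<in>V. x ^ card M' * x ^ card {j\<in>J. s j = 0})"
        by (intro sum.cong refl) (simp only: power_add)
      then show ?thesis by (simp only: pattern_gf_def V_def[symmetric] sum_distrib_left)
    qed
    finally show ?thesis .
  qed
  show ?thesis using main unfolding J_def by (intro exI[of _ U]) blast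
qed

end

section \<open>Patterns with many zeros\<close>

context coordinates
begin

text \<open>Block \<open>s \<ge> 1\<close> of \<open>l\<close> nodes carries the values at \<open>1, \<dots>, l\<close> of a parabola whose leading coefficient
  is the sum of the duplicated coordinates; the nodes of block \<open>0\<close> carry that sum itself.\<close>

definition node :: "nat \<Rightarrow> nat \<Rightarrow> nat \<Rightarrow> nat \<Rightarrow> real" where
  "node k l j r = (if 2 * k - 2 \<le> r \<and> r < \<kappa> then (if j div l = 0 then 1 else (real (j mod l) + 1)\<^sup>2)
     else if 1 \<le> j div l \<and> r = 2 * (j div l) - 2 then - 2 * (real (j mod l) + 1)
     else if 1 \<le> j div l \<and> r = 2 * (j div l) - 1 then 1 else 0)"

text \<open>Before perturbation, each inner function is \<open>K\<close> times the absolute value of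
  its predecessor minus a node value; the predecessor of the first one is the special
  coordinate.\<close>

definition inner_coeff :: "nat \<Rightarrow> nat \<Rightarrow> real \<Rightarrow> nat \<Rightarrow> nat \<Rightarrow> real" where
  "inner_coeff k l K j i = (if j < d then - node k l (i - d) j else 0) + (if Suc j = i then K else 0)"

definition node_sum :: "nat \<Rightarrow> nat \<Rightarrow> nat \<Rightarrow> 'a \<Rightarrow> real" where
  "node_sum k l j c = (\<Sum>r<d. node k l j r * \<bar>b r \<bullet> c\<bar>)"

definition coord_sum :: "'a \<Rightarrow> real" where "coord_sum c = (\<Sum>r<d. \<bar>b r \<bullet> c\<bar>)"

lemma plf_inner:
  fixes t :: "nat \<Rightarrow> real" and K :: real and k l :: nat
  defines "y \<equiv> plf p (perturbed (inner_coeff k l K) t)"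
  shows "y (d + j) c = K * \<bar>y (\<kappa> + j) c\<bar> - (node_sum k l j c - t (d + j) * coord_sum c)"
proof -
  let ?i = "d + j"
  have "(\<Sum>j'<?i. inner_coeff k l K j' ?i * \<bar>y j' c\<bar>)
      = (\<Sum>j'<?i. if j' < d then - node k l j j' * \<bar>b j' \<bullet> c\<bar> else 0) + (\<Sum>j'<?i. if j' = \<kappa> + j then K * \<bar>y (\<kappa> + j) c\<bar> else 0)"
    unfolding sum.distrib[symmetric]
  proof (intro sum.cong refl)
    fix j'
    have "y j' c = b j' \<bullet> c" if "j' < d" using that by (simp add: y_def plf_perturbed_low)
    moreover have "Suc j' = ?i \<longleftrightarrow> j' = \<kappa> + j" using kappa_Suc by auto
    ultimately show "inner_coeff k l K j' ?i * \<bar>y j' c\<bar>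
        = (if j' < d then - node k l j j' * \<bar>b j' \<bullet> c\<bar> else 0) + (if j' = \<kappa> + j then K * \<bar>y (\<kappa> + j) c\<bar> else 0)"
      by (auto simp: inner_coeff_def distrib_right)
  qed
  also have "(\<Sum>j'<?i. if j' < d then - node k l j j' * \<bar>b j' \<bullet> c\<bar> else 0) = - node_sum k l j c"
    unfolding node_sum_def sum_negf[symmetric] by (intro sum.mono_neutral_cong_right) auto
  also have "(\<Sum>j'<?i. if j' = \<kappa> + j then K * \<bar>y (\<kappa> + j) c\<bar> else 0) = K * \<bar>y (\<kappa> + j) c\<bar>"
    using kappa_Suc by simp
  finally show ?thesis
    unfolding y_def using plf_perturbed[of ?i "inner_coeff k l K" t c] by (simp add: coord_sum_def)
qed

text \<open>Backward solution of the chain. With \<open>Z j = descent f L \<sigma> K (L - j)\<close>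
  and \<open>y (\<kappa> + j) = \<sigma> j * Z j / K\<close>, the recursion \<open>y (\<kappa> + j +
  1) = K * \<bar>y (\<kappa> + j)\<bar> - f j\<close> holds wherever \<open>Z j\<close> is
  nonnegative.\<close>

fun descent :: "(nat \<Rightarrow> 'a \<Rightarrow> real) \<Rightarrow> nat \<Rightarrow> (nat \<Rightarrow> real) \<Rightarrow> real \<Rightarrow> nat \<Rightarrow> 'a \<Rightarrow> real" where
  "descent f L \<sigma> K 0 c = 1"
| "descent f L \<sigma> K (Suc m) c = f (L - Suc m) c + \<sigma> (L - m) * descent f L \<sigma> K m c / K"

lemma continuous_on_descent:
  "(\<And>j. continuous_on A (f j)) \<Longrightarrow> continuous_on A (descent f L \<sigma> K m)"
proof (induction m)
  case (Suc m)
  have "continuous_on A (\<lambda>c. f (L - Suc m) c + \<sigma> (L - m) * descent f L \<sigma> K m c / K)"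
    unfolding divide_inverse using Suc by (intro continuous_intros) auto
  then show ?case by simp
qed simp

text \<open>Solving the recursion backwards from prescribed signs \<open>\<sigma>\<close> leaves one equation for each
  prescribed zero and one for the special coordinate. They are small perturbations of a triangular
  system, and Brouwer's theorem solves them.\<close>

lemma pattern_exists:
  fixes k l :: nat and t \<sigma> :: "nat \<Rightarrow> real" and q :: "nat \<Rightarrow> nat"
  defines "C \<equiv> 10 * (real k + 1) * (real l + 1)\<^sup>2"
  defines "K \<equiv> 32 * (C + 1)"
  defines "y \<equiv> plf p (perturbed (inner_coeff k l K) t)"
  assumes k: "1 \<le> k" "2 * k \<le> d" and l: "1 \<le> l"
    and q: "\<And>s. 1 \<le> s \<Longrightarrow> s < k \<Longrightarrow> q s < l" and \<sigma>: "\<And>j. \<sigma> j = 1 \<or> \<sigma> j = -1"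
    and t: "\<And>i. 0 < t i \<and> t i < 1 / (16 * C)"
  shows "\<exists>c. c \<in> coord_space ({..<2 * k - 1} \<union> {\<kappa>}) \<and> (\<forall>r<2 * k - 1. 0 < b r \<bullet> c) \<and> 0 < b \<kappa> \<bullet> c \<and>
    (\<forall>j. 1 \<le> j \<longrightarrow> j \<le> k * l \<longrightarrow> sgn (y (\<kappa> + j) c) = (if \<exists>s. 1 \<le> s \<and> s < k \<and> j = s * l + q s then 0 else \<sigma> j))"
proof -
  define L where "L = k * l"
  have C: "C \<ge> 10"
  proof -
    have "1 * 1 \<le> (real k + 1) * (real l + 1)\<^sup>2" by (intro mult_mono) auto
    then show ?thesis unfolding C_def mult.assoc by linarith
  qed
  \<comment> \<open>On the search box \<open>X\<close>, \<open>C\<close> bounds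
    \<open>coord_sum\<close> and the node values with room to spare. Then
    \<open>\<bar>Z j\<bar> \<le> 2 * (C + 1)\<close>, and \<open>K\<close> makes the feedback term
    at most 1/16. The bound on \<open>t\<close> limits the perturbation to 1/16 as well, so
    \<open>Z j\<close> differs from the node value by at most 1/8.\<close>
  have K: "K > 0" "K \<ge> 32" using C by (auto simp: K_def)
  have k2: "2 * k - 2 < \<kappa>" using k kappa_Suc by linarith
  define Q where "Q r = real (q (r div 2 + 1)) + 1" for r
  have Qr: "1 \<le> Q r \<and> Q r \<le> real l" if "r < 2 * k - 2" for r
  proof -
    have "r div 2 + 1 < k" using that by auto
    then have "q (r div 2 + 1) < l" by (intro q) auto
    then show ?thesis by (simp add: Q_def)
  qed
  \<comment> \<open>In block \<open>s\<close> the coordinate \<open>2 * s - 2\<close> is fixed at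
    the position \<open>Q\<close> of the wanted zero and \<open>2 * s - 1\<close> varies by 1/8
    around its square, so the parabola is the square of the distance to \<open>Q\<close> plus a
    small shift \<open>\<xi> s\<close>. One duplicated coordinate is 1, the others are 0.\<close>
  define lo where "lo r = (if r < 2 * k - 2 then if even r then Q r else (Q r)\<^sup>2 - 1/8 else if r = 2 * k - 2 then 1 else 0)" for r
  define hi where "hi r = (if r < 2 * k - 2 then if even r then Q r else (Q r)\<^sup>2 + 1/8 else if r = 2 * k - 2 \<or> r = \<kappa> then 1 else 0)" for r
  define X where "X = {c. \<forall>r\<in>{..<d}. lo r \<le> b r \<bullet> c \<and> b r \<bullet> c \<le> hi r}"
  have lo_pos: "0 < lo r" if "r < 2 * k - 1" for r
  proof -
    have "0 < (Q r)\<^sup>2 - 1/8 \<and> 0 < Q r" if "r < 2 * k - 2"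
    proof -
      have "1\<^sup>2 \<le> (Q r)\<^sup>2" using Qr[OF that] by (intro power_mono) auto
      then have "0 < (Q r)\<^sup>2 - 1/8" unfolding power_one by linarith
      then show ?thesis using Qr[OF that] by linarith
    qed
    then show ?thesis using that unfolding lo_def by (cases "r < 2 * k - 2"; cases "even r") auto
  qed
  have lo_nonneg: "0 \<le> lo r" for r using lo_pos[of r] by (cases "r < 2 * k - 1") (auto simp: lo_def)
  have lohi: "lo r \<le> hi r" for r by (simp add: lo_def hi_def)
  have hi_le: "hi r \<le> (if r < 2 * k - 2 then (real l + 1)\<^sup>2 else 0) + (if r = 2 * k - 2 then 1 else 0) + (if r = \<kappa> then 1 else 0)" for r
  proof -
    have "(Q r)\<^sup>2 + 1/8 \<le> (real l + 1)\<^sup>2 \<and> Q r \<le> (real l + 1)\<^sup>2" if "r < 2 * k - 2"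
    proof -
      have "(Q r)\<^sup>2 \<le> (real l)\<^sup>2" using Qr[OF that] by (intro power_mono) auto
      moreover have "(real l + 1)\<^sup>2 = (real l)\<^sup>2 + 2 * real l + 1" by (simp add: power2_eq_square algebra_simps)
      moreover have "Q r \<le> real l" "0 \<le> (real l)\<^sup>2" using Qr[OF that] by auto
      ultimately show ?thesis by (intro conjI) linarith+
    qed
    then show ?thesis by (auto simp: hi_def)
  qed
  have hi_nonneg: "0 \<le> hi r" for r using lo_nonneg[of r] lohi[of r] by linarith
  have XD: "lo r \<le> b r \<bullet> c \<and> b r \<bullet> c \<le> hi r" if "c \<in> X" "r < d" for r c using that by (simp add: X_def)
  have absX: "\<bar>b r \<bullet> c\<bar> = b r \<bullet> c" "\<bar>b r \<bullet> c\<bar> \<le> hi r" "lo r \<le> b r \<bullet> c" if "c \<in> X" "r < d" for r c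
    using XD[OF that] lo_nonneg[of r] by linarith+
  have sumX: "0 \<le> coord_sum c \<and> coord_sum c \<le> C" if "c \<in> X" for c
  proof -
    have "coord_sum c \<le> (\<Sum>r<d. (if r < 2 * k - 2 then (real l + 1)\<^sup>2 else 0) + (if r = 2 * k - 2 then 1 else 0) + (if r = \<kappa> then 1 else 0))"
      unfolding coord_sum_def using absX(2)[OF that] hi_le by (intro sum_mono) (meson lessThan_iff order_trans)
    also have "\<dots> \<le> real (2 * k - 2) * (real l + 1)\<^sup>2 + 1 + 1"
    proof -
      have "(\<Sum>r<d. if r < 2 * k - 2 then (real l + 1)\<^sup>2 else 0) = (\<Sum>r<2 * k - 2. (real l + 1)\<^sup>2)"
        using k2 kappa_Suc by (intro sum.mono_neutral_cong_right) auto
      then show ?thesis using k2 kappa_Suc by (simp add: sum.distrib)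
    qed
    also have "\<dots> \<le> C"
    proof -
      define w where "w = (real l + 1)\<^sup>2"
      have "real (2 * k - 2) * w \<le> (2 * real k) * w" unfolding w_def by (intro mult_right_mono) auto
      moreover have "1 \<le> w" "0 \<le> real k * w" by (simp_all add: w_def)
      moreover have "C = 10 * (real k * w) + 10 * w" by (simp add: C_def w_def algebra_simps)
      ultimately show ?thesis unfolding w_def[symmetric] by linarith
    qed
    finally show ?thesis by (simp add: coord_sum_def sum_nonneg)
  qed
  define \<xi> where "\<xi> s c = b (2 * s - 1) \<bullet> c - (real (q s) + 1)\<^sup>2" for s c
  have \<xi>: "\<bar>\<xi> s c\<bar> \<le> 1/8" if "c \<in> X" "1 \<le> s" "s < k" for s c
  proof -
    have r: "2 * s - 1 < 2 * k - 2" "odd (2 * s - 1)" "(2 * s - 1) div 2 + 1 = s" "2 * s - 1 < d" using that k2 kappa_Suc by auto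
    then have "lo (2 * s - 1) = (real (q s) + 1)\<^sup>2 - 1/8" "hi (2 * s - 1) = (real (q s) + 1)\<^sup>2 + 1/8"
      by (simp_all add: lo_def hi_def Q_def)
    then show ?thesis using XD[OF that(1) r(4)] unfolding \<xi>_def by linarith
  qed
  have nodes: "node_sum k l j c = (if j div l = 0 then 1 else (real (j mod l) - real (q (j div l)))\<^sup>2 + \<xi> (j div l) c)"
    if c: "c \<in> X" and j: "j < L" for j c
  proof -
    define s where "s = j div l"
    define m where "m = real (j mod l) + 1"
    have sk: "s < k" using j l by (simp add: s_def L_def less_mult_imp_div_less)
    have top: "b (2 * k - 2) \<bullet> c = 1" using XD[OF c, of "2 * k - 2"] k2 kappa_Suc by (simp add: lo_def hi_def)
    have dup: "b r \<bullet> c = 0" if "2 * k - 2 < r" "r < \<kappa>" for r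
      using XD[OF c, of r] that kappa_Suc by (simp add: lo_def hi_def)
    have "node k l j r * \<bar>b r \<bullet> c\<bar> = (if r = 2 * k - 2 then (if s = 0 then 1 else m\<^sup>2) else 0)
        + (if r = 2 * s - 2 then (if 1 \<le> s then - 2 * m * (b r \<bullet> c) else 0) else 0)
        + (if r = 2 * s - 1 then (if 1 \<le> s then b r \<bullet> c else 0) else 0)" if r: "r < d" for r
    proof -
      have a1: "\<bar>b r \<bullet> c\<bar> = b r \<bullet> c" by (rule absX(1)[OF c r])
      consider "r < 2 * k - 2" | "r = 2 * k - 2" | "2 * k - 2 < r" "r < \<kappa>" | "r = \<kappa>" using r kappa_Suc by linarith
      then show ?thesis
      proof cases
        case 1
        then show ?thesis unfolding a1 node_def s_def[symmetric] m_def[symmetric] by auto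
      next
        case 2
        then show ?thesis using k2 top sk unfolding a1 node_def s_def[symmetric] m_def[symmetric] by auto
      next
        case 3
        then show ?thesis using dup[OF 3] sk unfolding a1 by auto
      next
        case 4
        then show ?thesis using k2 sk unfolding a1 node_def s_def[symmetric] m_def[symmetric] by auto
      qed
    qed
    then have "node_sum k l j c = (\<Sum>r<d. (if r = 2 * k - 2 then (if s = 0 then 1 else m\<^sup>2) else 0)
        + (if r = 2 * s - 2 then (if 1 \<le> s then - 2 * m * (b r \<bullet> c) else 0) else 0)
        + (if r = 2 * s - 1 then (if 1 \<le> s then b r \<bullet> c else 0) else 0))"
      unfolding node_sum_def by (intro sum.cong) auto
    also have "\<dots> = (if s = 0 then 1 else m\<^sup>2) + (if 1 \<le> s then - 2 * m * (b (2 * s - 2) \<bullet> c) else 0)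
        + (if 1 \<le> s then b (2 * s - 1) \<bullet> c else 0)"
    proof -
      have "2 * k - 2 < d" "2 * s - 2 < d" "2 * s - 1 < d" using k2 kappa_Suc sk by auto
      then show ?thesis by (simp add: sum.distrib)
    qed
    finally have ns: "node_sum k l j c = (if s = 0 then 1 else m\<^sup>2) + (if 1 \<le> s then - 2 * m * (b (2 * s - 2) \<bullet> c) else 0)
        + (if 1 \<le> s then b (2 * s - 1) \<bullet> c else 0)" .
    show ?thesis
    proof (cases "s = 0")
      case True
      then show ?thesis using ns by (simp add: s_def)
    next
      case False
      have r: "2 * s - 2 < 2 * k - 2" "even (2 * s - 2)" "(2 * s - 2) div 2 + 1 = s" "2 * s - 2 < d"
        using sk k2 kappa_Suc False by auto
      then have "b (2 * s - 2) \<bullet> c = real (q s) + 1"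
        using XD[OF c, of "2 * s - 2"] by (simp add: lo_def hi_def Q_def)
      then have "node_sum k l j c = m\<^sup>2 - 2 * m * (real (q s) + 1) + (\<xi> s c + (real (q s) + 1)\<^sup>2)"
        using ns False by (simp add: \<xi>_def)
      also have "\<dots> = (m - (real (q s) + 1))\<^sup>2 + \<xi> s c" by (simp add: power2_eq_square algebra_simps)
      finally show ?thesis using False by (simp add: m_def s_def)
    qed
  qed
  have node_bound: "\<bar>node_sum k l j c\<bar> \<le> C - 1" if c: "c \<in> X" and j: "j < L" for j c
  proof (cases "j div l = 0")
    case True
    then show ?thesis using nodes[OF c j] C by simp
  next
    case False
    then have s: "1 \<le> j div l" "j div l < k" using j l by (auto simp: L_def less_mult_imp_div_less)
    have "real (q (j div l)) \<le> real l" "real (j mod l) \<le> real l" using q[OF s] l mod_less_divisor[of l j] by auto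
    then have "\<bar>real (j mod l) - real (q (j div l))\<bar> \<le> \<bar>real l\<bar>" by linarith
    then have "(real (j mod l) - real (q (j div l)))\<^sup>2 \<le> (real l)\<^sup>2" by (simp only: abs_le_square_iff)
    moreover have "\<bar>\<xi> (j div l) c\<bar> \<le> 1/8" by (rule \<xi>[OF c s])
    moreover have "(real l)\<^sup>2 + 2 \<le> C"
    proof -
      have "10 * 1 * (real l + 1)\<^sup>2 \<le> C" unfolding C_def by (intro mult_right_mono) auto
      moreover have "(real l + 1)\<^sup>2 = (real l)\<^sup>2 + 2 * real l + 1" by (simp add: power2_eq_square algebra_simps)
      ultimately show ?thesis using zero_le_power2[of "real l"] by linarith
    qed
    moreover have "0 \<le> (real (j mod l) - real (q (j div l)))\<^sup>2" by simp
    moreover have "node_sum k l j c = (real (j mod l) - real (q (j div l)))\<^sup>2 + \<xi> (j div l) c"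
      using nodes[OF c j] False by simp
    ultimately show ?thesis by linarith
  qed
  define f where "f j c = node_sum k l j c - t (d + j) * coord_sum c" for j c
  have tc: "0 \<le> t i * coord_sum c \<and> t i * coord_sum c \<le> 1/16" if "c \<in> X" for i c
  proof -
    have "t i * coord_sum c \<le> (1 / (16 * C)) * C" using t[of i] sumX[OF that] C by (intro mult_mono) auto
    then show ?thesis using t[of i] sumX[OF that] C by simp
  qed
  define Z where "Z j c = descent f L \<sigma> K (L - j) c" for j c
  have Z_L: "Z L c = 1" for c by (simp add: Z_def)
  have Z_step: "Z j c = f j c + \<sigma> (Suc j) * Z (Suc j) c / K" if jL: "j < L" for j c
  proof -
    obtain m where m: "L - j = Suc m" using Suc_diff_Suc[OF jL] by metis
    then have "L - Suc m = j" "L - m = Suc j" "L - Suc j = m" using jL by auto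
    then show ?thesis using m by (simp add: Z_def)
  qed
  have Z_bound: "\<bar>Z j c\<bar> \<le> 2 * (C + 1)" if "c \<in> X" "j \<le> L" for j c
    using that(2)
  proof (induction "L - j" arbitrary: j)
    case 0
    then show ?case using Z_L C by simp
  next
    case (Suc m)
    then have jL: "j < L" by simp
    have "\<bar>Z (Suc j) c\<bar> \<le> 2 * (C + 1)" using Suc by (intro Suc.hyps(1)) auto
    then have "\<bar>\<sigma> (Suc j) * Z (Suc j) c / K\<bar> \<le> 2 * (C + 1) / K"
      using \<sigma>[of "Suc j"] K by (auto simp: abs_mult divide_right_mono)
    also have "\<dots> = 1/16" using C by (simp add: K_def)
    finally have "\<bar>\<sigma> (Suc j) * Z (Suc j) c / K\<bar> \<le> 1/16" .
    moreover define w where "w = \<sigma> (Suc j) * Z (Suc j) c / K"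
    ultimately have "\<bar>w\<bar> \<le> 1/16" by simp
    moreover have "\<bar>f j c\<bar> \<le> C - 1 + 1/16"
    proof -
      define v where "v = t (d + j) * coord_sum c"
      then have "0 \<le> v" "v \<le> 1/16" using tc[OF that(1), of "d + j"] by auto
      then show ?thesis using node_bound[OF that(1) jL] unfolding f_def v_def[symmetric] by linarith
    qed
    moreover have "Z j c = f j c + w" using Z_step[OF jL, of c] by (simp add: w_def)
    then have "\<bar>Z j c\<bar> \<le> \<bar>f j c\<bar> + \<bar>w\<bar>" using abs_triangle_ineq[of "f j c" w] by simp
    ultimately show ?case using C by argo
  qed
  have Z_near: "\<bar>Z j c - node_sum k l j c\<bar> \<le> 1/8" if "c \<in> X" "j < L" for j c
  proof -
    have "\<bar>Z (Suc j) c\<bar> \<le> 2 * (C + 1)" using Z_bound[OF that(1), of "Suc j"] that(2) by simp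
    then have "\<bar>\<sigma> (Suc j) * Z (Suc j) c / K\<bar> \<le> 2 * (C + 1) / K"
      using \<sigma>[of "Suc j"] K by (auto simp: abs_mult divide_right_mono)
    also have "\<dots> = 1/16" using C by (simp add: K_def)
    finally have "\<bar>\<sigma> (Suc j) * Z (Suc j) c / K\<bar> \<le> 1/16" .
    moreover define w where "w = \<sigma> (Suc j) * Z (Suc j) c / K"
    ultimately have "\<bar>w\<bar> \<le> 1/16" by simp
    moreover define v where "v = t (d + j) * coord_sum c"
    then have "0 \<le> v" "v \<le> 1/16" using tc[OF that(1), of "d + j"] by auto
    moreover have "Z j c = node_sum k l j c - v + w" using Z_step[OF that(2), of c] by (simp add: w_def v_def f_def)
    ultimately show ?thesis by linarith
  qed
  have contZ: "continuous_on UNIV (Z j)" for j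
  proof -
    have "continuous_on UNIV (f j)" for j
      unfolding f_def node_sum_def coord_sum_def by (intro continuous_intros)
    then show ?thesis unfolding Z_def by (intro continuous_on_descent) auto
  qed
  \<comment> \<open>A fixed point makes \<open>Z\<close> vanish at the prescribed node of each block
    and starts the chain with \<open>Z 0 / K\<close>. On \<open>X\<close> the value of
    \<open>Z\<close> at such a node differs from \<open>\<xi> s\<close> by at most 1/8, so
    \<open>X\<close> is mapped into itself.\<close>
  define F where "F c = vec (\<lambda>r. if r < 2 * k - 2 \<and> odd r then b r \<bullet> c - Z ((r div 2 + 1) * l + q (r div 2 + 1)) c
      else if r = \<kappa> then Z 0 c / K else lo r)" for c
  have L0: "0 < L" using k l by (simp add: L_def)
  have jz: "s * l + q s < L" "(s * l + q s) div l = s" "(s * l + q s) mod l = q s" if "1 \<le> s" "s < k" for s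
  proof -
    have "q s < l" by (rule q[OF that])
    moreover have "s * l + l \<le> k * l" using that by (metis Suc_leI add.commute mult_Suc mult_le_mono1)
    ultimately show "s * l + q s < L" "(s * l + q s) div l = s" "(s * l + q s) mod l = q s" using l by (auto simp: L_def)
  qed
  have "\<exists>c\<in>X. F c = c"
  proof -
    have Xeq: "X = (\<Inter>r\<in>{..<d}. {c. lo r \<le> b r \<bullet> c} \<inter> {c. b r \<bullet> c \<le> hi r})" by (auto simp: X_def)
    have "closed X" unfolding Xeq by (intro closed_INT ballI closed_Int closed_halfspace_ge closed_halfspace_le)
    moreover have "bounded X" unfolding bounded_iff
    proof (intro exI ballI)
      fix c assume c: "c \<in> X"
      have "norm c = norm (\<Sum>r<d. (b r \<bullet> c) *\<^sub>R b r)" using vec_coords[of c] by (simp add: vec_def)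
      also have "\<dots> \<le> (\<Sum>r<d. norm ((b r \<bullet> c) *\<^sub>R b r))" by (rule norm_sum)
      also have "\<dots> = coord_sum c" unfolding coord_sum_def using b_Basis by (intro sum.cong) auto
      finally show "norm c \<le> C" using sumX[OF c] by linarith
    qed
    ultimately have "compact X" by (simp add: compact_eq_bounded_closed)
    moreover have "convex X" unfolding Xeq by (intro convex_INT convex_Int convex_halfspace_ge convex_halfspace_le)
    moreover have "X \<noteq> {}"
    proof -
      have "vec lo \<in> X" using lohi by (simp add: X_def inner_vec)
      then show ?thesis by blast
    qed
    moreover have "continuous_on X F"
    proof -
      have "continuous_on UNIV (\<lambda>c. if r < 2 * k - 2 \<and> odd r then b r \<bullet> c - Z ((r div 2 + 1) * l + q (r div 2 + 1)) c
        else if r = \<kappa> then Z 0 c / K else lo r)" for r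
        using contZ K by (cases "r < 2 * k - 2 \<and> odd r"; cases "r = \<kappa>") (auto simp: divide_inverse intro!: continuous_intros)
      then have "continuous_on UNIV F" unfolding F_def vec_def by (intro continuous_intros)
      then show ?thesis by (rule continuous_on_subset) simp
    qed
    moreover have "F \<in> X \<rightarrow> X"
    proof
      fix c assume c: "c \<in> X"
      have "lo r \<le> b r \<bullet> F c \<and> b r \<bullet> F c \<le> hi r" if r: "r < d" for r
      proof -
        consider "r < 2 * k - 2" "odd r" | "r = \<kappa>" | "\<not> (r < 2 * k - 2 \<and> odd r)" "r \<noteq> \<kappa>" by blast
        then show ?thesis
        proof cases
          case 1
          define s where "s = r div 2 + 1"
          have s: "1 \<le> s" "s < k" "r = 2 * s - 1" using 1 by (auto simp: s_def elim!: oddE)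
          have "node_sum k l (s * l + q s) c = \<xi> s c" using nodes[OF c jz(1)[OF s(1,2)]] jz(2,3)[OF s(1,2)] s by simp
          then have "\<bar>Z (s * l + q s) c - \<xi> s c\<bar> \<le> 1/8" using Z_near[OF c jz(1)[OF s(1,2)]] by simp
          moreover have "b r \<bullet> F c = b r \<bullet> c - Z (s * l + q s) c" using 1 r by (simp add: F_def inner_vec s_def)
          moreover have "Q r = real (q s) + 1" by (simp add: Q_def s_def)
          then have "b r \<bullet> c = (Q r)\<^sup>2 + \<xi> s c" unfolding \<xi>_def s(3)[symmetric] by simp
          ultimately have "\<bar>b r \<bullet> F c - (Q r)\<^sup>2\<bar> \<le> 1/8" by linarith
          moreover have "lo r = (Q r)\<^sup>2 - 1/8" "hi r = (Q r)\<^sup>2 + 1/8" using 1 by (simp_all add: lo_def hi_def)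
          ultimately show ?thesis by linarith
        next
          case 2
          have "\<bar>Z 0 c - 1\<bar> \<le> 1/8" using Z_near[OF c L0] nodes[OF c L0] by simp
          then have "0 \<le> Z 0 c" "Z 0 c \<le> 2" by linarith+
          then have "0 \<le> Z 0 c / K" "Z 0 c / K \<le> 1" using K by (auto simp: divide_le_eq)
          moreover have "b r \<bullet> F c = Z 0 c / K" using 2 r k2 by (simp add: F_def inner_vec)
          ultimately show ?thesis using 2 k2 by (simp add: lo_def hi_def)
        next
          case 3
          then show ?thesis using r lohi[of r] by (auto simp: F_def inner_vec)
        qed
      qed
      then show "F c \<in> X" by (simp add: X_def)
    qed
    ultimately show ?thesis using brouwer[of X F] by blast
  qed
  then obtain c where c: "c \<in> X" "F c = c" by blast
  have cr: "b r \<bullet> c = (if r < 2 * k - 2 \<and> odd r then b r \<bullet> c - Z ((r div 2 + 1) * l + q (r div 2 + 1)) c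
      else if r = \<kappa> then Z 0 c / K else lo r)" (is "_ = ?G r c") if "r < d" for r
  proof -
    have "b r \<bullet> c = b r \<bullet> F c" by (simp only: c(2))
    also have "\<dots> = ?G r c" unfolding F_def by (rule inner_vec[OF that])
    finally show ?thesis .
  qed
  have Z0: "Z (s * l + q s) c = 0" if s: "1 \<le> s" "s < k" for s
  proof -
    have r: "2 * s - 1 < 2 * k - 2" "odd (2 * s - 1)" "(2 * s - 1) div 2 + 1 = s" "2 * s - 1 < d" using s k2 kappa_Suc by auto
    then show ?thesis using cr[of "2 * s - 1"] by simp
  qed
  \<comment> \<open>At any other node of a block the parabola is at least \<open>1 - 1/8\<close>,
    which exceeds the error 1/8 in \<open>Z\<close>; the nodes of block 0 have value 1.\<close>
  have Zpos: "0 < Z j c" if j: "j \<le> L" and nz: "\<not> (\<exists>s. 1 \<le> s \<and> s < k \<and> j = s * l + q s)" for j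
  proof (cases "j = L")
    case False
    then have jL: "j < L" using j by simp
    have "node_sum k l j c \<ge> 7/8"
    proof (cases "j div l = 0")
      case True
      then show ?thesis using nodes[OF c(1) jL] by simp
    next
      case False
      then have s: "1 \<le> j div l" "j div l < k" using jL l by (auto simp: L_def less_mult_imp_div_less)
      have "j = (j div l) * l + j mod l" by simp
      then have "j mod l \<noteq> q (j div l)" using nz s by metis
      then have "1 \<le> \<bar>real (j mod l) - real (q (j div l))\<bar>" by linarith
      then have "1 \<le> (real (j mod l) - real (q (j div l)))\<^sup>2" using power_mono[of 1 "\<bar>real (j mod l) - real (q (j div l))\<bar>" 2] by simp
      moreover have "node_sum k l j c = (real (j mod l) - real (q (j div l)))\<^sup>2 + \<xi> (j div l) c"
        using nodes[OF c(1) jL] False by simp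
      ultimately show ?thesis using \<xi>[OF c(1) s] by linarith
    qed
    then show ?thesis using Z_near[OF c(1) jL] by linarith
  qed (simp add: Z_L)
  have Znn: "0 \<le> Z j c" if "j \<le> L" for j using Zpos[OF that] Z0 by force
  have y\<kappa>: "y \<kappa> c = Z 0 c / K"
  proof -
    have "y \<kappa> c = b \<kappa> \<bullet> c" using kappa by (simp add: y_def plf_perturbed_low)
    then show ?thesis using cr[OF kappa(1)] k2 by simp
  qed
  \<comment> \<open>At \<open>j = 0\<close> the value is the special coordinate itself, which is
    positive whatever \<open>\<sigma> 0\<close> is; the prescribed signs start at
    \<open>j = 1\<close>.\<close>
  have yj: "y (\<kappa> + j) c = (if j = 0 then 1 else \<sigma> j) * Z j c / K" if "j \<le> L" for j
    using that
  proof (induction j)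
    case 0
    then show ?case using y\<kappa> by simp
  next
    case (Suc j)
    have "\<bar>(if j = 0 then 1 else \<sigma> j) * Z j c / K\<bar> = Z j c / K"
      using \<sigma>[of j] Znn[of j] Suc.prems K by (auto simp: abs_mult)
    then have "K * \<bar>y (\<kappa> + j) c\<bar> = Z j c" using Suc K by simp
    moreover have "y (\<kappa> + Suc j) c = K * \<bar>y (\<kappa> + j) c\<bar> - f j c"
      using plf_inner[of k l K t j c] kappa_Suc by (simp add: y_def f_def)
    moreover have "Z j c = f j c + \<sigma> (Suc j) * Z (Suc j) c / K" using Z_step[of j c] Suc.prems by simp
    ultimately show ?case by simp
  qed
  show ?thesis
  proof (intro exI[of _ c] conjI allI impI)
    show "c \<in> coord_space ({..<2 * k - 1} \<union> {\<kappa>})"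
      unfolding coord_space_def
    proof (intro CollectI allI impI)
      fix r assume "r < d" "r \<notin> {..<2 * k - 1} \<union> {\<kappa>}"
      then have r: "r < d" "\<not> (r < 2 * k - 2 \<and> odd r)" "r \<noteq> \<kappa>" "\<not> r < 2 * k - 1" by auto
      then have "b r \<bullet> c = lo r" using cr[OF r(1)] by (simp only: if_False)
      then show "b r \<bullet> c = 0" using r k by (auto simp: lo_def)
    qed
    show "0 < b r \<bullet> c" if "r < 2 * k - 1" for r
    proof -
      have "r < d" using that k2 kappa_Suc by linarith
      then show ?thesis using absX(3)[OF c(1), of r] lo_pos[OF that] by linarith
    qed
    have "0 < Z 0 c"
    proof (rule Zpos)
      show "\<not> (\<exists>s. 1 \<le> s \<and> s < k \<and> 0 = s * l + q s)" using l by auto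
    qed simp
    then show "0 < b \<kappa> \<bullet> c" using cr[OF kappa(1)] k2 K by simp
    fix j assume j: "1 \<le> j" "j \<le> k * l"
    then have jL: "j \<le> L" by (simp add: L_def)
    show "sgn (y (\<kappa> + j) c) = (if \<exists>s. 1 \<le> s \<and> s < k \<and> j = s * l + q s then 0 else \<sigma> j)"
    proof (cases "\<exists>s. 1 \<le> s \<and> s < k \<and> j = s * l + q s")
      case True
      then have "Z j c = 0" using Z0 by blast
      then show ?thesis using yj[OF jL] True by simp
    next
      case False
      have "y (\<kappa> + j) c = \<sigma> j * (Z j c / K)" using yj[OF jL] j by simp
      moreover have "0 < Z j c / K" using Zpos[OF jL False] K by simp
      ultimately have "sgn (y (\<kappa> + j) c) = sgn (\<sigma> j)" by (simp only: sgn_mult sgn_pos mult_1_right)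
      then show ?thesis using False \<sigma>[of j] by auto
    qed
  qed
qed

end

section \<open>Block polytopes\<close>

text \<open>A sign vector is determined by its set of zeros and its set of ones. The resulting upper
  bound has, up to factors depending on \<open>k\<close>, the order that
  \<open>pattern_exists\<close> attains for \<open>k - 1\<close> zeros.\<close>

lemma card_sign_refinements_le:
  assumes "finite J"
  shows "card {s \<in> sign_refinements J (\<lambda>_. 0). card {j\<in>J. s j = 0} = i} \<le> card J ^ i * 2 ^ card J"
proof -
  define f where "f s = ({j\<in>J. s j = 0}, {j\<in>J. s j = (1::real)})" for s
  let ?A = "{s \<in> sign_refinements J (\<lambda>_. 0). card {j\<in>J. s j = 0} = i}"
  have "inj_on f ?A"
  proof (rule inj_onI)
    fix s s' assume s: "s \<in> ?A" "s' \<in> ?A" "f s = f s'"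
    show "s = s'"
    proof
      fix j
      have e: "{j\<in>J. s j = 0} = {j\<in>J. s' j = 0}" "{j\<in>J. s j = 1} = {j\<in>J. s' j = 1}"
        using s(3) by (simp_all add: f_def)
      have v: "s j = -1 \<or> s j = 0 \<or> s j = 1" "s' j = -1 \<or> s' j = 0 \<or> s' j = 1" "j \<notin> J \<Longrightarrow> s j = 0 \<and> s' j = 0"
        using s(1,2) by (cases "j \<in> J"; simp add: sign_refinements_def)+
      show "s j = s' j"
      proof (cases "j \<in> J")
        case True
        then have "s j = 0 \<longleftrightarrow> s' j = 0" "s j = 1 \<longleftrightarrow> s' j = 1" using e by blast+
        then show ?thesis using v(1,2) by argo
      qed (use v(3) in simp)
    qed
  qed
  moreover have "f ` ?A \<subseteq> {A. A \<subseteq> J \<and> card A = i} \<times> Pow J" by (auto simp: f_def)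
  moreover have fin: "finite ({A. A \<subseteq> J \<and> card A = i} \<times> Pow J)" using assms by simp
  ultimately have "card ?A \<le> card ({A. A \<subseteq> J \<and> card A = i} \<times> Pow J)" by (rule card_inj_on_le)
  also have "\<dots> = (card J choose i) * 2 ^ card J" using assms by (simp add: card_cartesian_product n_subsets card_Pow)
  also have "\<dots> \<le> card J ^ i * 2 ^ card J"
    using binomial_le_pow[of i "card J"] by (cases "i \<le> card J") (auto simp: binomial_eq_0)
  finally show ?thesis .
qed

text \<open>The polynomial form of \<open>pattern_gf\<close>, so that identities between values
  become identities between coefficients.\<close>

definition pattern_poly :: "(nat \<Rightarrow> 'a::euclidean_space) \<Rightarrow> (nat \<Rightarrow> nat \<Rightarrow> real) \<Rightarrow> 'a set \<Rightarrow> nat set \<Rightarrow> nat \<Rightarrow> real poly" where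
  "pattern_poly p a S J n = (\<Sum>s\<in>patterns p a S n. monom 1 (card {j\<in>J. s j = 0}))"

lemma poly_pattern_poly: "poly (pattern_poly p a S J n) x = pattern_gf p a S J n x"
  by (simp add: pattern_poly_def pattern_gf_def poly_sum poly_monom)

lemma coeff_pattern_poly:
  "coeff (pattern_poly p a S J n) i = real (card {s \<in> patterns p a S n. card {j\<in>J. s j = 0} = i})"
proof -
  have "coeff (pattern_poly p a S J n) i = (\<Sum>s\<in>patterns p a S n. if card {j\<in>J. s j = 0} = i then 1 else 0)"
    by (simp add: pattern_poly_def coeff_sum)
  also have "\<dots> = real (card {s \<in> patterns p a S n. card {j\<in>J. s j = 0} = i})"
    using finite_patterns[of p a S n] by (simp add: sum.If_cases Int_def)
  finally show ?thesis .
qed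

lemma degree_pattern_poly:
  assumes "generic p a S J n" "J \<subseteq> {..<n}"
  shows "degree (pattern_poly p a S J n) \<le> dim S - 1"
proof (rule degree_le, intro allI impI)
  fix i assume i: "dim S - 1 < i"
  have "{s \<in> patterns p a S n. card {j\<in>J. s j = 0} = i} = {}"
    using zeros_less_dim[OF assms(1) _ assms(2)] i by fastforce
  then show "coeff (pattern_poly p a S J n) i = 0" unfolding coeff_pattern_poly by (simp only: card.empty of_nat_0)
qed

lemma coeff_pattern_poly_le:
  assumes gen: "generic p a S J n" and J: "J \<subseteq> {..<n}"
  shows "coeff (pattern_poly p a S J n) i \<le> real (card J) ^ i * 2 ^ card J"
proof -
  have fJ: "finite J" using J finite_subset by blast
  have "patterns p a S n \<subseteq> sign_refinements J (\<lambda>_. 0)"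
  proof
    fix s assume s: "s \<in> patterns p a S n"
    then obtain c where c: "c \<in> S" "c \<noteq> 0" "\<forall>j<n. sgn (plf p a j c) = s j" by (rule patternE)
    have "s j = 0" if "j \<notin> J" for j
    proof (cases "j < n")
      case True
      then have "plf p a j c = 0" using gen c(1) that by (simp add: generic_def)
      then show ?thesis using c(3) True by (metis sgn_0)
    qed (use pattern_outside[OF s] in simp)
    then show "s \<in> sign_refinements J (\<lambda>_. 0)" using pattern_values[OF s] by (auto simp: sign_refinements_def)
  qed
  then have "card {s \<in> patterns p a S n. card {j\<in>J. s j = 0} = i} \<le> card {s \<in> sign_refinements J (\<lambda>_. 0). card {j\<in>J. s j = 0} = i}"
    using finite_sign_refinements[OF fJ] by (intro card_mono) auto
  also have "\<dots> \<le> card J ^ i * 2 ^ card J" by (rule card_sign_refinements_le[OF fJ])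
  finally have "real (card {s \<in> patterns p a S n. card {j\<in>J. s j = 0} = i}) \<le> real (card J ^ i * 2 ^ card J)" by (rule of_nat_mono)
  then show ?thesis by (simp only: coeff_pattern_poly of_nat_mult of_nat_power of_nat_numeral)
qed

context coordinates
begin

text \<open>\<open>V\<close> counts the patterns without duplicated coordinates and \<open>F\<close>
  those with one of them; \<open>U\<close> is the common part from
  \<open>pattern_gf_duplicates\<close>. The polytope itself carries all \<open>d + 1 - 2 * k\<close>
  duplicates. \<open>F\<close> lives in the even dimension \<open>2 * k\<close>, where the symmetry
  makes it odd; \<open>V\<close> lives in dimension \<open>2 * k - 1\<close>, where it is
  even.\<close>

lemma block_polytope:
  fixes k l :: nat
  assumes k: "1 \<le> k" "2 * k \<le> d" and l: "1 \<le> l"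
  obtains T \<sigma> \<gamma> \<tau> \<beta> and U V F :: "real poly"
  where "cubical T" "box_cap e T \<sigma> \<gamma>" "box_topped e T \<tau> \<beta>" "\<sigma> < \<tau>"
    and "\<And>i. i < d \<Longrightarrow> real (face_number T i) = coeff (([:2, 1:] ^ (d + 1 - 2 * k) - monom 1 (d + 1 - 2 * k)) * U + monom 1 (d + 1 - 2 * k) * V) i"
    and "F = smult 2 U + pCons 0 V"
    and "\<And>x. poly F x = - poly F (- 2 - x)" "\<And>x. poly V x = poly V (- 2 - x)" "poly V (-1) = 2"
    and "degree F \<le> 2 * k - 1" "degree V \<le> 2 * k - 2"
    and "\<And>i. 0 \<le> coeff F i \<and> coeff F i \<le> real (2 * k + k * l) ^ i * 2 ^ (2 * k + k * l)"
    and "\<And>i. 0 \<le> coeff V i \<and> coeff V i \<le> real (2 * k + k * l) ^ i * 2 ^ (2 * k + k * l)"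
    and "real l ^ (k - 1) * 2 ^ (k * l - (k - 1)) \<le> coeff F (k - 1)"
proof -
  define C where "C = 10 * (real k + 1) * (real l + 1)\<^sup>2"
  have C: "C > 0" by (simp add: C_def add_pos_pos)
  define K where "K = 32 * (C + 1)"
  define N where "N = d + k * l"
  have k2: "2 * k - 2 < \<kappa>" using k kappa_Suc by linarith
  obtain t where "(\<forall>i. 0 < t i \<and> t i < 1 / (16 * C)) \<and>
     (\<forall>B\<subseteq>{..<d}. generic p (perturbed (inner_coeff k l K) t) (coord_space B) (B \<union> {d..<N}) N)"
    using generic_perturbation[of N "1 / (16 * C)" "inner_coeff k l K"] C by (auto simp: N_def)
  then have t: "\<And>i. 0 < t i \<and> t i < 1 / (16 * C)"
    and gen: "\<And>B. B \<subseteq> {..<d} \<Longrightarrow> generic p (perturbed (inner_coeff k l K) t) (coord_space B) (B \<union> {d..<N}) N" by simp_all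
  define a where "a = perturbed (inner_coeff k l K) t"
  have out: "a j i = 0" if "i < d" for i j using that by (simp add: a_def perturbed_outer)
  define M where "M = {2 * k - 2..<\<kappa>}"
  define B0 where "B0 = {..<d} - M"
  have B0: "B0 = {..<2 * k - 2} \<union> {\<kappa>}" using k2 kappa_Suc by (auto simp: B0_def M_def)
  have M: "M \<subseteq> {..<d}" "2 * k - 2 \<in> M" using k2 kappa_Suc by (auto simp: M_def)
  have same: "a r i = a r' i" if "d \<le> i" "r \<in> M" "r' \<in> M" for i r r'
  proof -
    have "r < \<kappa>" "r' < \<kappa>" "2 * k - 2 \<le> r" "2 * k - 2 \<le> r'" using that by (auto simp: M_def)
    then have r: "r < d" "r' < d" "Suc r \<noteq> i" "Suc r' \<noteq> i" "node k l (i - d) r = node k l (i - d) r'"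
      using that(1) kappa_Suc by (auto simp: node_def)
    then show ?thesis using that(1) unfolding a_def perturbed_def inner_coeff_def by (simp only: if_True if_False simp_thms)
  qed
  have "\<exists>U :: (nat \<Rightarrow> real) set. \<forall>M'. M' \<subseteq> M \<longrightarrow> M' \<noteq> {} \<longrightarrow> (\<forall>x. pattern_gf p a (coord_space (B0 \<union> M')) (B0 \<union> M' \<union> {d..<N}) N x
      = ((x + 2) ^ card M' - x ^ card M') * (\<Sum>\<rho>\<in>U. x ^ card {j \<in> B0 \<union> {d..<N}. \<rho> j = 0})
        + x ^ card M' * pattern_gf p a (coord_space B0) (B0 \<union> {d..<N}) N x)"
  proof (rule pattern_gf_duplicates)
    show "a j i = 0" if "i < d" "j < i" for i j by (rule out[OF that(1)])
    show "d \<le> N" by (simp add: N_def)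
  qed (rule M(1), erule (2) same, rule B0_def)
  then obtain W :: "(nat \<Rightarrow> real) set" where W: "\<And>M' x. M' \<subseteq> M \<Longrightarrow> M' \<noteq> {} \<Longrightarrow> pattern_gf p a (coord_space (B0 \<union> M')) (B0 \<union> M' \<union> {d..<N}) N x
      = ((x + 2) ^ card M' - x ^ card M') * (\<Sum>\<rho>\<in>W. x ^ card {j \<in> B0 \<union> {d..<N}. \<rho> j = 0})
        + x ^ card M' * pattern_gf p a (coord_space B0) (B0 \<union> {d..<N}) N x" by blast
  define U :: "real poly" where "U = (\<Sum>\<rho>\<in>W. monom 1 (card {j \<in> B0 \<union> {d..<N}. \<rho> j = 0}))"
  define V where "V = pattern_poly p a (coord_space B0) (B0 \<union> {d..<N}) N"
  define B1 where "B1 = B0 \<union> {2 * k - 2}"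
  define F where "F = pattern_poly p a (coord_space B1) (B1 \<union> {d..<N}) N"
  have pU: "poly U x = (\<Sum>\<rho>\<in>W. x ^ card {j \<in> B0 \<union> {d..<N}. \<rho> j = 0})" for x by (simp add: U_def poly_sum poly_monom)
  have pV: "poly V x = pattern_gf p a (coord_space B0) (B0 \<union> {d..<N}) N x" for x by (simp add: V_def poly_pattern_poly)
  have B0d: "B0 \<subseteq> {..<d}" and B1d: "B1 \<subseteq> {..<d}" using k2 kappa_Suc by (auto simp: B0_def B1_def)
  have cB0: "card B0 = 2 * k - 1" unfolding B0 using k2 k by simp
  have cB1: "card B1 = 2 * k" unfolding B1_def using cB0 B0 k2 k by simp
  have J0: "B0 \<union> {d..<N} \<subseteq> {..<N}" and J1: "B1 \<union> {d..<N} \<subseteq> {..<N}" using B0d B1d by (auto simp: N_def)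
  have cJ: "card (B \<union> {d..<N}) = card B + k * l" if "B \<subseteq> {..<d}" for B
  proof -
    have "finite B" "B \<inter> {d..<N} = {}" using that finite_subset by auto
    then show ?thesis by (simp add: card_Un_disjoint N_def)
  qed
  have g0: "generic p a (coord_space B0) (B0 \<union> {d..<N}) N" and g1: "generic p a (coord_space B1) (B1 \<union> {d..<N}) N"
    unfolding a_def using gen B0d B1d by blast+
  have dim0: "dim (coord_space B0) = 2 * k - 1" and dim1: "dim (coord_space B1) = 2 * k"
    using dim_coord_space B0d B1d cB0 cB1 by auto
  have nz: "\<exists>j<N. plf p a j c \<noteq> 0" if "c \<in> S - {0}" for S c
    using plf_nonzero_coord[of a N c S] out that by (simp add: N_def)
  have F: "F = smult 2 U + pCons 0 V"
  proof -
    have "poly F x = poly (smult 2 U + pCons 0 V) x" for x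
      using W[of "{2 * k - 2}" x] M by (simp add: F_def poly_pattern_poly B1_def pU pV algebra_simps)
    then show ?thesis by (intro poly_eq_poly_eq_iff[THEN iffD1] ext)
  qed
  have symF: "poly F x = - poly F (- 2 - x)" for x
  proof -
    have "odd (2 * k - 1)" using k by simp
    then show ?thesis using pattern_gf_symmetric[OF g1 J1 nz[of _ "coord_space B1"], of x] by (simp add: F_def poly_pattern_poly dim1)
  qed
  have symV: "poly V x = poly V (- 2 - x)" for x
    using pattern_gf_symmetric[OF g0 J0 nz[of _ "coord_space B0"], of x] by (simp add: pV dim0)
  have V1: "poly V (-1) = 2"
  proof -
    have "odd (2 * k - 1)" using k by simp
    then show ?thesis using pattern_gf_minus_one[OF g0 J0 nz[of _ "coord_space B0"]] by (simp add: pV dim0)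
  qed
  have boundV: "0 \<le> coeff V i \<and> coeff V i \<le> real (2 * k + k * l) ^ i * 2 ^ (2 * k + k * l)" for i
  proof -
    have "coeff V i \<le> real (2 * k - 1 + k * l) ^ i * 2 ^ (2 * k - 1 + k * l)"
      unfolding V_def using coeff_pattern_poly_le[OF g0 J0, of i] cJ[OF B0d] cB0 by simp
    also have "\<dots> \<le> real (2 * k + k * l) ^ i * 2 ^ (2 * k + k * l)" by (intro mult_mono power_mono power_increasing) auto
    finally show ?thesis by (simp add: V_def coeff_pattern_poly)
  qed
  have boundF: "0 \<le> coeff F i \<and> coeff F i \<le> real (2 * k + k * l) ^ i * 2 ^ (2 * k + k * l)" for i
    using coeff_pattern_poly_le[OF g1 J1, of i] cJ[OF B1d] cB1 by (simp add: F_def) (simp add: coeff_pattern_poly)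
  have lower: "real l ^ (k - 1) * 2 ^ (k * l - (k - 1)) \<le> coeff F (k - 1)"
  proof -
    \<comment> \<open>One zero is placed freely in each of the blocks 1 to \<open>k - 1\<close>, and
      all other inner functions get arbitrary signs; \<open>pattern_exists\<close> realizes every
      such choice.\<close>
    define Qs where "Qs = Pi\<^sub>E {1..<k} (\<lambda>_. {..<l})"
    define rows where "rows = {d..<N}"
    define Zq where "Zq q = (\<lambda>s. \<kappa> + (s * l + q s)) ` {1..<k}" for q :: "nat \<Rightarrow> nat"
    have qd: "(s * l + q s) div l = s" if "q \<in> Qs" "s \<in> {1..<k}" for q s
    proof -
      have "q s < l" using that by (auto simp: Qs_def PiE_def Pi_def)
      then show ?thesis by simp
    qed
    have injZ: "inj_on (\<lambda>s. \<kappa> + (s * l + q s)) {1..<k}" if "q \<in> Qs" for q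
    proof (rule inj_onI)
      fix s s' assume s: "s \<in> {1..<k}" "s' \<in> {1..<k}" "\<kappa> + (s * l + q s) = \<kappa> + (s' * l + q s')"
      have "s = (s * l + q s) div l" by (rule qd[OF that s(1), symmetric])
      also have "\<dots> = (s' * l + q s') div l" using s(3) by (simp only: add_left_cancel)
      also have "\<dots> = s'" by (rule qd[OF that s(2)])
      finally show "s = s'" .
    qed
    have cZ: "card (Zq q) = k - 1" if "q \<in> Qs" for q unfolding Zq_def using card_image[OF injZ[OF that]] by simp
    have Zrows: "Zq q \<subseteq> rows" if q: "q \<in> Qs" for q
    proof
      fix i assume "i \<in> Zq q"
      then obtain s where s: "s \<in> {1..<k}" "i = \<kappa> + (s * l + q s)" by (auto simp: Zq_def)
      have "q s < l" using q s by (auto simp: Qs_def PiE_def Pi_def)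
      moreover have "Suc s * l \<le> k * l" using s by (intro mult_le_mono) auto
      moreover have "1 * 1 \<le> s * l" using s l by (intro mult_le_mono) auto
      ultimately show "i \<in> rows" using s kappa_Suc unfolding rows_def N_def by (simp only: atLeastLessThan_iff mult_Suc) linarith
    qed
    \<comment> \<open>The second component is the set of inner functions that are to be
      positive.\<close>
    define A where "A = (SIGMA q:Qs. Pow (rows - Zq q))"
    define G where "G = {s \<in> patterns p a (coord_space B1) N. card {j\<in>B1 \<union> {d..<N}. s j = 0} = k - 1}"
    have real: "\<exists>s\<in>G. (\<forall>i\<in>rows. s i = 0 \<longleftrightarrow> i \<in> Zq q) \<and> (\<forall>i\<in>rows. s i = 1 \<longleftrightarrow> i \<in> P)" if qP: "(q, P) \<in> A" for q P
    proof -
      have q: "q \<in> Qs" and P: "P \<subseteq> rows - Zq q" using qP by (auto simp: A_def)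
      define \<sigma> where "\<sigma> j = (if \<kappa> + j \<in> P then 1 else -1 :: real)" for j
      have ql: "q s < l" if "1 \<le> s" "s < k" for s using q that by (auto simp: Qs_def PiE_def Pi_def)
      have "\<exists>c. c \<in> coord_space ({..<2 * k - 1} \<union> {\<kappa>}) \<and> (\<forall>r<2 * k - 1. 0 < b r \<bullet> c) \<and> 0 < b \<kappa> \<bullet> c \<and>
        (\<forall>j. 1 \<le> j \<longrightarrow> j \<le> k * l \<longrightarrow> sgn (plf p a (\<kappa> + j) c) = (if \<exists>s. 1 \<le> s \<and> s < k \<and> j = s * l + q s then 0 else \<sigma> j))"
        unfolding a_def K_def C_def
        by (rule pattern_exists[OF k l ql]) (use t in \<open>auto simp: \<sigma>_def C_def\<close>)
      then obtain c where c: "c \<in> coord_space ({..<2 * k - 1} \<union> {\<kappa>})" "\<forall>r<2 * k - 1. 0 < b r \<bullet> c" "0 < b \<kappa> \<bullet> c"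
        "\<And>j. 1 \<le> j \<Longrightarrow> j \<le> k * l \<Longrightarrow> sgn (plf p a (\<kappa> + j) c) = (if \<exists>s. 1 \<le> s \<and> s < k \<and> j = s * l + q s then 0 else \<sigma> j)"
        by blast
      have "{..<2 * k - 1} \<union> {\<kappa>} = B1" unfolding B1_def B0 using k by auto
      then have cS: "c \<in> coord_space B1" using c(1) by simp
      have "c \<noteq> 0" using c(3) by auto
      define s where "s = sign_pattern p a N c"
      have sp: "s \<in> patterns p a (coord_space B1) N" using cS \<open>c \<noteq> 0\<close> by (auto simp: s_def patterns_def)
      have srow: "s i = (if i \<in> Zq q then 0 else if i \<in> P then 1 else -1)" if i: "i \<in> rows" for i
      proof -
        define j where "j = i - \<kappa>"
        have j: "1 \<le> j" "j \<le> k * l" "i = \<kappa> + j" "i < N" using i kappa_Suc by (auto simp: rows_def N_def j_def)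
        have "(\<exists>s. 1 \<le> s \<and> s < k \<and> j = s * l + q s) \<longleftrightarrow> i \<in> Zq q" using j(3) by (auto simp: Zq_def)
        then show ?thesis using c(4)[OF j(1,2)] j(3,4) by (simp add: s_def sign_pattern_def \<sigma>_def)
      qed
      have sB: "s r \<noteq> 0" if "r \<in> B1" for r
      proof -
        have r: "r < d" "r < N" using that B1d by (auto simp: N_def)
        have "plf p a r c = b r \<bullet> c" using plf_low[of r a c] out r by simp
        moreover have "0 < b r \<bullet> c" using that c(2,3) k unfolding B1_def B0 by auto
        ultimately show ?thesis using r by (simp add: s_def sign_pattern_def)
      qed
      have "{j\<in>B1 \<union> {d..<N}. s j = 0} = Zq q"
        using sB srow Zrows[OF q] unfolding rows_def by (auto split: if_splits)
      then have "s \<in> G" using sp cZ[OF q] by (simp add: G_def)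
      moreover have "(s i = 0 \<longleftrightarrow> i \<in> Zq q) \<and> (s i = 1 \<longleftrightarrow> i \<in> P)" if "i \<in> rows" for i using srow[OF that] P by auto
      ultimately show ?thesis by blast
    qed
    have "\<forall>x\<in>A. \<exists>s. s \<in> G \<and> (\<forall>i\<in>rows. s i = 0 \<longleftrightarrow> i \<in> Zq (fst x)) \<and> (\<forall>i\<in>rows. s i = 1 \<longleftrightarrow> i \<in> snd x)"
    proof
      fix x assume "x \<in> A"
      then have "(fst x, snd x) \<in> A" by simp
      from real[OF this] show "\<exists>s. s \<in> G \<and> (\<forall>i\<in>rows. s i = 0 \<longleftrightarrow> i \<in> Zq (fst x)) \<and> (\<forall>i\<in>rows. s i = 1 \<longleftrightarrow> i \<in> snd x)" by blast
    qed
    then obtain \<Phi> where \<Phi>: "\<forall>x\<in>A. \<Phi> x \<in> G \<and> (\<forall>i\<in>rows. \<Phi> x i = 0 \<longleftrightarrow> i \<in> Zq (fst x)) \<and> (\<forall>i\<in>rows. \<Phi> x i = 1 \<longleftrightarrow> i \<in> snd x)"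
      using bchoice[of A "\<lambda>x s. s \<in> G \<and> (\<forall>i\<in>rows. s i = 0 \<longleftrightarrow> i \<in> Zq (fst x)) \<and> (\<forall>i\<in>rows. s i = 1 \<longleftrightarrow> i \<in> snd x)"] by blast
    have "inj_on \<Phi> A"
    proof (rule inj_onI)
      fix x x' assume x: "x \<in> A" "x' \<in> A" "\<Phi> x = \<Phi> x'"
      obtain q P q' P' where eq: "x = (q, P)" "x' = (q', P')" by (cases x; cases x')
      have q: "q \<in> Qs" "q' \<in> Qs" "P \<subseteq> rows" "P' \<subseteq> rows" using x eq by (auto simp: A_def)
      have "i \<in> Zq q \<longleftrightarrow> i \<in> Zq q'" "i \<in> P \<longleftrightarrow> i \<in> P'" if "i \<in> rows" for i
        using bspec[OF \<Phi> x(1)] bspec[OF \<Phi> x(2)] x(3) that unfolding eq by simp_all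
      then have "Zq q = Zq q'" and PP: "P = P'" using Zrows q by blast+
      have "q s = q' s" for s
      proof (cases "s \<in> {1..<k}")
        case True
        then have "\<kappa> + (s * l + q s) \<in> Zq q'" using \<open>Zq q = Zq q'\<close> by (auto simp: Zq_def)
        then obtain s' where s': "s' \<in> {1..<k}" "\<kappa> + (s * l + q s) = \<kappa> + (s' * l + q' s')" by (auto simp: Zq_def)
        have "s = (s * l + q s) div l" by (rule qd[OF q(1) True, symmetric])
        also have "\<dots> = (s' * l + q' s') div l" using s'(2) by (simp only: add_left_cancel)
        also have "\<dots> = s'" by (rule qd[OF q(2) s'(1)])
        finally have "s = s'" .
        then show ?thesis using s'(2) by (simp only: add_left_cancel)
      next
        case False
        then show ?thesis using q by (auto simp: Qs_def PiE_def extensional_def)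
      qed
      then show "x = x'" using eq PP by auto
    qed
    moreover have "\<Phi> ` A \<subseteq> G" using \<Phi> by blast
    moreover have "finite G" by (rule finite_subset[OF _ finite_patterns[of p a "coord_space B1" N]]) (auto simp: G_def)
    ultimately have "card A \<le> card G" by (rule card_inj_on_le)
    moreover have "card A = l ^ (k - 1) * 2 ^ (k * l - (k - 1))"
    proof -
      have fQ: "finite Qs" unfolding Qs_def by (intro finite_PiE) auto
      have "card A = (\<Sum>q\<in>Qs. card (Pow (rows - Zq q)))" unfolding A_def using fQ by (intro card_SigmaI) (auto simp: rows_def)
      also have "\<dots> = (\<Sum>q\<in>Qs. 2 ^ (k * l - (k - 1)))"
      proof (rule sum.cong)
        fix q assume q: "q \<in> Qs"
        have "card (rows - Zq q) = card rows - card (Zq q)" using Zrows[OF q] by (intro card_Diff_subset) (auto simp: Zq_def)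
        then show "card (Pow (rows - Zq q)) = 2 ^ (k * l - (k - 1))" using cZ[OF q] by (simp add: card_Pow rows_def N_def)
      qed simp
      also have "\<dots> = card Qs * 2 ^ (k * l - (k - 1))" by simp
      also have "card Qs = l ^ (k - 1)" unfolding Qs_def by (simp add: card_PiE)
      finally show ?thesis .
    qed
    ultimately have "real (l ^ (k - 1) * 2 ^ (k * l - (k - 1))) \<le> real (card G)" by linarith
    then show ?thesis by (simp add: F_def coeff_pattern_poly G_def)
  qed
  have gT: "generic p a UNIV {..<N} N"
  proof -
    have "{..<d} \<union> {d..<N} = {..<N}" by (auto simp: N_def)
    then show ?thesis using gen[of "{..<d}"] by (simp add: a_def coord_space_UNIV)
  qed
  interpret outer_system b p \<kappa> d N a
  proof unfold_locales
    show "d \<le> N" by (simp add: N_def)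
    show "a j i = 0" if "i < d" "j < i" for i j by (rule out[OF that(1)])
    show "generic p a UNIV {..<N} N" by (rule gT)
  qed
  obtain T \<sigma> \<gamma> \<tau> \<beta> where T: "cubical T" "box_cap e T \<sigma> \<gamma>" "box_topped e T \<tau> \<beta>" "\<sigma> < \<tau>"
    "\<And>i. i < d \<Longrightarrow> face_number T i = card {s \<in> patterns p a UNIV N. card {j\<in>{..<N}. s j = 0} = i}"
    using shear_body by blast
  have "real (face_number T i) = coeff (([:2, 1:] ^ (d + 1 - 2 * k) - monom 1 (d + 1 - 2 * k)) * U + monom 1 (d + 1 - 2 * k) * V) i"
    if "i < d" for i
  proof -
    have cM: "card M = d + 1 - 2 * k" using k kappa_Suc by (simp add: M_def)
    have "B0 \<union> M = {..<d}" "B0 \<union> M \<union> {d..<N} = {..<N}" using M(1) by (auto simp: B0_def N_def)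
    then have "poly (pattern_poly p a UNIV {..<N} N) x
        = poly (([:2, 1:] ^ (d + 1 - 2 * k) - monom 1 (d + 1 - 2 * k)) * U + monom 1 (d + 1 - 2 * k) * V) x" for x
      using W[of M x] M by (auto simp: poly_pattern_poly coord_space_UNIV cM pU pV poly_monom poly_power add.commute)
    then have "pattern_poly p a UNIV {..<N} N
        = ([:2, 1:] ^ (d + 1 - 2 * k) - monom 1 (d + 1 - 2 * k)) * U + monom 1 (d + 1 - 2 * k) * V"
      by (intro poly_eq_poly_eq_iff[THEN iffD1] ext)
    then show ?thesis using T(5)[OF that] coeff_pattern_poly[of p a UNIV "{..<N}" N i] by simp
  qed
  moreover have "degree F \<le> 2 * k - 1" unfolding F_def using degree_pattern_poly[OF g1 J1] dim1 by simp
  moreover have "degree V \<le> 2 * k - 2" unfolding V_def using degree_pattern_poly[OF g0 J0] dim0 by simp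
  ultimately show ?thesis using that T(1-4) F symF symV V1 boundF boundV lower by blast
qed

end

section \<open>Limits of block polytopes\<close>

abbreviation (input) xx2 :: "real poly" where "xx2 \<equiv> [:0, 2, 1:]"
abbreviation (input) reflection :: "real poly" where "reflection \<equiv> [:-2, -1:]"

lemma pcompose_xx2: "pcompose xx2 reflection = xx2" by (simp add: pcompose_pCons)

lemma poly_reflectionI:
  "(\<And>x. poly F x = - poly F (- 2 - x)) \<Longrightarrow> F = - pcompose F reflection"
  "(\<And>x. poly F x = poly F (- 2 - x)) \<Longrightarrow> F = pcompose F reflection"
proof -
  have r: "poly reflection x = - 2 - x" for x by simp
  have m: "poly (- pcompose F reflection) x = - poly F (- 2 - x)" for x by (simp only: poly_minus poly_pcompose r)
  have p: "poly (pcompose F reflection) x = poly F (- 2 - x)" for x by (simp only: poly_pcompose r)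
  show "F = - pcompose F reflection" if "\<And>x. poly F x = - poly F (- 2 - x)"
    by (rule poly_eq_poly_eq_iff[THEN iffD1], rule ext) (use that m in metis)
  show "F = pcompose F reflection" if "\<And>x. poly F x = poly F (- 2 - x)"
    by (rule poly_eq_poly_eq_iff[THEN iffD1], rule ext) (use that p in metis)
qed

lemma pcompose_power: "pcompose (P ^ n) Q = pcompose P Q ^ n" for P Q :: "real poly"
  by (induction n) (simp_all add: pcompose_mult pcompose_1)

text \<open>\<open>F\<close> minus its value at 0 vanishes at 0 and, by symmetry, at -2, hence is a
  multiple of \<open>xx2\<close>; the quotient is again symmetric and of smaller degree.\<close>

lemma even_poly:
  assumes "F = pcompose F reflection"
  shows "\<exists>R. F = pcompose R xx2"
  using assms
proof (induction "degree F" arbitrary: F rule: less_induct)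
  case less
  define c where "c = poly F 0"
  define G where "G = F - [:c:]"
  have s0: "poly F (-2) = poly F 0" using arg_cong[OF less.prems, of "\<lambda>p. poly p 0"] by (simp add: poly_pcompose)
  have "poly G 0 = 0" by (simp add: G_def c_def)
  then obtain G' where G': "G = [:0, 1:] * G'" using poly_eq_0_iff_dvd[of G 0] by (auto elim: dvdE)
  have "poly G (-2) = 0" using s0 by (simp add: G_def c_def)
  then have "poly G' (-2) = 0" by (simp add: G')
  then obtain H where H: "G' = [:2, 1:] * H" using poly_eq_0_iff_dvd[of G' "-2"] by (auto elim: dvdE)
  have GH: "G = xx2 * H" unfolding G' H by (simp add: mult.assoc[symmetric])
  have "pcompose G reflection = G" unfolding G_def using less.prems by (simp add: pcompose_diff pcompose_const)
  then have "xx2 * pcompose H reflection = xx2 * H" unfolding GH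
    using pcompose_xx2 by (simp only: pcompose_mult)
  then have Hs: "H = pcompose H reflection" by (simp only: mult_cancel_left) simp
  show ?case
  proof (cases "H = 0")
    case True
    then have "F = pcompose [:c:] xx2" using GH by (simp add: G_def pcompose_const)
    then show ?thesis by blast
  next
    case False
    then have "degree G = 2 + degree H" unfolding GH by (subst degree_mult_eq) auto
    moreover have "degree G \<le> max (degree F) (degree [:c:])" unfolding G_def by (rule degree_diff_le_max)
    ultimately have "degree H < degree F" by simp
    from less.hyps[OF this Hs] obtain R where "H = pcompose R xx2" by blast
    then have "F = pcompose (pCons c R) xx2" using GH by (simp add: G_def pcompose_pCons algebra_simps)
    then show ?thesis by blast
  qed
qed

lemma even_poly_expand:
  assumes "F = pcompose F reflection" "degree F \<le> 2 * m"
  obtains \<gamma> where "F = (\<Sum>j\<le>m. smult (\<gamma> j) (xx2 ^ j))"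
proof -
  obtain R where R: "F = pcompose R xx2" using even_poly[OF assms(1)] by blast
  have "degree R \<le> m" using assms(2) unfolding R by (simp add: degree_pcompose)
  have X: "pcompose [:0, 1:] xx2 = xx2" by (simp add: pcompose_pCons)
  have "F = pcompose (\<Sum>j\<le>degree R. monom (coeff R j) j) xx2" unfolding R by (simp add: poly_as_sum_of_monoms)
  also have "\<dots> = (\<Sum>j\<le>degree R. smult (coeff R j) (xx2 ^ j))"
    unfolding pcompose_sum
    by (intro sum.cong refl) (simp only: monom_altdef pcompose_smult pcompose_power X)
  also have "\<dots> = (\<Sum>j\<le>m. smult (coeff R j) (xx2 ^ j))"
    using \<open>degree R \<le> m\<close> by (intro sum.mono_neutral_left) (auto simp: coeff_eq_0)
  finally show ?thesis using that by blast
qed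

text \<open>Antisymmetry forces a zero at the fixed point -1 of the reflection; the quotient by
  \<open>[:1, 1:]\<close> is symmetric.\<close>

lemma odd_poly_expand:
  assumes "F = - pcompose F reflection" "degree F \<le> 2 * m + 1"
  obtains \<gamma> where "F = (\<Sum>j\<le>m. smult (\<gamma> j) ([:1, 1:] * xx2 ^ j))"
proof -
  have "poly F (-1) = - poly F (-1)" using arg_cong[OF assms(1), of "\<lambda>p. poly p (-1)"] by (simp add: poly_pcompose)
  then have "poly F (-1) = 0" by simp
  then obtain H where H: "F = [:1, 1:] * H" using poly_eq_0_iff_dvd[of F "-1"] by (auto elim: dvdE)
  have "pcompose [:1, 1:] reflection = - [:1, 1:]" by (simp add: pcompose_pCons)
  then have "- pcompose F reflection = [:1, 1:] * pcompose H reflection" unfolding H by (simp only: pcompose_mult mult_minus_left minus_minus)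
  then have "[:1, 1:] * H = [:1, 1:] * pcompose H reflection" using assms(1) H by simp
  then have "H = pcompose H reflection" by (simp only: mult_cancel_left) simp
  moreover have "degree H \<le> 2 * m"
  proof (cases "H = 0")
    case False
    then have "degree F = 1 + degree H" unfolding H by (subst degree_mult_eq) auto
    then show ?thesis using assms(2) by simp
  qed simp
  ultimately obtain \<gamma> where "H = (\<Sum>j\<le>m. smult (\<gamma> j) (xx2 ^ j))" by (rule even_poly_expand)
  then have "F = (\<Sum>j\<le>m. smult (\<gamma> j) ([:1, 1:] * xx2 ^ j))" unfolding H by (simp only: sum_distrib_left mult_smult_right)
  then show ?thesis using that by blast
qed

lemma coeff_mult_xx2_power:
  "coeff (B * xx2 ^ j) i = (if i < j then 0 else coeff (B * [:2, 1:] ^ j) (i - j))"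
proof -
  have "xx2 = monom 1 1 * [:2, 1:]" by (simp add: monom_altdef)
  then have "B * xx2 ^ j = monom 1 j * (B * [:2, 1:] ^ j)"
    by (simp only: power_mult_distrib monom_power mult_1 power_one mult.left_commute)
  then show ?thesis by (metis coeff_monom_mult mult_cancel_right2)
qed

text \<open>\<open>B * xx2 ^ i\<close> has lowest term \<open>2 ^ i\<close> in degree
  \<open>i\<close>, so the equations for the \<open>\<gamma> n j\<close> are triangular and are
  solved from the bottom up in the limit.\<close>

lemma triangular_limit:
  fixes G :: "nat \<Rightarrow> real poly" and \<gamma> :: "nat \<Rightarrow> nat \<Rightarrow> real"
  assumes B: "coeff B 0 = 1" and G: "\<And>n. G n = (\<Sum>j\<le>m. smult (\<gamma> n j) (B * xx2 ^ j))"
    and M: "M \<le> Suc m" and lim: "\<And>j. j < M \<Longrightarrow> (\<lambda>n. coeff (G n) j) \<longlonglongrightarrow> (if j = m then 1 else 0)"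
    and j: "j < M"
  shows "(\<lambda>n. \<gamma> n j) \<longlonglongrightarrow> (if j = m then 1 / 2 ^ m else 0)"
  using j
proof (induction j rule: less_induct)
  case (less j)
  let ?c = "\<lambda>i. coeff (B * xx2 ^ i) j"
  have diag: "?c j = 2 ^ j" by (simp add: coeff_mult_xx2_power coeff_mult_0 B coeff_0_power)
  have "\<gamma> n j = (coeff (G n) j - (\<Sum>i<j. \<gamma> n i * ?c i)) / 2 ^ j" for n
  proof -
    have "coeff (G n) j = (\<Sum>i\<le>m. \<gamma> n i * ?c i)" unfolding G by (simp only: coeff_sum coeff_smult)
    also have "\<dots> = (\<Sum>i\<le>j. \<gamma> n i * ?c i)"
    proof (rule sum.mono_neutral_right)
      show "\<forall>i\<in>{..m} - {..j}. \<gamma> n i * ?c i = 0" by (simp add: coeff_mult_xx2_power)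
    qed (use less.prems M in auto)
    also have "\<dots> = (\<Sum>i<j. \<gamma> n i * ?c i) + \<gamma> n j * 2 ^ j" by (simp add: lessThan_Suc_atMost[symmetric] diag)
    finally show ?thesis by simp
  qed
  moreover have "(\<lambda>n. (coeff (G n) j - (\<Sum>i<j. \<gamma> n i * ?c i)) / 2 ^ j) \<longlonglongrightarrow> ((if j = m then 1 else 0) - (\<Sum>i<j. 0 * ?c i)) / 2 ^ j"
  proof (intro tendsto_intros lim less.prems)
    fix i assume "i \<in> {..<j}"
    then have i: "i < j" "i < M" "i \<noteq> m" using less.prems M by auto
    show "(\<lambda>n. \<gamma> n i) \<longlonglongrightarrow> 0" using less.IH[OF i(1,2)] i(3) by simp
  qed simp
  ultimately show ?case by (auto split: if_splits)
qed

text \<open>The \<open>m + 1\<close> parameters of an odd polynomial of degree at most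
  \<open>2 * m + 1\<close> are determined by its \<open>m + 1\<close> lowest coefficients. All of
  these but the last tend to 0, so a single term survives.\<close>

lemma odd_poly_limit:
  fixes F :: "nat \<Rightarrow> real poly"
  assumes odd: "\<And>n. F n = - pcompose (F n) reflection" and deg: "\<And>n. degree (F n) \<le> 2 * m + 1"
    and lim: "\<And>j. j < Suc m \<Longrightarrow> (\<lambda>n. coeff (F n) j) \<longlonglongrightarrow> (if j = m then 1 else 0)"
  shows "(\<lambda>n. coeff (F n) i) \<longlonglongrightarrow> coeff (smult (1 / 2 ^ m) ([:1, 1:] * xx2 ^ m)) i"
proof -
  have "\<exists>\<gamma>. F n = (\<Sum>j\<le>m. smult (\<gamma> j) ([:1, 1:] * xx2 ^ j))" for n
    using odd_poly_expand[OF odd deg, of n] by blast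
  then obtain \<gamma> where \<gamma>: "\<And>n. F n = (\<Sum>j\<le>m. smult (\<gamma> n j) ([:1, 1:] * xx2 ^ j))" by metis
  have g: "(\<lambda>n. \<gamma> n j) \<longlonglongrightarrow> (if j = m then 1 / 2 ^ m else 0)" if "j \<le> m" for j
    by (rule triangular_limit[OF _ \<gamma> order_refl lim]) (use that in auto)
  have "(\<lambda>n. \<Sum>j\<le>m. \<gamma> n j * coeff ([:1, 1:] * xx2 ^ j) i) \<longlonglongrightarrow> (\<Sum>j\<le>m. (if j = m then 1 / 2 ^ m else 0) * coeff ([:1, 1:] * xx2 ^ j) i)"
    by (intro tendsto_sum tendsto_mult tendsto_const g) simp
  moreover have "(\<Sum>j\<le>m. (if j = m then 1 / 2 ^ m else 0) * coeff ([:1, 1:] * xx2 ^ j) i) = (\<Sum>j\<in>{m}. 1 / 2 ^ m * coeff ([:1, 1:] * xx2 ^ j) i)"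
    by (rule sum.mono_neutral_cong_right) auto
  ultimately show ?thesis unfolding \<gamma> coeff_sum coeff_smult by simp
qed

text \<open>Only \<open>m\<close> of the \<open>m + 1\<close> parameters are controlled by low
  coefficients; the value at -1, where \<open>xx2\<close> is -1, supplies the last one.\<close>

lemma even_poly_limit:
  fixes F :: "nat \<Rightarrow> real poly"
  assumes even: "\<And>n. F n = pcompose (F n) reflection" and deg: "\<And>n. degree (F n) \<le> 2 * m"
    and lim: "\<And>j. j < m \<Longrightarrow> (\<lambda>n. coeff (F n) j) \<longlonglongrightarrow> 0" and one: "(\<lambda>n. poly (F n) (-1)) \<longlonglongrightarrow> 0"
  shows "(\<lambda>n. coeff (F n) i) \<longlonglongrightarrow> 0"
proof -
  have "\<exists>\<gamma>. F n = (\<Sum>j\<le>m. smult (\<gamma> j) (xx2 ^ j))" for n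
    using even_poly_expand[OF even deg, of n] by blast
  then obtain \<gamma> where \<gamma>: "\<And>n. F n = (\<Sum>j\<le>m. smult (\<gamma> n j) (xx2 ^ j))" by metis
  have low: "(\<lambda>n. \<gamma> n j) \<longlonglongrightarrow> 0" if "j < m" for j
  proof -
    have "(\<lambda>n. \<gamma> n j) \<longlonglongrightarrow> (if j = m then 1 / 2 ^ m else 0)"
      by (rule triangular_limit[of 1 F _ _ m]) (use that lim \<gamma> in auto)
    then show ?thesis using that by simp
  qed
  have "poly (F n) (-1) = (\<Sum>j<m. \<gamma> n j * (-1) ^ j) + \<gamma> n m * (-1) ^ m" for n
    unfolding \<gamma> by (simp add: poly_sum poly_power lessThan_Suc_atMost[symmetric])
  then have "\<gamma> n m = (poly (F n) (-1) - (\<Sum>j<m. \<gamma> n j * (-1) ^ j)) * (-1) ^ m" for n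
    by (simp add: mult.assoc flip: power_add)
  moreover have "(\<lambda>n. (poly (F n) (-1) - (\<Sum>j<m. \<gamma> n j * (-1) ^ j)) * (-1) ^ m) \<longlonglongrightarrow> (0 - (\<Sum>j<m. 0 * (-1) ^ j)) * (-1) ^ m"
    by (intro tendsto_mult tendsto_diff tendsto_sum tendsto_const one low) simp
  ultimately have "(\<lambda>n. \<gamma> n m) \<longlonglongrightarrow> 0" by simp
  then have g: "(\<lambda>n. \<gamma> n j) \<longlonglongrightarrow> 0" if "j \<le> m" for j using low that by (cases "j = m") auto
  have "(\<lambda>n. \<Sum>j\<le>m. \<gamma> n j * coeff (xx2 ^ j) i) \<longlonglongrightarrow> (\<Sum>j\<le>m. 0 * coeff (xx2 ^ j) i)"
    by (intro tendsto_sum tendsto_mult tendsto_const g) simp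
  then show ?thesis unfolding \<gamma> coeff_sum coeff_smult by simp
qed

text \<open>A coefficient of degree \<open>j\<close> is at most of order
  \<open>l ^ j * 2 ^ (k * l)\<close>, the normalizing one at least of order
  \<open>l ^ (k - 1) * 2 ^ (k * l)\<close>, so a factor \<open>l\<close> is gained. The constant
  collects the powers that depend on \<open>k\<close> only.\<close>

lemma low_coeff_ratio:
  fixes x Nm :: real
  assumes k: "1 \<le> k" and l: "1 \<le> l" and j: "j < k - 1"
    and x: "0 \<le> x" "x \<le> real (2 * k + k * l) ^ j * 2 ^ (2 * k + k * l)"
    and Nm: "real l ^ (k - 1) * 2 ^ (k * l - (k - 1)) \<le> Nm"
  shows "norm (x / Nm) \<le> (real (3 * k) ^ k * 2 ^ (3 * k)) / real l"
proof -
  let ?E = "2 ^ (k * l - (k - 1)) :: real"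
  have kl: "k * 1 \<le> k * l" using l by (intro mult_le_mono) auto
  have "0 < real l ^ (k - 1) * ?E" using l by simp
  then have Nm0: "0 < Nm" using Nm by linarith
  have "2 * k + k * l \<le> 3 * k * l" using kl by simp
  then have "real (2 * k + k * l) \<le> real (3 * k) * real l" unfolding of_nat_mult[symmetric] of_nat_le_iff .
  then have "real (2 * k + k * l) ^ j \<le> (real (3 * k) * real l) ^ j" by (intro power_mono) auto
  also have "\<dots> = real (3 * k) ^ j * real l ^ j" by (rule power_mult_distrib)
  also have "\<dots> \<le> real (3 * k) ^ k * real l ^ j" using k j by (intro mult_right_mono power_increasing) auto
  finally have A: "real (2 * k + k * l) ^ j \<le> real (3 * k) ^ k * real l ^ j" .
  have "2 * k + k * l \<le> 3 * k + (k * l - (k - 1))" using kl by simp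
  then have "(2::real) ^ (2 * k + k * l) \<le> 2 ^ (3 * k + (k * l - (k - 1)))" by (intro power_increasing) auto
  then have D: "(2::real) ^ (2 * k + k * l) \<le> 2 ^ (3 * k) * ?E" by (simp only: power_add)
  have "x \<le> (real (3 * k) ^ k * real l ^ j) * (2 ^ (3 * k) * ?E)"
    using x(2) mult_mono[OF A D] by (smt (verit) mult_nonneg_nonneg of_nat_0_le_iff zero_le_power zero_le_numeral)
  then have "x * real l \<le> ((real (3 * k) ^ k * real l ^ j) * (2 ^ (3 * k) * ?E)) * real l" by (intro mult_right_mono) auto
  also have "\<dots> = (real (3 * k) ^ k * 2 ^ (3 * k)) * (real l ^ Suc j * ?E)" by (simp add: mult_ac)
  also have "\<dots> \<le> (real (3 * k) ^ k * 2 ^ (3 * k)) * (real l ^ (k - 1) * ?E)"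
    using j l by (intro mult_left_mono mult_right_mono power_increasing) auto
  also have "\<dots> \<le> (real (3 * k) ^ k * 2 ^ (3 * k)) * Nm" by (intro mult_left_mono Nm) auto
  finally have "x * real l \<le> (real (3 * k) ^ k * 2 ^ (3 * k)) * Nm" .
  then have "x / Nm \<le> (real (3 * k) ^ k * 2 ^ (3 * k)) / real l" using Nm0 l by (simp add: divide_simps mult_ac)
  then show ?thesis using x(1) Nm0 by simp
qed

context coordinates
begin

definition block :: "'a set \<Rightarrow> bool" where
  "block T \<longleftrightarrow> cubical T \<and> (\<exists>\<sigma> \<gamma> \<tau> \<beta>. box_cap e T \<sigma> \<gamma> \<and> box_topped e T \<tau> \<beta> \<and> \<sigma> < \<tau>)"

text \<open>The normalization \<open>Nm\<close> is the coefficient of degree \<open>k - 1\<close> in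
  \<open>F\<close>. Its growth, recorded as \<open>real n \<le> Nm n\<close>, later lets bounded
  quantities such as \<open>box_loss\<close> disappear after division.\<close>

lemma block_limit:
  assumes k: "1 \<le> k" "2 * k \<le> d"
  shows "\<exists>T Nm. (\<forall>n. block (T n) \<and> real n \<le> Nm n \<and> 0 < Nm n) \<and>
    (\<forall>i<d. (\<lambda>n. real (face_number (T n) i) / Nm n) \<longlonglongrightarrow>
       coeff (smult (1 / 2 ^ k) (([:2, 1:] ^ (d + 1 - 2 * k) - monom 1 (d + 1 - 2 * k)) * ([:1, 1:] * xx2 ^ (k - 1)))) i)"
proof -
  define m where "m = d + 1 - 2 * k"
  define A :: "real poly" where "A = [:2, 1:] ^ m - monom 1 m"
  define bd where "bd l i = real (2 * k + k * l) ^ i * 2 ^ (2 * k + k * l)" for l i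
  define good where "good l T U V F \<longleftrightarrow> block T \<and>
      (\<forall>i<d. real (face_number T i) = coeff (A * U + monom 1 m * V) i) \<and> F = smult 2 U + pCons 0 V \<and>
      (\<forall>x. poly F x = - poly F (- 2 - x)) \<and> (\<forall>x. poly V x = poly V (- 2 - x)) \<and> poly V (-1) = 2 \<and>
      degree F \<le> 2 * k - 1 \<and> degree V \<le> 2 * k - 2 \<and> (\<forall>i. 0 \<le> coeff F i \<and> coeff F i \<le> bd l i) \<and>
      (\<forall>i. 0 \<le> coeff V i \<and> coeff V i \<le> bd l i) \<and> real l ^ (k - 1) * 2 ^ (k * l - (k - 1)) \<le> coeff F (k - 1)"
    for l T and U V F :: "real poly"
  have "\<exists>T U V F. good (Suc n) T U V F" for n
  proof (rule block_polytope[OF k, of "Suc n"])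
    fix T \<sigma> \<gamma> \<tau> \<beta> and U V F :: "real poly"
    assume "cubical T" "box_cap e T \<sigma> \<gamma>" "box_topped e T \<tau> \<beta>" "\<sigma> < \<tau>"
    then have "block T" unfolding block_def by blast
    moreover assume "\<And>i. i < d \<Longrightarrow> real (face_number T i) = coeff (([:2, 1:] ^ (d + 1 - 2 * k) - monom 1 (d + 1 - 2 * k)) * U + monom 1 (d + 1 - 2 * k) * V) i"
      "F = smult 2 U + pCons 0 V" "\<And>x. poly F x = - poly F (- 2 - x)" "\<And>x. poly V x = poly V (- 2 - x)" "poly V (-1) = 2"
      "degree F \<le> 2 * k - 1" "degree V \<le> 2 * k - 2"
      "\<And>i. 0 \<le> coeff F i \<and> coeff F i \<le> real (2 * k + k * Suc n) ^ i * 2 ^ (2 * k + k * Suc n)"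
      "\<And>i. 0 \<le> coeff V i \<and> coeff V i \<le> real (2 * k + k * Suc n) ^ i * 2 ^ (2 * k + k * Suc n)"
      "real (Suc n) ^ (k - 1) * 2 ^ (k * Suc n - (k - 1)) \<le> coeff F (k - 1)"
    ultimately have "good (Suc n) T U V F" unfolding good_def A_def m_def bd_def by blast
    then show ?thesis by blast
  qed simp
  then obtain T U V F where good: "\<And>n. good (Suc n) (T n) (U n) (V n) (F n)" by metis
  note g = good[unfolded good_def]
  define Nm where "Nm n = coeff (F n) (k - 1)" for n
  have NmL: "real (Suc n) ^ (k - 1) * 2 ^ (k * Suc n - (k - 1)) \<le> Nm n" for n using g[of n] unfolding Nm_def by blast
  have Nm: "real n \<le> Nm n" "0 < Nm n" for n
  proof -
    have "Suc n \<le> k * Suc n - (k - 1)" using k(1) by (cases k) auto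
    then have "(2::real) ^ Suc n \<le> 2 ^ (k * Suc n - (k - 1))" by (intro power_increasing) auto
    also have "\<dots> \<le> real (Suc n) ^ (k - 1) * 2 ^ (k * Suc n - (k - 1))"
      using mult_right_mono[of 1 "real (Suc n) ^ (k - 1)" "2 ^ (k * Suc n - (k - 1))"] one_le_power[of "real (Suc n)" "k - 1"] by simp
    finally have "2 ^ Suc n \<le> Nm n" using NmL[of n] by linarith
    moreover have "real (Suc n) < 2 ^ Suc n" by (rule of_nat_less_two_power)
    ultimately show "real n \<le> Nm n" "0 < Nm n" by auto
  qed
  have toZ: "(\<lambda>n. C / real (Suc n)) \<longlonglongrightarrow> 0" for C :: real
    using tendsto_mult_right_zero[OF LIMSEQ_inverse_real_of_nat, of C] by (simp add: divide_inverse)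
  have lowF: "(\<lambda>n. coeff (F n) j / Nm n) \<longlonglongrightarrow> 0" and lowV: "(\<lambda>n. coeff (V n) j / Nm n) \<longlonglongrightarrow> 0" if j: "j < k - 1" for j
  proof -
    have "norm (coeff (F n) j / Nm n) \<le> (real (3 * k) ^ k * 2 ^ (3 * k)) / real (Suc n)"
      "norm (coeff (V n) j / Nm n) \<le> (real (3 * k) ^ k * 2 ^ (3 * k)) / real (Suc n)" for n
      using g[of n] unfolding bd_def by (intro low_coeff_ratio[OF k(1) _ j _ _ NmL]; simp)+
    then show "(\<lambda>n. coeff (F n) j / Nm n) \<longlonglongrightarrow> 0" "(\<lambda>n. coeff (V n) j / Nm n) \<longlonglongrightarrow> 0"
      by (intro Lim_null_comparison[OF always_eventually toZ] allI; blast)+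
  qed
  have "(\<lambda>n. coeff (smult (inverse (Nm n)) (F n)) i) \<longlonglongrightarrow> coeff (smult (1 / 2 ^ (k - 1)) ([:1, 1:] * xx2 ^ (k - 1))) i" for i
  proof (rule odd_poly_limit)
    fix n
    have "F n = - pcompose (F n) reflection"
      by (rule poly_reflectionI(1)) (use g[of n] in blast)
    then show "smult (inverse (Nm n)) (F n) = - pcompose (smult (inverse (Nm n)) (F n)) reflection"
      by (metis pcompose_smult smult_minus_right)
    show "degree (smult (inverse (Nm n)) (F n)) \<le> 2 * (k - 1) + 1" using g[of n] k by (auto intro: order_trans[OF degree_smult_le])
  next
    fix j assume "j < Suc (k - 1)"
    then consider "j < k - 1" | "j = k - 1" by linarith
    then show "(\<lambda>n. coeff (smult (inverse (Nm n)) (F n)) j) \<longlonglongrightarrow> (if j = k - 1 then 1 else 0)"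
    proof cases
      case 1
      then show ?thesis using lowF[OF 1] by (simp add: divide_inverse mult.commute)
    next
      case 2
      have "coeff (smult (inverse (Nm n)) (F n)) j = 1" for n
      proof -
        have "inverse (Nm n) * Nm n = 1" using Nm(2)[of n] by simp
        then show ?thesis using 2 by (simp only: coeff_smult Nm_def)
      qed
      then show ?thesis using 2 by simp
    qed
  qed
  then have limF: "(\<lambda>n. coeff (F n) i / Nm n) \<longlonglongrightarrow> coeff (smult (1 / 2 ^ (k - 1)) ([:1, 1:] * xx2 ^ (k - 1))) i" for i
    by (simp only: coeff_smult divide_inverse mult.commute)
  have "(\<lambda>n. coeff (smult (inverse (Nm n)) (V n)) i) \<longlonglongrightarrow> 0" for i
  proof (rule even_poly_limit)
    fix n
    have "V n = pcompose (V n) reflection"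
      by (rule poly_reflectionI(2)) (use g[of n] in blast)
    then show "smult (inverse (Nm n)) (V n) = pcompose (smult (inverse (Nm n)) (V n)) reflection"
      by (metis pcompose_smult)
    show "degree (smult (inverse (Nm n)) (V n)) \<le> 2 * (k - 1)" using g[of n] k by (auto intro: order_trans[OF degree_smult_le])
  next
    fix j assume "j < k - 1"
    then show "(\<lambda>n. coeff (smult (inverse (Nm n)) (V n)) j) \<longlonglongrightarrow> 0" using lowV by (simp add: divide_inverse mult.commute)
  next
    have "norm (poly (smult (inverse (Nm n)) (V n)) (-1)) \<le> 4 / real (Suc n)" for n
    proof -
      have "poly (smult (inverse (Nm n)) (V n)) (-1) = 2 / Nm n" using g[of n] by (simp add: divide_inverse mult.commute)
      moreover have "real (Suc n) \<le> 2 * Nm n"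
      proof (cases n)
        case 0
        have "1 \<le> Nm 0" using NmL[of 0] k(1) order_trans[OF _ NmL[of 0], of 1] by simp
        then show ?thesis using 0 by simp
      next
        case (Suc n')
        then show ?thesis using Nm(1)[of n] by simp
      qed
      ultimately show ?thesis using Nm(2)[of n] by (simp add: divide_simps)
    qed
    then show "(\<lambda>n. poly (smult (inverse (Nm n)) (V n)) (-1)) \<longlonglongrightarrow> 0"
      by (intro Lim_null_comparison[OF always_eventually toZ] allI)
  qed
  then have limV: "(\<lambda>n. coeff (V n) i / Nm n) \<longlonglongrightarrow> 0" for i
    by (simp only: coeff_smult divide_inverse mult.commute)
  \<comment> \<open>By \<open>F = 2 U + x V\<close> and since \<open>V\<close> is negligible,
    \<open>U\<close> is asymptotically half of \<open>F\<close>; this turns the denominator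
    \<open>2 ^ (k - 1)\<close> into \<open>2 ^ k\<close>.\<close>
  have limU: "(\<lambda>n. coeff (U n) i / Nm n) \<longlonglongrightarrow> 1 / 2 ^ k * coeff ([:1, 1:] * xx2 ^ (k - 1)) i" for i
  proof -
    define v where "v n = (if i = 0 then 0 else coeff (V n) (i - 1))" for n
    have "(\<lambda>n. v n / Nm n) \<longlonglongrightarrow> 0" unfolding v_def using limV[of "i - 1"] by (cases "i = 0") auto
    from tendsto_mult[OF tendsto_const[of "1/2"] tendsto_diff[OF limF[of i] this]]
    have L: "(\<lambda>n. 1 / 2 * (coeff (F n) i / Nm n - v n / Nm n)) \<longlonglongrightarrow> 1 / 2 * (coeff (smult (1 / 2 ^ (k - 1)) ([:1, 1:] * xx2 ^ (k - 1))) i - 0)" .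
    have "coeff (F n) i = 2 * coeff (U n) i + v n" for n
    proof -
      have "F n = smult 2 (U n) + pCons 0 (V n)" using g[of n] by blast
      then show ?thesis by (simp add: v_def coeff_pCons split: nat.split)
    qed
    then have e: "1 / 2 * (coeff (F n) i / Nm n - v n / Nm n) = coeff (U n) i / Nm n" for n by (simp add: add_divide_distrib)
    have "(2::real) ^ k = 2 * 2 ^ (k - 1)" using k(1) by (cases k) auto
    then have "1 / 2 * (coeff (smult (1 / 2 ^ (k - 1)) ([:1, 1:] * xx2 ^ (k - 1))) i - 0) = 1 / 2 ^ k * coeff ([:1, 1:] * xx2 ^ (k - 1)) i"
       by simp
    then show ?thesis using L unfolding e  by presburger
  qed
  have "(\<lambda>n. real (face_number (T n) i) / Nm n) \<longlonglongrightarrow> coeff (smult (1 / 2 ^ k) (A * ([:1, 1:] * xx2 ^ (k - 1)))) i" if i: "i < d" for i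
  proof -
    have "real (face_number (T n) i) / Nm n = (\<Sum>j\<le>i. coeff A j * (coeff (U n) (i - j) / Nm n)) + (\<Sum>j\<le>i. coeff (monom 1 m) j * (coeff (V n) (i - j) / Nm n))" for n
    proof -
      have "real (face_number (T n) i) = coeff (A * U n + monom 1 m * V n) i" using g[of n] i by blast
      also have "\<dots> = (\<Sum>j\<le>i. coeff A j * coeff (U n) (i - j)) + (\<Sum>j\<le>i. coeff (monom 1 m) j * coeff (V n) (i - j))"
        by (simp only: coeff_add coeff_mult)
      finally show ?thesis by (simp only: add_divide_distrib sum_divide_distrib times_divide_eq_right)
    qed
    moreover have "(\<lambda>n. (\<Sum>j\<le>i. coeff A j * (coeff (U n) (i - j) / Nm n)) + (\<Sum>j\<le>i. coeff (monom 1 m) j * (coeff (V n) (i - j) / Nm n)))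
      \<longlonglongrightarrow> (\<Sum>j\<le>i. coeff A j * (1 / 2 ^ k * coeff ([:1, 1:] * xx2 ^ (k - 1)) (i - j))) + (\<Sum>j\<le>i. coeff (monom 1 m) j * 0)"
      by (intro tendsto_add tendsto_sum tendsto_mult tendsto_const limU limV)
    moreover have "(\<Sum>j\<le>i. coeff A j * (1 / 2 ^ k * coeff ([:1, 1:] * xx2 ^ (k - 1)) (i - j))) + (\<Sum>j\<le>i. coeff (monom 1 m) j * 0)
        = coeff (smult (1 / 2 ^ k) (A * ([:1, 1:] * xx2 ^ (k - 1)))) i"
      unfolding coeff_smult coeff_mult[of A] sum_distrib_left by (simp only: mult_zero_right sum.neutral_const add_0_right mult.left_commute)
    ultimately show ?thesis by simp
  qed
  then show ?thesis using g Nm unfolding A_def m_def by (intro exI[of _ T] exI[of _ Nm]) blast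
qed

end

section \<open>Extreme rays of the Adin cone\<close>

lemma f_polynomial_coeff:
  assumes "degree \<Phi> < d" "fps_nth t 0 = 0"
  shows "f_polynomial d (coeff \<Phi>) t = fps_of_poly \<Phi> oo t"
proof -
  have "fps_of_poly \<Phi> = (\<Sum>i<d. fps_const (coeff \<Phi> i) * fps_X ^ i)"
  proof (rule fps_ext)
    fix n
    have "fps_nth (\<Sum>i<d. fps_const (coeff \<Phi> i) * fps_X ^ i) n = (\<Sum>i<d. if i = n then coeff \<Phi> i else 0)"
      by (simp add: fps_sum_nth fps_X_power_nth if_distrib cong: if_cong)
    also have "\<dots> = (if n < d then coeff \<Phi> n else 0)" by simp
    also have "\<dots> = coeff \<Phi> n" using assms(1) by (metis dual_order.strict_trans2 le_degree)
    finally show "fps_nth (fps_of_poly \<Phi>) n = fps_nth (\<Sum>i<d. fps_const (coeff \<Phi> i) * fps_X ^ i) n" by simp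
  qed
  also have "\<dots> oo t = (\<Sum>i<d. fps_const (coeff \<Phi> i) * t ^ i)"
    unfolding fps_compose_sum_distrib
    by (intro sum.cong refl) (simp add: fps_compose_mult_distrib[OF assms(2)] fps_compose_power[OF assms(2), symmetric] fps_X_fps_compose_startby0[OF assms(2)])
  finally show ?thesis by (simp only: f_polynomial_def)
qed

lemma hcoef_sum:
  "(\<Sum>j<d. f j * hcoef d j i) = fps_nth (fps_X * (1 - fps_X) ^ (d - 1) / (1 + fps_X) * f_polynomial d f (2 * fps_X / (1 - fps_X))) i"
proof -
  have "fps_X * (1 - fps_X) ^ (d - 1) / (1 + fps_X) * f_polynomial d f (2 * fps_X / (1 - fps_X))
      = (\<Sum>j<d. fps_const (f j) * (fps_X * (1 - fps_X) ^ (d - 1) / (1 + fps_X) * (2 * fps_X / (1 - fps_X)) ^ j))"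
    unfolding f_polynomial_def sum_distrib_left by (intro sum.cong) (simp_all only: mult.left_commute)
  then show ?thesis by (simp only: fps_sum_nth fps_mult_left_const_nth hcoef_def)
qed

text \<open>The \<open>h\<close>-series substitutes \<open>mobius\<close> into the
  \<open>f\<close>-polynomial. The substitution takes \<open>2 + x\<close> to
  \<open>2 / (1 - X)\<close> and \<open>1 + x\<close> to \<open>(1 + X) / (1 - X)\<close>, which is
  why the factored form of \<open>ray\<close> is convenient.\<close>

abbreviation (input) iu :: "real fps" where "iu \<equiv> inverse (1 - fps_X)"
abbreviation (input) iv :: "real fps" where "iv \<equiv> inverse (1 + fps_X)"
abbreviation (input) mobius :: "real fps" where "mobius \<equiv> 2 * fps_X / (1 - fps_X)"

lemma iu: "iu * (1 - fps_X) = 1" "iv * (1 + fps_X) = 1" "mobius = 2 * fps_X * iu"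
  by (auto simp: inverse_mult_eq_1 fps_divide_unit)

lemma mobius_0: "fps_nth mobius 0 = 0" unfolding iu(3) by simp

lemma mobius_add2: "2 + mobius = 2 * iu"
proof -
  have "2 + mobius = 2 * (iu * (1 - fps_X)) + 2 * fps_X * iu" by (simp only: iu mult_1_right)
  also have "\<dots> = 2 * iu" by (simp add: algebra_simps)
  finally show ?thesis .
qed

lemma mobius_add1: "1 + mobius = (1 + fps_X) * iu"
proof -
  have "1 + mobius = iu * (1 - fps_X) + 2 * fps_X * iu" by (simp only: iu)
  also have "\<dots> = (1 + fps_X) * iu" by (simp add: algebra_simps)
  finally show ?thesis .
qed

lemma compose_linear: "fps_of_poly [:c, 1:] oo mobius = fps_const c + mobius"
  by (simp add: fps_of_poly_pCons fps_compose_add_distrib fps_X_fps_compose_startby0[OF mobius_0])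

lemma compose_gap: "fps_of_poly ([:2, 1:] ^ m - monom 1 m) oo mobius = 2 ^ m * iu ^ m * (1 - fps_X ^ m)"
proof -
  have two: "fps_const (2::real) = 2" by (simp add: numeral_fps_const)
  have "fps_of_poly (monom 1 m) oo mobius = mobius ^ m"
    by (simp add: fps_of_poly_monom fps_compose_power[OF mobius_0, symmetric] fps_X_fps_compose_startby0[OF mobius_0])
  moreover have "fps_of_poly ([:2, 1:] ^ m) oo mobius = (2 * iu) ^ m"
    by (simp only: fps_of_poly_power fps_compose_power[OF mobius_0, symmetric] compose_linear two mobius_add2)
  ultimately have "fps_of_poly ([:2, 1:] ^ m - monom 1 m) oo mobius = (2 * iu) ^ m - mobius ^ m"
    by (simp only: fps_of_poly_diff fps_compose_sub_distrib)
  also have "\<dots> = 2 ^ m * iu ^ m * (1 - fps_X ^ m)" unfolding iu(3) by (simp add: power_mult_distrib algebra_simps)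
  finally show ?thesis .
qed

lemma gap_div: "(1 - fps_X ^ m) * iu = (\<Sum>j<m. fps_X ^ j)"
proof -
  have "(1 - fps_X ^ m) * iu = (1 - fps_X) * (\<Sum>j<m. fps_X ^ j) * iu" by (simp only: one_diff_power_eq)
  also have "\<dots> = (iu * (1 - fps_X)) * (\<Sum>j<m. fps_X ^ j)" by (simp only: mult_ac)
  finally show ?thesis by (simp only: iu mult_1)
qed

text \<open>Up to a power of 2 this is the limit in \<open>block_limit\<close>;
  \<open>hcoef_ray\<close> identifies it as the direction in which only the \<open>k\<close>-th
  entry of the \<open>g\<close>-vector changes.\<close>

definition ray :: "nat \<Rightarrow> nat \<Rightarrow> real poly" where
  "ray d k = ([:2, 1:] ^ (d + 1 - 2 * k) - monom 1 (d + 1 - 2 * k)) * ([:1, 1:] * [:0, 2, 1:] ^ (k - 1))"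

lemma degree_gap: "0 < m \<Longrightarrow> degree ([:2, 1:] ^ m - monom 1 m :: real poly) < m"
proof -
  assume m: "0 < m"
  have "degree ([:2, 1:] ^ m :: real poly) = m" by (simp add: degree_power_eq)
  moreover have "lead_coeff ([:2, 1:] ^ m :: real poly) = 1" by (simp add: lead_coeff_power)
  ultimately have "coeff ([:2, 1:] ^ m - monom 1 m :: real poly) i = 0" if "m \<le> i" for i
    using that by (cases "i = m") (auto simp: coeff_eq_0)
  then have "degree ([:2, 1:] ^ m - monom 1 m :: real poly) \<le> m - 1" using m by (intro degree_le) auto
  then show ?thesis using m by simp
qed

lemma degree_ray:
  assumes "1 \<le> k" "2 * k \<le> d"
  shows "degree (ray d k) < d"
proof -
  have "degree ([:1, 1:] * [:0, 2, 1:] ^ (k - 1) :: real poly) = 1 + 2 * (k - 1)"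
    by (subst degree_mult_eq) (auto simp: degree_power_eq)
  moreover have "degree (ray d k) \<le> degree ([:2, 1:] ^ (d + 1 - 2 * k) - monom 1 (d + 1 - 2 * k) :: real poly) + degree ([:1, 1:] * [:0, 2, 1:] ^ (k - 1) :: real poly)"
    unfolding ray_def by (rule degree_mult_le)
  moreover have "degree ([:2, 1:] ^ (d + 1 - 2 * k) - monom 1 (d + 1 - 2 * k) :: real poly) < d + 1 - 2 * k"
    using assms by (intro degree_gap) simp
  ultimately show ?thesis using assms by linarith
qed

text \<open>After the substitution all powers of \<open>1 - X\<close> and \<open>1 + X\<close>
  cancel except in \<open>(1 - X ^ m) / (1 - X)\<close>, and the series is a multiple of
  \<open>X ^ k + ... + X ^ (d - k)\<close>. Its coefficients jump only once in the first half, at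
  \<open>k\<close>.\<close>

lemma hcoef_ray:
  assumes k: "1 \<le> k" "2 * k \<le> d"
  shows "(\<Sum>j<d. coeff (ray d k) j * hcoef d j i) = 4 ^ (k - 1) * 2 ^ (d + 1 - 2 * k) * (if k \<le> i \<and> i \<le> d - k then 1 else 0)"
proof -
  define m where "m = d + 1 - 2 * k"
  have two: "fps_const (2::real) = 2" by (simp add: numeral_fps_const)
  have "fps_of_poly [:0, 2, 1:] oo mobius = 4 * fps_X * iu ^ 2"
  proof -
    have "[:0, 2, 1:] = [:0, 1:] * [:2, 1 :: real:]" by simp
    then have "fps_of_poly [:0, 2, 1:] oo mobius = mobius * (2 + mobius)"
      by (simp only: fps_of_poly_mult fps_compose_mult_distrib[OF mobius_0] compose_linear two) simp
    then show ?thesis unfolding mobius_add2 unfolding iu(3) by (simp add: power2_eq_square)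
  qed
  then have "fps_of_poly (ray d k) oo mobius = 2 ^ m * iu ^ m * (1 - fps_X ^ m) * ((1 + fps_X) * iu * (4 * fps_X * iu ^ 2) ^ (k - 1))"
    unfolding ray_def m_def[symmetric]
    by (simp only: fps_of_poly_mult fps_of_poly_power fps_compose_mult_distrib[OF mobius_0] fps_compose_power[OF mobius_0, symmetric] compose_gap compose_linear fps_const_1_eq_1 mobius_add1)
  then have ev: "f_polynomial d (coeff (ray d k)) mobius = 2 ^ m * iu ^ m * (1 - fps_X ^ m) * ((1 + fps_X) * iu * (4 * fps_X * iu ^ 2) ^ (k - 1))"
    using f_polynomial_coeff[OF degree_ray[OF k] mobius_0] by simp
  obtain k' where k': "k = Suc k'" using k by (cases k) auto
  have d1: "d - 1 = m + (k' + k')" using k by (simp add: m_def k')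
  have cancel: "iu ^ n * (1 - fps_X) ^ n = 1" for n by (simp only: power_mult_distrib[symmetric] iu power_one)
  have "fps_X * (1 - fps_X) ^ (d - 1) / (1 + fps_X) * f_polynomial d (coeff (ray d k)) mobius
      = fps_X * (1 - fps_X) ^ (d - 1) * iv * (2 ^ m * iu ^ m * (1 - fps_X ^ m) * ((1 + fps_X) * iu * (4 * fps_X * iu ^ 2) ^ k'))"
    unfolding ev by (simp add: fps_divide_unit k')
  also have "\<dots> = (iv * (1 + fps_X)) * (iu ^ (m + (k' + k')) * (1 - fps_X) ^ (m + (k' + k'))) * (4 ^ k' * 2 ^ m * (fps_X ^ Suc k' * ((1 - fps_X ^ m) * iu)))"
    unfolding d1 by (simp only: power2_eq_square power_mult_distrib power_add power_Suc mult_ac)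
  also have "\<dots> = 4 ^ k' * 2 ^ m * (fps_X ^ k * (\<Sum>j<m. fps_X ^ j))" by (simp only: iu cancel mult_1 gap_div k')
  also have "\<dots> = fps_const (4 ^ k' * 2 ^ m) * (fps_X ^ k * (\<Sum>j<m. fps_X ^ j))"
    by (simp add: numeral_fps_const fps_const_mult[symmetric] fps_const_power[symmetric] del: fps_const_mult fps_const_power)
  finally have "(\<Sum>j<d. coeff (ray d k) j * hcoef d j i) = 4 ^ k' * 2 ^ m * fps_nth (fps_X ^ k * (\<Sum>j<m. fps_X ^ j)) i"
    unfolding hcoef_sum by (simp only: fps_mult_left_const_nth)
  also have "fps_nth (fps_X ^ k * (\<Sum>j<m. fps_X ^ j)) i = (if k \<le> i \<and> i - k < m then 1 else (0::real))"
    by (auto simp: fps_X_power_mult_nth fps_sum_nth fps_X_power_nth)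
  also have "(k \<le> i \<and> i - k < m) \<longleftrightarrow> (k \<le> i \<and> i \<le> d - k)" using k by (auto simp: m_def)
  finally show ?thesis by (simp add: k' m_def)
qed

text \<open>The face polynomial of the cube is \<open>(x + 2) ^ d - x ^ d\<close>. Its
  \<open>h\<close>-series agrees with \<open>2 ^ (d - 1) / (1 - X)\<close> up to a multiple of
  \<open>X ^ (d + 1)\<close>, so the cube has \<open>g i = 0\<close> for all positive
  \<open>i\<close>.\<close>

lemma cubical_h_cube:
  assumes d: "1 \<le> d" and i: "i \<le> d"
  shows "cubical_h d (coeff ([:2, 1:] ^ d - monom 1 d)) i = 2 ^ (d - 1)"
proof -
  let ?C = "[:2, 1:] ^ d - monom 1 d :: real poly"
  obtain d' where d': "d = Suc d'" using d by (cases d) auto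
  have deg: "degree ?C < d" using d by (intro degree_gap) simp
  have cancel: "iu ^ n * (1 - fps_X) ^ n = 1" for n by (simp only: power_mult_distrib[symmetric] iu power_one)
  have "fps_X * (1 - fps_X) ^ (d - 1) / (1 + fps_X) * f_polynomial d (coeff ?C) mobius
      = fps_X * (1 - fps_X) ^ d' * iv * (2 ^ d * iu ^ Suc d' * (1 - fps_X ^ d))"
    unfolding f_polynomial_coeff[OF deg mobius_0] compose_gap by (simp add: fps_divide_unit d')
  also have "\<dots> = (iu ^ d' * (1 - fps_X) ^ d') * (2 ^ d' * iv * (2 * fps_X * iu * (1 - fps_X ^ d)))"
    by (simp only: d' power_Suc mult_ac)
  also have "\<dots> = 2 ^ d' * iv * (2 * fps_X * iu * (1 - fps_X ^ d))" by (simp only: cancel mult_1)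
  finally have A: "fps_X * (1 - fps_X) ^ (d - 1) / (1 + fps_X) * f_polynomial d (coeff ?C) mobius = 2 ^ d' * iv * (2 * fps_X * iu * (1 - fps_X ^ d))" .
  have B: "2 ^ (d - 1) * ((1 - (- fps_X) ^ (d + 1)) / (1 + fps_X)) = 2 ^ d' * iv * (1 - (- fps_X) ^ (d + 1) :: real fps)"
    by (simp add: fps_divide_unit d')
  have X: "(- fps_X :: real fps) ^ (d + 1) = fps_X ^ (d + 1) * (-1) ^ (d + 1)"
    by (subst power_minus) (rule mult.commute)
  have "cubical_h_series d (coeff ?C) = 2 ^ d' * iv * (2 * fps_X * iu * (1 - fps_X ^ d)) + 2 ^ d' * iv * (1 - (- fps_X) ^ (d + 1))"
    unfolding cubical_h_series_def A B ..
  also have "\<dots> = 2 ^ d' * iv * (1 + mobius) + fps_X ^ (d + 1) * (- (2 ^ d' * iv * (2 * iu + (-1) ^ (d + 1))))"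
    unfolding X iu(3) by (simp add: algebra_simps)
  also have "2 ^ d' * iv * (1 + mobius) = fps_const (2 ^ d') * iu"
  proof -
    have "2 ^ d' * iv * (1 + mobius) = 2 ^ d' * (iv * (1 + fps_X)) * iu" unfolding mobius_add1 by (simp only: mult_ac)
    also have "\<dots> = 2 ^ d' * iu" by (simp only: iu mult_1_right)
    finally show ?thesis by (simp add: numeral_fps_const fps_const_power[symmetric] del: fps_const_power)
  qed
  finally have "cubical_h d (coeff ?C) i = 2 ^ d' * fps_nth iu i + fps_nth (fps_X ^ (d + 1) * (- (2 ^ d' * iv * (2 * iu + (-1) ^ (d + 1))))) i"
    by (simp only: cubical_h_def fps_add_nth fps_mult_left_const_nth)
  moreover have "fps_nth (fps_X ^ (d + 1) * (- (2 ^ d' * iv * (2 * iu + (-1) ^ (d + 1))))) i = 0"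
    using i by (simp only: fps_X_power_mult_nth) simp
  moreover have "fps_nth iu i = 1"
  proof -
    have "iu = Abs_fps (\<lambda>_. 1)" using fps_inverse_gp[where ?'a = real] fps_inverse_idempotent[of "Abs_fps (\<lambda>_. 1) :: real fps"] by (simp add: fps_inverse_gp')
    then show ?thesis by simp
  qed
  ultimately show ?thesis by (simp add: d')
qed

text \<open>The right-hand side meets the description in \<open>f_of_g\<close>, which has one
  solution by \<open>f_of_g_unique\<close>: ray \<open>k\<close>, divided by its constant from
  \<open>hcoef_ray\<close>, raises \<open>h i\<close> by 1 for
  \<open>k \<le> i \<le> d - k\<close>.\<close>

lemma f_of_g_expand:
  assumes d: "1 \<le> d"
  shows "f_of_g d g = (\<lambda>i. coeff ([:2, 1:] ^ d - monom 1 d) i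
    + (\<Sum>k=1..d div 2. g k / (4 ^ (k - 1) * 2 ^ (d + 1 - 2 * k)) * coeff (ray d k) i))" (is "_ = ?f")
  unfolding f_of_g_def
proof (rule the1_equality[OF f_of_g_unique], intro conjI)
  let ?c = "\<lambda>k. g k / (4 ^ (k - 1) * 2 ^ (d + 1 - 2 * k))"
  have kd: "1 \<le> k" "2 * k \<le> d" if "k \<in> {1..d div 2}" for k using that by auto
  show "?f \<in> Rd d" unfolding Rd_def
  proof (intro CollectI allI impI)
    fix i assume i: "d \<le> i"
    have "coeff (ray d k) i = 0" if "k \<in> {1..d div 2}" for k
      by (rule coeff_eq_0) (use degree_ray[OF kd[OF that]] i in linarith)
    moreover have "coeff ([:2, 1:] ^ d - monom 1 d :: real poly) i = 0"
      by (rule coeff_eq_0) (use degree_gap[of d] i d in linarith)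
    ultimately show "?f i = 0" by simp
  qed
  have h: "cubical_h d ?f i = 2 ^ (d - 1) + (\<Sum>k=1..d div 2. g k * (if k \<le> i \<and> i \<le> d - k then 1 else 0))" if i: "i \<le> d" for i
  proof -
    have "(\<Sum>j<d. ?f j * hcoef d j i) = (\<Sum>j<d. coeff ([:2, 1:] ^ d - monom 1 d) j * hcoef d j i) + (\<Sum>j<d. \<Sum>k=1..d div 2. ?c k * coeff (ray d k) j * hcoef d j i)"
      by (simp only: distrib_right sum.distrib sum_distrib_right)
    also have "(\<Sum>j<d. \<Sum>k=1..d div 2. ?c k * coeff (ray d k) j * hcoef d j i) = (\<Sum>k=1..d div 2. \<Sum>j<d. ?c k * coeff (ray d k) j * hcoef d j i)"
      by (rule sum.swap)
    also have "\<dots> = (\<Sum>k=1..d div 2. ?c k * (\<Sum>j<d. coeff (ray d k) j * hcoef d j i))"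
      by (simp only: sum_distrib_left mult.assoc)
    also have "\<dots> = (\<Sum>k=1..d div 2. g k * (if k \<le> i \<and> i \<le> d - k then 1 else 0))"
    proof (rule sum.cong[OF refl])
      fix k assume "k \<in> {1..d div 2}"
      note hcoef_ray[OF kd[OF this], of i]
      then show "?c k * (\<Sum>j<d. coeff (ray d k) j * hcoef d j i) = g k * (if k \<le> i \<and> i \<le> d - k then 1 else 0)" by simp
    qed
    finally show ?thesis using cubical_h_cube[OF d i] by (simp only: cubical_h_expand)
  qed
  show "cubical_Dehn_Sommerville d ?f" unfolding cubical_Dehn_Sommerville_def
  proof (intro allI impI)
    fix i assume i: "i \<le> d"
    have "(\<Sum>k=1..d div 2. g k * (if k \<le> i \<and> i \<le> d - k then 1 else 0)) = (\<Sum>k=1..d div 2. g k * (if k \<le> d - i \<and> d - i \<le> d - k then 1 else 0))"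
      using i by (intro sum.cong refl) (auto dest: kd)
    then show "cubical_h d ?f i = cubical_h d ?f (d - i)" using h[OF i] h[of "d - i"] by simp
  qed
  show "\<forall>i\<in>{1..d div 2}. cubical_g d ?f i = g i"
  proof
    fix i assume i: "i \<in> {1..d div 2}"
    then have id: "i \<le> d" "i - 1 \<le> d" "i \<noteq> 0" by auto
    have "cubical_g d ?f i = cubical_h d ?f i - cubical_h d ?f (i - 1)" using id by (simp only: cubical_g_def if_False)
    also have "\<dots> = (\<Sum>k=1..d div 2. g k * (if k \<le> i \<and> i \<le> d - k then 1 else 0)) - (\<Sum>k=1..d div 2. g k * (if k \<le> i - 1 \<and> i - 1 \<le> d - k then 1 else 0))"
      unfolding h[OF id(1)] h[OF id(2)] by linarith
    also have "\<dots> = (\<Sum>k=1..d div 2. if k = i then g k else 0)"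
      unfolding sum_subtractf[symmetric] using i by (intro sum.cong refl) auto
    also have "\<dots> = g i" using i by simp
    finally show "cubical_g d ?f i = g i" .
  qed
qed

section \<open>Approximation of directions in the Adin cone\<close>

context coordinates
begin

section \<open>The unit cube as a sign polytope\<close>

abbreviation (input) "flat \<equiv> (\<lambda>_ _. 0) :: nat \<Rightarrow> nat \<Rightarrow> real"

lemma plf_flat: "i < d \<Longrightarrow> plf p flat i c = b i \<bullet> c" by (rule plf_low) auto

lemma generic_flat: "generic p flat UNIV {..<d} d"
  using generic_outer[of flat "{..<d}"] by (simp add: coord_space_UNIV)

lemma patterns_flat: "patterns p flat UNIV d = sign_refinements {..<d} (\<lambda>_. 0) - {\<lambda>_. 0}"
proof (intro equalityI subsetI)
  fix s assume s: "s \<in> patterns p flat UNIV d"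
  then have "s \<in> sign_refinements {..<d} (\<lambda>_. 0)" using patterns_subset by blast
  moreover have "s \<noteq> (\<lambda>_. 0)"
  proof -
    obtain c where c: "c \<in> UNIV" "c \<noteq> 0" "\<forall>j<d. sgn (plf p flat j c) = s j" using s by (rule patternE)
    obtain j where "j < d" "plf p flat j c \<noteq> 0" using plf_nonzero_coord[of flat d c UNIV] c(2) by auto
    then have "s j \<noteq> 0" using c(3) by (metis sgn_0_0)
    then show ?thesis by auto
  qed
  ultimately show "s \<in> sign_refinements {..<d} (\<lambda>_. 0) - {\<lambda>_. 0}" by blast
next
  fix s assume s: "s \<in> sign_refinements {..<d} (\<lambda>_. 0) - {\<lambda>_. 0}"
  then have sv: "\<And>j. j < d \<Longrightarrow> s j \<in> {-1, 0, 1}" "\<And>j. d \<le> j \<Longrightarrow> s j = 0" by (auto simp: sign_refinements_def)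
  obtain j where j: "s j \<noteq> 0" using s by auto
  then have "j < d" using sv(2)[of j] by (cases "j < d") auto
  then have "vec s \<noteq> 0" using inner_vec[of j s] j by auto
  moreover have "sgn (plf p flat i (vec s)) = s i" if "i < d" for i
    using sv(1)[OF that] that by (auto simp: plf_flat inner_vec)
  ultimately show "s \<in> patterns p flat UNIV d" using sv(2) by (intro patternI[of "vec s"]) auto
qed

lemma card_patterns_flat:
  "real (card {s \<in> patterns p flat UNIV d. card {j\<in>{..<d}. s j = 0} = i}) = coeff ([:2, 1:] ^ d - monom 1 d) i"
proof -
  have "poly (pattern_poly p flat UNIV {..<d} d) x = poly ([:2, 1:] ^ d - monom 1 d) x" for x
  proof -
    let ?A = "sign_refinements {..<d} (\<lambda>_. 0)"
    have fin: "finite ?A" by (rule finite_sign_refinements) simp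
    have mem: "(\<lambda>_. 0) \<in> ?A" by (simp add: sign_refinements_def)
    have "poly (pattern_poly p flat UNIV {..<d} d) x = (\<Sum>s\<in>?A - {\<lambda>_. 0}. x ^ card {j\<in>{..<d}. s j = 0})"
      unfolding pattern_poly_def patterns_flat by (simp add: poly_sum poly_monom)
    also have "\<dots> = (\<Sum>s\<in>?A. x ^ card {j\<in>{..<d}. s j = 0}) - x ^ card {j\<in>{..<d}. (0::real) = 0}"
      using fin mem by (simp only: sum_diff1 if_True)
    also have "(\<Sum>s\<in>?A. x ^ card {j\<in>{..<d}. s j = 0}) = (x + 2) ^ d" using sum_sign_refinements[of "{..<d}" x "\<lambda>_. 0"] by simp
    also have "{j\<in>{..<d}. (0::real) = 0} = {..<d}" by auto
    finally show ?thesis by (simp add: poly_power poly_monom add.commute)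
  qed
  then have "pattern_poly p flat UNIV {..<d} d = [:2, 1:] ^ d - monom 1 d" by (intro poly_eq_poly_eq_iff[THEN iffD1] ext)
  then show ?thesis using coeff_pattern_poly[of p flat UNIV "{..<d}" d i] by simp
qed

text \<open>The affine map takes signs to 0 and 1, so that \<open>body\<close> is the cube in the
  statement of the theorem; it halves all edges, hence the weights 1/2.\<close>

definition cube_vertex :: "(nat \<Rightarrow> real) \<Rightarrow> 'a" where "cube_vertex v = vec (\<lambda>i. (1 + v i) / 2)"
definition cube_support :: "'a \<Rightarrow> real" where "cube_support c = (\<Sum>i<d. (\<bar>b i \<bullet> c\<bar> + b i \<bullet> c) / 2)"

lemma sign_polytope_cube: "sign_polytope d (plf p flat) cube_vertex (\<lambda>_ _. 1 / 2) cube_support"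
proof -
  interpret S: sign_polytope d "plf p flat" "dual_point p d flat" "dual_weight d flat" "support_function p d flat"
  proof (rule sign_polytope_plf[OF generic_flat])
    show "\<exists>i<d. plf p flat i c \<noteq> 0" if "c \<noteq> 0" for c using plf_nonzero_coord[of flat d c UNIV] that by auto
  qed simp
  show ?thesis
  proof (rule sign_polytope.intro)
    show "(0::real) < 1 / 2" by simp
    show "cube_support c - c \<bullet> cube_vertex v = (\<Sum>i<d. (\<bar>plf p flat i c\<bar> - v i * plf p flat i c) * (1 / 2))" for v c
    proof -
      have "c \<bullet> cube_vertex v = (\<Sum>i<d. (1 + v i) / 2 * (b i \<bullet> c))"
        unfolding cube_vertex_def vec_def by (simp add: inner_sum_right inner_commute)
      then have "cube_support c - c \<bullet> cube_vertex v = (\<Sum>i<d. (\<bar>b i \<bullet> c\<bar> + b i \<bullet> c) / 2 - (1 + v i) / 2 * (b i \<bullet> c))"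
        by (simp only: cube_support_def sum_subtractf)
      also have "\<dots> = (\<Sum>i<d. (\<bar>plf p flat i c\<bar> - v i * plf p flat i c) * (1 / 2))"
        by (intro sum.cong refl) (simp add: plf_flat field_simps)
      finally show ?thesis .
    qed
    show "\<exists>i<d. plf p flat i c \<noteq> 0" if "c \<noteq> 0" for c by (rule S.nonzero[OF that])
    show "\<exists>c'. c' \<noteq> 0 \<and> (\<forall>i<d. sgn (plf p flat i c') = t i)"
      if "c \<noteq> 0" "\<And>i. i < d \<Longrightarrow> t i \<in> {-1, 0, 1}" "\<And>i. i < d \<Longrightarrow> plf p flat i c \<noteq> 0 \<Longrightarrow> t i = sgn (plf p flat i c)" for c t
      using S.refine[of c t] that by blast
    show "DIM('a) \<le> dim {c'. \<forall>i<d. sgn (plf p flat i c') = sgn (plf p flat i c)} + card {i. i < d \<and> plf p flat i c = 0}" if "c \<noteq> 0" for c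
      by (rule S.dim_cell[OF that])
  qed
qed

lemma Basis_eq: "Basis = b ` {..<d}" using b by (auto simp: bij_betw_def)

lemma mem_cube:
  assumes "I \<subseteq> {..<d}"
  shows "x \<in> cube (b ` I) \<longleftrightarrow> (\<forall>i<d. 0 \<le> b i \<bullet> x \<and> b i \<bullet> x \<le> (if i \<in> I then 1 else 0))"
proof -
  have inj: "inj_on b {..<d}" using b by (auto simp: bij_betw_def)
  have "(\<Sum>(b ` I)) \<bullet> b i = (if i \<in> I then 1 else 0)" if i: "i < d" for i
  proof -
    have fin: "finite I" using assms finite_subset by blast
    have "(\<Sum>(b ` I)) = (\<Sum>j\<in>I. b j)" using inj assms by (subst sum.reindex) (auto intro: inj_on_subset)
    then have "(\<Sum>(b ` I)) \<bullet> b i = (\<Sum>j\<in>I. b j \<bullet> b i)" by (simp add: inner_sum_left)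
    also have "\<dots> = (\<Sum>j\<in>I. if j = i then 1 else 0)" using assms i by (intro sum.cong) (auto simp: inner_b)
    also have "\<dots> = (if i \<in> I then 1 else 0)" using fin by simp
    finally show ?thesis .
  qed
  then show ?thesis unfolding cube_def mem_box Basis_eq by (auto simp: inner_commute)
qed

interpretation C: sign_polytope d "plf p flat" cube_vertex "\<lambda>_ _. 1 / 2" cube_support
  by (rule sign_polytope_cube)

lemma body_cube: "C.body = cube Basis"
proof -
  have "cube_vertex ` sign_vertices d = {x. \<forall>i\<in>Basis. x \<bullet> i = 0 \<or> x \<bullet> i = 1}"
  proof (intro equalityI subsetI)
    fix x assume "x \<in> cube_vertex ` sign_vertices d"
    then obtain v where v: "v \<in> sign_vertices d" "x = cube_vertex v" by blast
    have "x \<bullet> b i = 0 \<or> x \<bullet> b i = 1" if "i < d" for i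
    proof -
      have "x \<bullet> b i = (1 + v i) / 2" using inner_vec[OF that, of "\<lambda>i. (1 + v i) / 2"] v(2) by (simp add: cube_vertex_def inner_commute)
      moreover have "v i = -1 \<or> v i = 1" using v(1) that by (auto simp: sign_vertices_def)
      ultimately show ?thesis by auto
    qed
    then show "x \<in> {x. \<forall>i\<in>Basis. x \<bullet> i = 0 \<or> x \<bullet> i = 1}" unfolding Basis_eq by auto
  next
    fix x :: 'a assume x: "x \<in> {x. \<forall>i\<in>Basis. x \<bullet> i = 0 \<or> x \<bullet> i = 1}"
    define v where "v i = (if i < d then 2 * (b i \<bullet> x) - 1 else 1)" for i
    have "b i \<bullet> x = 0 \<or> b i \<bullet> x = 1" if "i < d" for i using x b_Basis[OF that] by (auto simp: inner_commute)
    then have "v \<in> sign_vertices d" by (auto simp: sign_vertices_def v_def)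
    moreover have "cube_vertex v = x"
    proof -
      have "cube_vertex v = vec (\<lambda>i. b i \<bullet> x)" unfolding cube_vertex_def vec_def by (intro sum.cong) (auto simp: v_def)
      then show ?thesis by (simp add: vec_coords)
    qed
    ultimately show "x \<in> cube_vertex ` sign_vertices d" by blast
  qed
  then show ?thesis unfolding C.body_def cube_def unit_interval_convex_hull by simp
qed

lemma f_vector_cube: "f_vector (cube (Basis :: 'a set)) i = coeff ([:2, 1:] ^ d - monom 1 d) i"
proof -
  have dimc: "aff_dim (cube (Basis :: 'a set)) = int d" using C.aff_dim_body by (simp add: body_cube dim)
  have set: "{j. j < d \<and> s j = 0} = {j\<in>{..<d}. s j = 0}" for s :: "nat \<Rightarrow> real" by auto
  have "card {F. F face_of cube (Basis :: 'a set) \<and> aff_dim F = int i} = card {s \<in> patterns p flat UNIV d. card {j\<in>{..<d}. s j = 0} = i}" if "i < d"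
    using C.card_faces[of i] that unfolding body_cube dim set sign_polytope_pats[OF sign_polytope_cube] .
  moreover have "coeff ([:2, 1:] ^ d - monom 1 d :: real poly) i = 0" if "\<not> i < d"
    by (rule coeff_eq_0) (use degree_gap[of d] kappa_Suc that in linarith)
  ultimately show ?thesis unfolding f_vector_def dimc using card_patterns_flat[of i] by auto
qed

lemma cube_like_cube:
  assumes r: "r < d"
  shows "cube_like r (cube (b ` {..<r}))"
proof -
  \<comment> \<open>The direction that is -1 on the coordinates from \<open>r\<close> on is maximal
    on the cube exactly where these coordinates vanish.\<close>
  define f where "f i = (if r \<le> i \<and> i < d then -1 else 0 :: real)" for i
  have bf: "b i \<bullet> vec f = f i" if "i < d" for i by (rule inner_vec[OF that])
  have sg: "\<forall>i<d. sgn (plf p flat i (vec f)) = f i" by (auto simp: plf_flat bf f_def)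
  have "vec f \<noteq> 0" using bf[OF r] r by (auto simp: f_def)
  then have pat: "f \<in> C.pats" unfolding C.pats_def using sg by (auto simp: f_def)
  have "C.face f = C.body \<inter> {x. vec f \<bullet> x = cube_support (vec f)}" using C.supporting_face[OF sg] by simp
  also have "\<dots> = cube (b ` {..<r})"
  proof -
    have "cube_support (vec f) = 0" unfolding cube_support_def by (intro sum.neutral) (auto simp: bf f_def)
    moreover have "vec f \<bullet> x = - (\<Sum>i\<in>{r..<d}. b i \<bullet> x)" for x
    proof -
      have "vec f \<bullet> x = (\<Sum>i<d. f i * (b i \<bullet> x))" by (simp add: vec_def inner_sum_left)
      also have "\<dots> = (\<Sum>i\<in>{r..<d}. - (b i \<bullet> x))" by (intro sum.mono_neutral_cong_right) (auto simp: f_def)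
      finally show ?thesis by (simp add: sum_negf)
    qed
    ultimately have "x \<in> C.body \<inter> {x. vec f \<bullet> x = cube_support (vec f)} \<longleftrightarrow> x \<in> cube Basis \<and> (\<Sum>i\<in>{r..<d}. b i \<bullet> x) = 0" for x
      by (simp add: body_cube)
    moreover have "x \<in> cube Basis \<and> (\<Sum>i\<in>{r..<d}. b i \<bullet> x) = 0 \<longleftrightarrow> x \<in> cube (b ` {..<r})" for x
    proof -
      have full: "x \<in> cube Basis \<longleftrightarrow> (\<forall>i<d. 0 \<le> b i \<bullet> x \<and> b i \<bullet> x \<le> 1)" using mem_cube[of "{..<d}" x] by (simp add: Basis_eq)
      have low: "x \<in> cube (b ` {..<r}) \<longleftrightarrow> (\<forall>i<d. 0 \<le> b i \<bullet> x \<and> b i \<bullet> x \<le> (if i < r then 1 else 0))" using mem_cube[of "{..<r}" x] r by simp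
      have "(\<Sum>i\<in>{r..<d}. b i \<bullet> x) = 0 \<longleftrightarrow> (\<forall>i\<in>{r..<d}. b i \<bullet> x = 0)" if "\<forall>i<d. 0 \<le> b i \<bullet> x"
        using that by (intro sum_nonneg_eq_0_iff) auto
      note zero = this
      show ?thesis
      proof
        assume l: "x \<in> cube Basis \<and> (\<Sum>i\<in>{r..<d}. b i \<bullet> x) = 0"
        then have nn: "\<forall>i<d. 0 \<le> b i \<bullet> x \<and> b i \<bullet> x \<le> 1" using full by simp
        then have "\<forall>i\<in>{r..<d}. b i \<bullet> x = 0" using zero l by simp
        then show "x \<in> cube (b ` {..<r})" unfolding low using nn by simp
      next
        assume "x \<in> cube (b ` {..<r})"
        then have l: "\<And>i. i < d \<Longrightarrow> 0 \<le> b i \<bullet> x \<and> b i \<bullet> x \<le> (if i < r then 1 else 0)" unfolding low by simp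
        have "b i \<bullet> x \<le> 1" if "i < d" for i using l[OF that] by (cases "i < r") auto
        moreover have "\<forall>i\<in>{r..<d}. b i \<bullet> x = 0"
        proof
          fix i assume "i \<in> {r..<d}"
          then show "b i \<bullet> x = 0" using l[of i] by simp
        qed
        ultimately show "x \<in> cube Basis \<and> (\<Sum>i\<in>{r..<d}. b i \<bullet> x) = 0" unfolding full using l by simp
      qed
    qed
    ultimately show ?thesis by blast
  qed
  finally have "C.face f = cube (b ` {..<r})" .
  moreover have "{i. i < d \<and> f i = 0} = {..<r}" using r by (auto simp: f_def)
  ultimately show ?thesis using C.cube_like_face[OF pat] by simp
qed

lemma cubical_polytope:
  fixes P :: "'a set"
  assumes "cubical P"
  shows "cubical_polytope d P"
  unfolding cubical_polytope_def
proof (intro conjI allI impI)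
  show "polytope P" "aff_dim P = int d" using assms by (auto simp: cubical_def dim)
  fix F assume "F face_of P" "F \<noteq> P" "F \<noteq> {}"
  then obtain r where r: "r < d" "cube_like r F" using assms unfolding cubical_def dim by blast
  have "b ` {..<r} \<subseteq> Basis" using r by (auto intro: b_Basis)
  then show "\<exists>B\<subseteq>(Basis :: 'a set). combinatorially_equivalent F (cube B)"
    using cube_like_combinatorially_equivalent[OF r(2) cube_like_cube[OF r(1)]]
    by (intro exI[of _ "b ` {..<r}"] conjI)
qed

lemma f_vector_cubical:
  fixes P :: "'a set"
  assumes "cubical P"
  shows "f_vector P i = (if i < d then real (face_number P i) else 0)"
proof -
  have "aff_dim P = int d" using assms by (simp add: cubical_def dim)
  then show ?thesis unfolding f_vector_def face_number_def by simp
qed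

section \<open>Gluing with prescribed multiplicities\<close>

definition topped :: "'a set \<Rightarrow> bool" where
  "topped P \<longleftrightarrow> cubical P \<and> (\<exists>\<tau> \<beta>. box_topped e P \<tau> \<beta>)"

text \<open>The starting point of the gluing is a combinatorial cube that ends in a box. Its
  \<open>f\<close>-vector is the apex of the cone, so only the glued blocks contribute to the
  difference from the apex.\<close>

lemma topped_cube: "\<exists>P. topped P \<and> (\<forall>i<d. real (face_number P i) = coeff ([:2, 1:] ^ d - monom 1 d) i)"
proof -
  interpret outer_system b p \<kappa> d d flat
    by unfold_locales (auto intro: generic_flat)
  obtain T \<sigma> \<gamma> \<tau> \<beta> where T: "cubical T" "box_cap e T \<sigma> \<gamma>" "box_topped e T \<tau> \<beta>" "\<sigma> < \<tau>"
    "\<And>i. i < d \<Longrightarrow> face_number T i = card {s \<in> patterns p flat UNIV d. card {j\<in>{..<d}. s j = 0} = i}"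
    using shear_body by blast
  then have "topped T" unfolding topped_def by blast
  moreover have "\<forall>i<d. real (face_number T i) = coeff ([:2, 1:] ^ d - monom 1 d) i"
  proof (intro allI impI)
    fix i assume "i < d"
    then show "real (face_number T i) = coeff ([:2, 1:] ^ d - monom 1 d) i"
      by (subst T(5)) (simp only:, rule card_patterns_flat)
  qed
  ultimately show ?thesis by (intro exI[of _ T] conjI)
qed

text \<open>The result of a gluing ends in a box again, so the step can be repeated.\<close>

lemma glue_copies:
  assumes P: "topped P" and T: "block T"
  shows "\<exists>R. topped R \<and> (\<forall>i<d. real (face_number R i) = real (face_number P i) + real n * (real (face_number T i) - real (box_loss e i)))"
proof (induction n)
  case 0
  then show ?case using P by auto
next
  case (Suc n)
  then obtain R where R: "topped R" "\<And>i. i < d \<Longrightarrow> real (face_number R i) = real (face_number P i) + real n * (real (face_number T i) - real (box_loss e i))" by blast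
  obtain \<tau> \<beta> where Rb: "cubical R" "box_topped e R \<tau> \<beta>" using R(1) by (auto simp: topped_def)
  obtain \<sigma> \<gamma> \<tau>' \<beta>' where Tb: "cubical T" "box_cap e T \<sigma> \<gamma>" "box_topped e T \<tau>' \<beta>'" "\<sigma> < \<tau>'" using T by (auto simp: block_def)
  obtain Q \<tau>'' \<beta>'' where Q: "cubical Q" "box_topped e Q \<tau>'' \<beta>''"
    "\<And>i. i < DIM('a) \<Longrightarrow> face_number Q i + box_loss e i = face_number R i + face_number T i"
    using box_glue[OF e_Basis Rb Tb] by blast
  have "topped Q" using Q(1,2) by (auto simp: topped_def)
  moreover have "real (face_number Q i) = real (face_number P i) + real (Suc n) * (real (face_number T i) - real (box_loss e i))" if "i < d" for i
  proof -
    have "real (face_number Q i) + real (box_loss e i) = real (face_number R i) + real (face_number T i)"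
      using Q(3)[of i] that dim by (metis of_nat_add)
    then show ?thesis using R(2)[OF that] by (simp add: algebra_simps)
  qed
  ultimately show ?case by blast
qed

lemma glue_family:
  assumes P: "topped P" and K: "finite K" "\<And>k. k \<in> K \<Longrightarrow> block (T k)"
  shows "\<exists>R. topped R \<and> (\<forall>i<d. real (face_number R i) = real (face_number P i) + (\<Sum>k\<in>K. real (n k) * (real (face_number (T k) i) - real (box_loss e i))))"
  using K
proof (induction K rule: finite_induct)
  case empty
  then show ?case using P by auto
next
  case (insert k K)
  then obtain R where R: "topped R" "\<And>i. i < d \<Longrightarrow> real (face_number R i) = real (face_number P i) + (\<Sum>k\<in>K. real (n k) * (real (face_number (T k) i) - real (box_loss e i)))" by auto
  have "block (T k)" using insert.prems by simp
  from glue_copies[OF R(1) this, of "n k"] obtain Q where "topped Q"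
    "\<And>i. i < d \<Longrightarrow> real (face_number Q i) = real (face_number R i) + real (n k) * (real (face_number (T k) i) - real (box_loss e i))" by blast
  then show ?case using R(2) insert.hyps by (intro exI[of _ Q]) simp
qed

end

text \<open>The angle does not change when \<open>y n - v\<close> is divided by
  \<open>\<Xi> n\<close>; the rescaled vectors tend to the nonzero vector \<open>x - v\<close>, and
  \<open>arccos\<close> is continuous on its domain up to the endpoint 1.\<close>

lemma angle_tendsto_0:
  fixes y :: "nat \<Rightarrow> nat \<Rightarrow> real"
  assumes pos: "\<And>n. 0 < \<Xi> n" and lim: "\<And>i. i < d \<Longrightarrow> (\<lambda>n. (y n i - v i) / \<Xi> n) \<longlonglongrightarrow> x i - v i"
    and ne: "i0 < d" "x i0 \<noteq> v i0"
  shows "(\<lambda>n. angle_at d x v (y n)) \<longlonglongrightarrow> 0"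
proof -
  define w where "w i = x i - v i" for i
  define z where "z n i = (y n i - v i) / \<Xi> n" for n i
  define arg where "arg n = (\<Sum>i<d. w i * z n i) / (L2_set w {..<d} * L2_set (z n) {..<d})" for n
  have zl: "(\<lambda>n. z n i) \<longlonglongrightarrow> w i" if "i < d" for i unfolding z_def w_def by (rule lim[OF that])
  have angle: "angle_at d x v (y n) = arccos (arg n)" for n
  proof -
    have e: "y n i - v i = \<Xi> n * z n i" for i using pos[of n] by (simp add: z_def)
    have "(\<Sum>i<d. w i * (\<Xi> n * z n i)) = \<Xi> n * (\<Sum>i<d. w i * z n i)" by (simp add: sum_distrib_left mult.left_commute)
    moreover have "L2_set (\<lambda>i. \<Xi> n * z n i) {..<d} = \<Xi> n * L2_set (z n) {..<d}" using pos[of n] by (simp add: L2_set_right_distrib)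
    ultimately show ?thesis unfolding angle_at_def e arg_def w_def[symmetric] using pos[of n] by (simp add: mult.left_commute[of _ "\<Xi> n"])
  qed
  \<comment> \<open>If a rescaled vector is zero, the quotient is 0 by convention and the bound
    still holds.\<close>
  have ratio: "\<bar>s / t\<bar> \<le> 1" if "\<bar>s\<bar> \<le> t" for s t :: real
    using that by (cases "t = 0") (auto simp: abs_divide divide_le_eq_1)
  have sq: "(\<Sum>i<d. w i * w i) = L2_set w {..<d} * L2_set w {..<d}"
    unfolding L2_set_def by (simp add: sum_nonneg power2_eq_square)
  have "0 < (\<Sum>i<d. w i * w i)" by (rule sum_pos2[of _ i0]) (use ne in \<open>auto simp: w_def not_square_less_zero zero_less_mult_iff linorder_neq_iff\<close>)
  then have nz: "L2_set w {..<d} * L2_set w {..<d} \<noteq> 0" using sq by linarith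
  have "(\<lambda>n. L2_set (z n) {..<d}) \<longlonglongrightarrow> L2_set w {..<d}" unfolding L2_set_def by (intro tendsto_intros zl) simp
  then have "arg \<longlonglongrightarrow> (\<Sum>i<d. w i * w i) / (L2_set w {..<d} * L2_set w {..<d})"
    unfolding arg_def using nz by (intro tendsto_divide tendsto_mult tendsto_sum tendsto_const zl) auto
  then have "arg \<longlonglongrightarrow> 1" using nz unfolding sq by simp
  moreover have "arg n \<in> {-1..1}" for n
  proof -
    have "\<bar>\<Sum>i<d. w i * z n i\<bar> \<le> (\<Sum>i<d. \<bar>w i\<bar> * \<bar>z n i\<bar>)" using sum_abs[of "\<lambda>i. w i * z n i" "{..<d}"] by (simp add: abs_mult)
    also have "\<dots> \<le> L2_set w {..<d} * L2_set (z n) {..<d}" by (rule L2_set_mult_ineq)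
    finally have "\<bar>arg n\<bar> \<le> 1" unfolding arg_def by (rule ratio)
    then show ?thesis by (simp add: abs_le_iff)
  qed
  ultimately have "(\<lambda>n. arccos (arg n)) \<longlonglongrightarrow> arccos 1"
    by (intro continuous_on_tendsto_compose[OF continuous_on_arccos'] always_eventually) auto
  then show ?thesis unfolding angle by simp
qed

text \<open>Rounding down changes the multiplicity by less than one copy, which weighs
  \<open>Nm n / \<Xi> n\<close> and tends to 0.\<close>

lemma rounded_multiple:
  fixes \<Xi> Nm :: "nat \<Rightarrow> real"
  assumes "0 \<le> c" "\<And>n. 0 < \<Xi> n" "\<And>n. 0 < Nm n" "(\<lambda>n. Nm n / \<Xi> n) \<longlonglongrightarrow> 0"
  shows "(\<lambda>n. real (nat \<lfloor>c * \<Xi> n / Nm n\<rfloor>) * (Nm n / \<Xi> n)) \<longlonglongrightarrow> c"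
proof (rule Lim_transform2[OF tendsto_const])
  show "(\<lambda>n. c - real (nat \<lfloor>c * \<Xi> n / Nm n\<rfloor>) * (Nm n / \<Xi> n)) \<longlonglongrightarrow> 0"
  proof (rule Lim_null_comparison[OF always_eventually assms(4)], rule allI)
    fix n
    define q where "q = Nm n / \<Xi> n"
    have q: "0 < q" using assms(2,3) by (simp add: q_def)
    have cq: "c * \<Xi> n / Nm n = c / q" by (simp add: q_def)
    have "0 \<le> c / q" using assms(1) q by simp
    then have r: "real (nat \<lfloor>c / q\<rfloor>) = of_int \<lfloor>c / q\<rfloor>" by simp
    define s :: real where "s = of_int \<lfloor>c / q\<rfloor>"
    have "s \<le> c / q" "c / q < s + 1" unfolding s_def by linarith+
    then have "s * q \<le> c" "c < (s + 1) * q" using pos_le_divide_eq[OF q, of s c] pos_divide_less_eq[OF q, of c "s + 1"] by blast+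
    then have "norm (c - s * q) \<le> q" unfolding real_norm_def distrib_right by linarith
    then show "norm (c - real (nat \<lfloor>c * \<Xi> n / Nm n\<rfloor>) * (Nm n / \<Xi> n)) \<le> Nm n / \<Xi> n" unfolding cq r s_def q_def[symmetric] .
  qed
qed

lemma (in coordinates) approximation:
  assumes d2: "2 \<le> d" and \<epsilon>: "0 < \<epsilon>" and g: "\<And>k. k \<in> {1..d div 2} \<Longrightarrow> 0 \<le> g k"
    and ne: "f_of_g d g \<noteq> f_vector (cube (Basis :: 'a set))"
  shows "\<exists>P :: 'a set. cubical_polytope d P \<and> f_vector P \<noteq> f_vector (cube (Basis :: 'a set)) \<and>
    angle_at d (f_of_g d g) (f_vector (cube (Basis :: 'a set))) (f_vector P) < \<epsilon>"
proof -
  let ?x = "f_of_g d g" and ?f0 = "f_vector (cube (Basis :: 'a set))"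
  define K where "K = {1..d div 2}"
  define \<phi> where "\<phi> k i = coeff (smult (1 / 2 ^ k) (ray d k)) i" for k i
  \<comment> \<open>The coefficient of \<open>ray d k\<close> in \<open>f_of_g_expand\<close>; the
    factor \<open>2 ^ k\<close> undoes the normalization in \<open>\<phi>\<close>.\<close>
  define c where "c k = g k / (4 ^ (k - 1) * 2 ^ (d + 1 - 2 * k)) * 2 ^ k" for k
  have c: "0 \<le> c k" if "k \<in> K" for k using g that by (simp add: c_def K_def)
  have "\<forall>k\<in>K. \<exists>TN. (\<forall>n. block (fst TN n) \<and> real n \<le> snd TN n \<and> 0 < snd TN n) \<and>
      (\<forall>i<d. (\<lambda>n. real (face_number (fst TN n) i) / snd TN n) \<longlonglongrightarrow> \<phi> k i)"
  proof
    fix k assume "k \<in> K"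
    then have "1 \<le> k" "2 * k \<le> d" by (auto simp: K_def)
    from block_limit[OF this] obtain T Nm where "(\<forall>n. block (T n) \<and> real n \<le> Nm n \<and> 0 < Nm n) \<and>
      (\<forall>i<d. (\<lambda>n. real (face_number (T n) i) / Nm n) \<longlonglongrightarrow> \<phi> k i)" unfolding \<phi>_def ray_def by blast
    then show "\<exists>TN. (\<forall>n. block (fst TN n) \<and> real n \<le> snd TN n \<and> 0 < snd TN n) \<and>
      (\<forall>i<d. (\<lambda>n. real (face_number (fst TN n) i) / snd TN n) \<longlonglongrightarrow> \<phi> k i)"
      by (intro exI[of _ "(T, Nm)"]) simp
  qed
  from bchoice[OF this] obtain TN where TN: "\<forall>k\<in>K. (\<forall>n. block (fst (TN k) n) \<and> real n \<le> snd (TN k) n \<and> 0 < snd (TN k) n) \<and>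
      (\<forall>i<d. (\<lambda>n. real (face_number (fst (TN k) n) i) / snd (TN k) n) \<longlonglongrightarrow> \<phi> k i)" by blast
  define T where "T k = fst (TN k)" for k
  define Nm where "Nm k = snd (TN k)" for k
  have T: "block (T k n)" and Nm: "real n \<le> Nm k n" "0 < Nm k n" if "k \<in> K" for k n using TN that by (auto simp: T_def Nm_def)
  have limT: "(\<lambda>n. real (face_number (T k n) i) / Nm k n) \<longlonglongrightarrow> \<phi> k i" if "k \<in> K" "i < d" for k i
    using TN that by (auto simp: T_def Nm_def)
  \<comment> \<open>A scale that outgrows every \<open>Nm k\<close>, so that rounding the
    multiplicities to integers is harmless for all \<open>k\<close> at once.\<close>
  define \<Xi> where "\<Xi> n = real (Suc n) * (1 + (\<Sum>k\<in>K. Nm k n))" for n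
  have S0: "0 \<le> (\<Sum>k\<in>K. Nm k n)" for n using Nm(2) by (intro sum_nonneg) (auto intro: less_imp_le)
  have \<Xi>: "0 < \<Xi> n" for n unfolding \<Xi>_def using S0[of n] by (intro mult_pos_pos) auto
  have ratio: "(\<lambda>n. Nm k n / \<Xi> n) \<longlonglongrightarrow> 0" if k: "k \<in> K" for k
  proof (rule Lim_null_comparison[OF always_eventually LIMSEQ_inverse_real_of_nat], rule allI)
    fix n
    have "Nm k n \<le> (\<Sum>k\<in>K. Nm k n)" using k Nm(2) by (intro member_le_sum) (auto simp: K_def intro: less_imp_le)
    then have le: "Nm k n \<le> 1 + (\<Sum>k\<in>K. Nm k n)" by simp
    have "real (Suc n) * Nm k n \<le> \<Xi> n" unfolding \<Xi>_def by (intro mult_left_mono le) simp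
    then have "Nm k n / \<Xi> n \<le> inverse (real (Suc n))" using \<Xi>[of n] by (simp add: divide_simps mult.commute)
    then show "norm (Nm k n / \<Xi> n) \<le> inverse (real (Suc n))" using Nm(2)[OF k, of n] \<Xi>[of n] by simp
  qed
  define m where "m n k = nat \<lfloor>c k * \<Xi> n / Nm k n\<rfloor>" for n k
  have limm: "(\<lambda>n. real (m n k) * (Nm k n / \<Xi> n)) \<longlonglongrightarrow> c k" if "k \<in> K" for k
    unfolding m_def by (rule rounded_multiple[OF c[OF that] \<Xi> Nm(2)[OF that] ratio[OF that]])
  obtain P0 where P0: "topped P0" "\<And>i. i < d \<Longrightarrow> real (face_number P0 i) = coeff ([:2, 1:] ^ d - monom 1 d) i"
    using topped_cube by blast
  have "\<forall>n. \<exists>R. topped R \<and> (\<forall>i<d. real (face_number R i) = real (face_number P0 i) + (\<Sum>k\<in>K. real (m n k) * (real (face_number (T k n) i) - real (box_loss e i))))"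
    by (rule allI, rule glue_family[OF P0(1)]) (auto simp: K_def intro: T[unfolded K_def])
  from choice[OF this] obtain P where PP: "\<forall>n. topped (P n) \<and> (\<forall>i<d. real (face_number (P n) i) = real (face_number P0 i) + (\<Sum>k\<in>K. real (m n k) * (real (face_number (T k n) i) - real (box_loss e i))))" ..
  have P: "topped (P n)" for n using PP[rule_format, of n] by (rule conjunct1)
  have fP: "real (face_number (P n) i) = real (face_number P0 i) + (\<Sum>k\<in>K. real (m n k) * (real (face_number (T k n) i) - real (box_loss e i)))" if "i < d" for n i
    using PP[THEN spec, THEN conjunct2, THEN spec, THEN mp, OF that] .
  have cub: "cubical (P n)" for n using P by (simp add: topped_def)
  have lim: "(\<lambda>n. (f_vector (P n) i - ?f0 i) / \<Xi> n) \<longlonglongrightarrow> ?x i - ?f0 i" if i: "i < d" for i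
  proof -
    have "(f_vector (P n) i - ?f0 i) / \<Xi> n = (\<Sum>k\<in>K. real (m n k) * (Nm k n / \<Xi> n) * (real (face_number (T k n) i) / Nm k n - real (box_loss e i) / Nm k n))" for n
    proof -
      have "f_vector (P n) i - ?f0 i = (\<Sum>k\<in>K. real (m n k) * (real (face_number (T k n) i) - real (box_loss e i)))"
        using fP[OF i, of n] P0(2)[OF i] i f_vector_cubical[OF cub[of n], of i] f_vector_cube[of i] by simp
      then have "(f_vector (P n) i - ?f0 i) / \<Xi> n = (\<Sum>k\<in>K. real (m n k) * (real (face_number (T k n) i) - real (box_loss e i)) / \<Xi> n)"
        by (simp only: sum_divide_distrib)
      also have "\<dots> = (\<Sum>k\<in>K. real (m n k) * (Nm k n / \<Xi> n) * (real (face_number (T k n) i) / Nm k n - real (box_loss e i) / Nm k n))"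
      proof (rule sum.cong[OF refl])
        fix k assume "k \<in> K"
        then have "Nm k n \<noteq> 0" using Nm(2)[of k n] by simp
        then show "real (m n k) * (real (face_number (T k n) i) - real (box_loss e i)) / \<Xi> n
          = real (m n k) * (Nm k n / \<Xi> n) * (real (face_number (T k n) i) / Nm k n - real (box_loss e i) / Nm k n)"
          by (simp add: diff_divide_distrib[symmetric])
      qed
      finally show ?thesis .
    qed
    moreover have "(\<lambda>n. \<Sum>k\<in>K. real (m n k) * (Nm k n / \<Xi> n) * (real (face_number (T k n) i) / Nm k n - real (box_loss e i) / Nm k n))
        \<longlonglongrightarrow> (\<Sum>k\<in>K. c k * (\<phi> k i - 0))"
    proof (intro tendsto_sum tendsto_mult tendsto_diff limm limT i)
      fix k assume k: "k \<in> K"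
      \<comment> \<open>The loss per gluing is constant while each block grows without bound, so it
        does not affect the limiting direction.\<close>
      have "filterlim (Nm k) at_top sequentially"
        by (rule filterlim_at_top_mono[OF filterlim_real_sequentially]) (use Nm(1)[OF k] in auto)
      then show "(\<lambda>n. real (box_loss e i) / Nm k n) \<longlonglongrightarrow> 0"
        by (intro tendsto_divide_0[OF tendsto_const] filterlim_at_top_imp_at_infinity)
    qed
    moreover have "?x i - ?f0 i = (\<Sum>k\<in>K. c k * (\<phi> k i - 0))"
    proof -
      have "?x i - ?f0 i = (\<Sum>k\<in>K. g k / (4 ^ (k - 1) * 2 ^ (d + 1 - 2 * k)) * coeff (ray d k) i)"
        using f_of_g_expand[of d g] d2 f_vector_cube[of i] by (simp add: K_def)
      also have "\<dots> = (\<Sum>k\<in>K. c k * (\<phi> k i - 0))" by (intro sum.cong refl) (simp add: c_def \<phi>_def)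
      finally show ?thesis .
    qed
    ultimately show ?thesis by simp
  qed
  obtain i0 where i0: "i0 < d" "?x i0 \<noteq> ?f0 i0"
  proof -
    obtain i where i: "?x i \<noteq> ?f0 i" using ne by (auto simp: fun_eq_iff)
    have "?x \<in> Rd d" using theI'[OF f_of_g_unique[of d g]] unfolding f_of_g_def by blast
    then have "?x i = 0" if "d \<le> i" using that by (simp add: Rd_def)
    moreover have "?f0 i = 0" if "d \<le> i"
      unfolding f_vector_cube by (rule coeff_eq_0) (use degree_gap[of d] d2 that in linarith)
    ultimately show ?thesis using that[of i] i by force
  qed
  have "\<forall>\<^sub>F n in sequentially. angle_at d ?x ?f0 (f_vector (P n)) < \<epsilon>"
    using order_tendstoD(2)[OF angle_tendsto_0[where y = "\<lambda>n. f_vector (P n)", OF \<Xi> lim i0] \<epsilon>] by simp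
  \<comment> \<open>The difference from the apex is eventually nonzero, so the angle is a genuine
    one and not the value of a degenerate quotient.\<close>
  moreover have "\<forall>\<^sub>F n in sequentially. (f_vector (P n) i0 - ?f0 i0) / \<Xi> n \<noteq> 0"
    using tendsto_imp_eventually_ne[OF lim[OF i0(1)]] i0(2)  by (metis (lifting) ext add_0 diff_add_cancel)
  ultimately have "\<forall>\<^sub>F n in sequentially. angle_at d ?x ?f0 (f_vector (P n)) < \<epsilon> \<and> (f_vector (P n) i0 - ?f0 i0) / \<Xi> n \<noteq> 0"
    by (rule eventually_conj)
  then obtain n where n: "angle_at d ?x ?f0 (f_vector (P n)) < \<epsilon>" "(f_vector (P n) i0 - ?f0 i0) / \<Xi> n \<noteq> 0"
    using eventually_happens'[OF sequentially_bot] by blast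
  have "f_vector (P n) \<noteq> ?f0" using n(2) by auto
  then show ?thesis using n(1) cubical_polytope[OF cub[of n]] by blast
qed

theorem theorem1p3:
  fixes d :: nat and \<epsilon> :: real and x :: "nat \<Rightarrow> real"
  assumes "2 \<le> d"
    and "DIM('a::euclidean_space) = d"
    and "\<epsilon> > 0"
    and "x \<in> Adin_cone d"
    and "x \<noteq> f_vector (cube (Basis :: 'a set))"
  shows "\<exists>P :: 'a set. cubical_polytope d P \<and>
           f_vector P \<noteq> f_vector (cube (Basis :: 'a set)) \<and>
           angle_at d x (f_vector (cube (Basis :: 'a set))) (f_vector P) < \<epsilon>"
proof -
  obtain b where "bij_betw b {0..<card (Basis :: 'a set)} (Basis :: 'a set)"
    using ex_bij_betw_nat_finite[OF finite_Basis] by blast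
  then have b: "bij_betw b {..<d} (Basis :: 'a set)" using assms(2) by (simp add: atLeast0LessThan)
  interpret coordinates b "\<lambda>i. if i < d then b i else 0" "d - 1" d
    by unfold_locales (use assms b in auto)
  obtain g where g: "x = f_of_g d g" "\<forall>i\<in>{1..d div 2}. 0 \<le> g i" using assms(4) unfolding Adin_cone_def by blast
  show ?thesis using approximation[OF assms(1,3), of g] g assms(5) by blast
qed

end
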